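(* Let $\mathfrak{g}$ be a finite-dimensional semisimple complex Lie algebra with finite Weyl group $W_f$ and affine Weyl group $W=W_f\ltimes\mathbb{Z}\Phi$, and let $n_{y,x}\in\mathbb{Z}[v]$, for $x,y\in W^+$, be the antispherical Kazhdan–Lusztig polynomials. With $w_0$ the longest element of $W_f$, for all $x,y\in W^+$ we have $$\deg n_{y,x}\;\le\;\ell(w_0)=\dim\mathfrak{n}^+.$$
   Context: $\mathfrak{g}=\mathfrak{n}^-\oplus\mathfrak{h}\oplus\mathfrak{n}^+$ is a fixed triangular decomposition, $\Phi$ the root system. $W$ is the Coxeter group with generators the simple reflections $s_1,\dots,s_r$ of $W_f$ and the affine reflection $s_0$ (one for each simple factor); $\ell$ denotes the length function and $\le$ the Bruhat order. $W^+\subset W$ is the set of shortest coset representatives of $W_f\backslash W$. The Hecke algebra $\mathcal{H}$ is the $\mathbb{Z}[v,v^{-1}]$-algebra with basis $H_x$, $x\in W$, with $H_xH_y=H_{xy}$ if $\ell(xy)=\ell(x)+\ell(y)$ and $H_s^2=(v^{-1}-v)H_s+1$ for each simple reflection $s$. There is a unique ring involution $\overline{\,\cdot\,}$ with $\overline{v}=v^{-1}$, $\overline{H_x}=(H_{x^{-1}})^{-1}$; $\underline{H}_x$ is the unique element with $\overline{\underline{H}_x}=\underline{H}_x$ and $\underline{H}_x\in H_x+\sum_{y<x}v\mathbb{Z}[v]H_y$. Let $\mathcal{H}_f\subset\mathcal{H}$ be the Hecke algebra of $W_f$. The antispherical module is the right $\mathcal{H}$-module $\mathcal{AS}=\mathbb{Z}[v,v^{-1}]\otimes_{\mathcal{H}_f}\mathcal{H}$,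 where $H_{s_i}$ ($s_i\in W_f$ simple) acts on $\mathbb{Z}[v,v^{-1}]$ by $-v$. For $x\in W^+$ put $N_x=1\otimes H_x$ and $\underline{N}_x=1\otimes\underline{H}_x$; $\{N_x\}_{x\in W^+}$ is a $\mathbb{Z}[v,v^{-1}]$-basis of $\mathcal{AS}$, and $n_{y,x}$ is defined by $\underline{N}_x=\sum_{y\in W^+}n_{y,x}N_y$. (The zero polynomial is regarded as satisfying any degree bound.) *)

theory Defs
  imports
    Complex_Main
    "HOL-Library.Poly_Mapping"
    "HOL-Library.Function_Algebras"
    "HOL-Computational_Algebra.Polynomial"
    "HOL-Computational_Algebra.Group_Closure"
    "HOL-Algebra.Bij"
    "HOL-Algebra.Ring"
    "HOL-Algebra.Generated_Groups"
begin

section \<open>Semisimple complex Lie algebras\<close>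

class complex_lie_algebra = ab_group_add +
  fixes scaleC :: "complex \<Rightarrow> 'a \<Rightarrow> 'a"
    and bracket :: "'a \<Rightarrow> 'a \<Rightarrow> 'a"
  assumes scaleC_add_right: "scaleC c (x + y) = scaleC c x + scaleC c y"
    and scaleC_add_left: "scaleC (c + d) x = scaleC c x + scaleC d x"
    and scaleC_scaleC: "scaleC c (scaleC d x) = scaleC (c * d) x"
    and scaleC_one: "scaleC 1 x = x"
    and bracket_add_left: "bracket (x + y) z = bracket x z + bracket y z"
    and bracket_add_right: "bracket x (y + z) = bracket x y + bracket x z"
    and bracket_scaleC_left: "bracket (scaleC c x) y = scaleC c (bracket x y)"
    and bracket_scaleC_right: "bracket x (scaleC c y) = scaleC c (bracket x y)"
    and bracket_self: "bracket x x = 0"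
    and jacobi: "bracket x (bracket y z) + bracket y (bracket z x) + bracket z (bracket x y) = 0"

global_interpretation complex_vector: vector_space scaleC
  by unfold_locales (rule scaleC_add_right scaleC_add_left scaleC_scaleC scaleC_one)+

definition lie_finite_dimensional :: "'g::complex_lie_algebra itself \<Rightarrow> bool"
  where "lie_finite_dimensional TYPE('g) \<longleftrightarrow>
    (\<exists>B::'g set. finite B \<and> complex_vector.span B = UNIV)"

definition bracket_space ::
    "'g::complex_lie_algebra set \<Rightarrow> 'g set \<Rightarrow> 'g set"
  where "bracket_space A B = complex_vector.span {bracket a b | a b. a \<in> A \<and> b \<in> B}"

definition lie_ideal :: "'g::complex_lie_algebra set \<Rightarrow> bool"
  where "lie_ideal I \<longleftrightarrow> complex_vector.subspace I \<and> (\<forall>x. \<forall>y\<in>I. bracket x y \<in> I)"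

definition lie_solvable :: "'g::complex_lie_algebra set \<Rightarrow> bool"
  where "lie_solvable A \<longleftrightarrow> (\<exists>n. ((\<lambda>B. bracket_space B B) ^^ n) A = {0})"

definition lie_semisimple :: "'g::complex_lie_algebra itself \<Rightarrow> bool"
  where "lie_semisimple TYPE('g) \<longleftrightarrow>
    (\<forall>I::'g set. lie_ideal I \<and> lie_solvable I \<longrightarrow> I = {0})"

definition ad_diagonalizable :: "'g::complex_lie_algebra \<Rightarrow> bool"
  where "ad_diagonalizable x \<longleftrightarrow> complex_vector.span {y. \<exists>c. bracket x y = scaleC c y} = UNIV"

text \<open>In a semisimple Lie algebra, a Cartan subalgebra is a toral subalgebra that is equal
  to its own centralizer.\<close>

definition cartan_subalgebra :: "'g::complex_lie_algebra set \<Rightarrow> bool"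
  where "cartan_subalgebra h \<longleftrightarrow>
    complex_vector.subspace h \<and> (\<forall>x\<in>h. ad_diagonalizable x) \<and> {y. \<forall>x\<in>h. bracket x y = 0} = h"


section \<open>Roots, coroots and the Weyl groups\<close>

text \<open>Linear functionals on \<open>h\<close> are represented by functions on the whole Lie algebra that
  vanish outside \<open>h\<close>.\<close>

type_synonym 'g weight = "'g \<Rightarrow> complex"

definition dual_space :: "'g::complex_lie_algebra set \<Rightarrow> 'g weight set"
  where "dual_space h = {\<phi>.
    (\<forall>x\<in>h. \<forall>y\<in>h. \<phi> (x + y) = \<phi> x + \<phi> y) \<and>
    (\<forall>c. \<forall>x\<in>h. \<phi> (scaleC c x) = c * \<phi> x) \<and>
    (\<forall>x. x \<notin> h \<longrightarrow> \<phi> x = 0)}"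

definition root_space ::
    "'g::complex_lie_algebra set \<Rightarrow> 'g weight \<Rightarrow> 'g set"
  where "root_space h \<alpha> = {x. \<forall>t\<in>h. bracket t x = scaleC (\<alpha> t) x}"

definition roots :: "'g::complex_lie_algebra set \<Rightarrow> 'g weight set"
  where "roots h = {\<alpha> \<in> dual_space h. \<alpha> \<noteq> 0 \<and> root_space h \<alpha> \<noteq> {0}}"

definition positive_system ::
    "'g::complex_lie_algebra set \<Rightarrow> 'g weight set \<Rightarrow> bool"
  where "positive_system h P \<longleftrightarrow>
    P \<union> uminus ` P = roots h \<and> P \<inter> uminus ` P = {} \<and>
    (\<forall>\<alpha>\<in>P. \<forall>\<beta>\<in>P. \<alpha> + \<beta> \<in> roots h \<longrightarrow> \<alpha> + \<beta> \<in> P)"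

definition n_plus ::
    "'g::complex_lie_algebra set \<Rightarrow> 'g weight set \<Rightarrow> 'g set"
  where "n_plus h P = complex_vector.span (\<Union>\<alpha>\<in>P. root_space h \<alpha>)"

definition simple_roots :: "'g::complex_lie_algebra weight set \<Rightarrow> 'g weight set"
  where "simple_roots P = {\<alpha> \<in> P. \<not> (\<exists>\<beta>\<in>P. \<exists>\<gamma>\<in>P. \<alpha> = \<beta> + \<gamma>)}"

definition coroot :: "'g::complex_lie_algebra set \<Rightarrow> 'g weight \<Rightarrow> 'g"
  where "coroot h \<alpha> =
    (THE t. t \<in> bracket_space (root_space h \<alpha>) (root_space h (- \<alpha>)) \<and> \<alpha> t = 2)"

text \<open>Both Weyl groups are groups of bijections of \<open>dual_space h\<close>.\<close>

definition reflection ::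
    "'g::complex_lie_algebra set \<Rightarrow> 'g weight \<Rightarrow> 'g weight \<Rightarrow> 'g weight"
  where "reflection h \<alpha> = (\<lambda>\<phi>\<in>dual_space h. \<phi> - (\<lambda>x. \<phi> (coroot h \<alpha>) * \<alpha> x))"

definition translation ::
    "'g::complex_lie_algebra set \<Rightarrow> 'g weight \<Rightarrow> 'g weight \<Rightarrow> 'g weight"
  where "translation h \<mu> = (\<lambda>\<phi>\<in>dual_space h. \<phi> + \<mu>)"

definition finite_weyl ::
    "'g::complex_lie_algebra set \<Rightarrow> ('g weight \<Rightarrow> 'g weight) set"
  where "finite_weyl h = generate (BijGroup (dual_space h)) (reflection h ` roots h)"

text \<open>Here \<open>group_closure (roots h)\<close> is the root lattice.\<close>

definition affine_weyl ::
    "'g::complex_lie_algebra set \<Rightarrow> ('g weight \<Rightarrow> 'g weight) monoid"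
  where "affine_weyl h = (BijGroup (dual_space h))
    \<lparr>carrier := {compose (dual_space h) (translation h \<mu>) w | \<mu> w.
       \<mu> \<in> group_closure (roots h) \<and> w \<in> finite_weyl h}\<rparr>"

text \<open>The root lattice acts by translations, so the reflecting hyperplanes are
  \<open>{\<phi>. \<phi> (coroot h \<alpha>) = k}\<close> for integers \<open>k\<close>, and the upper walls of the fundamental alcove
  are \<open>{\<phi>. \<phi> (coroot h \<theta>) = 1}\<close>, where \<open>coroot h \<theta>\<close> is the highest coroot of a simple factor.
  The highest coroots of the simple factors are precisely the coroots that are maximal
  for the usual partial order.\<close>

definition coroot_le ::
    "'g::complex_lie_algebra set \<Rightarrow> 'g weight set \<Rightarrow> 'g weight \<Rightarrow> 'g weight \<Rightarrow> bool"
  where "coroot_le h P \<beta> \<gamma> \<longleftrightarrow> (\<exists>c :: 'g weight \<Rightarrow> nat.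
    coroot h \<gamma> = coroot h \<beta> + (\<Sum>\<alpha>\<in>simple_roots P. scaleC (of_nat (c \<alpha>)) (coroot h \<alpha>)))"

definition highest_coroot_roots ::
    "'g::complex_lie_algebra set \<Rightarrow> 'g weight set \<Rightarrow> 'g weight set"
  where "highest_coroot_roots h P =
    {\<theta> \<in> roots h. \<forall>\<beta>\<in>roots h. coroot_le h P \<theta> \<beta> \<longrightarrow> \<beta> = \<theta>}"

definition affine_simple_reflections ::
    "'g::complex_lie_algebra set \<Rightarrow> 'g weight set \<Rightarrow> ('g weight \<Rightarrow> 'g weight) set"
  where "affine_simple_reflections h P =
    reflection h ` simple_roots P \<union>
    (\<lambda>\<theta>. compose (dual_space h) (translation h \<theta>) (reflection h \<theta>)) ` highest_coroot_roots h P"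


section \<open>Length, Bruhat order and coset representatives\<close>

definition word_length :: "('w, 'm) monoid_scheme \<Rightarrow> 'w set \<Rightarrow> 'w \<Rightarrow> nat"
  where "word_length G S w =
    (LEAST n. \<exists>ws. set ws \<subseteq> S \<and> length ws = n \<and> foldr (mult G) ws \<one>\<^bsub>G\<^esub> = w)"

definition bruhat_less :: "('w, 'm) monoid_scheme \<Rightarrow> 'w set \<Rightarrow> 'w \<Rightarrow> 'w \<Rightarrow> bool"
  where "bruhat_less G S = (\<lambda>x y. x \<in> carrier G \<and> word_length G S x < word_length G S y \<and>
    (\<exists>s\<in>S. \<exists>u\<in>carrier G. y = x \<otimes>\<^bsub>G\<^esub> (u \<otimes>\<^bsub>G\<^esub> s \<otimes>\<^bsub>G\<^esub> inv\<^bsub>G\<^esub> u)))\<^sup>+\<^sup>+"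

definition shortest_coset_reps ::
    "('w, 'm) monoid_scheme \<Rightarrow> 'w set \<Rightarrow> 'w set \<Rightarrow> 'w set"
  where "shortest_coset_reps G S U =
    {x \<in> carrier G. \<forall>u\<in>U. word_length G S x \<le> word_length G S (u \<otimes>\<^bsub>G\<^esub> x)}"


section \<open>The Hecke algebra\<close>

text \<open>The ring \<open>\<int>[v, v\<inverse>]\<close> is the group ring of \<open>\<int>\<close>: the exponent of a monomial is its key.\<close>

type_synonym laurent = "int \<Rightarrow>\<^sub>0 int"

definition v :: laurent
  where "v = Poly_Mapping.single 1 1"

definition v_inv :: laurent
  where "v_inv = Poly_Mapping.single (- 1) 1"

definition laurent_of_poly :: "int poly \<Rightarrow> laurent"
  where "laurent_of_poly p = poly (map_poly of_int p) v"

type_synonym 'w hecke = "'w \<Rightarrow>\<^sub>0 laurent"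

definition hecke_scale :: "laurent \<Rightarrow> 'w hecke \<Rightarrow> 'w hecke"
  where "hecke_scale a b = Poly_Mapping.map ((*) a) b"

definition hecke_basis :: "'w \<Rightarrow> 'w hecke"
  where "hecke_basis x = Poly_Mapping.single x 1"

text \<open>\<open>H\<close> is the Hecke algebra of the Coxeter system \<open>(G, S)\<close>, as an algebra structure on the
  free module with basis \<open>carrier G\<close>.\<close>

definition hecke_algebra ::
    "('w, 'm) monoid_scheme \<Rightarrow> 'w set \<Rightarrow> 'w hecke ring \<Rightarrow> bool"
  where "hecke_algebra G S H \<longleftrightarrow>
    carrier H = {b. Poly_Mapping.keys b \<subseteq> carrier G} \<and>
    \<zero>\<^bsub>H\<^esub> = 0 \<and> add H = (+) \<and> \<one>\<^bsub>H\<^esub> = hecke_basis \<one>\<^bsub>G\<^esub> \<and>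
    Ring.ring H \<and>
    (\<forall>a. \<forall>b\<in>carrier H. \<forall>c\<in>carrier H.
      hecke_scale a b \<otimes>\<^bsub>H\<^esub> c = hecke_scale a (b \<otimes>\<^bsub>H\<^esub> c) \<and>
      b \<otimes>\<^bsub>H\<^esub> hecke_scale a c = hecke_scale a (b \<otimes>\<^bsub>H\<^esub> c)) \<and>
    (\<forall>x\<in>carrier G. \<forall>y\<in>carrier G.
      word_length G S (x \<otimes>\<^bsub>G\<^esub> y) = word_length G S x + word_length G S y \<longrightarrow>
      hecke_basis x \<otimes>\<^bsub>H\<^esub> hecke_basis y = hecke_basis (x \<otimes>\<^bsub>G\<^esub> y)) \<and>
    (\<forall>s\<in>S. hecke_basis s \<otimes>\<^bsub>H\<^esub> hecke_basis s =
      hecke_scale (v_inv - v) (hecke_basis s) + \<one>\<^bsub>H\<^esub>)"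

definition hecke_bar :: "('w, 'm) monoid_scheme \<Rightarrow> 'w hecke ring \<Rightarrow> 'w hecke \<Rightarrow> 'w hecke"
  where "hecke_bar G H = (THE d. d \<in> extensional (carrier H) \<and> d \<in> ring_hom H H \<and>
    (\<forall>b\<in>carrier H. d (d b) = b) \<and>
    d (hecke_scale v \<one>\<^bsub>H\<^esub>) = hecke_scale v_inv \<one>\<^bsub>H\<^esub> \<and>
    (\<forall>x\<in>carrier G. d (hecke_basis x) = inv\<^bsub>H\<^esub> (hecke_basis (inv\<^bsub>G\<^esub> x))))"

definition kl_basis ::
    "('w, 'm) monoid_scheme \<Rightarrow> 'w set \<Rightarrow> 'w hecke ring \<Rightarrow> 'w \<Rightarrow> 'w hecke"
  where "kl_basis G S H x = (THE b. b \<in> carrier H \<and> hecke_bar G H b = b \<and>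
    Poly_Mapping.lookup b x = 1 \<and>
    (\<forall>y. y \<noteq> x \<and> Poly_Mapping.lookup b y \<noteq> 0 \<longrightarrow> bruhat_less G S y x) \<and>
    (\<forall>y. y \<noteq> x \<longrightarrow> (\<exists>p. Poly_Mapping.lookup b y = v * laurent_of_poly p)))"


section \<open>The antispherical module and its Kazhdan--Lusztig polynomials\<close>

text \<open>\<open>U\<close> is a standard parabolic subgroup. The Hecke algebra of \<open>U\<close> acts on \<open>\<int>[v, v\<inverse>]\<close> through
  the character sending \<open>H\<^sub>s\<close> to \<open>- v\<close> for the simple reflections \<open>s\<close> in \<open>U\<close>; its value at
  \<open>H\<^sub>w\<close> is therefore \<open>(- v)\<close> to the power of the length of \<open>w\<close>.\<close>

definition parabolic_hecke :: "'w set \<Rightarrow> 'w hecke set"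
  where "parabolic_hecke U = {b. Poly_Mapping.keys b \<subseteq> U}"

definition sign_character ::
    "('w, 'm) monoid_scheme \<Rightarrow> 'w set \<Rightarrow> 'w hecke \<Rightarrow> laurent"
  where "sign_character G S b =
    (\<Sum>w\<in>Poly_Mapping.keys b. Poly_Mapping.lookup b w * (- v) ^ word_length G S w)"

text \<open>The tensor product over the Hecke algebra of \<open>U\<close> is the free abelian group on pairs
  \<open>(a, b)\<close> modulo biadditivity and balancedness; its elements are cosets. Generators with
  \<open>b\<close> outside \<open>carrier H\<close> occur in no relation and span a complementary summand.\<close>

type_synonym 'w pre_tensor = "(laurent \<times> 'w hecke) \<Rightarrow>\<^sub>0 int"

definition pure_tensor :: "laurent \<Rightarrow> 'w hecke \<Rightarrow> 'w pre_tensor"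
  where "pure_tensor a b = Poly_Mapping.single (a, b) 1"

definition tensor_relations ::
    "('w, 'm) monoid_scheme \<Rightarrow> 'w set \<Rightarrow> 'w set \<Rightarrow> 'w hecke ring \<Rightarrow> 'w pre_tensor set"
  where "tensor_relations G S U H = group_closure (
    {pure_tensor (a + a') b - pure_tensor a b - pure_tensor a' b | a a' b. b \<in> carrier H} \<union>
    {pure_tensor a (b + b') - pure_tensor a b - pure_tensor a b' | a b b'.
       b \<in> carrier H \<and> b' \<in> carrier H} \<union>
    {pure_tensor (a * sign_character G S k) b - pure_tensor a (k \<otimes>\<^bsub>H\<^esub> b) | a k b.
       k \<in> parabolic_hecke U \<and> b \<in> carrier H})"

definition tensor_class ::
    "('w, 'm) monoid_scheme \<Rightarrow> 'w set \<Rightarrow> 'w set \<Rightarrow> 'w hecke ring \<Rightarrow>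
     'w pre_tensor \<Rightarrow> 'w pre_tensor set"
  where "tensor_class G S U H f = {g. g - f \<in> tensor_relations G S U H}"

text \<open>The function \<open>n\<close> below is \<open>y \<mapsto> n\<^bsub>y,x\<^esub>\<close>. Since \<open>\<int>[v, v\<inverse>]\<close> acts on the left tensor factor,
  \<open>n\<^bsub>y,x\<^esub> N\<^sub>y\<close> is the class of \<open>n\<^bsub>y,x\<^esub> \<otimes> H\<^sub>y\<close>.\<close>

definition antispherical_kl ::
    "('w, 'm) monoid_scheme \<Rightarrow> 'w set \<Rightarrow> 'w set \<Rightarrow> 'w hecke ring \<Rightarrow> 'w \<Rightarrow> 'w \<Rightarrow> laurent"
  where "antispherical_kl G S U H y x = Poly_Mapping.lookup
    (THE n :: 'w \<Rightarrow>\<^sub>0 laurent. Poly_Mapping.keys n \<subseteq> shortest_coset_reps G S U \<and>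
      tensor_class G S U H (pure_tensor 1 (kl_basis G S H x)) =
      tensor_class G S U H
        (\<Sum>z\<in>Poly_Mapping.keys n. pure_tensor (Poly_Mapping.lookup n z) (hecke_basis z))) y"

end

theory Submission
  imports Defs
begin

text \<open>Fix $x, y \in W^+$ and let $r_{y,z}$ be the coefficient of $N_y$ in
  $\overline{N_z}$. Since the Kazhdan-Lusztig element $\underline{H}_x$ is invariant under
  the bar involution, so is its image in the antispherical module, and comparing
  coefficients gives $n_{y,x} = \sum_z \overline{n_{z,x}}\, r_{y,z}$. The polynomials
  $n_{z,x}$ have no negative powers of $v$, so $\overline{n_{z,x}}$ has no positive ones,
  and the degree of $n_{y,x}$ is at most the largest degree of an $r_{y,z}$. The theorem is
  therefore a statement about the $R$-polynomials $r_{y,z}$, and it holds because $\deg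
  r_{y,z} \le \ell(\mathrm{fin}(y z^{-1}))$, where $\mathrm{fin} : W \to W_f$ forgets the
  translation part of an affine transformation (\<open>ncoef_Tbar_degree\<close>,
  \<open>antispherical_degree_bound\<close>).

This bound is proved by induction on $\ell(z)$. If $z = z's > z'$ then $\overline{H_z} =
  \overline{H_{z'}} (H_s + v - v^{-1})$. When $ys \notin W^+$, right multiplication by the
  last factor multiplies the coefficient of $N_y$ by $-v^{-1}$, and $y z^{-1}$ differs from
  $y z'^{-1}$ by a simple reflection of $W_f$ on the left, so the length of the finite part
  changes by at most one. When $ys \in W^+$, the coefficient of $N_{ys}$ contributes with
  factor one, and $ys\,z'^{-1} = y z^{-1}$. The only step that raises the degree is the
  contribution $(v - v^{-1}) r_{y,z'}$, which occurs when $ys > y$. There geometry enters: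
  $y$ and $z'$ lie in the dominant chamber, and crossing a wall upwards inside this chamber
  always means moving away from the origin. Hence the affine roots $y \alpha_s$ and $z'
  \alpha_s$ both have negative finite parts (\<open>Wp_direction\<close>), and passing from
  $\mathrm{fin}(y z'^{-1})$ to $\mathrm{fin}(y s z'^{-1})$ multiplies by a reflection that
  increases the length (\<open>linp_increase\<close>).

The definitions speak about an abstract Lie algebra, so the combinatorial input is derived
  from it. The root system is obtained from strings of weights under
  $\mathfrak{sl}_2$-triples; semisimplicity is the absence of nonzero solvable ideals, and
  it provides a triple for each root because the root spaces without one span a nilpotent
  ideal (\<open>no_degenerate_roots\<close>). The affine Weyl group is then shown to act on
  affine roots in such a way that lengths count inversions
  (\<open>affine_reflection_action\<close>); this yields the exchange condition, the lifting
  property of the Bruhat order and shortest coset representatives. On the Hecke algebra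
  side, the bar involution and the Kazhdan-Lusztig basis are defined by unique
  characterisation, so their existence has to be established (\<open>hecke_bar_eq\<close>,
  \<open>kl_basis_is_kl\<close>), and so has the freeness of the tensor product
  (\<open>antispherical_kl_eq_ncoef\<close>). Finally, the longest element makes all
  positive roots negative, which gives $\ell(w_0) = |\Phi^+| = \dim \mathfrak{n}^+$
  (\<open>length_longest_element\<close>, \<open>dim_n_plus\<close>).\<close>

section \<open>Weight spaces\<close>

global_interpretation lie_ad: Vector_Spaces.linear scaleC scaleC "bracket x" for x :: "'g::complex_lie_algebra"
  by unfold_locales (simp_all add: bracket_add_right bracket_scaleC_right)

lemma bracket_skew: "bracket x y = - bracket y (x::'g::complex_lie_algebra)"
proof -
  have "bracket (x + y) (x + y) = bracket x x + bracket x y + (bracket y x + bracket y y)"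
    by (simp only: bracket_add_left bracket_add_right ac_simps)
  then have "bracket x y + bracket y x = 0" by (simp add: bracket_self)
  then show ?thesis by (simp add: eq_neg_iff_add_eq_0)
qed

lemma bracket_zero_left [simp]: "bracket 0 (x::'g::complex_lie_algebra) = 0"
  by (subst bracket_skew) (simp add: lie_ad.zero)
lemma bracket_zero_right [simp]: "bracket (x::'g::complex_lie_algebra) 0 = 0"
  by (simp add: lie_ad.zero)
lemma bracket_minus_left: "bracket (- x) (y::'g::complex_lie_algebra) = - bracket x y"
  by (metis bracket_skew lie_ad.neg)
lemma bracket_minus_right: "bracket x (- y::'g::complex_lie_algebra) = - bracket x y"
  by (rule lie_ad.neg)

lemma leibniz: "bracket t (bracket x (y::'g::complex_lie_algebra)) = bracket (bracket t x) y + bracket x (bracket t y)"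
proof -
  have "bracket t (bracket x y) + bracket x (bracket y t) + bracket y (bracket t x) = 0" by (rule jacobi)
  then have "bracket t (bracket x y) = - bracket x (bracket y t) - bracket y (bracket t x)"
    by (simp add: eq_diff_eq eq_neg_iff_add_eq_0 add.commute add.left_commute)
  then show ?thesis
    by (metis add.commute bracket_skew diff_conv_add_uminus minus_minus bracket_minus_right)
qed

lemma bracket_power_add:
  "(bracket x ^^ k) (y + z) = (bracket x ^^ k) y + (bracket x ^^ k) (z::'g::complex_lie_algebra)"
  by (induction k) (simp_all add: bracket_add_right)
lemma bracket_power_scaleC:
  "(bracket x ^^ k) (scaleC c y) = scaleC c ((bracket x ^^ k) (y::'g::complex_lie_algebra))"
  by (induction k) (simp_all add: bracket_scaleC_right)
lemma bracket_power_zero [simp]: "(bracket x ^^ k) (0::'g::complex_lie_algebra) = 0"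
  by (induction k) simp_all

text \<open>The usual argument for eigenvectors of one operator, run for a family: applying
  the operator \<open>bracket t\<close> minus its eigenvalue at one vector removes that
  vector from the sum, and \<open>t\<close> may depend on which other vector is to be
  isolated.\<close>

lemma eigenvectors_independent:
  fixes x :: "'i \<Rightarrow> 'g::complex_lie_algebra" and wt :: "'i \<Rightarrow> 'g \<Rightarrow> complex"
  assumes "finite A"
    and "\<And>a t. a \<in> A \<Longrightarrow> t \<in> T \<Longrightarrow> bracket t (x a) = scaleC (wt a t) (x a)"
    and "\<And>a b. a \<in> A \<Longrightarrow> b \<in> A \<Longrightarrow> a \<noteq> b \<Longrightarrow> \<exists>t\<in>T. wt a t \<noteq> wt b t"
    and "(\<Sum>a\<in>A. x a) = 0"
  shows "\<forall>a\<in>A. x a = 0"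
  using assms
proof (induction A arbitrary: x)
  case empty then show ?case by simp
next
  case (insert c A)
  have *: "scaleC (wt a t - wt c t) (x a) = 0" if "a \<in> A" "t \<in> T" for a t
  proof -
    let ?y = "\<lambda>a. scaleC (wt a t - wt c t) (x a)"
    have "(\<Sum>a\<in>insert c A. ?y a) = bracket t (\<Sum>a\<in>insert c A. x a) - scaleC (wt c t) (\<Sum>a\<in>insert c A. x a)"
    proof -
      have "(\<Sum>a\<in>insert c A. bracket t (x a)) = (\<Sum>a\<in>insert c A. scaleC (wt a t) (x a))"
        using insert.prems(1) that by (intro sum.cong) auto
      then show ?thesis
        by (simp add: lie_ad.sum complex_vector.scale_sum_right complex_vector.scale_left_diff_distrib sum_subtractf
            scaleC_scaleC del: sum.insert)
    qed
    also have "\<dots> = 0" unfolding insert.prems(3) by simp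
    finally have s0: "(\<Sum>a\<in>A. ?y a) = 0" using insert.hyps by simp
    have "\<forall>a\<in>A. ?y a = 0"
      by (rule insert.IH[OF _ _ s0]) (use insert.prems in \<open>auto simp: bracket_scaleC_right scaleC_scaleC mult.commute\<close>)
    then show ?thesis using that by blast
  qed
  have A0: "x a = 0" if a: "a \<in> A" for a
  proof -
    have "a \<noteq> c" using a insert.hyps by blast
    then obtain t where "t \<in> T" "wt a t \<noteq> wt c t" using insert.prems(2)[of a c] a by auto
    then show ?thesis using *[OF a] by auto
  qed
  then have "x c = 0" using insert.prems(3) insert.hyps by simp
  with A0 show ?case by blast
qed

lemma span_UN_subspaces:
  fixes V :: "'i \<Rightarrow> 'g::complex_lie_algebra set"
  assumes "y \<in> complex_vector.span (\<Union>a\<in>I. V a)" and sub: "\<And>a. a \<in> I \<Longrightarrow> complex_vector.subspace (V a)"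
  shows "\<exists>A z. finite A \<and> A \<subseteq> I \<and> (\<forall>a\<in>A. z a \<in> V a) \<and> y = (\<Sum>a\<in>A. z a)"
  using assms(1)
proof (induction rule: complex_vector.span_induct_alt)
  case base
  then show ?case by (intro exI[of _ "{}"]) auto
next
  case (step c x y)
  then obtain A z a where A: "finite A" "A \<subseteq> I" "\<forall>a\<in>A. z a \<in> V a" "y = (\<Sum>a\<in>A. z a)"
    and a: "a \<in> I" "x \<in> V a" by blast
  let ?z = "\<lambda>b. (if b \<in> A then z b else 0) + (if b = a then scaleC c x else 0)"
  have "(\<Sum>b\<in>insert a A. ?z b) = (\<Sum>b\<in>insert a A. if b \<in> A then z b else 0) + (\<Sum>b\<in>insert a A. if b = a then scaleC c x else 0)"
    by (rule sum.distrib)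
  also have "(\<Sum>b\<in>insert a A. if b \<in> A then z b else 0) = (\<Sum>b\<in>A. z b)"
    by (rule sum.mono_neutral_cong_right) (use A in auto)
  also have "(\<Sum>b\<in>insert a A. if b = a then scaleC c x else 0) = scaleC c x"
    using A by (subst sum.delta) auto
  finally have "scaleC c x + y = (\<Sum>b\<in>insert a A. ?z b)" using A by (simp add: add.commute)
  moreover have "?z b \<in> V b" if b: "b \<in> insert a A" for b
  proof -
    have sb: "complex_vector.subspace (V b)" using b a A sub by auto
    show ?thesis
      by (rule complex_vector.subspace_add[OF sb])
        (use A a sb in \<open>auto simp: complex_vector.subspace_0 complex_vector.subspace_scale\<close>)
  qed
  ultimately show ?case using A a by (intro exI[of _ "insert a A"] exI[of _ ?z]) auto
qed

lemma subspace_root_space: "complex_vector.subspace (root_space h (\<alpha> :: 'g::complex_lie_algebra weight))"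
  by (rule complex_vector.subspaceI)
    (auto simp: root_space_def bracket_add_right scaleC_add_right bracket_scaleC_right scaleC_scaleC mult.commute)

lemma root_space_bracket:
  assumes "x \<in> root_space h \<alpha>" "y \<in> root_space h \<beta>"
  shows "bracket x y \<in> root_space h (\<alpha> + \<beta>)"
  using assms by (auto simp: root_space_def leibniz[of _ x y] bracket_scaleC_left bracket_scaleC_right
      scaleC_add_left)

text \<open>Weights are functions, so their pointwise scalar multiples have to be introduced
  separately.\<close>

definition wscale :: "complex \<Rightarrow> 'g::complex_lie_algebra weight \<Rightarrow> 'g weight" where
  "wscale c \<alpha> = (\<lambda>x. c * \<alpha> x)"

lemma wscale_apply [simp]: "wscale c \<alpha> x = c * \<alpha> x" by (simp add: wscale_def)
lemma wscale_0 [simp]: "wscale 0 \<alpha> = 0" by (simp add: fun_eq_iff)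
lemma wscale_1 [simp]: "wscale 1 \<alpha> = \<alpha>" by (simp add: fun_eq_iff)

lemma dual_space_zero: "0 \<in> dual_space h" by (simp add: dual_space_def)
lemma dual_space_add: "\<alpha> \<in> dual_space h \<Longrightarrow> \<beta> \<in> dual_space h \<Longrightarrow> \<alpha> + \<beta> \<in> dual_space h"
  by (auto simp: dual_space_def algebra_simps)
lemma dual_space_scale: "\<alpha> \<in> dual_space h \<Longrightarrow> wscale c \<alpha> \<in> dual_space h"
  by (auto simp: dual_space_def algebra_simps)
lemma dual_space_minus: "\<alpha> \<in> dual_space h \<Longrightarrow> - \<alpha> \<in> dual_space h"
  by (auto simp: dual_space_def)
lemma dual_space_diff: "\<alpha> \<in> dual_space h \<Longrightarrow> \<beta> \<in> dual_space h \<Longrightarrow> \<alpha> - \<beta> \<in> dual_space h"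
  by (auto simp: dual_space_def algebra_simps)

lemma dual_space_neqE:
  assumes "\<alpha> \<in> dual_space h" "\<beta> \<in> dual_space h" "\<alpha> \<noteq> \<beta>" obtains t where "t \<in> h" "\<alpha> t \<noteq> \<beta> t"
proof -
  obtain t where t: "\<alpha> t \<noteq> \<beta> t" using assms(3) by blast
  then have "t \<in> h" using assms by (auto simp: dual_space_def)
  then show ?thesis using t that by blast
qed

locale triangular_decomposition =
  fixes h :: "'g::complex_lie_algebra set" and P :: "'g weight set"
  assumes fin_dim: "lie_finite_dimensional TYPE('g)"
    and semisimple: "lie_semisimple TYPE('g)"
    and cartan: "cartan_subalgebra h"
    and positive: "positive_system h P"
begin

lemma uminus_roots: "\<alpha> \<in> roots h \<Longrightarrow> - \<alpha> \<in> roots h"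
proof -
  assume a: "\<alpha> \<in> roots h"
  have e: "roots h = P \<union> uminus ` P" using positive by (simp add: positive_system_def)
  from a consider "\<alpha> \<in> P" | \<beta> where "\<beta> \<in> P" "\<alpha> = - \<beta>" unfolding e by blast
  then show ?thesis by cases (simp_all add: e)
qed

lemma subspace_h: "complex_vector.subspace h" using cartan by (simp add: cartan_subalgebra_def)
lemma diag_h: "t \<in> h \<Longrightarrow> ad_diagonalizable t" using cartan by (simp add: cartan_subalgebra_def)
lemma centralizer_h: "{y. \<forall>x\<in>h. bracket x y = 0} = h"
  using cartan by (simp add: cartan_subalgebra_def)
lemma h_abelian: "x \<in> h \<Longrightarrow> y \<in> h \<Longrightarrow> bracket x y = 0"
  using equalityD2[OF centralizer_h] by blast
lemma root_space_0: "root_space h 0 = h"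
proof -
  have "root_space h 0 = {y. \<forall>x\<in>h. bracket x y = 0}" by (simp add: root_space_def)
  then show ?thesis by (simp only: centralizer_h)
qed
lemma root_spaceD: "x \<in> root_space h \<alpha> \<Longrightarrow> t \<in> h \<Longrightarrow> bracket t x = scaleC (\<alpha> t) x"
  by (simp add: root_space_def)

text \<open>Commuting diagonalisable operators are simultaneously diagonalisable. In the
  induction step, a vector that is already an eigenvector for \<open>F\<close> is split into
  eigenvectors of the new operator \<open>t\<close>; the components stay eigenvectors for
  \<open>F\<close> because their deviations from being so are eigenvectors of
  \<open>t\<close> that sum to zero.\<close>

lemma simultaneous_eigenvectors_span:
  assumes "finite F" "F \<subseteq> h"
  shows "complex_vector.span {y. \<forall>t\<in>F. \<exists>c. bracket t y = scaleC c y} = UNIV"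
  using assms
proof (induction F)
  case empty then show ?case by simp
next
  case (insert t F)
  let ?E = "{y. \<forall>t\<in>F. \<exists>c. bracket t y = scaleC c y}"
    and ?E' = "{y. \<forall>t\<in>insert t F. \<exists>c. bracket t y = scaleC c y}"
  let ?V = "\<lambda>c. {z. bracket t z = scaleC c z}"
  have sub: "complex_vector.subspace (?V c)" for c
    by (rule complex_vector.subspaceI)
      (auto simp: bracket_add_right scaleC_add_right bracket_scaleC_right scaleC_scaleC mult.commute)
  have "?E \<subseteq> complex_vector.span ?E'"
  proof
    fix y assume y: "y \<in> ?E"
    have "complex_vector.span (\<Union>c\<in>UNIV. ?V c) = UNIV"
    proof -
      have "(\<Union>c\<in>UNIV. ?V c) = {y. \<exists>c. bracket t y = scaleC c y}" by auto
      then show ?thesis using diag_h[of t] insert.prems by (simp add: ad_diagonalizable_def)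
    qed
    then have "y \<in> complex_vector.span (\<Union>c\<in>UNIV. ?V c)" by simp
    from span_UN_subspaces[OF this sub]
    obtain A z where A: "finite A" "\<And>c. c \<in> A \<Longrightarrow> bracket t (z c) = scaleC c (z c)" "y = (\<Sum>c\<in>A. z c)" by blast
    have "z c \<in> ?E'" if c: "c \<in> A" for c
    proof -
      have "\<exists>d. bracket s (z c) = scaleC d (z c)" if s: "s \<in> F" for s
      proof -
        obtain d where d: "bracket s y = scaleC d y" using y s by blast
        let ?x = "\<lambda>c. bracket s (z c) - scaleC d (z c)"
        have st: "bracket t s = 0" using insert.prems s h_abelian by auto
        have "\<forall>c\<in>A. ?x c = 0"
        proof (rule eigenvectors_independent[where T = "{t}" and wt = "\<lambda>c t. c"])
          show "bracket r (?x c) = scaleC c (?x c)" if "c \<in> A" "r \<in> {t}" for c r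
            using that A st
            by (simp add: lie_ad.diff leibniz[of t s] bracket_scaleC_right complex_vector.scale_right_diff_distrib
                scaleC_scaleC mult.commute)
          show "(\<Sum>a\<in>A. ?x a) = 0"
            using d unfolding A(3) by (simp add: lie_ad.sum complex_vector.scale_sum_right sum_subtractf)
        qed (use A in auto)
        then show ?thesis using c by auto
      qed
      then show ?thesis using A c by blast
    qed
    then show "y \<in> complex_vector.span ?E'"
      unfolding A(3) by (intro complex_vector.span_sum complex_vector.span_base)
  qed
  then have "complex_vector.span ?E \<subseteq> complex_vector.span ?E'"
    by (rule complex_vector.span_minimal) simp
  then show ?case using insert by auto
qed

text \<open>Unlike a root, a weight may be zero. Strings of roots can pass through zero, so
  the string arguments below are made for weights.\<close>

definition is_weight :: "'g weight \<Rightarrow> bool" where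
  "is_weight \<beta> \<longleftrightarrow> \<beta> \<in> dual_space h \<and> root_space h \<beta> \<noteq> {0}"

lemma roots_iff: "\<alpha> \<in> roots h \<longleftrightarrow> is_weight \<alpha> \<and> \<alpha> \<noteq> 0"
  by (auto simp: roots_def is_weight_def)

lemma is_weight_cases: "is_weight \<beta> \<Longrightarrow> \<beta> = 0 \<or> \<beta> \<in> roots h"
  by (auto simp: roots_iff)

lemma root_dual: "\<alpha> \<in> roots h \<Longrightarrow> \<alpha> \<in> dual_space h" by (simp add: roots_def)

lemma is_weightI: "\<beta> \<in> dual_space h \<Longrightarrow> y \<in> root_space h \<beta> \<Longrightarrow> y \<noteq> 0 \<Longrightarrow> is_weight \<beta>"
  by (auto simp: is_weight_def)

lemma is_weightE:
  assumes "is_weight \<beta>" obtains y where "y \<in> root_space h \<beta>" "y \<noteq> 0" "\<beta> \<in> dual_space h"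
  using assms complex_vector.subspace_0[OF subspace_root_space[of h \<beta>]] by (auto simp: is_weight_def)

lemma h_finite_span: "\<exists>F. finite F \<and> F \<subseteq> h \<and> h \<subseteq> complex_vector.span F"
proof -
  obtain B :: "'g set" where B: "finite B" "complex_vector.span B = UNIV"
    using fin_dim by (auto simp: lie_finite_dimensional_def)
  obtain F where F: "F \<subseteq> h" "\<not> complex_vector.dependent F" "h \<subseteq> complex_vector.span F"
    by (rule complex_vector.maximal_independent_subset[of h])
  have "finite F" using complex_vector.independent_span_bound[OF B(1) F(2)] B(2) by simp
  then show ?thesis using F by blast
qed

text \<open>A simultaneous eigenvector for a finite spanning set of \<open>h\<close> is one
  for all of \<open>h\<close>, and its eigenvalue depends linearly on the element of
  \<open>h\<close>.\<close>

lemma weight_spaces_span: "complex_vector.span (\<Union>\<beta>\<in>{\<beta>. is_weight \<beta>}. root_space h \<beta>) = UNIV"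
proof -
  obtain F where F: "finite F" "F \<subseteq> h" "h \<subseteq> complex_vector.span F" using h_finite_span by blast
  have "y \<in> complex_vector.span (\<Union>\<beta>\<in>{\<beta>. is_weight \<beta>}. root_space h \<beta>)"
    if y: "\<forall>t\<in>F. \<exists>c. bracket t y = scaleC c y" for y
  proof (cases "y = 0")
    case False
    have ex: "\<exists>c. bracket t y = scaleC c y" if "t \<in> h" for t
    proof -
      have "t \<in> complex_vector.span F" using F that by blast
      then show ?thesis
      proof (induction rule: complex_vector.span_induct_alt)
        case base show ?case by (intro exI[of _ 0]) simp
      next
        case (step d s t)
        then obtain a b where "bracket s y = scaleC a y" "bracket t y = scaleC b y" using y by blast
        then show ?case by (intro exI[of _ "d * a + b"])
            (simp add: bracket_add_left bracket_scaleC_left scaleC_add_left scaleC_scaleC)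
      qed
    qed
    \<comment> \<open>Elements of the dual space are required to vanish outside
      \<open>h\<close>, hence the default value zero.\<close>
    define \<beta> where "\<beta> = (\<lambda>t. if t \<in> h then (SOME c. bracket t y = scaleC c y) else 0)"
    have b: "bracket t y = scaleC (\<beta> t) y" if "t \<in> h" for t
      using someI_ex[OF ex[OF that]] that by (simp add: \<beta>_def)
    have uniq: "c = d" if "scaleC c y = scaleC d y" for c d using that False by simp
    have "\<beta> \<in> dual_space h"
      unfolding dual_space_def
    proof (intro CollectI conjI allI ballI impI)
      fix s t assume "s \<in> h" "t \<in> h"
      then have "s + t \<in> h" using subspace_h complex_vector.subspace_add by blast
      then have "scaleC (\<beta> (s + t)) y = scaleC (\<beta> s + \<beta> t) y"
        using b[of "s + t"] b[of s] b[of t] \<open>s \<in> h\<close> \<open>t \<in> h\<close> by (simp add: bracket_add_left scaleC_add_left)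
      then show "\<beta> (s + t) = \<beta> s + \<beta> t" by (rule uniq)
    next
      fix c t assume "t \<in> h"
      then have "scaleC c t \<in> h" using subspace_h complex_vector.subspace_scale by blast
      then have "scaleC (\<beta> (scaleC c t)) y = scaleC (c * \<beta> t) y"
        using b[of "scaleC c t", symmetric] b[of t] \<open>t \<in> h\<close>
        by (simp only: bracket_scaleC_left scaleC_scaleC)
      then show "\<beta> (scaleC c t) = c * \<beta> t" by (rule uniq)
    qed (simp add: \<beta>_def)
    moreover have "y \<in> root_space h \<beta>" using b by (simp add: root_space_def)
    ultimately show ?thesis using False is_weightI by (intro complex_vector.span_base) blast
  qed (simp add: complex_vector.span_zero)
  then have "complex_vector.span {y. \<forall>t\<in>F. \<exists>c. bracket t y = scaleC c y} \<subseteq>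
      complex_vector.span (\<Union>\<beta>\<in>{\<beta>. is_weight \<beta>}. root_space h \<beta>)"
    by (intro complex_vector.span_minimal) auto
  then show ?thesis using simultaneous_eigenvectors_span[OF F(1,2)] by auto
qed

lemma weight_vectors_independent:
  assumes A: "A \<subseteq> dual_space h" and x: "\<And>\<alpha>. \<alpha> \<in> A \<Longrightarrow> x \<alpha> \<in> root_space h \<alpha> \<and> x \<alpha> \<noteq> 0"
  shows "inj_on x A" and "\<not> complex_vector.dependent (x ` A)"
proof -
  have zero: "\<forall>\<alpha>\<in>B. y \<alpha> = 0" if "finite B" "B \<subseteq> dual_space h" "\<And>\<alpha>. \<alpha> \<in> B \<Longrightarrow> y \<alpha> \<in> root_space h \<alpha>"
    "(\<Sum>\<alpha>\<in>B. y \<alpha>) = 0" for B y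
    by (rule eigenvectors_independent[where T = h and wt = "\<lambda>\<alpha> t. \<alpha> t"])
      (use that in \<open>auto simp: root_space_def elim!: dual_space_neqE\<close>, metis dual_space_neqE subsetD)
  show inj: "inj_on x A"
  proof (rule inj_onI, rule ccontr)
    fix \<alpha> \<beta> assume ab: "\<alpha> \<in> A" "\<beta> \<in> A" "x \<alpha> = x \<beta>" "\<alpha> \<noteq> \<beta>"
    obtain t where t: "t \<in> h" "\<alpha> t \<noteq> \<beta> t" using ab A dual_space_neqE by (metis subsetD)
    have "scaleC (\<alpha> t) (x \<alpha>) = scaleC (\<beta> t) (x \<alpha>)" using x[OF ab(1)] x[OF ab(2)] t ab by (auto simp: root_space_def)
    then show False using t x ab by auto
  qed
  show "\<not> complex_vector.dependent (x ` A)"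
    unfolding complex_vector.independent_explicit_finite_subsets
  proof (intro allI impI)
    fix T u assume T: "T \<subseteq> x ` A" "finite T" and s: "(\<Sum>v\<in>T. scaleC (u v) v) = 0"
    obtain B where B: "B \<subseteq> A" "finite B" "T = x ` B" using T by (meson finite_subset_image)
    have "(\<Sum>\<alpha>\<in>B. scaleC (u (x \<alpha>)) (x \<alpha>)) = 0"
      using s B sum.reindex[OF inj_on_subset[OF inj B(1)], of "\<lambda>v. scaleC (u v) v"] by simp
    moreover have "scaleC (u (x \<alpha>)) (x \<alpha>) \<in> root_space h \<alpha>" if "\<alpha> \<in> B" for \<alpha>
    proof -
      have "\<alpha> \<in> A" using that B by blast
      then show ?thesis using x complex_vector.subspace_scale[OF subspace_root_space] by blast
    qed
    ultimately have "\<forall>\<alpha>\<in>B. scaleC (u (x \<alpha>)) (x \<alpha>) = 0"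
      using B A by (intro zero) auto
    then show "\<forall>v\<in>T. u v = 0" using B x by auto
  qed
qed

lemma finite_roots: "finite (roots h)"
proof (rule ccontr)
  assume inf: "\<not> finite (roots h)"
  have "\<forall>\<alpha>\<in>roots h. \<exists>y. y \<in> root_space h \<alpha> \<and> y \<noteq> 0" by (auto simp: roots_iff elim!: is_weightE)
  then obtain x where x: "\<And>\<alpha>. \<alpha> \<in> roots h \<Longrightarrow> x \<alpha> \<in> root_space h \<alpha> \<and> x \<alpha> \<noteq> 0" by metis
  have d: "roots h \<subseteq> dual_space h" using root_dual by blast
  obtain B :: "'g set" where B: "finite B" "complex_vector.span B = UNIV"
    using fin_dim by (auto simp: lie_finite_dimensional_def)
  have "finite (x ` roots h)"
    using complex_vector.independent_span_bound[OF B(1)] weight_vectors_independent(2)[OF d x] B(2) by simp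
  then show False using inf finite_imageD weight_vectors_independent(1)[OF d x] by blast
qed

lemma finite_weights: "finite {\<beta>. is_weight \<beta>}"
  by (rule finite_subset[of _ "insert 0 (roots h)"]) (use finite_roots is_weight_cases in auto)

lemma bracket_power_root_space:
  assumes "x \<in> root_space h \<alpha>" "y \<in> root_space h \<beta>"
  shows "(bracket x ^^ k) y \<in> root_space h (\<beta> + wscale (of_nat k) \<alpha>)"
proof (induction k)
  case 0 then show ?case using assms(2) by (simp add: zero_fun_def[symmetric])
next
  case (Suc k)
  have eq: "\<alpha> + (\<beta> + wscale (of_nat k) \<alpha>) = \<beta> + wscale (of_nat (Suc k)) \<alpha>"
    by (rule ext) (simp add: algebra_simps)
  show ?case using root_space_bracket[OF assms(1) Suc] unfolding eq by (simp only: funpow.simps comp_apply)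
qed

text \<open>Each application of \<open>bracket x\<close> shifts the weight by
  \<open>\<alpha>\<close>, and there are only finitely many weights.\<close>

lemma ad_root_vector_nilpotent:
  assumes x: "x \<in> root_space h \<alpha>" and a: "\<alpha> \<in> dual_space h" "\<alpha> \<noteq> 0"
  shows "\<exists>k. \<forall>y. (bracket x ^^ k) y = 0"
proof -
  let ?k = "Suc (card {\<beta>. is_weight \<beta>})"
  have hom: "(bracket x ^^ ?k) y = 0" if y: "y \<in> root_space h \<beta>" "\<beta> \<in> dual_space h" for y \<beta>
  proof (rule ccontr)
    assume n: "(bracket x ^^ ?k) y \<noteq> 0"
    have w: "is_weight (\<beta> + wscale (of_nat j) \<alpha>)" if "j \<le> ?k" for j
    proof (rule is_weightI[OF _ bracket_power_root_space[OF x y(1)]])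
      show "\<beta> + wscale (of_nat j) \<alpha> \<in> dual_space h" using y a by (intro dual_space_add dual_space_scale)
      show "(bracket x ^^ j) y \<noteq> 0"
      proof
        assume "(bracket x ^^ j) y = 0"
        moreover have "(bracket x ^^ ?k) y = (bracket x ^^ (?k - j)) ((bracket x ^^ j) y)"
          using that by (metis funpow_add comp_apply le_add_diff_inverse2)
        ultimately show False using n by simp
      qed
    qed
    have "inj_on (\<lambda>j. \<beta> + wscale (of_nat j) \<alpha>) {..?k}"
    proof (rule inj_onI)
      fix i j assume e: "\<beta> + wscale (of_nat i) \<alpha> = \<beta> + wscale (of_nat j) \<alpha>"
      obtain t where t: "\<alpha> t \<noteq> 0" using a(2) by (auto simp: fun_eq_iff)
      have "\<beta> t + of_nat i * \<alpha> t = \<beta> t + of_nat j * \<alpha> t" using fun_cong[OF e, of t] by simp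
      then show "i = j" using t by simp
    qed
    then have "card {..?k} \<le> card {\<beta>. is_weight \<beta>}"
      by (rule card_inj_on_le) (use w finite_weights in auto)
    then show False by simp
  qed
  have "(bracket x ^^ ?k) y = 0" for y
  proof -
    have "y \<in> complex_vector.span (\<Union>\<beta>\<in>{\<beta>. is_weight \<beta>}. root_space h \<beta>)" by (simp add: weight_spaces_span)
    then show ?thesis
    proof (induction rule: complex_vector.span_induct_alt)
      case base show ?case by simp
    next
      case (step c s t)
      then obtain \<beta> where "s \<in> root_space h \<beta>" "\<beta> \<in> dual_space h" by (auto simp: is_weight_def)
      then show ?case using hom step by (simp only: bracket_power_add bracket_power_scaleC) simp
    qed
  qed
  then show ?thesis by blast
qed

section \<open>Weight strings\<close>

text \<open>The computation with \<open>e f^(k+1) y\<close> in representations of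
  $\mathfrak{sl}_2$, done before it is known that \<open>\<alpha> t\<close> is nonzero:
  nilpotency of \<open>f\<close> forces the factor \<open>\<beta> t - m (\<alpha> t /
  2)\<close> to vanish for some \<open>m\<close>. With \<open>\<alpha> t = 0\<close> this
  shows that all weights vanish at \<open>t\<close>; with \<open>\<alpha> t = 2\<close> it
  gives the integrality of weights and the weight strings.\<close>

lemma highest_weight_vector:
  assumes e: "e \<in> root_space h \<alpha>" and f: "f \<in> root_space h (- \<alpha>)" and t: "t = bracket e f"
    and a: "\<alpha> \<in> dual_space h" "\<alpha> \<noteq> 0"
    and y: "y \<in> root_space h \<beta>" "y \<noteq> 0" "bracket e y = 0"
  shows "\<exists>m::nat. \<beta> t = of_nat m * (\<alpha> t / 2) \<and> (\<forall>j\<le>m. (bracket f ^^ j) y \<noteq> 0)"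
proof -
  have th: "t \<in> h" using root_space_bracket[OF e f] t by (simp add: root_space_0)
  have tf: "bracket t ((bracket f ^^ k) y) = scaleC (\<beta> t - of_nat k * \<alpha> t) ((bracket f ^^ k) y)" for k
    using root_spaceD[OF bracket_power_root_space[OF f y(1)] th, of k] by simp
  have ef: "bracket e ((bracket f ^^ Suc k) y) =
      scaleC (of_nat (Suc k) * (\<beta> t - of_nat k * (\<alpha> t / 2))) ((bracket f ^^ k) y)" for k
  proof (induction k)
    case 0 then show ?case using y tf[of 0] by (simp add: leibniz[of e] t[symmetric])
  next
    case (Suc k)
    have "bracket e ((bracket f ^^ Suc (Suc k)) y) =
        bracket t ((bracket f ^^ Suc k) y) + bracket f (bracket e ((bracket f ^^ Suc k) y))"
      by (simp add: leibniz[of e] t[symmetric])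
    also have "\<dots> = scaleC (\<beta> t - of_nat (Suc k) * \<alpha> t) ((bracket f ^^ Suc k) y) +
        scaleC (of_nat (Suc k) * (\<beta> t - of_nat k * (\<alpha> t / 2))) ((bracket f ^^ Suc k) y)"
      unfolding Suc tf by (simp add: bracket_scaleC_right)
    also have "\<dots> = scaleC (of_nat (Suc (Suc k)) * (\<beta> t - of_nat (Suc k) * (\<alpha> t / 2))) ((bracket f ^^ Suc k) y)"
      unfolding scaleC_add_left[symmetric] by (rule arg_cong[of _ _ "\<lambda>c. scaleC c _"]) (simp add: field_simps)
    finally show ?case .
  qed
  have "\<exists>k. (bracket f ^^ k) y = 0"
    using ad_root_vector_nilpotent[OF f] dual_space_minus[OF a(1)] a(2) by auto
  then obtain k where k: "(bracket f ^^ k) y = 0" "\<And>j. j < k \<Longrightarrow> (bracket f ^^ j) y \<noteq> 0"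
    using exists_least_iff[of "\<lambda>k. (bracket f ^^ k) y = 0"] by blast
  then obtain m where m: "k = Suc m" using y(2) by (cases k) auto
  have "of_nat (Suc m) * (\<beta> t - of_nat m * (\<alpha> t / 2)) = 0"
    using ef[of m] k(1) k(2)[of m] unfolding m by (simp del: funpow.simps)
  then have "\<beta> t = of_nat m * (\<alpha> t / 2)" by (simp del: of_nat_Suc)
  then show ?thesis using k m by auto
qed

lemma lift_to_highest:
  assumes e: "e \<in> root_space h \<alpha>" and a: "\<alpha> \<in> dual_space h" "\<alpha> \<noteq> 0"
    and y: "y \<in> root_space h \<beta>" "y \<noteq> 0"
  shows "\<exists>q. (bracket e ^^ q) y \<noteq> 0 \<and> bracket e ((bracket e ^^ q) y) = 0"
proof -
  have "\<exists>k. (bracket e ^^ k) y = 0" using ad_root_vector_nilpotent[OF e a] by blast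
  then obtain k where k: "(bracket e ^^ k) y = 0" "\<And>j. j < k \<Longrightarrow> (bracket e ^^ j) y \<noteq> 0"
    using exists_least_iff[of "\<lambda>k. (bracket e ^^ k) y = 0"] by blast
  then obtain m where "k = Suc m" using y(2) by (cases k) auto
  then show ?thesis using k by (intro exI[of _ m]) auto
qed

lemma abelian_ideal_zero:
  fixes I :: "'g set"
  assumes I: "lie_ideal I" and z: "\<And>x y. x \<in> I \<Longrightarrow> y \<in> I \<Longrightarrow> bracket x y = 0"
  shows "I = {0}"
proof -
  have "{bracket a b | a b. a \<in> I \<and> b \<in> I} \<subseteq> {0}" using z by blast
  then have "complex_vector.span {bracket a b | a b. a \<in> I \<and> b \<in> I} \<subseteq> complex_vector.span {0}"
    by (rule complex_vector.span_mono)
  then have "bracket_space I I = {0}" using complex_vector.span_zero by (auto simp: bracket_space_def)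
  then have "lie_solvable I" unfolding lie_solvable_def by (intro exI[of _ 1]) simp
  with I show ?thesis using semisimple unfolding lie_semisimple_def by blast
qed

lemma central_imp_zero:
  fixes t :: 'g
  assumes "\<And>y. bracket y t = 0" shows "t = 0"
proof -
  let ?I = "complex_vector.span {t}"
  have z: "bracket y x = 0" if "x \<in> ?I" for x y
    using that assms by (auto simp: complex_vector.span_singleton bracket_scaleC_right)
  have "lie_ideal ?I" using z complex_vector.span_zero by (auto simp: lie_ideal_def)
  then have "?I = {0}" using z by (rule abelian_ideal_zero)
  then show ?thesis using complex_vector.span_base[of t "{t}"] by auto
qed

text \<open>An element of \<open>h\<close> on which all roots vanish is central, and a
  central element spans an abelian ideal.\<close>

lemma zero_if_roots_vanish:
  assumes t: "t \<in> h" and r: "\<And>\<beta>. \<beta> \<in> roots h \<Longrightarrow> \<beta> t = 0" shows "t = 0"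
proof (rule central_imp_zero)
  fix y
  have "bracket t y = 0"
  proof -
    have "y \<in> complex_vector.span (\<Union>\<beta>\<in>{\<beta>. is_weight \<beta>}. root_space h \<beta>)" by (simp add: weight_spaces_span)
    then show ?thesis
    proof (induction rule: complex_vector.span_induct_alt)
      case base show ?case by simp
    next
      case (step c x y)
      then obtain \<beta> where b: "x \<in> root_space h \<beta>" "is_weight \<beta>" by blast
      then have "\<beta> t = 0" using is_weight_cases r by fastforce
      then show ?case using step b root_spaceD[OF b(1) t] by (simp add: bracket_add_right bracket_scaleC_right)
    qed
  qed
  then show "bracket y t = 0" using bracket_skew[of y t] by simp
qed

text \<open>The case \<open>\<alpha> t = 0\<close> of \<open>highest_weight_vector\<close>:
  every root string then has \<open>\<beta> t = 0\<close>.\<close>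

lemma bracket_opposite_eq_zero:
  assumes e: "e \<in> root_space h \<alpha>" and f: "f \<in> root_space h (- \<alpha>)" and r: "\<alpha> \<in> roots h"
    and z: "\<alpha> (bracket e f) = 0"
  shows "bracket e f = 0"
proof (rule zero_if_roots_vanish)
  let ?t = "bracket e f"
  note a = root_dual[OF r]
  have a0: "\<alpha> \<noteq> 0" using r by (simp add: roots_iff)
  show "?t \<in> h" using root_space_bracket[OF e f] by (simp add: root_space_0)
  fix \<beta> assume "\<beta> \<in> roots h"
  then obtain y where y: "y \<in> root_space h \<beta>" "y \<noteq> 0" by (auto simp: roots_iff elim!: is_weightE)
  obtain q where q: "(bracket e ^^ q) y \<noteq> 0" "bracket e ((bracket e ^^ q) y) = 0"
    using lift_to_highest[OF e a a0 y] by blast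
  from highest_weight_vector[OF e f refl a a0 bracket_power_root_space[OF e y(1)] q] z
  show "\<beta> ?t = 0" by simp
qed

definition sl2_triple :: "'g weight \<Rightarrow> 'g \<Rightarrow> 'g \<Rightarrow> 'g \<Rightarrow> bool" where
  "sl2_triple \<alpha> e f t \<longleftrightarrow> \<alpha> \<in> roots h \<and> e \<in> root_space h \<alpha> \<and> f \<in> root_space h (- \<alpha>) \<and>
     t = bracket e f \<and> \<alpha> t = 2"

lemma sl2_tripleD:
  assumes "sl2_triple \<alpha> e f t"
  shows "\<alpha> \<in> roots h" "\<alpha> \<in> dual_space h" "\<alpha> \<noteq> 0" "e \<in> root_space h \<alpha>" "f \<in> root_space h (- \<alpha>)"
    "t = bracket e f" "\<alpha> t = 2" "t \<in> h"
  using assms root_space_bracket[of e h \<alpha> f "- \<alpha>"]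
  by (auto simp: sl2_triple_def roots_def root_space_0)

lemma dual_space_uminus: "\<beta> \<in> dual_space h \<Longrightarrow> \<beta> (- t) = - \<beta> t"
proof -
  assume b: "\<beta> \<in> dual_space h"
  show ?thesis
  proof (cases "t \<in> h")
    case True
    have "\<forall>c. \<forall>x\<in>h. \<beta> (scaleC c x) = c * \<beta> x" using b by (simp add: dual_space_def)
    then have "\<beta> (scaleC (- 1) t) = - 1 * \<beta> t" using True by blast
    then show ?thesis by simp
  next
    case False
    moreover have "- t \<notin> h" using False complex_vector.subspace_neg[OF subspace_h, of "- t"] by auto
    ultimately show ?thesis using b by (auto simp: dual_space_def)
  qed
qed

lemma sl2_triple_swap: "sl2_triple \<alpha> e f t \<Longrightarrow> sl2_triple (- \<alpha>) f e (- t)"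
  using bracket_skew[of f e] by (auto simp: sl2_triple_def uminus_roots dual_space_uminus root_dual)

text \<open>\<open>q\<close> is the number of steps up to a highest weight and
  \<open>m\<close> the length of the string going down from there; the string need not be
  the whole weight string through \<open>\<beta>\<close>, but it reaches far enough to
  contain the reflection of \<open>\<beta>\<close>.\<close>

lemma sl2_string:
  assumes s: "sl2_triple \<alpha> e f t" and b: "is_weight \<beta>"
  shows "\<exists>q m::nat. \<beta> t = of_nat m - 2 * of_nat q \<and>
    (\<forall>j\<le>m. is_weight (\<beta> + wscale (of_nat q - of_nat j) \<alpha>))"
proof -
  note s' = sl2_tripleD[OF s]
  obtain y where y: "y \<in> root_space h \<beta>" "y \<noteq> 0" and bd: "\<beta> \<in> dual_space h" using b is_weightE by blast
  obtain q where q: "(bracket e ^^ q) y \<noteq> 0" "bracket e ((bracket e ^^ q) y) = 0"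
    using lift_to_highest[OF s'(4,2,3) y] by blast
  let ?y = "(bracket e ^^ q) y" and ?b = "\<beta> + wscale (of_nat q) \<alpha>"
  have y': "?y \<in> root_space h ?b" by (rule bracket_power_root_space[OF s'(4) y(1)])
  obtain m :: nat where m: "?b t = of_nat m * (\<alpha> t / 2)" "\<forall>j\<le>m. (bracket f ^^ j) ?y \<noteq> 0"
    using highest_weight_vector[OF s'(4,5,6,2,3) y' q] by blast
  have "is_weight (\<beta> + wscale (of_nat q - of_nat j) \<alpha>)" if "j \<le> m" for j
  proof (rule is_weightI)
    show "\<beta> + wscale (of_nat q - of_nat j) \<alpha> \<in> dual_space h" using bd s' by (intro dual_space_add dual_space_scale)
    have eq: "?b + wscale (of_nat j) (- \<alpha>) = \<beta> + wscale (of_nat q - of_nat j) \<alpha>"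
      by (rule ext) (simp add: algebra_simps)
    show "(bracket f ^^ j) ?y \<in> root_space h (\<beta> + wscale (of_nat q - of_nat j) \<alpha>)"
      using bracket_power_root_space[OF s'(5) y', of j] unfolding eq .
    show "(bracket f ^^ j) ?y \<noteq> 0" by (rule m(2)[rule_format, OF that])
  qed
  moreover have "\<beta> t = of_nat m - 2 * of_nat q" using m(1) s'(7) by (simp add: algebra_simps)
  ultimately show ?thesis by blast
qed

lemma sl2_weight_int: "sl2_triple \<alpha> e f t \<Longrightarrow> is_weight \<beta> \<Longrightarrow> \<exists>n::int. \<beta> t = of_int n"
  using sl2_string[of \<alpha> e f t \<beta>] by (metis of_int_diff of_int_mult of_int_numeral of_int_of_nat_eq)

lemma sl2_string_down:
  assumes s: "sl2_triple \<alpha> e f t" and b: "is_weight \<beta>" and n: "\<beta> t = of_nat n" and j: "j \<le> n"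
  shows "is_weight (\<beta> - wscale (of_nat j) \<alpha>)"
proof -
  obtain q m :: nat where qm: "\<beta> t = of_nat m - 2 * of_nat q"
    "\<And>j. j \<le> m \<Longrightarrow> is_weight (\<beta> + wscale (of_nat q - of_nat j) \<alpha>)"
    using sl2_string[OF s b] by blast
  have "(of_nat m :: complex) = of_nat (n + 2 * q)" using qm(1) n by simp
  then have "m = n + 2 * q" by (simp only: of_nat_eq_iff)
  then have "q + j \<le> m" using j by simp
  then have "is_weight (\<beta> + wscale (of_nat q - of_nat (q + j)) \<alpha>)" by (rule qm(2))
  moreover have "\<beta> + wscale (of_nat q - of_nat (q + j)) \<alpha> = \<beta> - wscale (of_nat j) \<alpha>"
    by (rule ext) (simp add: algebra_simps)
  ultimately show ?thesis by (simp only:)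
qed

lemma sl2_reflection:
  assumes s: "sl2_triple \<alpha> e f t" and b: "is_weight \<beta>"
  shows "is_weight (\<beta> - wscale (\<beta> t) \<alpha>)"
proof -
  obtain n :: int where n: "\<beta> t = of_int n" using sl2_weight_int[OF s b] by blast
  show ?thesis
  proof (cases "n \<ge> 0")
    case True
    then have 1: "\<beta> t = of_nat (nat n)" using n by simp
    show ?thesis using sl2_string_down[OF s b 1 order_refl] unfolding 1 .
  next
    case False
    then have 1: "\<beta> (- t) = of_nat (nat (- n))" using n b by (simp add: dual_space_uminus is_weight_def)
    have 2: "\<beta> - wscale (of_nat (nat (- n))) (- \<alpha>) = \<beta> - wscale (\<beta> t) \<alpha>"
      using n False by (intro ext) simp
    show ?thesis using sl2_string_down[OF sl2_triple_swap[OF s] b 1 order_refl] unfolding 2 .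
  qed
qed

lemma sl2_reflection_root:
  assumes s: "sl2_triple \<alpha> e f t" and b: "\<beta> \<in> roots h"
  shows "\<beta> - wscale (\<beta> t) \<alpha> \<in> roots h"
proof -
  have "\<beta> - wscale (\<beta> t) \<alpha> \<noteq> 0"
  proof
    assume z: "\<beta> - wscale (\<beta> t) \<alpha> = 0"
    have "\<beta> t - \<beta> t * \<alpha> t = 0" using fun_cong[OF z, of t] by simp
    then have "\<beta> t = 0" by (simp add: sl2_tripleD(7)[OF s])
    then have "\<beta> = 0" using z by simp
    then show False using b by (simp add: roots_iff)
  qed
  then show ?thesis using sl2_reflection[OF s, of \<beta>] b by (simp add: roots_iff)
qed

text \<open>A substitute for complete reducibility: along \<open>z\<close>, \<open>e
  z\<close>, \<open>e^2 z\<close>, and so on, the eigenvalue of \<open>f e\<close> decreases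
  by the eigenvalue of \<open>t\<close>, which is positive. It stays negative, so
  \<open>e\<close> never kills these vectors unless \<open>z = 0\<close>; but
  \<open>e\<close> is nilpotent.\<close>

lemma fe_negative_zero:
  assumes s: "sl2_triple \<alpha> e f t" and z: "z \<in> root_space h \<beta>" and n: "\<beta> t = of_nat n"
    and c: "bracket f (bracket e z) = scaleC (of_real c) z" "c < 0"
  shows "z = 0"
proof (rule ccontr)
  assume nz: "z \<noteq> 0"
  note s' = sl2_tripleD[OF s]
  have "\<exists>c<0. bracket f (bracket e ((bracket e ^^ k) z)) = scaleC (of_real c) ((bracket e ^^ k) z)" for k
  proof (induction k)
    case 0 then show ?case using c by auto
  next
    case (Suc k)
    then obtain c where c: "c < 0" "bracket f (bracket e ((bracket e ^^ k) z)) = scaleC (of_real c) ((bracket e ^^ k) z)" by blast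
    let ?w = "(bracket e ^^ Suc k) z"
    have "bracket t ?w = scaleC (of_nat n + of_nat (Suc k) * 2) ?w"
      using root_spaceD[OF bracket_power_root_space[OF s'(4) z] s'(8), of "Suc k"] n s'(7) by simp
    moreover have "bracket e (bracket f ?w) = scaleC (of_real c) ?w" using c by (simp add: bracket_scaleC_right)
    ultimately have "bracket f (bracket e ?w) = scaleC (of_real c) ?w - scaleC (of_nat n + of_nat (Suc k) * 2) ?w"
      using leibniz[of e f ?w] s'(6) by (simp add: eq_diff_eq algebra_simps)
    also have "\<dots> = scaleC (of_real (c - (of_nat n + of_nat (Suc k) * 2))) ?w"
      by (simp add: complex_vector.scale_left_diff_distrib)
    finally show ?case using c(1) by (intro exI[of _ "c - (of_nat n + of_nat (Suc k) * 2)"]) auto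
  qed note ne = this
  obtain q where q: "(bracket e ^^ q) z \<noteq> 0" "bracket e ((bracket e ^^ q) z) = 0"
    using lift_to_highest[OF s'(4,2,3) z nz] by blast
  then show False using ne[of q] by auto
qed

text \<open>Subtracting a multiple of \<open>e\<close> from \<open>z\<close> achieves that
  \<open>\<alpha>\<close> vanishes on \<open>[f, z]\<close>; then \<open>f e z = - 2
  z\<close>, and \<open>fe_negative_zero\<close> applies.\<close>

lemma root_space_one_dim:
  assumes s: "sl2_triple \<alpha> e f t" and z: "z \<in> root_space h \<alpha>"
  shows "\<exists>c. z = scaleC c e"
proof -
  note s' = sl2_tripleD[OF s]
  let ?u = "bracket f z"
  define c where "c = - \<alpha> ?u / 2"
  define z' where "z' = z - scaleC c e"
  have fe: "bracket f e = - t" using bracket_skew[of f e] s' by simp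
  have "?u \<in> h" using root_space_bracket[OF s'(5) z] by (simp add: root_space_0)
  have z'r: "z' \<in> root_space h \<alpha>" using z s' complex_vector.subspace_diff complex_vector.subspace_scale subspace_root_space
    unfolding z'_def by blast
  let ?u' = "bracket f z'"
  have u'h: "?u' \<in> h" using root_space_bracket[OF s'(5) z'r] by (simp add: root_space_0)
  have u': "?u' = ?u + scaleC c t" by (simp add: z'_def lie_ad.diff bracket_scaleC_right fe)
  have "\<alpha> ?u' = \<alpha> ?u + c * \<alpha> t"
    unfolding u' using s'(2,8) \<open>?u \<in> h\<close> complex_vector.subspace_scale[OF subspace_h] by (auto simp: dual_space_def)
  then have "\<alpha> ?u' = 0" using s' by (simp add: c_def)
  then have "bracket ?u' e = 0" using root_spaceD[OF s'(4) u'h] by simp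
  then have 1: "bracket e ?u' = 0" using bracket_skew[of e ?u'] by simp
  have "bracket t z' = scaleC 2 z'" using root_spaceD[OF z'r s'(8)] s' by simp
  then have "bracket f (bracket e z') = scaleC (of_real (- 2)) z'"
    using leibniz[of f e z'] 1 fe by (simp add: bracket_minus_left)
  then have "z' = 0" using fe_negative_zero[OF s z'r, of 2 "- 2"] s' by simp
  then show ?thesis by (auto simp: z'_def)
qed

lemma double_root_not_weight:
  assumes s: "sl2_triple \<alpha> e f t" shows "\<not> is_weight (wscale 2 \<alpha>)"
proof
  note s' = sl2_tripleD[OF s]
  assume "is_weight (wscale 2 \<alpha>)"
  then obtain y where y: "y \<in> root_space h (wscale 2 \<alpha>)" "y \<noteq> 0" by (blast elim: is_weightE)
  have "- \<alpha> + wscale 2 \<alpha> = \<alpha>" by (rule ext) simp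
  then have "bracket f y \<in> root_space h \<alpha>" using root_space_bracket[OF s'(5) y(1)] by simp
  then obtain c where "bracket f y = scaleC c e" using root_space_one_dim[OF s] by blast
  then have 1: "bracket e (bracket f y) = 0" by (simp add: bracket_scaleC_right bracket_self)
  have "bracket f e = - t" using bracket_skew[of f e] s' by simp
  moreover have "bracket t y = scaleC 4 y" using root_spaceD[OF y(1) s'(8)] s' by simp
  ultimately have "bracket f (bracket e y) = scaleC (of_real (- 4)) y"
    using leibniz[of f e y] 1 by (simp add: bracket_minus_left)
  then have "y = 0" using fe_negative_zero[OF s y(1), of 4 "- 4"] s' by simp
  then show False using y by blast
qed

text \<open>If the claim fails, the two reflections in \<open>\<beta>\<close> and
  \<open>\<gamma>\<close> fix the same hyperplane, the weights vanishing at
  \<open>t\<close>, but are different, so their composite is a nontrivial shear of infinite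
  order, and the roots obtained by applying it repeatedly to \<open>\<beta>\<close> are
  pairwise distinct.\<close>

lemma proportional_coroots:
  assumes s1: "sl2_triple \<gamma> e f t" and s2: "sl2_triple \<beta> e' f' t'" and p: "t = scaleC c t'"
  shows "wscale c \<gamma> = \<beta>"
proof (rule ccontr)
  assume ne: "wscale c \<gamma> \<noteq> \<beta>"
  note s1' = sl2_tripleD[OF s1] and s2' = sl2_tripleD[OF s2]
  \<comment> \<open>The orbit of \<open>\<beta>\<close> under the composite of the two
    reflections.\<close>
  let ?\<mu> = "\<lambda>n::nat. \<beta> + wscale (2 * of_nat n) (wscale c \<gamma> - \<beta>)"
  have tt: "\<mu> t = c * \<mu> t'" if "\<mu> \<in> dual_space h" for \<mu> using that s2'(8) p by (auto simp: dual_space_def)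
  have cg: "c * \<gamma> t' = 2" using tt[OF s1'(2)] s1'(7) by simp
  have r: "?\<mu> n \<in> roots h" for n
  proof (induction n)
    case 0
    have "?\<mu> 0 = \<beta>" by (rule ext) simp
    then show ?case using s2' by simp
  next
    case (Suc n)
    have m2: "?\<mu> n t' = 2" using cg s2'(7) by simp
    have 1: "?\<mu> n - wscale 2 \<beta> \<in> roots h" using sl2_reflection_root[OF s2 Suc] unfolding m2 .
    have v: "(?\<mu> n - wscale 2 \<beta>) t = - 2 * c"
      using tt[OF root_dual[OF 1]] cg s2'(7) by simp
    have "?\<mu> n - wscale 2 \<beta> - wscale (- 2 * c) \<gamma> \<in> roots h"
      using sl2_reflection_root[OF s1 1] unfolding v .
    moreover have "?\<mu> n - wscale 2 \<beta> - wscale (- 2 * c) \<gamma> = ?\<mu> (Suc n)"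
      by (rule ext) (simp add: algebra_simps)
    ultimately show ?case by (simp only:)
  qed
  have "\<exists>x. wscale c \<gamma> x \<noteq> \<beta> x" using ne by (meson ext)
  then obtain x where x: "c * \<gamma> x - \<beta> x \<noteq> 0" by auto
  have "inj ?\<mu>"
  proof (rule injI)
    fix i j assume e: "?\<mu> i = ?\<mu> j"
    have "\<beta> x + 2 * of_nat i * (c * \<gamma> x - \<beta> x) = \<beta> x + 2 * of_nat j * (c * \<gamma> x - \<beta> x)"
      using fun_cong[OF e, of x] by simp
    then have "(2 * of_nat i :: complex) * (c * \<gamma> x - \<beta> x) = 2 * of_nat j * (c * \<gamma> x - \<beta> x)"
      by (rule add_left_imp_eq)
    then have "(2 * of_nat i :: complex) = 2 * of_nat j" using x by (metis mult_right_cancel)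
    then show "i = j" by simp
  qed
  then have "infinite (range ?\<mu>)" by (rule range_inj_infinite)
  moreover have "range ?\<mu> \<subseteq> roots h" using r by (rule image_subsetI)
  ultimately show False using finite_subset[OF _ finite_roots] by simp
qed

end


section \<open>Every root has a triple\<close>

lemma bracket_space_mono: "B \<subseteq> B' \<Longrightarrow> bracket_space T B \<subseteq> bracket_space T B'"
  unfolding bracket_space_def by (rule complex_vector.span_mono) blast

lemma bracket_space_funpow_mono: "B \<subseteq> B' \<Longrightarrow> (bracket_space T ^^ n) B \<subseteq> (bracket_space T ^^ n) B'"
  by (induction n) (simp_all add: bracket_space_mono)

lemma bracket_in_bracket_space: "a \<in> A \<Longrightarrow> b \<in> B \<Longrightarrow> bracket a b \<in> bracket_space A B"
  unfolding bracket_space_def by (rule complex_vector.span_base) blast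

lemma bracket_space_least:
  assumes "complex_vector.subspace M" "\<And>a b. a \<in> A \<Longrightarrow> b \<in> B \<Longrightarrow> bracket a b \<in> M"
  shows "bracket_space A B \<subseteq> M"
  unfolding bracket_space_def by (rule complex_vector.span_minimal) (use assms in auto)

text \<open>The induction step of Engel's theorem. If the subalgebra \<open>T\<close> acts
  nilpotently and \<open>x\<close> normalises it, then \<open>x\<close> preserves each step
  of the descending chain \<open>T^i g\<close>. Modulo the next step, a product of
  \<open>j\<close> elements of \<open>T' = T + C x\<close> acts like a multiple of the
  \<open>j\<close>-th power of \<open>x\<close>, so \<open>k\<close> factors suffice to get
  from one step of the chain to the next.\<close>

lemma engel_step:
  fixes x :: "'g::complex_lie_algebra"
  assumes x: "\<And>a. a \<in> T \<Longrightarrow> bracket x a \<in> T" and T: "complex_vector.subspace T"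
    and T': "\<And>p. p \<in> T' \<Longrightarrow> \<exists>s. \<exists>a\<in>T. p = scaleC s x + a"
    and k: "\<And>y. (bracket x ^^ k) y = 0"
    and N: "(bracket_space T ^^ N) UNIV \<subseteq> {0}"
  shows "(bracket_space T' ^^ (k * N)) UNIV \<subseteq> {0}"
proof -
  define C where "C i = (bracket_space T ^^ i) UNIV" for i
  have C_Suc: "C (Suc i) = bracket_space T (C i)" for i by (simp add: C_def)
  have C_sub: "complex_vector.subspace (C i)" for i
    by (cases i) (simp_all add: C_def bracket_space_def)
  have C_dec: "C (Suc i) \<subseteq> C i" for i
  proof (induction i)
    case 0 show ?case by (simp add: C_def)
  next
    case (Suc i) then show ?case unfolding C_Suc[of "Suc i"] C_Suc[of i] by (rule bracket_space_mono)
  qed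
  have xC: "bracket x y \<in> C i" if "y \<in> C i" for i y
    using that
  proof (induction i arbitrary: y)
    case 0 show ?case by (simp add: C_def)
  next
    case (Suc i)
    have "C (Suc i) \<subseteq> {y. bracket x y \<in> C (Suc i)}"
      unfolding C_Suc[of i]
    proof (rule bracket_space_least)
      show "complex_vector.subspace {y. bracket x y \<in> bracket_space T (C i)}"
        unfolding C_Suc[symmetric]
        by (rule complex_vector.subspaceI)
          (auto simp: bracket_add_right bracket_scaleC_right complex_vector.subspace_0[OF C_sub]
            complex_vector.subspace_add[OF C_sub] complex_vector.subspace_scale[OF C_sub])
      fix a b assume ab: "a \<in> T" "b \<in> C i"
      have "bracket (bracket x a) b \<in> C (Suc i)" "bracket a (bracket x b) \<in> C (Suc i)"
        unfolding C_Suc using ab x Suc.IH by (auto intro!: bracket_in_bracket_space)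
      then show "bracket a b \<in> {y. bracket x y \<in> bracket_space T (C i)}"
        unfolding C_Suc[symmetric] using complex_vector.subspace_add[OF C_sub] by (simp add: leibniz[of x])
    qed
    then show ?case using Suc.prems by blast
  qed
  have xkC: "(bracket x ^^ j) y \<in> C i" if "y \<in> C i" for i j y
    using that by (induction j) (simp_all add: xC)
  \<comment> \<open>Within \<open>C i\<close>, a product of \<open>j\<close> elements of
    \<open>T'\<close> is a multiple of the \<open>j\<close>-th power of \<open>x\<close>, up
    to an element of \<open>C (Suc i)\<close>.\<close>
  have main: "(bracket_space T' ^^ j) (C i) \<subseteq> {u + (bracket x ^^ j) d | u d. u \<in> C (Suc i) \<and> d \<in> C i}" for i j
  proof (induction j)
    case 0
    have "y = 0 + y \<and> 0 \<in> C (Suc i)" for y :: 'g using complex_vector.subspace_0[OF C_sub] by simp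
    then show ?case by (simp only: funpow_0) blast
  next
    case (Suc j)
    let ?M = "{u + (bracket x ^^ Suc j) d | u d. u \<in> C (Suc i) \<and> d \<in> C i}"
    have "bracket_space T' ((bracket_space T' ^^ j) (C i)) \<subseteq> ?M"
    proof (rule bracket_space_least)
      show "complex_vector.subspace ?M"
      proof (rule complex_vector.subspaceI)
        show "0 \<in> ?M"
          by (intro CollectI exI[of _ 0]) (simp add: complex_vector.subspace_0[OF C_sub])
      next
        fix p q assume "p \<in> ?M" "q \<in> ?M"
        then obtain u d u' d' where e: "p = u + (bracket x ^^ Suc j) d" "q = u' + (bracket x ^^ Suc j) d'"
          and m: "u \<in> C (Suc i)" "d \<in> C i" "u' \<in> C (Suc i)" "d' \<in> C i" by blast
        have "p + q = (u + u') + (bracket x ^^ Suc j) (d + d')"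
          unfolding e bracket_power_add by (simp only: ac_simps)
        then show "p + q \<in> ?M" using m complex_vector.subspace_add[OF C_sub] by blast
      next
        fix c p assume "p \<in> ?M"
        then obtain u d where e: "p = u + (bracket x ^^ Suc j) d" and m: "u \<in> C (Suc i)" "d \<in> C i" by blast
        have "scaleC c p = scaleC c u + (bracket x ^^ Suc j) (scaleC c d)"
          unfolding e bracket_power_scaleC by (simp only: scaleC_add_right)
        then show "scaleC c p \<in> ?M" using m complex_vector.subspace_scale[OF C_sub] by blast
      qed
    next
      fix p q assume p: "p \<in> T'" and q: "q \<in> (bracket_space T' ^^ j) (C i)"
      obtain s a where a: "a \<in> T" "p = scaleC s x + a" using T' p by blast
      obtain u d where m: "u \<in> C (Suc i)" "d \<in> C i" "q = u + (bracket x ^^ j) d" using Suc.IH q by blast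
      have "u \<in> C i" using C_dec m by blast
      then have "q \<in> C i" unfolding m(3) using xkC[OF m(2)] complex_vector.subspace_add[OF C_sub] by blast
      then have "bracket a q \<in> C (Suc i)" unfolding C_Suc using a by (intro bracket_in_bracket_space)
      moreover have "scaleC s (bracket x u) \<in> C (Suc i)"
        using xC[OF m(1)] complex_vector.subspace_scale[OF C_sub] by blast
      ultimately have "scaleC s (bracket x u) + bracket a q \<in> C (Suc i)"
        using complex_vector.subspace_add[OF C_sub] by blast
      moreover have "scaleC s d \<in> C i" using m complex_vector.subspace_scale[OF C_sub] by blast
      moreover have "bracket p q = (scaleC s (bracket x u) + bracket a q) + (bracket x ^^ Suc j) (scaleC s d)"
      proof -
        have "bracket p q = scaleC s (bracket x q) + bracket a q"
          unfolding a(2) by (simp only: bracket_add_left bracket_scaleC_left)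
        also have "bracket x q = bracket x u + (bracket x ^^ Suc j) d"
          unfolding m(3) by (simp add: bracket_add_right)
        also have "scaleC s (bracket x u + (bracket x ^^ Suc j) d) = scaleC s (bracket x u) + (bracket x ^^ Suc j) (scaleC s d)"
          by (simp only: scaleC_add_right bracket_power_scaleC)
        finally show ?thesis by (simp only: ac_simps)
      qed
      ultimately show "bracket p q \<in> ?M" by blast
    qed
    then show ?case by simp
  qed
  have step: "(bracket_space T' ^^ k) (C i) \<subseteq> C (Suc i)" for i
    using main[of k i] k by auto
  have "(bracket_space T' ^^ (k * i)) UNIV \<subseteq> C i" for i
  proof (induction i)
    case 0 show ?case by (simp add: C_def)
  next
    case (Suc i)
    have "(bracket_space T' ^^ (k * Suc i)) UNIV = (bracket_space T' ^^ k) ((bracket_space T' ^^ (k * i)) UNIV)"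
      by (simp add: funpow_add)
    also have "\<dots> \<subseteq> (bracket_space T' ^^ k) (C i)" using Suc by (rule bracket_space_funpow_mono)
    finally show ?case using step by blast
  qed
  then show ?thesis using N unfolding C_def by blast
qed

context triangular_decomposition
begin

lemma dual_add: "\<phi> \<in> dual_space h \<Longrightarrow> s \<in> h \<Longrightarrow> t \<in> h \<Longrightarrow> \<phi> (s + t) = \<phi> s + \<phi> t"
  by (simp add: dual_space_def)
lemma dual_scaleC: "\<phi> \<in> dual_space h \<Longrightarrow> t \<in> h \<Longrightarrow> \<phi> (scaleC c t) = c * \<phi> t"
  by (simp add: dual_space_def)
lemma h_scaleC: "t \<in> h \<Longrightarrow> scaleC c t \<in> h" by (rule complex_vector.subspace_scale[OF subspace_h])
lemma h_add: "s \<in> h \<Longrightarrow> t \<in> h \<Longrightarrow> s + t \<in> h" by (rule complex_vector.subspace_add[OF subspace_h])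
lemma h_diff: "s \<in> h \<Longrightarrow> t \<in> h \<Longrightarrow> s - t \<in> h" by (rule complex_vector.subspace_diff[OF subspace_h])
lemma dual_diff: assumes "\<phi> \<in> dual_space h" "s \<in> h" "t \<in> h" shows "\<phi> (s - t) = \<phi> s - \<phi> t"
proof -
  have "\<phi> (s - t) + \<phi> t = \<phi> s" using dual_add[OF assms(1) h_diff[OF assms(2,3)] assms(3)] by simp
  then show ?thesis by (simp add: eq_diff_eq)
qed

lemma sl2_triple_if_nonzero:
  assumes r: "\<alpha> \<in> roots h" and x: "x \<in> root_space h \<alpha>" and y: "y \<in> root_space h (- \<alpha>)" and n: "bracket x y \<noteq> 0"
  shows "\<exists>s. s \<noteq> 0 \<and> sl2_triple \<alpha> x (scaleC s y) (scaleC s (bracket x y))"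
proof -
  let ?u = "bracket x y" let ?s = "2 / \<alpha> ?u"
  have u: "?u \<in> h" using root_space_bracket[OF x y] by (simp add: root_space_0)
  have a: "\<alpha> ?u \<noteq> 0" using bracket_opposite_eq_zero[OF x y r] n by blast
  have "\<alpha> (scaleC ?s ?u) = 2" using dual_scaleC[OF root_dual[OF r] u] a by simp
  moreover have "scaleC ?s y \<in> root_space h (- \<alpha>)" by (rule complex_vector.subspace_scale[OF subspace_root_space y])
  ultimately have "sl2_triple \<alpha> x (scaleC ?s y) (scaleC ?s ?u)"
    using r x by (simp add: sl2_triple_def bracket_scaleC_right)
  then show ?thesis using a by (intro exI[of _ ?s]) simp
qed

text \<open>The aim of this part is that these roots do not exist. They are the roots for
  which the coroot would be undefined.\<close>

definition degenerate :: "'g weight \<Rightarrow> bool" where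
  "degenerate \<alpha> \<longleftrightarrow> \<alpha> \<in> roots h \<and> \<not> (\<exists>e f t. sl2_triple \<alpha> e f t)"

lemma degenerate_bracket:
  assumes "degenerate \<alpha>" "x \<in> root_space h \<alpha>" "y \<in> root_space h (- \<alpha>)" shows "bracket x y = 0"
proof (rule ccontr)
  assume "bracket x y \<noteq> 0"
  then have "\<exists>s. s \<noteq> 0 \<and> sl2_triple \<alpha> x (scaleC s y) (scaleC s (bracket x y))"
    using assms by (intro sl2_triple_if_nonzero) (simp_all add: degenerate_def)
  then show False using assms(1) unfolding degenerate_def by blast
qed

lemma int_mult_eq_4:
  assumes "(n::int) * m = 4" shows "n \<in> {1, -1, 2, -2, 4, -4}"
proof -
  have "n dvd 4" using assms by (metis dvd_triv_left)
  then have "\<bar>n\<bar> \<le> 4" using dvd_imp_le_int[of 4 n] by simp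
  then have "n \<in> {-4, -3, -2, -1, 0, 1, 2, 3, 4}" by auto
  then show ?thesis using assms by auto presburger+
qed

text \<open>The two Cartan integers of proportional roots have product 4. The possible
  ratios are therefore 1/2, 1, 2 up to sign, and twice a root is not a weight.\<close>

lemma proportional_roots:
  assumes s1: "sl2_triple \<gamma> e f t" and s2: "sl2_triple \<beta> e' f' t'" and p: "wscale c \<gamma> = \<beta>"
  shows "\<beta> = \<gamma> \<or> \<beta> = - \<gamma>"
proof -
  note s1' = sl2_tripleD[OF s1] and s2' = sl2_tripleD[OF s2]
  have w: "is_weight \<beta>" "is_weight \<gamma>" using s1'(1) s2'(1) by (simp_all add: roots_iff)
  obtain n m :: int where nm: "\<beta> t = of_int n" "\<gamma> t' = of_int m"
    using sl2_weight_int[OF s1 w(1)] sl2_weight_int[OF s2 w(2)] by blast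
  have n: "of_int n = 2 * c" using fun_cong[OF p, of t] nm s1'(7) by (simp add: mult.commute)
  have m: "c * of_int m = 2" using fun_cong[OF p, of t'] nm s2'(7) by simp
  have "(of_int (n * m) :: complex) = of_int 4" using m by (simp add: n mult.assoc)
  then have "n * m = 4" by (simp only: of_int_eq_iff)
  then consider "n = 1" | "n = -1" | "n = 2" | "n = -2" | "n = 4" | "n = -4" using int_mult_eq_4 by blast
  then show ?thesis
  proof cases
    case 1
    then have "2 * c = 1" using n by simp
    then have "\<gamma> = wscale 2 \<beta>" unfolding p[symmetric]
      by (intro ext) (simp only: wscale_apply mult.assoc[symmetric] mult_1)
    then show ?thesis using double_root_not_weight[OF s2] w by simp
  next
    case 2
    then have "c = - 1 / 2" using n by (simp add: field_simps)
    then have "\<gamma> = wscale 2 (- \<beta>)" unfolding p[symmetric] by (intro ext) simp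
    then show ?thesis using double_root_not_weight[OF sl2_triple_swap[OF s2]] w by simp
  next
    case 3
    then have "c = 1" using n by simp
    then show ?thesis using p by simp
  next
    case 4
    then have "c = - 1" using n by simp
    then have "\<beta> = - \<gamma>" unfolding p[symmetric] by (intro ext) simp
    then show ?thesis ..
  next
    case 5
    then have "c = 2" using n by simp
    then show ?thesis using double_root_not_weight[OF s1] w p by simp
  next
    case 6
    then have "c = - 2" using n by simp
    then have "\<beta> = wscale 2 (- \<gamma>)" unfolding p[symmetric] by (intro ext) simp
    then show ?thesis using double_root_not_weight[OF sl2_triple_swap[OF s1]] w by simp
  qed
qed

text \<open>By the Jacobi identity. If \<open>\<alpha> + \<beta>\<close> had a triple with
  \<open>e\<close> proportional to \<open>[x, y]\<close>, expanding \<open>[[x, y],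
  f]\<close> leaves only the term \<open>[y, [x, f]]\<close>, since the other one is a
  bracket of opposite root vectors for the degenerate root \<open>\<alpha>\<close>. So
  \<open>\<beta>\<close> would have a triple with a coroot proportional to that of
  \<open>\<alpha> + \<beta>\<close>. Then the two roots are proportional, hence equal up to
  sign, which is impossible.\<close>

lemma degenerate_absorbs:
  assumes b: "degenerate \<alpha>" and r: "\<beta> \<in> roots h" and x: "x \<in> root_space h \<alpha>" and y: "y \<in> root_space h \<beta>"
    and n: "bracket x y \<noteq> 0"
  shows "degenerate (\<alpha> + \<beta>)"
proof -
  let ?g = "\<alpha> + \<beta>"
  have ar: "\<alpha> \<in> roots h" using b by (simp add: degenerate_def)
  have "?g \<noteq> 0"
  proof
    assume "?g = 0"
    then have "\<beta> = - \<alpha>" by (metis add.inverse_unique)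
    then show False using degenerate_bracket[OF b x] y n by simp
  qed
  moreover have "is_weight ?g"
    by (rule is_weightI[OF dual_space_add[OF root_dual[OF ar] root_dual[OF r]] root_space_bracket[OF x y] n])
  ultimately have gr: "?g \<in> roots h" by (simp add: roots_iff)
  have "\<not> (\<exists>e f t. sl2_triple ?g e f t)"
  proof
    assume "\<exists>e f t. sl2_triple ?g e f t"
    then obtain e f t where s: "sl2_triple ?g e f t" by blast
    note s' = sl2_tripleD[OF s]
    obtain c where c: "bracket x y = scaleC c e" using root_space_one_dim[OF s root_space_bracket[OF x y]] by blast
    have c0: "c \<noteq> 0" using c n by auto
    have t0: "t \<noteq> 0" using s'(2,7) dual_scaleC[OF s'(2,8), of 0] by auto
    have "bracket y f \<in> root_space h (\<beta> + - ?g)" by (rule root_space_bracket[OF y s'(5)])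
    then have yf: "bracket y f \<in> root_space h (- \<alpha>)" by simp
    have "bracket x f \<in> root_space h (\<alpha> + - ?g)" by (rule root_space_bracket[OF x s'(5)])
    then have xf: "bracket x f \<in> root_space h (- \<beta>)" by simp
    have "bracket (bracket x y) f = bracket x (bracket y f) - bracket y (bracket x f)"
      using leibniz[of x y f] by simp
    moreover have "bracket x (bracket y f) = 0" by (rule degenerate_bracket[OF b x yf])
    moreover have "bracket (bracket x y) f = scaleC c t" using c s'(6) by (simp add: bracket_scaleC_left)
    ultimately have t': "bracket y (bracket x f) = scaleC (- c) t" by simp
    then have "bracket y (bracket x f) \<noteq> 0" using c0 t0 by simp
    then obtain d where d: "d \<noteq> 0" "sl2_triple \<beta> y (scaleC d (bracket x f)) (scaleC d (bracket y (bracket x f)))"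
      using sl2_triple_if_nonzero[OF r y xf] by blast
    have "t = scaleC (- 1 / (d * c)) (scaleC d (bracket y (bracket x f)))"
      unfolding t' using c0 d by (simp add: scaleC_scaleC scaleC_one)
    then have "wscale (- 1 / (d * c)) ?g = \<beta>" by (rule proportional_coroots[OF s d(2)])
    then have "\<beta> = ?g \<or> \<beta> = - ?g" by (rule proportional_roots[OF s d(2)])
    then show False
    proof
      assume "\<beta> = ?g" then show False using ar by (simp add: roots_iff)
    next
      assume g: "\<beta> = - ?g"
      have "\<alpha> = wscale 2 ?g"
      proof (rule ext)
        fix z have "\<beta> z = - (\<alpha> z + \<beta> z)" using fun_cong[OF g, of z] by simp
        then show "\<alpha> z = wscale 2 ?g z" by (simp add: algebra_simps eq_neg_iff_add_eq_0)
      qed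
      then show False using double_root_not_weight[OF s] ar by (simp add: roots_iff)
    qed
  qed
  then show ?thesis using gr by (simp add: degenerate_def)
qed

abbreviation degenerate_vectors :: "'g set" where "degenerate_vectors \<equiv> (\<Union>\<alpha>\<in>{\<alpha>. degenerate \<alpha>}. root_space h \<alpha>)"

text \<open>Engel's theorem for the span of the degenerate root vectors. The subset
  \<open>T\<close> is chosen maximal among linearly independent sets of degenerate root
  vectors that span a subalgebra acting nilpotently. If \<open>T\<close> does not yet span,
  the sets \<open>D i\<close> of \<open>i\<close>-fold brackets with \<open>T\<close>
  eventually enter the span of \<open>T\<close>, and a vector \<open>x\<close> taken just
  before that normalises the span, so that \<open>engel_step\<close> allows it to be
  added.\<close>

lemma degenerate_vectors_nilpotent:
  "\<exists>T. finite T \<and> T \<subseteq> degenerate_vectors \<and> degenerate_vectors \<subseteq> complex_vector.span T \<and>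
     (\<exists>N. (bracket_space (complex_vector.span T) ^^ N) UNIV \<subseteq> {0})"
proof -
  let ?Nil = "\<lambda>T. \<exists>N. (bracket_space (complex_vector.span T) ^^ N) UNIV \<subseteq> {0::'g}"
  define adm where "adm T \<longleftrightarrow> finite T \<and> T \<subseteq> degenerate_vectors \<and> \<not> complex_vector.dependent T \<and>
    (\<forall>a\<in>T. \<forall>b\<in>T. bracket a b \<in> complex_vector.span T) \<and> ?Nil T" for T
  obtain B :: "'g set" where B: "finite B" "complex_vector.span B = UNIV"
    using fin_dim by (auto simp: lie_finite_dimensional_def)
  have "bracket_space {0} UNIV \<subseteq> {0::'g}" by (rule bracket_space_least) auto
  then have "?Nil {}" by (intro exI[of _ 1]) simp
  then have adm0: "adm {}" unfolding adm_def using complex_vector.independent_empty by auto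
  have bound: "\<forall>T. adm T \<longrightarrow> card T < Suc (card B)"
  proof (intro allI impI)
    fix T assume "adm T"
    then have "\<not> complex_vector.dependent T" unfolding adm_def by (elim conjE)
    then show "card T < Suc (card B)" using complex_vector.independent_span_bound[OF B(1), of T] B(2) by simp
  qed
  obtain T where T: "adm T" and max: "\<And>T'. adm T' \<Longrightarrow> card T' \<le> card T"
    using ex_has_greatest_nat[OF adm0 bound] by (elim exE conjE) blast
  note T' = T[unfolded adm_def]
  let ?S = "complex_vector.span T"
  have "degenerate_vectors \<subseteq> ?S"
  proof (rule ccontr)
    assume ns: "\<not> degenerate_vectors \<subseteq> ?S"
    then obtain \<alpha>0 where a0: "degenerate \<alpha>0" by blast
    have z: "0 \<in> degenerate_vectors" using a0 complex_vector.subspace_0[OF subspace_root_space] by blast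
    define D where "D i = ((\<lambda>X. {bracket a d | a d. a \<in> T \<and> d \<in> X}) ^^ i) degenerate_vectors" for i
    have D_Suc: "D (Suc i) = {bracket a d | a d. a \<in> T \<and> d \<in> D i}" for i by (simp add: D_def)
    have D_degenerate: "D i \<subseteq> degenerate_vectors" for i
    proof (induction i)
      case 0 then show ?case by (simp add: D_def)
    next
      case (Suc i)
      show ?case
      proof
        fix v assume "v \<in> D (Suc i)"
        then obtain a d where v: "v = bracket a d" "a \<in> T" "d \<in> D i" unfolding D_Suc by blast
        obtain \<alpha> where a: "degenerate \<alpha>" "a \<in> root_space h \<alpha>" using v(2) T' by blast
        obtain \<delta> where d: "degenerate \<delta>" "d \<in> root_space h \<delta>" using v(3) Suc by blast
        show "v \<in> degenerate_vectors"
        proof (cases "v = 0")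
          case False
          then have "degenerate (\<alpha> + \<delta>)" using degenerate_absorbs[OF a(1) _ a(2) d(2)] d(1) v by (simp add: degenerate_def)
          then show ?thesis using root_space_bracket[OF a(2) d(2)] v by blast
        qed (use z in simp)
      qed
    qed
    have D_chain: "D i \<subseteq> (bracket_space ?S ^^ i) UNIV" for i
    proof (induction i)
      case 0 then show ?case by simp
    next
      case (Suc i)
      then show ?case unfolding D_Suc
        by (auto intro!: bracket_in_bracket_space complex_vector.span_base)
    qed
    obtain N where "(bracket_space ?S ^^ N) UNIV \<subseteq> {0}" using T' by blast
    then have "D N \<subseteq> ?S" using D_chain[of N] complex_vector.span_zero by blast
    then obtain i where i: "D i \<subseteq> ?S" "\<And>j. j < i \<Longrightarrow> \<not> D j \<subseteq> ?S"
      using exists_least_iff[of "\<lambda>i. D i \<subseteq> ?S"] by blast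
    obtain j where j: "i = Suc j" using i(1) ns by (cases i) (auto simp: D_def)
    obtain x where x: "x \<in> D j" "x \<notin> ?S" using i(2)[of j] j by blast
    have ax: "bracket a x \<in> ?S" if "a \<in> T" for a using i(1) x that unfolding j D_Suc by blast
    obtain \<alpha> where \<alpha>: "degenerate \<alpha>" "x \<in> root_space h \<alpha>" using x D_degenerate by blast
    obtain k where k: "\<And>y. (bracket x ^^ k) y = 0"
      using ad_root_vector_nilpotent[OF \<alpha>(2)] \<alpha>(1) by (auto simp: degenerate_def roots_def)
    have xT: "bracket x a \<in> ?S" if "a \<in> ?S" for a
      using that
    proof (induction rule: complex_vector.span_induct_alt)
      case base then show ?case by (simp add: complex_vector.span_zero)
    next
      case (step c a b)
      have "bracket x a \<in> ?S" using ax[OF step(1)] complex_vector.span_neg[of "bracket a x" T] bracket_skew[of x a] by simp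
      then show ?case using step
        by (simp add: bracket_add_right bracket_scaleC_right complex_vector.span_add complex_vector.span_scale)
    qed
    let ?T = "insert x T"
    have "\<exists>s. \<exists>a\<in>?S. p = scaleC s x + a" if p: "p \<in> complex_vector.span ?T" for p
    proof -
      obtain s where "p - scaleC s x \<in> ?S" using p unfolding complex_vector.span_insert by blast
      then show ?thesis by (intro exI[of _ s] bexI[of _ "p - scaleC s x"]) auto
    qed
    then have "(bracket_space (complex_vector.span ?T) ^^ (k * N)) UNIV \<subseteq> {0}"
      using k \<open>(bracket_space ?S ^^ N) UNIV \<subseteq> {0}\<close> xT by (intro engel_step[of ?S x]) auto
    moreover have "\<not> complex_vector.dependent ?T" using complex_vector.independent_insertI[OF x(2)] T' by blast
    moreover have "\<forall>a\<in>?T. \<forall>b\<in>?T. bracket a b \<in> complex_vector.span ?T"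
    proof (intro ballI)
      fix a b assume "a \<in> ?T" "b \<in> ?T"
      moreover have "?S \<subseteq> complex_vector.span ?T" by (rule complex_vector.span_mono) blast
      ultimately show "bracket a b \<in> complex_vector.span ?T"
        using ax xT[OF complex_vector.span_base] T' complex_vector.span_zero by (auto simp: bracket_self)
    qed
    moreover have "?T \<subseteq> degenerate_vectors" using T' x D_degenerate by blast
    ultimately have "adm ?T" using T' unfolding adm_def by blast
    moreover have "x \<notin> T" using x complex_vector.span_base by blast
    ultimately show False using max[of ?T] T' by simp
  qed
  then show ?thesis using T' by blast
qed

text \<open>The degenerate root vectors span an ideal, by \<open>degenerate_absorbs\<close>,
  and it acts nilpotently. If it is not zero, its centre is not zero either, because the
  last nonzero step of its descending central series lies in it. But the centre of an ideal
  is an abelian ideal.\<close>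

lemma no_degenerate_roots: "\<not> degenerate \<alpha>"
proof
  assume degenerate: "degenerate \<alpha>"
  obtain T N where T: "T \<subseteq> degenerate_vectors" "degenerate_vectors \<subseteq> complex_vector.span T"
    and N: "(bracket_space (complex_vector.span T) ^^ N) UNIV \<subseteq> {0::'g}"
    using degenerate_vectors_nilpotent by blast
  let ?n = "complex_vector.span T"
  have n_eq: "?n = complex_vector.span degenerate_vectors"
    using T complex_vector.span_mono[OF T(1)] complex_vector.span_minimal[OF T(2)] by blast
  have ideal: "bracket x y \<in> ?n" if "y \<in> ?n" for x y
  proof -
    have hom: "bracket x y \<in> ?n" if x: "x \<in> root_space h \<beta>" "is_weight \<beta>" and y: "y \<in> root_space h \<delta>" "degenerate \<delta>" for x y \<beta> \<delta>
    proof (cases "bracket x y = 0")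
      case True then show ?thesis by (simp add: complex_vector.span_zero)
    next
      case False
      have "degenerate (\<beta> + \<delta>)"
      proof (cases "\<beta> = 0")
        case True then show ?thesis using y by simp
      next
        case f: False
        then have "\<beta> \<in> roots h" using x by (simp add: roots_iff)
        moreover have "bracket y x \<noteq> 0" using False bracket_skew[of x y] by auto
        ultimately have "degenerate (\<delta> + \<beta>)" using degenerate_absorbs[OF y(2) _ y(1) x(1)] by blast
        then show ?thesis by (simp only: add.commute)
      qed
      then show ?thesis unfolding n_eq using root_space_bracket[OF x(1) y(1)]
        by (intro complex_vector.span_base) blast
    qed
    have "y \<in> complex_vector.span degenerate_vectors" using that n_eq by simp
    then show ?thesis
    proof (induction rule: complex_vector.span_induct_alt)
      case base show ?case by (simp add: complex_vector.span_zero)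
    next
      case (step c y y')
      then obtain \<delta> where d: "y \<in> root_space h \<delta>" "degenerate \<delta>" by blast
      have "x \<in> complex_vector.span (\<Union>\<beta>\<in>{\<beta>. is_weight \<beta>}. root_space h \<beta>)" by (simp add: weight_spaces_span)
      then have "bracket x y \<in> ?n"
      proof (induction rule: complex_vector.span_induct_alt)
        case base show ?case by (simp add: complex_vector.span_zero)
      next
        case (step c x x')
        then obtain \<beta> where "x \<in> root_space h \<beta>" "is_weight \<beta>" by blast
        then have "bracket x y \<in> ?n" using hom d by blast
        then show ?case using step
          by (simp add: bracket_add_left bracket_scaleC_left complex_vector.span_add complex_vector.span_scale)
      qed
      then show ?case using step
        by (simp add: bracket_add_right bracket_scaleC_right complex_vector.span_add complex_vector.span_scale)
    qed
  qed
  \<comment> \<open>The centre of the ideal.\<close>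
  let ?Z = "{z \<in> ?n. \<forall>y\<in>?n. bracket y z = 0}"
  have "?Z = {0}"
  proof (rule abelian_ideal_zero)
    show "lie_ideal ?Z" unfolding lie_ideal_def
    proof (intro conjI allI ballI)
      show "complex_vector.subspace ?Z"
        by (rule complex_vector.subspaceI)
          (auto simp: complex_vector.span_zero complex_vector.span_add complex_vector.span_scale bracket_add_right bracket_scaleC_right)
      fix x z assume z: "z \<in> ?Z"
      have "bracket y (bracket x z) = 0" if "y \<in> ?n" for y
      proof -
        have "bracket y x \<in> ?n" using ideal[OF that, of x] complex_vector.span_neg bracket_skew[of y x] by simp
        then show ?thesis using z that by (simp add: leibniz[of y x z])
      qed
      then show "bracket x z \<in> ?Z" using z ideal by blast
    qed
  qed auto
  \<comment> \<open>The descending central series of the ideal.\<close>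
  define E where "E i = (bracket_space ?n ^^ i) ?n" for i
  have E_Suc: "E (Suc i) = bracket_space ?n (E i)" for i by (simp add: E_def)
  have E_n: "E i \<subseteq> ?n" for i
  proof (induction i)
    case 0 show ?case by (simp add: E_def)
  next
    case (Suc i)
    show ?case unfolding E_Suc by (rule bracket_space_least) (use Suc ideal in auto)
  qed
  have "E N \<subseteq> (bracket_space ?n ^^ N) UNIV" unfolding E_def by (rule bracket_space_funpow_mono) simp
  then have "E N \<subseteq> {0}" using N by blast
  then obtain i where i: "E i \<subseteq> {0}" "\<And>j. j < i \<Longrightarrow> \<not> E j \<subseteq> {0}"
    using exists_least_iff[of "\<lambda>i. E i \<subseteq> {0}"] by blast
  obtain x where x: "x \<in> root_space h \<alpha>" "x \<noteq> 0" using degenerate by (auto simp: degenerate_def roots_iff elim!: is_weightE)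
  then have "x \<in> ?n" using T degenerate by blast
  then obtain j where j: "i = Suc j" using i(1) x(2) by (cases i) (auto simp: E_def)
  obtain z where z: "z \<in> E j" "z \<noteq> 0" using i(2)[of j] j by blast
  have "bracket y z = 0" if "y \<in> ?n" for y
    using bracket_in_bracket_space[OF that z(1)] i(1) unfolding j E_Suc by blast
  then have "z \<in> ?Z" using z E_n by blast
  then show False using \<open>?Z = {0}\<close> z by blast
qed

lemma root_sl2: "\<alpha> \<in> roots h \<Longrightarrow> \<exists>e f t. sl2_triple \<alpha> e f t"
  using no_degenerate_roots[of \<alpha>] by (simp add: degenerate_def)

lemma sl2_triple_coroot:
  assumes s: "sl2_triple \<alpha> e f t" shows "coroot h \<alpha> = t"
  unfolding coroot_def
proof (rule the_equality)
  note s' = sl2_tripleD[OF s]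
  let ?B = "bracket_space (root_space h \<alpha>) (root_space h (- \<alpha>))"
  show "t \<in> ?B \<and> \<alpha> t = 2" using bracket_in_bracket_space[OF s'(4,5)] s'(6,7) by simp
  fix t' assume t': "t' \<in> ?B \<and> \<alpha> t' = 2"
  have "?B \<subseteq> complex_vector.span {t}"
  proof (rule bracket_space_least)
    fix a b assume "a \<in> root_space h \<alpha>" "b \<in> root_space h (- \<alpha>)"
    then obtain c d where "a = scaleC c e" "b = scaleC d f"
      using root_space_one_dim[OF s] root_space_one_dim[OF sl2_triple_swap[OF s]] by blast
    then have "bracket a b = scaleC (c * d) t"
      using s'(6) by (simp add: bracket_scaleC_left bracket_scaleC_right scaleC_scaleC)
    then show "bracket a b \<in> complex_vector.span {t}" by (simp add: complex_vector.span_base complex_vector.span_scale)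
  qed simp
  then obtain c where c: "t' = scaleC c t" using t' unfolding complex_vector.span_singleton by blast
  then have "c * \<alpha> t = 2" using dual_scaleC[OF s'(2,8)] t' by simp
  then have "c = 1" using s'(7) by simp
  then show "t' = t" using c by (simp add: scaleC_one)
qed

lemma coroot_sl2: "\<alpha> \<in> roots h \<Longrightarrow> \<exists>e f. sl2_triple \<alpha> e f (coroot h \<alpha>)"
  using root_sl2 sl2_triple_coroot by blast

lemma coroot_h: "\<alpha> \<in> roots h \<Longrightarrow> coroot h \<alpha> \<in> h"
  using coroot_sl2 sl2_tripleD(8) by blast
lemma root_coroot: "\<alpha> \<in> roots h \<Longrightarrow> \<alpha> (coroot h \<alpha>) = 2"
  using coroot_sl2 sl2_tripleD(7) by blast
lemma pairing_int: "\<alpha> \<in> roots h \<Longrightarrow> \<beta> \<in> roots h \<Longrightarrow> \<exists>n::int. \<beta> (coroot h \<alpha>) = of_int n"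
  using coroot_sl2 sl2_weight_int roots_iff by blast
lemma reflect_root: "\<alpha> \<in> roots h \<Longrightarrow> \<beta> \<in> roots h \<Longrightarrow> \<beta> - wscale (\<beta> (coroot h \<alpha>)) \<alpha> \<in> roots h"
  using coroot_sl2 sl2_reflection_root by blast
lemma roots_proportional: "\<alpha> \<in> roots h \<Longrightarrow> \<beta> \<in> roots h \<Longrightarrow> wscale c \<alpha> = \<beta> \<Longrightarrow> \<beta> = \<alpha> \<or> \<beta> = - \<alpha>"
  using coroot_sl2 proportional_roots by blast
lemma coroot_inj:
  assumes "\<alpha> \<in> roots h" "\<beta> \<in> roots h" "coroot h \<alpha> = coroot h \<beta>" shows "\<alpha> = \<beta>"
proof -
  obtain e f e' f' where "sl2_triple \<alpha> e f (coroot h \<alpha>)" "sl2_triple \<beta> e' f' (coroot h \<beta>)"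
    using coroot_sl2 assms by blast
  from proportional_coroots[OF this, of 1] show ?thesis using assms(3) by (simp add: scaleC_one)
qed
lemma coroot_minus: "\<alpha> \<in> roots h \<Longrightarrow> coroot h (- \<alpha>) = - coroot h \<alpha>"
  using coroot_sl2 sl2_triple_swap sl2_triple_coroot by blast

lemma root_diff:
  assumes a: "\<alpha> \<in> roots h" and b: "\<beta> \<in> roots h" and n: "\<beta> (coroot h \<alpha>) = of_int n" "n > 0" and ne: "\<beta> \<noteq> \<alpha>"
  shows "\<beta> - \<alpha> \<in> roots h"
proof -
  obtain e f where s: "sl2_triple \<alpha> e f (coroot h \<alpha>)" using coroot_sl2 a by blast
  have w: "is_weight \<beta>" using b by (simp add: roots_iff)
  have m: "\<beta> (coroot h \<alpha>) = of_nat (nat n)" using n by simp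
  have "is_weight (\<beta> - wscale (of_nat 1) \<alpha>)" by (rule sl2_string_down[OF s w m]) (use n in simp)
  then show ?thesis using ne by (simp add: roots_iff)
qed

text \<open>Root spaces are one-dimensional, so one root vector for each positive root forms
  a basis.\<close>

lemma dim_n_plus: "complex_vector.dim (n_plus h P) = card P"
proof -
  have Pr: "P \<subseteq> roots h" using positive by (auto simp: positive_system_def)
  have "\<forall>\<alpha>\<in>P. \<exists>e. e \<in> root_space h \<alpha> \<and> e \<noteq> 0 \<and> (\<forall>z\<in>root_space h \<alpha>. \<exists>c. z = scaleC c e)"
  proof
    fix \<alpha> assume "\<alpha> \<in> P"
    then obtain e f t where s: "sl2_triple \<alpha> e f t" using root_sl2 Pr by blast
    note s' = sl2_tripleD[OF s]
    have "e \<noteq> 0" using s'(2,6,7,8) dual_scaleC[OF s'(2,8), of 0] by auto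
    then show "\<exists>e. e \<in> root_space h \<alpha> \<and> e \<noteq> 0 \<and> (\<forall>z\<in>root_space h \<alpha>. \<exists>c. z = scaleC c e)"
      using s'(4) root_space_one_dim[OF s] by blast
  qed
  then obtain e where e: "\<And>\<alpha>. \<alpha> \<in> P \<Longrightarrow> e \<alpha> \<in> root_space h \<alpha> \<and> e \<alpha> \<noteq> 0"
    "\<And>\<alpha> z. \<alpha> \<in> P \<Longrightarrow> z \<in> root_space h \<alpha> \<Longrightarrow> \<exists>c. z = scaleC c (e \<alpha>)" by metis
  have Pd: "P \<subseteq> dual_space h" using Pr root_dual by blast
  note ind = weight_vectors_independent[OF Pd e(1)]
  have "complex_vector.span (e ` P) = complex_vector.span (\<Union>\<alpha>\<in>P. root_space h \<alpha>)"
  proof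
    show "complex_vector.span (e ` P) \<subseteq> complex_vector.span (\<Union>\<alpha>\<in>P. root_space h \<alpha>)"
      by (rule complex_vector.span_mono) (use e(1) in blast)
    have "(\<Union>\<alpha>\<in>P. root_space h \<alpha>) \<subseteq> complex_vector.span (e ` P)"
    proof
      fix z assume "z \<in> (\<Union>\<alpha>\<in>P. root_space h \<alpha>)"
      then obtain \<alpha> where a: "\<alpha> \<in> P" "z \<in> root_space h \<alpha>" by blast
      then obtain c where "z = scaleC c (e \<alpha>)" using e(2) by blast
      then show "z \<in> complex_vector.span (e ` P)" using a
        by (simp add: complex_vector.span_base complex_vector.span_scale)
    qed
    then show "complex_vector.span (\<Union>\<alpha>\<in>P. root_space h \<alpha>) \<subseteq> complex_vector.span (e ` P)"
      by (rule complex_vector.span_minimal) simp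
  qed
  then have "complex_vector.dim (n_plus h P) = card (e ` P)"
    unfolding n_plus_def complex_vector.dim_span using ind(2) by (intro complex_vector.dim_eq_card)
  then show ?thesis using card_image[OF ind(1)] by simp
qed

text \<open>A reflection that preserves the finite set of roots is determined by its root:
  the composite of two candidates is a shear, and it moves some root through infinitely many
  others unless the candidates agree.\<close>

lemma coroot_unique:
  assumes g: "\<gamma> \<in> roots h" and t: "t1 \<in> h" "t2 \<in> h" "\<gamma> t1 = 2" "\<gamma> t2 = 2"
    and r1: "\<And>\<mu>. \<mu> \<in> roots h \<Longrightarrow> \<mu> - wscale (\<mu> t1) \<gamma> \<in> roots h"
    and r2: "\<And>\<mu>. \<mu> \<in> roots h \<Longrightarrow> \<mu> - wscale (\<mu> t2) \<gamma> \<in> roots h"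
  shows "t1 = t2"
proof -
  have "\<mu> t1 = \<mu> t2" if m: "\<mu> \<in> roots h" for \<mu>
  proof (rule ccontr)
    assume ne: "\<mu> t1 \<noteq> \<mu> t2"
    \<comment> \<open>The amount by which the composite of the two reflections moves
      \<open>\<mu>\<close> along \<open>\<gamma>\<close>.\<close>
    define \<delta> where "\<delta> = \<mu> t2 - \<mu> t1"
    \<comment> \<open>The orbit of \<open>\<mu>\<close> under the shear.\<close>
    let ?m = "\<lambda>n::nat. \<mu> + wscale (of_nat n * \<delta>) \<gamma>"
    have r: "?m n \<in> roots h" for n
    proof (induction n)
      case 0 then show ?case using m by simp
    next
      case (Suc n)
      have 1: "?m n - wscale (?m n t2) \<gamma> \<in> roots h" by (rule r2[OF Suc])
      have 2: "?m n - wscale (?m n t2) \<gamma> - wscale ((?m n - wscale (?m n t2) \<gamma>) t1) \<gamma> \<in> roots h" by (rule r1[OF 1])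
      have "?m n - wscale (?m n t2) \<gamma> - wscale ((?m n - wscale (?m n t2) \<gamma>) t1) \<gamma> = ?m (Suc n)"
        by (rule ext) (simp add: t \<delta>_def algebra_simps)
      then show ?case using 2 by (simp only:)
    qed
    have "inj ?m"
    proof (rule injI)
      fix i j assume e: "?m i = ?m j"
      have "\<mu> t1 + of_nat i * \<delta> * 2 = \<mu> t1 + of_nat j * \<delta> * 2" using fun_cong[OF e, of t1] t by simp
      then show "i = j" using ne by (simp add: \<delta>_def)
    qed
    then have "infinite (range ?m)" by (rule range_inj_infinite)
    moreover have "range ?m \<subseteq> roots h" using r by (rule image_subsetI)
    ultimately show False using finite_subset[OF _ finite_roots] by simp
  qed
  note eq = this
  have "t1 - t2 = 0"
  proof (rule zero_if_roots_vanish[OF h_diff[OF t(1,2)]])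
    fix \<mu> assume m: "\<mu> \<in> roots h"
    show "\<mu> (t1 - t2) = 0" unfolding dual_diff[OF root_dual[OF m] t(1,2)] eq[OF m] by simp
  qed
  then show ?thesis by simp
qed

text \<open>Conjugating the reflection in \<open>\<beta>\<close> by the reflection in
  \<open>\<alpha>\<close> gives a reflection in the reflected root that preserves the roots,
  and \<open>coroot_unique\<close> identifies its coroot.\<close>

lemma coroot_reflect:
  assumes a: "\<alpha> \<in> roots h" and b: "\<beta> \<in> roots h"
  shows "coroot h (\<beta> - wscale (\<beta> (coroot h \<alpha>)) \<alpha>) = coroot h \<beta> - scaleC (\<alpha> (coroot h \<beta>)) (coroot h \<alpha>)"
proof (rule coroot_unique)
  let ?g = "\<beta> - wscale (\<beta> (coroot h \<alpha>)) \<alpha>" and ?t = "coroot h \<beta> - scaleC (\<alpha> (coroot h \<beta>)) (coroot h \<alpha>)"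
  show g: "?g \<in> roots h" by (rule reflect_root[OF a b])
  show "coroot h ?g \<in> h" by (rule coroot_h[OF g])
  show th: "?t \<in> h" using a b by (intro h_diff h_scaleC coroot_h)
  show "?g (coroot h ?g) = 2" by (rule root_coroot[OF g])
  have ev: "\<mu> ?t = \<mu> (coroot h \<beta>) - \<alpha> (coroot h \<beta>) * \<mu> (coroot h \<alpha>)" if "\<mu> \<in> dual_space h" for \<mu>
    using that a b by (simp add: dual_diff dual_scaleC coroot_h h_scaleC)
  show "?g ?t = 2"
    using ev[OF root_dual[OF g]] by (simp add: root_coroot a b algebra_simps)
  show "\<mu> - wscale (\<mu> (coroot h ?g)) ?g \<in> roots h" if "\<mu> \<in> roots h" for \<mu> by (rule reflect_root[OF g that])
  show "\<mu> - wscale (\<mu> ?t) ?g \<in> roots h" if m: "\<mu> \<in> roots h" for \<mu>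
  proof -
    let ?m1 = "\<mu> - wscale (\<mu> (coroot h \<alpha>)) \<alpha>"
    let ?m2 = "?m1 - wscale (?m1 (coroot h \<beta>)) \<beta>"
    have "?m2 - wscale (?m2 (coroot h \<alpha>)) \<alpha> \<in> roots h" by (intro reflect_root a b m)
    moreover have "?m2 - wscale (?m2 (coroot h \<alpha>)) \<alpha> = \<mu> - wscale (\<mu> ?t) ?g"
      unfolding ev[OF root_dual[OF m]] by (rule ext) (simp add: root_coroot a b algebra_simps)
    ultimately show ?thesis by (simp only:)
  qed
qed

end


section \<open>Groups acting on roots\<close>

text \<open>An axiomatic form of the action of a Coxeter group on its (real) roots:
  \<open>R\<close> is the set of roots, and \<open>detect\<close> replaces the fact that
  every positive root is a nonnegative combination of simple ones. Roots form an abstract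
  type, so that affine roots can be used without realising them in a vector space.\<close>

locale reflection_action = group G for G :: "('w, 'm) monoid_scheme" (structure) +
  fixes R Pos \<Delta> :: "'r set"
    and neg :: "'r \<Rightarrow> 'r"
    and act :: "'w \<Rightarrow> 'r \<Rightarrow> 'r"
    and refl :: "'r \<Rightarrow> 'w"
  assumes Pos_sub: "Pos \<subseteq> R"
    and neg_R: "a \<in> R \<Longrightarrow> neg a \<in> R"
    and neg_neg: "a \<in> R \<Longrightarrow> neg (neg a) = a"
    and neg_Pos: "a \<in> R \<Longrightarrow> neg a \<in> Pos \<longleftrightarrow> a \<notin> Pos"
    and act_R: "w \<in> carrier G \<Longrightarrow> a \<in> R \<Longrightarrow> act w a \<in> R"
    and act_one: "a \<in> R \<Longrightarrow> act \<one> a = a"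
    and act_mult: "w \<in> carrier G \<Longrightarrow> w' \<in> carrier G \<Longrightarrow> a \<in> R \<Longrightarrow> act (w \<otimes> w') a = act w (act w' a)"
    and act_neg: "w \<in> carrier G \<Longrightarrow> a \<in> R \<Longrightarrow> act w (neg a) = neg (act w a)"
    and refl_carrier: "a \<in> R \<Longrightarrow> refl a \<in> carrier G"
    and refl_sq: "a \<in> R \<Longrightarrow> refl a \<otimes> refl a = \<one>"
    and refl_act: "w \<in> carrier G \<Longrightarrow> a \<in> R \<Longrightarrow> refl (act w a) = w \<otimes> refl a \<otimes> inv w"
    and refl_neg: "a \<in> R \<Longrightarrow> refl (neg a) = refl a"
    and act_refl_self: "a \<in> R \<Longrightarrow> act (refl a) a = neg a"
    and act_refl_eq_neg: "a \<in> Pos \<Longrightarrow> b \<in> Pos \<Longrightarrow> act (refl b) a = neg a \<Longrightarrow> a = b"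
    and simple_Pos: "\<Delta> \<subseteq> Pos"
    and simple_perm: "a \<in> \<Delta> \<Longrightarrow> b \<in> Pos \<Longrightarrow> b \<noteq> a \<Longrightarrow> act (refl a) b \<in> Pos"
    and detect: "w \<in> carrier G \<Longrightarrow> b \<in> Pos \<Longrightarrow> act w b \<notin> Pos \<Longrightarrow> \<exists>a\<in>\<Delta>. act w a \<notin> Pos"
    and finite_inversions: "w \<in> carrier G \<Longrightarrow> finite {b \<in> Pos. act w b \<notin> Pos}"
    and generated: "carrier G = generate G (refl ` R)"
begin

abbreviation S :: "'w set" where "S \<equiv> refl ` \<Delta>"
abbreviation len :: "'w \<Rightarrow> nat" where "len \<equiv> word_length G S"
definition inversions :: "'w \<Rightarrow> 'r set" where "inversions w = {b \<in> Pos. act w b \<notin> Pos}"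
abbreviation word :: "'w list \<Rightarrow> 'w" where "word ws \<equiv> foldr (\<otimes>) ws \<one>"

lemma Pos_R: "b \<in> Pos \<Longrightarrow> b \<in> R" using Pos_sub by blast
lemma simple_R: "a \<in> \<Delta> \<Longrightarrow> a \<in> R" using simple_Pos Pos_sub by blast
lemma simple_in_Pos: "a \<in> \<Delta> \<Longrightarrow> a \<in> Pos" using simple_Pos by blast
lemma S_carrier: "S \<subseteq> carrier G" using refl_carrier simple_R by blast
lemma inv_refl: "a \<in> R \<Longrightarrow> inv (refl a) = refl a"
  using refl_sq refl_carrier by (metis inv_equality)
lemma mult_refl_refl: "w \<in> carrier G \<Longrightarrow> a \<in> R \<Longrightarrow> w \<otimes> refl a \<otimes> refl a = w"
  by (simp add: m_assoc refl_carrier refl_sq)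
lemma refl_refl_mult: "w \<in> carrier G \<Longrightarrow> a \<in> R \<Longrightarrow> refl a \<otimes> (refl a \<otimes> w) = w"
  by (simp add: m_assoc[symmetric] refl_carrier refl_sq)
lemma act_inv_act: "w \<in> carrier G \<Longrightarrow> a \<in> R \<Longrightarrow> act (inv w) (act w a) = a"
  using act_mult[of "inv w" w a] act_one by simp
lemma act_act_inv: "w \<in> carrier G \<Longrightarrow> a \<in> R \<Longrightarrow> act w (act (inv w) a) = a"
  using act_mult[of w "inv w" a] act_one by simp

lemma act_mult_refl_self:
  "w \<in> carrier G \<Longrightarrow> a \<in> R \<Longrightarrow> act (w \<otimes> refl a) a = neg (act w a)"
  by (simp add: act_mult refl_carrier act_refl_self act_neg)

lemma act_mult_refl_self_Pos:
  "w \<in> carrier G \<Longrightarrow> a \<in> R \<Longrightarrow> act (w \<otimes> refl a) a \<in> Pos \<longleftrightarrow> act w a \<notin> Pos"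
  by (simp add: act_mult_refl_self neg_Pos act_R)

lemma word_carrier: "set ws \<subseteq> carrier G \<Longrightarrow> word ws \<in> carrier G"
  by (induction ws) auto

lemma word_append:
  "set us \<subseteq> carrier G \<Longrightarrow> set ws \<subseteq> carrier G \<Longrightarrow> word (us @ ws) = word us \<otimes> word ws"
  by (induction us) (auto simp: word_carrier m_assoc)

lemma inversions_one: "inversions \<one> = {}"
  by (auto simp: inversions_def act_one Pos_R)

lemma finite_inversions': "w \<in> carrier G \<Longrightarrow> finite (inversions w)"
  by (simp add: inversions_def finite_inversions)

lemma inversions_inv:
  assumes w: "w \<in> carrier G"
  shows "inversions (inv w) = (\<lambda>b. neg (act w b)) ` inversions w"
proof
  show "inversions (inv w) \<subseteq> (\<lambda>b. neg (act w b)) ` inversions w"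
  proof
    fix c assume c: "c \<in> inversions (inv w)"
    let ?b = "neg (act (inv w) c)"
    have cR: "c \<in> R" "c \<in> Pos" "act (inv w) c \<notin> Pos" using c by (auto simp: inversions_def Pos_R)
    have "act w ?b = neg c" using w cR by (simp add: act_neg act_R act_act_inv)
    then have "?b \<in> inversions w" "neg (act w ?b) = c"
      using w cR by (auto simp: inversions_def neg_Pos act_R neg_neg)
    then show "c \<in> (\<lambda>b. neg (act w b)) ` inversions w" by (metis (no_types, lifting) image_eqI)
  qed
  show "(\<lambda>b. neg (act w b)) ` inversions w \<subseteq> inversions (inv w)"
    using w by (auto simp: inversions_def neg_Pos act_R Pos_R act_neg act_inv_act neg_R)
qed

lemma card_inversions_inv:
  assumes w: "w \<in> carrier G" shows "card (inversions (inv w)) = card (inversions w)"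
proof -
  have "card (inversions (inv v)) \<le> card (inversions v)" if "v \<in> carrier G" for v
    unfolding inversions_inv[OF that] by (rule card_image_le[OF finite_inversions'[OF that]])
  from this[OF w] this[of "inv w"] w show ?thesis by simp
qed

text \<open>A simple reflection permutes the positive roots other than its own, so it
  transports the inversions of \<open>w\<close>, and its own root is the only new
  one.\<close>

lemma card_inversions_mult_refl:
  assumes w: "w \<in> carrier G" and a: "a \<in> \<Delta>" and p: "act w a \<in> Pos"
  shows "card (inversions (w \<otimes> refl a)) = Suc (card (inversions w))"
proof -
  let ?s = "refl a"
  note aR = simple_R[OF a] and sc = refl_carrier[OF simple_R[OF a]]
  have ss: "act ?s (act ?s b) = b" if "b \<in> R" for b
    using act_mult[OF sc sc that] refl_sq[OF aR] act_one[OF that] by simp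
  have eq: "inversions (w \<otimes> ?s) = insert a (act ?s ` inversions w)"
  proof
    show "inversions (w \<otimes> ?s) \<subseteq> insert a (act ?s ` inversions w)"
    proof
      fix b assume b: "b \<in> inversions (w \<otimes> ?s)"
      then have bP: "b \<in> Pos" "act w (act ?s b) \<notin> Pos"
        using w sc by (auto simp: inversions_def act_mult Pos_R)
      show "b \<in> insert a (act ?s ` inversions w)"
      proof (cases "b = a")
        case False
        then have "act ?s b \<in> inversions w" using bP a simple_perm by (auto simp: inversions_def)
        then have "act ?s (act ?s b) \<in> act ?s ` inversions w" by blast
        then show ?thesis using ss bP Pos_R by simp
      qed simp
    qed
    show "insert a (act ?s ` inversions w) \<subseteq> inversions (w \<otimes> ?s)"
    proof
      fix b assume "b \<in> insert a (act ?s ` inversions w)"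
      then show "b \<in> inversions (w \<otimes> ?s)"
      proof
        assume "b = a" then show ?thesis
          using a w aR p act_mult_refl_self_Pos simple_in_Pos by (auto simp: inversions_def)
      next
        assume "b \<in> act ?s ` inversions w"
        then obtain c where c: "c \<in> Pos" "act w c \<notin> Pos" "b = act ?s c"
          by (auto simp: inversions_def)
        then have "c \<noteq> a" using p by auto
        then show ?thesis using c a w sc by (auto simp: inversions_def simple_perm act_mult act_R Pos_R ss)
      qed
    qed
  qed
  have "inj_on (act ?s) (inversions w)"
    by (rule inj_on_inverseI[where g = "act ?s"]) (auto simp: inversions_def ss Pos_R)
  moreover have "a \<notin> act ?s ` inversions w"
  proof
    assume "a \<in> act ?s ` inversions w"
    then obtain c where c: "c \<in> Pos" "a = act ?s c" by (auto simp: inversions_def)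
    then have "c = neg a" using ss[of c] act_refl_self[OF aR] Pos_R by simp
    then show False using c neg_Pos aR a simple_in_Pos by blast
  qed
  ultimately show ?thesis unfolding eq using finite_inversions'[OF w]
    by (simp add: card_image)
qed

lemma card_inversions_mult_refl':
  assumes w: "w \<in> carrier G" and a: "a \<in> \<Delta>" and p: "act w a \<notin> Pos"
  shows "card (inversions w) = Suc (card (inversions (w \<otimes> refl a)))"
  using card_inversions_mult_refl[of "w \<otimes> refl a" a] w a p
  by (simp add: act_mult_refl_self_Pos simple_R refl_carrier mult_refl_refl)

text \<open>Conjugating a reflection by a simple reflection whose root it inverts shortens
  it by two inversions, so the induction is on the number of inversions of the
  reflection.\<close>

lemma refl_is_word:
  assumes "b \<in> Pos"
  shows "\<exists>ws. set ws \<subseteq> S \<and> word ws = refl b"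
  using assms
proof (induction "card (inversions (refl b))" arbitrary: b rule: less_induct)
  case less
  note bR = Pos_R[OF less.prems] and rb = refl_carrier[OF Pos_R[OF less.prems]]
  show ?case
  proof (cases "b \<in> \<Delta>")
    case True
    then show ?thesis using rb by (intro exI[of _ "[refl b]"]) auto
  next
    case False
    have "act (refl b) b \<notin> Pos" using act_refl_self[OF bR] neg_Pos[OF bR] less.prems by simp
    then obtain a where a: "a \<in> \<Delta>" "act (refl b) a \<notin> Pos" using detect[OF rb less.prems] by blast
    note aR = simple_R[OF a(1)] and ra = refl_carrier[OF simple_R[OF a(1)]]
    have ne: "b \<noteq> a" using a False by blast
    let ?u = "refl b \<otimes> refl a" and ?b = "act (refl a) b"
    have 1: "card (inversions (refl b)) = Suc (card (inversions ?u))"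
      by (rule card_inversions_mult_refl'[OF rb a])
    have iu: "inv ?u = refl a \<otimes> refl b" using rb ra by (simp add: inv_mult_group inv_refl aR bR)
    have "act (refl a) (neg (act (refl b) a)) \<in> Pos"
    proof (rule simple_perm[OF a(1)])
      show "neg (act (refl b) a) \<in> Pos" using a aR rb by (simp add: neg_Pos act_R)
      show "neg (act (refl b) a) \<noteq> a"
        using act_refl_eq_neg[of a b] less.prems ne a(1) simple_in_Pos neg_neg act_R rb aR by metis
    qed
    then have "act (inv ?u) a \<notin> Pos"
      using aR ra rb by (simp add: iu act_mult act_neg act_R neg_Pos)
    then have "card (inversions (inv ?u)) = Suc (card (inversions (inv ?u \<otimes> refl a)))"
      using card_inversions_mult_refl' rb ra a by simp
    moreover have "inv ?u \<otimes> refl a = refl ?b"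
      using refl_act[OF ra bR] inv_refl[OF aR] iu by simp
    ultimately have "card (inversions (refl ?b)) < card (inversions (refl b))"
      using 1 card_inversions_inv[of ?u] rb ra by simp
    moreover have bP: "?b \<in> Pos" using simple_perm a ne less.prems by blast
    ultimately obtain ws where ws: "set ws \<subseteq> S" "word ws = refl ?b" using less.hyps by blast
    have "word (refl a # ws @ [refl a]) = refl a \<otimes> (refl ?b \<otimes> refl a)"
      using ws ra S_carrier by (simp del: foldr_append add: word_append)
    also have "\<dots> = refl a \<otimes> (refl a \<otimes> refl b \<otimes> refl a \<otimes> refl a)"
      using refl_act[OF ra bR] inv_refl[OF aR] by simp
    also have "\<dots> = refl b" using ra rb aR by (simp add: mult_refl_refl refl_refl_mult)
    finally show ?thesis using ws a by (intro exI[of _ "refl a # ws @ [refl a]"]) auto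
  qed
qed

lemma exists_word:
  assumes "w \<in> carrier G" shows "\<exists>ws. set ws \<subseteq> S \<and> word ws = w"
proof -
  have r: "\<exists>ws. set ws \<subseteq> S \<and> word ws = refl b" if "b \<in> R" for b
    using refl_is_word[of b] refl_is_word[of "neg b"] neg_Pos refl_neg that by (cases "b \<in> Pos") auto
  have "w \<in> generate G (refl ` R)" using assms generated by simp
  then show ?thesis
  proof induction
    case one then show ?case by (intro exI[of _ "[]"]) auto
  next
    case (incl h) then show ?case using r by auto
  next
    case (inv h) then show ?case using r by (auto simp: inv_refl)
  next
    case (eng h1 h2)
    then obtain us ws where uw: "set us \<subseteq> S" "word us = h1" "set ws \<subseteq> S" "word ws = h2" by blast
    have "word (us @ ws) = h1 \<otimes> h2" using uw S_carrier by (subst word_append) auto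
    then show ?case using uw by (intro exI[of _ "us @ ws"]) auto
  qed
qed

lemma reduced_word:
  assumes "w \<in> carrier G" shows "\<exists>ws. set ws \<subseteq> S \<and> length ws = len w \<and> word ws = w"
proof -
  have "\<exists>n ws. set ws \<subseteq> S \<and> length ws = n \<and> word ws = w" using exists_word[OF assms] by blast
  then show ?thesis unfolding word_length_def by (rule LeastI_ex)
qed

lemma len_le: "set ws \<subseteq> S \<Longrightarrow> len (word ws) \<le> length ws"
  unfolding word_length_def by (rule Least_le) blast

text \<open>The strong exchange condition. Following the root \<open>b\<close> through the
  word from the right, there is a letter at which it turns negative; only the root of this
  letter turns negative there, and deleting the letter amounts to multiplying by the
  reflection in \<open>b\<close>.\<close>

lemma exchange:
  assumes "set ws \<subseteq> S" "b \<in> Pos" "act (word ws) b \<notin> Pos"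
  shows "\<exists>us. set us \<subseteq> S \<and> Suc (length us) = length ws \<and> word us = word ws \<otimes> refl b"
  using assms
proof (induction ws)
  case Nil then show ?case by (simp add: act_one Pos_R)
next
  case (Cons s ws)
  then obtain a where a: "a \<in> \<Delta>" "s = refl a" by auto
  note aR = simple_R[OF a(1)] and ra = refl_carrier[OF simple_R[OF a(1)]]
    and bR = Pos_R[OF Cons.prems(2)] and rb = refl_carrier[OF Pos_R[OF Cons.prems(2)]]
  have wc: "word ws \<in> carrier G" using Cons.prems S_carrier by (intro word_carrier) auto
  show ?case
  proof (cases "act (word ws) b \<in> Pos")
    case False
    then obtain us where us: "set us \<subseteq> S" "Suc (length us) = length ws" "word us = word ws \<otimes> refl b"
      using Cons by auto
    then show ?thesis using Cons.prems a ra rb wc by (intro exI[of _ "s # us"]) (auto simp: m_assoc)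
  next
    case True
    have "act (refl a) (act (word ws) b) \<notin> Pos" using Cons.prems a ra wc bR by (simp add: act_mult)
    then have "act (word ws) b = a" using simple_perm a True by blast
    then have "refl a = word ws \<otimes> refl b \<otimes> inv (word ws)" using refl_act[OF wc bR] by simp
    then have "refl a \<otimes> word ws \<otimes> refl b = word ws"
      using wc rb bR by (simp add: m_assoc refl_sq inv_solve_left)
    then show ?thesis using Cons.prems a by (intro exI[of _ ws]) auto
  qed
qed

lemma len_mult_refl_less:
  assumes w: "w \<in> carrier G" and b: "b \<in> Pos" and n: "act w b \<notin> Pos"
  shows "len (w \<otimes> refl b) < len w"
proof -
  obtain ws where ws: "set ws \<subseteq> S" "length ws = len w" "word ws = w" using reduced_word[OF w] by blast
  obtain us where "set us \<subseteq> S" "Suc (length us) = length ws" "word us = w \<otimes> refl b"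
    using exchange[OF ws(1) b] n ws by auto
  then show ?thesis using len_le[of us] ws by auto
qed

lemma len_mult_refl_greater:
  assumes w: "w \<in> carrier G" and b: "b \<in> Pos" and n: "act w b \<in> Pos"
  shows "len w < len (w \<otimes> refl b)"
  using len_mult_refl_less[of "w \<otimes> refl b" b] assms
  by (simp add: act_mult_refl_self_Pos Pos_R refl_carrier mult_refl_refl)

lemma len_one: "len \<one> = 0"
  using len_le[of "[]"] by simp

lemma len_eq_0: "w \<in> carrier G \<Longrightarrow> len w = 0 \<Longrightarrow> w = \<one>"
  using reduced_word[of w] by auto

lemma len_mult_le:
  assumes "w \<in> carrier G" "w' \<in> carrier G" shows "len (w \<otimes> w') \<le> len w + len w'"
proof -
  obtain us where us: "set us \<subseteq> S" "length us = len w" "word us = w" using reduced_word assms by blast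
  obtain ws where ws: "set ws \<subseteq> S" "length ws = len w'" "word ws = w'" using reduced_word assms by blast
  have "word (us @ ws) = w \<otimes> w'" using us ws S_carrier by (subst word_append) auto
  then show ?thesis using len_le[of "us @ ws"] us ws by auto
qed

lemma len_refl_le: "a \<in> \<Delta> \<Longrightarrow> len (refl a) \<le> 1"
  using len_le[of "[refl a]"] refl_carrier simple_R by simp

lemma len_mult_simple:
  assumes w: "w \<in> carrier G" and a: "a \<in> \<Delta>" and p: "act w a \<in> Pos"
  shows "len (w \<otimes> refl a) = Suc (len w)"
proof -
  have "len (w \<otimes> refl a) \<le> Suc (len w)"
    using len_mult_le[OF w, of "refl a"] len_refl_le[OF a] refl_carrier simple_R a by fastforce
  moreover have "len w < len (w \<otimes> refl a)" using len_mult_refl_greater simple_in_Pos assms by blast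
  ultimately show ?thesis by simp
qed

lemma len_mult_simple':
  assumes w: "w \<in> carrier G" and a: "a \<in> \<Delta>" and p: "act w a \<notin> Pos"
  shows "len w = Suc (len (w \<otimes> refl a))"
  using len_mult_simple[of "w \<otimes> refl a" a] assms
  by (simp add: act_mult_refl_self_Pos simple_R refl_carrier mult_refl_refl)

lemma right_descent:
  assumes w: "w \<in> carrier G" and ne: "w \<noteq> \<one>" shows "\<exists>a\<in>\<Delta>. act w a \<notin> Pos"
proof -
  obtain ws where ws: "set ws \<subseteq> S" "length ws = len w" "word ws = w" using reduced_word[OF w] by blast
  then obtain us s where us: "ws = us @ [s]" using ne by (cases ws rule: rev_cases) auto
  then obtain a where a: "a \<in> \<Delta>" "s = refl a" using ws by auto
  note ra = refl_carrier[OF simple_R[OF a(1)]]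
  have uc: "set us \<subseteq> carrier G" using ws us S_carrier by auto
  have "w = word us \<otimes> refl a" using ws us a ra uc by (simp del: foldr_append add: word_append)
  then have "w \<otimes> refl a = word us" using mult_refl_refl uc word_carrier simple_R a by simp
  then have "len (w \<otimes> refl a) \<le> length us" using len_le[of us] ws us by simp
  then have "len (w \<otimes> refl a) < len w" using ws us by simp
  then show ?thesis using len_mult_simple[OF w a(1)] a by force
qed

lemma len_eq_card_inversions:
  assumes "w \<in> carrier G" shows "len w = card (inversions w)"
  using assms
proof (induction "len w" arbitrary: w rule: less_induct)
  case less
  show ?case
  proof (cases "w = \<one>")
    case True then show ?thesis by (simp add: len_one inversions_one)
  next
    case False
    then obtain a where a: "a \<in> \<Delta>" "act w a \<notin> Pos" using right_descent less.prems by blast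
    then show ?thesis
      using less.hyps[of "w \<otimes> refl a"] len_mult_simple'[OF less.prems a]
        card_inversions_mult_refl'[OF less.prems a] less.prems refl_carrier simple_R by simp
  qed
qed

lemma len_inv: "w \<in> carrier G \<Longrightarrow> len (inv w) = len w"
  by (simp add: len_eq_card_inversions card_inversions_inv)

lemma len_simple_mult:
  assumes w: "w \<in> carrier G" and a: "a \<in> \<Delta>" and p: "act (inv w) a \<in> Pos"
  shows "len (refl a \<otimes> w) = Suc (len w)"
  using len_mult_simple[of "inv w" a] assms len_inv[of "refl a \<otimes> w"] len_inv[of w]
  by (simp add: inv_mult_group refl_carrier simple_R inv_refl)

lemma len_simple_mult':
  assumes w: "w \<in> carrier G" and a: "a \<in> \<Delta>" and p: "act (inv w) a \<notin> Pos"
  shows "len w = Suc (len (refl a \<otimes> w))"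
  using len_mult_simple'[of "inv w" a] assms len_inv[of "refl a \<otimes> w"] len_inv[of w]
  by (simp add: inv_mult_group refl_carrier simple_R inv_refl)

lemma len_refl: "a \<in> \<Delta> \<Longrightarrow> len (refl a) = 1"
  using len_mult_simple[of \<one> a] by (simp add: act_one simple_R simple_in_Pos refl_carrier len_one)

text \<open>The relation whose transitive closure is the strict Bruhat order: multiplication
  by a conjugate of a simple reflection that increases the length. The reflexive transitive
  closure \<open>ble\<close> is the Bruhat order itself.\<close>

definition bstep :: "'w \<Rightarrow> 'w \<Rightarrow> bool" where
  "bstep x y \<longleftrightarrow> x \<in> carrier G \<and> len x < len y \<and>
    (\<exists>s\<in>S. \<exists>u\<in>carrier G. y = x \<otimes> (u \<otimes> s \<otimes> inv u))"

abbreviation bless :: "'w \<Rightarrow> 'w \<Rightarrow> bool" where "bless \<equiv> bruhat_less G S"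
abbreviation ble :: "'w \<Rightarrow> 'w \<Rightarrow> bool" where "ble \<equiv> bstep\<^sup>*\<^sup>*"

lemma bless_eq: "bless = bstep\<^sup>+\<^sup>+"
  unfolding bruhat_less_def bstep_def ..

lemma bless_len: "bless x y \<Longrightarrow> len x < len y"
  unfolding bless_eq by (induction rule: tranclp_induct) (auto simp: bstep_def)

lemma bstep_carrier: "bstep x y \<Longrightarrow> x \<in> carrier G \<and> y \<in> carrier G"
  using S_carrier by (auto simp: bstep_def)

lemma bless_carrier: "bless x y \<Longrightarrow> x \<in> carrier G \<and> y \<in> carrier G"
  unfolding bless_eq by (induction rule: tranclp_induct) (auto dest: bstep_carrier)

lemma ble_neq_bless: "ble x y \<Longrightarrow> x \<noteq> y \<Longrightarrow> bless x y"
  unfolding bless_eq by (metis rtranclpD)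

lemma bless_ble: "bless x y \<Longrightarrow> ble x y"
  unfolding bless_eq by simp

lemma bstep_simple:
  assumes "x \<in> carrier G" "a \<in> \<Delta>" "act x a \<in> Pos" shows "bstep x (x \<otimes> refl a)"
proof -
  note ra = refl_carrier[OF simple_R[OF assms(2)]]
  have "x \<otimes> refl a = x \<otimes> (\<one> \<otimes> refl a \<otimes> inv \<one>)" using ra by simp
  moreover have "refl a \<in> S" using assms(2) by blast
  moreover have "len x < len (x \<otimes> refl a)" using len_mult_simple[OF assms] by simp
  ultimately show ?thesis using assms(1) one_closed unfolding bstep_def by metis
qed

text \<open>The lifting property for a single reflection. If \<open>z\<close> is
  \<open>y\<close> times the reflection in the positive root \<open>b\<close>, then
  multiplying both by the simple reflection in \<open>a\<close> replaces \<open>b\<close> by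
  its image, which is still positive unless \<open>b = a\<close>.\<close>

lemma bstep_lift:
  assumes st: "bstep y z" and a: "a \<in> \<Delta>"
  shows "y \<otimes> refl a = z \<or> bstep (y \<otimes> refl a) (z \<otimes> refl a)"
proof -
  obtain c u where y: "y \<in> carrier G" and ll: "len y < len z" and c: "c \<in> \<Delta>" and u: "u \<in> carrier G"
    and z: "z = y \<otimes> (u \<otimes> refl c \<otimes> inv u)" using st by (auto simp: bstep_def)
  note aR = simple_R[OF a] and ra = refl_carrier[OF simple_R[OF a]] and cR = simple_R[OF c]
    and rc = refl_carrier[OF simple_R[OF c]]
  define b where "b = (if act u c \<in> Pos then act u c else neg (act u c))"
  have b: "b \<in> Pos" "refl b = u \<otimes> refl c \<otimes> inv u"
    using act_R[OF u cR] by (auto simp: b_def neg_Pos refl_neg refl_act u cR)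
  note bR = Pos_R[OF b(1)] and rb = refl_carrier[OF Pos_R[OF b(1)]]
  have zb: "z = y \<otimes> refl b" using z b by simp
  have yb: "act y b \<in> Pos" using len_mult_refl_less[OF y b(1)] ll zb by force
  show ?thesis
  proof (cases "b = a")
    case True then show ?thesis using zb by simp
  next
    case False
    let ?b = "act (refl a) b"
    have bP: "?b \<in> Pos" using simple_perm a b False by blast
    have rb': "refl ?b = refl a \<otimes> refl b \<otimes> refl a" using refl_act[OF ra bR] inv_refl[OF aR] by simp
    have e: "y \<otimes> refl a \<otimes> refl ?b = z \<otimes> refl a"
      using y ra rb aR by (simp add: rb' zb m_assoc refl_refl_mult)
    have "act (y \<otimes> refl a) ?b = act y b"
      using act_mult[of "y \<otimes> refl a" "refl a" b] y ra bR aR by (simp add: mult_refl_refl)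
    then have "len (y \<otimes> refl a) < len (z \<otimes> refl a)"
      using len_mult_refl_greater[of "y \<otimes> refl a" ?b] bP yb y ra e by simp
    moreover have "refl ?b = (refl a \<otimes> u) \<otimes> refl c \<otimes> inv (refl a \<otimes> u)"
      using ra u rc aR by (simp add: rb' b(2) inv_mult_group inv_refl m_assoc)
    ultimately show ?thesis using e y ra u c unfolding bstep_def
      by (intro disjI2 conjI bexI[of _ "refl c"] bexI[of _ "refl a \<otimes> u"]) auto
  qed
qed

lemma ble_lift:
  assumes "ble y z" and a: "a \<in> \<Delta>"
  shows "ble (y \<otimes> refl a) z \<or> ble (y \<otimes> refl a) (z \<otimes> refl a)"
  using assms(1)
proof (induction rule: converse_rtranclp_induct)
  case base then show ?case by simp
next
  case (step y y')
  from bstep_lift[OF step(1) a] step show ?case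
    by (auto intro: converse_rtranclp_into_rtranclp)
qed

end

section \<open>Shortest coset representatives\<close>

text \<open>\<open>U\<close> plays the part of the finite Weyl group inside the affine one,
  with the roots \<open>Rf\<close> and simple roots \<open>\<Delta>f\<close>. The elements
  of \<open>U\<close> may only invert roots of \<open>Rf\<close>, and positivity on
  \<open>Rf\<close> is decided by \<open>\<Delta>f\<close>.\<close>

locale parabolic_action = reflection_action +
  fixes Rf \<Delta>f :: "'c set" and U :: "'a set"
  assumes U_subgroup: "subgroup U G"
    and Rf_sub: "Rf \<subseteq> R"
    and simplef_sub: "\<Delta>f \<subseteq> \<Delta>"
    and simplef_Rf: "\<Delta>f \<subseteq> Rf"
    and refl_U: "a \<in> \<Delta>f \<Longrightarrow> refl a \<in> U"
    and U_Rf: "u \<in> U \<Longrightarrow> b \<in> Rf \<Longrightarrow> act u b \<in> Rf"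
    and U_Pos: "u \<in> U \<Longrightarrow> b \<in> Pos \<Longrightarrow> b \<notin> Rf \<Longrightarrow> act u b \<in> Pos"
    and detect_f: "w \<in> carrier G \<Longrightarrow> b \<in> Pos \<Longrightarrow> b \<in> Rf \<Longrightarrow> act w b \<notin> Pos \<Longrightarrow> \<exists>a\<in>\<Delta>f. act w a \<notin> Pos"
begin

abbreviation Wp :: "'a set" where "Wp \<equiv> shortest_coset_reps G S U"

lemma U_carrier: "u \<in> U \<Longrightarrow> u \<in> carrier G" by (rule subgroup.mem_carrier[OF U_subgroup])
lemma U_inv: "u \<in> U \<Longrightarrow> inv u \<in> U" by (rule subgroup.m_inv_closed[OF U_subgroup])
lemma U_mult: "u \<in> U \<Longrightarrow> u' \<in> U \<Longrightarrow> u \<otimes> u' \<in> U" by (rule subgroup.m_closed[OF U_subgroup])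
lemma U_one: "\<one> \<in> U" by (rule subgroup.one_closed[OF U_subgroup])
lemma simplef: "a \<in> \<Delta>f \<Longrightarrow> a \<in> \<Delta> \<and> a \<in> Rf \<and> a \<in> Pos \<and> a \<in> R \<and> refl a \<in> carrier G"
  using simplef_sub simplef_Rf simple_in_Pos simple_R refl_carrier by blast

lemma U_left_descent:
  assumes u: "u \<in> U" and ne: "u \<noteq> \<one>" shows "\<exists>a\<in>\<Delta>f. act (inv u) a \<notin> Pos"
proof (rule ccontr)
  assume no: "\<not> ?thesis"
  have "inversions (inv u) = {}"
    using no detect_f[of "inv u"] U_Pos[OF U_inv[OF u]] U_carrier[OF u]
    by (auto simp: inversions_def)
  then have "len u = 0" using len_inv[of u] len_eq_card_inversions[of "inv u"] U_carrier[OF u] by simp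
  then show False using len_eq_0 U_carrier u ne by blast
qed

text \<open>Build up \<open>u\<close> by multiplying with simple reflections of
  \<open>U\<close> on the left: each one lengthens \<open>u x\<close> when it lengthens
  \<open>u\<close>, since \<open>inv x\<close> keeps the positive roots of \<open>Rf\<close>
  positive.\<close>

lemma len_U_mult:
  assumes x: "x \<in> carrier G" and pos: "\<And>b. b \<in> Rf \<Longrightarrow> b \<in> Pos \<Longrightarrow> act (inv x) b \<in> Pos" and u: "u \<in> U"
  shows "len (u \<otimes> x) = len u + len x"
  using u
proof (induction "len u" arbitrary: u rule: less_induct)
  case less
  note uc = U_carrier[OF less.prems]
  show ?case
  proof (cases "u = \<one>")
    case True then show ?thesis using x by (simp add: len_one)
  next
    case False
    then obtain a where a: "a \<in> \<Delta>f" "act (inv u) a \<notin> Pos" using U_left_descent less.prems by blast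
    note sa = simplef[OF a(1)]
    let ?u = "refl a \<otimes> u"
    have u': "?u \<in> U" using U_mult refl_U a less.prems by blast
    note uc' = U_carrier[OF u']
    have l: "len u = Suc (len ?u)" using len_simple_mult'[OF uc] sa a by blast
    have IH: "len (?u \<otimes> x) = len ?u + len x" using less.hyps u' l by simp
    have "inv ?u = inv u \<otimes> refl a" using uc sa by (simp add: inv_mult_group inv_refl)
    then have p: "act (inv ?u) a \<in> Pos" using act_mult_refl_self_Pos[of "inv u" a] a sa uc by simp
    have "act (inv ?u) a \<in> Rf" using U_Rf[OF U_inv[OF u']] sa by blast
    then have "act (inv (?u \<otimes> x)) a \<in> Pos"
      using pos p x uc' sa by (simp only: inv_mult_group act_mult inv_closed)
    then have "len (refl a \<otimes> (?u \<otimes> x)) = Suc (len (?u \<otimes> x))"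
      using len_simple_mult sa x uc' by blast
    moreover have "refl a \<otimes> (?u \<otimes> x) = u \<otimes> x" using refl_refl_mult[of "u \<otimes> x" a] sa x uc by (simp add: m_assoc)
    ultimately show ?thesis using IH l by simp
  qed
qed

text \<open>If \<open>x\<close> is shortest, no simple reflection of \<open>U\<close>
  shortens it from the left, and \<open>\<Delta>f\<close> decides positivity on all of
  \<open>Rf\<close>. For the affine Weyl group the condition says that the alcove of
  \<open>x\<close> lies in the dominant chamber.\<close>

lemma Wp_iff: "x \<in> Wp \<longleftrightarrow> x \<in> carrier G \<and> (\<forall>b\<in>Rf. b \<in> Pos \<longrightarrow> act (inv x) b \<in> Pos)"
proof
  assume x: "x \<in> Wp"
  then have xc: "x \<in> carrier G" and m: "\<And>u. u \<in> U \<Longrightarrow> len x \<le> len (u \<otimes> x)"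
    by (auto simp: shortest_coset_reps_def)
  have "act (inv x) a \<in> Pos" if "a \<in> \<Delta>f" for a
    using len_simple_mult'[OF xc, of a] m[OF refl_U[OF that]] simplef[OF that] by force
  then show "x \<in> carrier G \<and> (\<forall>b\<in>Rf. b \<in> Pos \<longrightarrow> act (inv x) b \<in> Pos)"
    using detect_f[of "inv x"] xc by blast
next
  assume "x \<in> carrier G \<and> (\<forall>b\<in>Rf. b \<in> Pos \<longrightarrow> act (inv x) b \<in> Pos)"
  then show "x \<in> Wp" using len_U_mult[of x] by (auto simp: shortest_coset_reps_def)
qed

lemma Wp_carrier: "x \<in> Wp \<Longrightarrow> x \<in> carrier G" by (simp add: Wp_iff)

lemma len_U_Wp: "u \<in> U \<Longrightarrow> x \<in> Wp \<Longrightarrow> len (u \<otimes> x) = len u + len x"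
  using len_U_mult Wp_iff by blast

lemma one_Wp: "\<one> \<in> Wp" by (simp add: Wp_iff act_one Pos_R)

lemma coset_decomp:
  assumes w: "w \<in> carrier G" shows "\<exists>u\<in>U. \<exists>x\<in>Wp. w = u \<otimes> x"
proof -
  let ?u = "arg_min (\<lambda>u. len (u \<otimes> w)) (\<lambda>u. u \<in> U)"
  have u: "?u \<in> U" and m: "\<And>u. u \<in> U \<Longrightarrow> len (?u \<otimes> w) \<le> len (u \<otimes> w)"
    using arg_min_nat_lemma[of "\<lambda>u. u \<in> U" \<one> "\<lambda>u. len (u \<otimes> w)"] U_one by auto
  note uc = U_carrier[OF u]
  have "len (?u \<otimes> w) \<le> len (u' \<otimes> (?u \<otimes> w))" if "u' \<in> U" for u'
    using m[OF U_mult[OF that u]] that uc w U_carrier by (simp add: m_assoc)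
  then have "?u \<otimes> w \<in> Wp" using uc w by (simp add: shortest_coset_reps_def)
  moreover have "w = inv ?u \<otimes> (?u \<otimes> w)" using uc w by (simp add: m_assoc[symmetric])
  ultimately show ?thesis using U_inv u by blast
qed

lemma coset_unique:
  assumes "u \<in> U" "u' \<in> U" "x \<in> Wp" "x' \<in> Wp" "u \<otimes> x = u' \<otimes> x'"
  shows "u = u' \<and> x = x'"
proof -
  let ?t = "inv u \<otimes> u'"
  have c: "u \<in> carrier G" "u' \<in> carrier G" "x \<in> carrier G" "x' \<in> carrier G"
    using assms U_carrier Wp_carrier by auto
  have t: "?t \<in> U" "inv ?t \<in> U" using U_inv U_mult assms by auto
  have x: "x = ?t \<otimes> x'"
    using c assms(5) by (metis inv_closed inv_solve_left m_assoc m_closed)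
  then have x': "x' = inv ?t \<otimes> x" using c by (metis inv_closed inv_solve_left m_closed)
  have "len x = len ?t + len x'" using x len_U_Wp[OF t(1) assms(4)] by simp
  moreover have "len x' = len (inv ?t) + len x" using x' len_U_Wp[OF t(2) assms(3)] by simp
  ultimately have "len ?t = 0" by simp
  then have 1: "?t = \<one>" using len_eq_0 t U_carrier by blast
  then have "x = x'" using x c by simp
  moreover have "u = u'" using 1 c by (metis inv_closed inv_equality inv_inv)
  ultimately show ?thesis by blast
qed

text \<open>Right multiplication by a simple reflection either stays among the shortest
  representatives or does not leave the coset: if it breaks dominance, it does so at a
  simple root of \<open>U\<close>, which must be the image of \<open>a\<close>.\<close>

lemma Wp_mult_simple:
  assumes x: "x \<in> Wp" and a: "a \<in> \<Delta>" and n: "x \<otimes> refl a \<notin> Wp"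
  shows "\<exists>c\<in>\<Delta>f. act x a = c \<and> x \<otimes> refl a = refl c \<otimes> x"
proof -
  note xc = Wp_carrier[OF x] and aR = simple_R[OF a] and ra = refl_carrier[OF simple_R[OF a]]
  have iv: "inv (x \<otimes> refl a) = refl a \<otimes> inv x" using xc ra aR by (simp add: inv_mult_group inv_refl)
  obtain b where "b \<in> Rf" "b \<in> Pos" "act (inv (x \<otimes> refl a)) b \<notin> Pos"
    using n xc ra unfolding Wp_iff by blast
  then obtain c where c: "c \<in> \<Delta>f" "act (inv (x \<otimes> refl a)) c \<notin> Pos"
    using detect_f[of "inv (x \<otimes> refl a)" b] xc ra by auto
  note sc = simplef[OF c(1)]
  have p: "act (inv x) c \<in> Pos" using x sc unfolding Wp_iff by blast
  have "act (refl a) (act (inv x) c) \<notin> Pos" using c iv xc ra sc by (simp add: act_mult)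
  then have "act (inv x) c = a" using simple_perm a p by blast
  then have xa: "act x a = c" using act_act_inv xc sc by blast
  then have "refl c = x \<otimes> refl a \<otimes> inv x" using refl_act[OF xc aR] by simp
  then have "x \<otimes> refl a = refl c \<otimes> x" using xc ra by (simp add: m_assoc)
  then show ?thesis using xa c by blast
qed

lemma Wp_mult_simple_less:
  assumes x: "x \<in> Wp" and a: "a \<in> \<Delta>" and n: "act x a \<notin> Pos"
  shows "x \<otimes> refl a \<in> Wp"
  using Wp_mult_simple[OF x a] n simplef by blast

end


section \<open>Combinatorics of the root system\<close>

context triangular_decomposition
begin

lemma P_roots: "\<alpha> \<in> P \<Longrightarrow> \<alpha> \<in> roots h"
  using positive by (auto simp: positive_system_def)
lemma finite_P: "finite P"
  using P_roots finite_subset[OF _ finite_roots] by blast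
lemma P_uminus:
  assumes "\<alpha> \<in> roots h" shows "- \<alpha> \<in> P \<longleftrightarrow> \<alpha> \<notin> P"
proof -
  have e: "roots h = P \<union> uminus ` P" "P \<inter> uminus ` P = {}" using positive by (simp_all add: positive_system_def)
  have 1: "- \<alpha> \<notin> P" if "\<alpha> \<in> P"
  proof
    assume "- \<alpha> \<in> P"
    then have "- (- \<alpha>) \<in> uminus ` P" by (rule imageI)
    then have "\<alpha> \<in> P \<inter> uminus ` P" using that by simp
    then show False by (simp only: e(2) empty_iff)
  qed
  have 2: "- \<alpha> \<in> P" if "\<alpha> \<notin> P"
  proof -
    have "\<alpha> \<in> P \<union> uminus ` P" using assms by (simp only: e(1))
    then have "\<alpha> \<in> uminus ` P" using that by (elim UnE) (simp_all only: simp_thms)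
    then show ?thesis by (elim imageE) simp
  qed
  show ?thesis using 1 2 by blast
qed
lemma P_add: "\<alpha> \<in> P \<Longrightarrow> \<beta> \<in> P \<Longrightarrow> \<alpha> + \<beta> \<in> roots h \<Longrightarrow> \<alpha> + \<beta> \<in> P"
  using positive by (simp add: positive_system_def)
lemma simple_P: "\<alpha> \<in> simple_roots P \<Longrightarrow> \<alpha> \<in> P" by (simp add: simple_roots_def)
lemma finite_simple: "finite (simple_roots P)"
  using finite_subset[OF _ finite_P] simple_P by blast
text \<open>The Cartan integer of \<open>\<beta>\<close> at \<open>\<alpha>\<close>. The
  pairing is a complex number that happens to be an integer, and taking the floor of the
  real part gives access to integer arithmetic.\<close>

definition ip :: "'g weight \<Rightarrow> 'g weight \<Rightarrow> int" where
  "ip \<beta> \<alpha> = \<lfloor>Re (\<beta> (coroot h \<alpha>))\<rfloor>"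

lemma ip_of_int: "\<alpha> \<in> roots h \<Longrightarrow> \<beta> \<in> roots h \<Longrightarrow> \<beta> (coroot h \<alpha>) = of_int (ip \<beta> \<alpha>)"
  using pairing_int[of \<alpha> \<beta>] by (auto simp: ip_def)

lemma ip_self: "\<alpha> \<in> roots h \<Longrightarrow> ip \<alpha> \<alpha> = 2" by (simp add: ip_def root_coroot)

definition sref :: "'g weight \<Rightarrow> 'g weight \<Rightarrow> 'g weight" where
  "sref \<alpha> \<phi> = \<phi> - wscale (\<phi> (coroot h \<alpha>)) \<alpha>"

lemma sref_apply: "sref \<alpha> \<phi> x = \<phi> x - \<phi> (coroot h \<alpha>) * \<alpha> x" by (simp add: sref_def)
lemma sref_root: "\<alpha> \<in> roots h \<Longrightarrow> \<beta> \<in> roots h \<Longrightarrow> sref \<alpha> \<beta> \<in> roots h"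
  unfolding sref_def by (rule reflect_root)
lemma sref_sref: "\<alpha> \<in> roots h \<Longrightarrow> sref \<alpha> (sref \<alpha> \<phi>) = \<phi>"
  by (rule ext) (simp add: sref_apply root_coroot algebra_simps)
lemma sref_self: "\<alpha> \<in> roots h \<Longrightarrow> sref \<alpha> \<alpha> = - \<alpha>"
  by (rule ext) (simp add: sref_apply root_coroot)
lemma sref_uminus: "sref \<alpha> (- \<beta>) = - sref \<alpha> \<beta>"
  by (rule ext) (simp add: sref_apply)
lemma coroot_sref:
  "\<alpha> \<in> roots h \<Longrightarrow> \<beta> \<in> roots h \<Longrightarrow> coroot h (sref \<alpha> \<beta>) = coroot h \<beta> - scaleC (\<alpha> (coroot h \<beta>)) (coroot h \<alpha>)"
  unfolding sref_def by (rule coroot_reflect)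
lemma pairing_sref:
  assumes "\<alpha> \<in> roots h" "\<beta> \<in> roots h" "\<phi> \<in> dual_space h"
  shows "\<phi> (coroot h (sref \<alpha> \<beta>)) = sref \<alpha> \<phi> (coroot h \<beta>)"
  unfolding coroot_sref[OF assms(1,2)] dual_diff[OF assms(3) coroot_h[OF assms(2)] h_scaleC[OF coroot_h[OF assms(1)]]]
    dual_scaleC[OF assms(3) coroot_h[OF assms(1)]] sref_apply by simp

text \<open>An invariant form built from the coroots alone. Its value at a root is a sum of
  squares of Cartan integers, and therefore positive.\<close>

definition form :: "'g weight \<Rightarrow> 'g weight \<Rightarrow> complex" where
  "form \<phi> \<psi> = (\<Sum>\<gamma>\<in>roots h. \<phi> (coroot h \<gamma>) * \<psi> (coroot h \<gamma>))"

lemma form_commute: "form \<phi> \<psi> = form \<psi> \<phi>" by (simp add: form_def mult.commute)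
lemma form_diff: "form (\<phi> - \<psi>) \<chi> = form \<phi> \<chi> - form \<psi> \<chi>"
  by (simp add: form_def sum_subtractf algebra_simps)
lemma form_scale: "form (wscale c \<phi>) \<psi> = c * form \<phi> \<psi>"
  by (simp add: form_def sum_distrib_left algebra_simps)

lemma form_sref:
  assumes a: "\<alpha> \<in> roots h" and d: "\<phi> \<in> dual_space h" "\<psi> \<in> dual_space h"
  shows "form (sref \<alpha> \<phi>) (sref \<alpha> \<psi>) = form \<phi> \<psi>"
proof -
  have "form (sref \<alpha> \<phi>) (sref \<alpha> \<psi>) = (\<Sum>\<gamma>\<in>roots h. \<phi> (coroot h (sref \<alpha> \<gamma>)) * \<psi> (coroot h (sref \<alpha> \<gamma>)))"
    unfolding form_def by (rule sum.cong) (simp_all add: pairing_sref a d)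
  also have "\<dots> = form \<phi> \<psi>"
    unfolding form_def
    by (rule sum.reindex_bij_witness[where i = "sref \<alpha>" and j = "sref \<alpha>"]) (simp_all add: sref_sref sref_root a)
  finally show ?thesis .
qed

text \<open>Invariance under the reflection in \<open>\<alpha>\<close>, applied to the pair
  of \<open>\<phi>\<close> and \<open>\<alpha>\<close>.\<close>

lemma form_root:
  assumes a: "\<alpha> \<in> roots h" and d: "\<phi> \<in> dual_space h"
  shows "2 * form \<phi> \<alpha> = \<phi> (coroot h \<alpha>) * form \<alpha> \<alpha>"
proof -
  have "form \<phi> \<alpha> = form (sref \<alpha> \<phi>) (sref \<alpha> \<alpha>)" using form_sref a d root_dual by simp
  also have "sref \<alpha> \<alpha> = wscale (- 1) \<alpha>" using sref_self[OF a] by (simp add: fun_eq_iff)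
  also have "form (sref \<alpha> \<phi>) (wscale (- 1) \<alpha>) = - (form \<phi> \<alpha> - \<phi> (coroot h \<alpha>) * form \<alpha> \<alpha>)"
  proof -
    have "form (sref \<alpha> \<phi>) (wscale (- 1) \<alpha>) = - form (sref \<alpha> \<phi>) \<alpha>"
      using form_commute[of "sref \<alpha> \<phi>" "wscale (- 1) \<alpha>"] form_commute[of "sref \<alpha> \<phi>" \<alpha>] form_scale[of "- 1" \<alpha> "sref \<alpha> \<phi>"] by simp
    then show ?thesis unfolding sref_def form_diff form_scale by simp
  qed
  finally show ?thesis by simp
qed

definition nrm :: "'g weight \<Rightarrow> int" where "nrm \<alpha> = (\<Sum>\<gamma>\<in>roots h. (ip \<alpha> \<gamma>)\<^sup>2)"

lemma form_nrm: "\<alpha> \<in> roots h \<Longrightarrow> form \<alpha> \<alpha> = of_int (nrm \<alpha>)"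
proof -
  assume a: "\<alpha> \<in> roots h"
  have "form \<alpha> \<alpha> = (\<Sum>\<gamma>\<in>roots h. of_int ((ip \<alpha> \<gamma>)\<^sup>2))"
    unfolding form_def
  proof (rule sum.cong[OF HOL.refl])
    fix \<gamma> assume g: "\<gamma> \<in> roots h"
    show "\<alpha> (coroot h \<gamma>) * \<alpha> (coroot h \<gamma>) = of_int ((ip \<alpha> \<gamma>)\<^sup>2)"
      unfolding ip_of_int[OF g a] by (simp add: power2_eq_square)
  qed
  then show ?thesis by (simp add: nrm_def)
qed

lemma nrm_pos: "\<alpha> \<in> roots h \<Longrightarrow> nrm \<alpha> > 0"
  unfolding nrm_def by (rule sum_pos2[OF finite_roots]) (auto simp: ip_self)

lemma form_ip: "\<alpha> \<in> roots h \<Longrightarrow> \<beta> \<in> roots h \<Longrightarrow> 2 * form \<beta> \<alpha> = of_int (ip \<beta> \<alpha> * nrm \<alpha>)"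
  using form_root[of \<alpha> \<beta>] root_dual[of \<beta>] ip_of_int[of \<alpha> \<beta>] by (simp add: form_nrm)

lemma ip_nrm:
  assumes "\<alpha> \<in> roots h" "\<beta> \<in> roots h" shows "ip \<beta> \<alpha> * nrm \<alpha> = ip \<alpha> \<beta> * nrm \<beta>"
proof -
  have "(of_int (ip \<beta> \<alpha> * nrm \<alpha>) :: complex) = of_int (ip \<alpha> \<beta> * nrm \<beta>)"
    using form_ip[OF assms] form_ip[OF assms(2,1)] form_commute[of \<alpha> \<beta>] by simp
  then show ?thesis by (simp only: of_int_eq_iff)
qed

lemma ip_pos_sym:
  assumes "\<alpha> \<in> roots h" "\<beta> \<in> roots h" shows "ip \<beta> \<alpha> > 0 \<longleftrightarrow> ip \<alpha> \<beta> > 0"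
  using ip_nrm[OF assms] nrm_pos[OF assms(1)] nrm_pos[OF assms(2)]
  by (metis zero_less_mult_pos2 mult_pos_pos)

lemma ip_uminus_left: "\<alpha> \<in> roots h \<Longrightarrow> \<beta> \<in> roots h \<Longrightarrow> ip (- \<beta>) \<alpha> = - ip \<beta> \<alpha>"
proof -
  assume a: "\<alpha> \<in> roots h" "\<beta> \<in> roots h"
  have "(of_int (ip (- \<beta>) \<alpha>) :: complex) = of_int (- ip \<beta> \<alpha>)"
    using ip_of_int[OF a] ip_of_int[OF a(1) uminus_roots[OF a(2)]] by simp
  then show ?thesis by (simp only: of_int_eq_iff)
qed

lemma ip_uminus_right: "\<alpha> \<in> roots h \<Longrightarrow> \<beta> \<in> roots h \<Longrightarrow> ip \<beta> (- \<alpha>) = - ip \<beta> \<alpha>"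
proof -
  assume a: "\<alpha> \<in> roots h" "\<beta> \<in> roots h"
  have "(of_int (ip \<beta> (- \<alpha>)) :: complex) = of_int (- ip \<beta> \<alpha>)"
    using ip_of_int[OF a] ip_of_int[OF uminus_roots[OF a(1)] a(2)]
    by (simp add: coroot_minus a dual_space_uminus root_dual)
  then show ?thesis by (simp only: of_int_eq_iff)
qed

text \<open>Otherwise \<open>\<beta> - \<alpha>\<close> would be a root of nonpositive
  norm.\<close>

lemma ip_both_ge_2:
  assumes a: "\<alpha> \<in> roots h" and b: "\<beta> \<in> roots h" and g: "ip \<beta> \<alpha> \<ge> 2" "ip \<alpha> \<beta> \<ge> 2"
  shows "\<beta> = \<alpha>"
proof (rule ccontr)
  assume ne: "\<beta> \<noteq> \<alpha>"
  have r: "\<beta> - \<alpha> \<in> roots h" by (rule root_diff[OF a b ip_of_int[OF a b] _ ne]) (use g in simp)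
  have "form (\<beta> - \<alpha>) (\<beta> - \<alpha>) = form \<beta> \<beta> - 2 * form \<beta> \<alpha> + form \<alpha> \<alpha>"
    using form_commute[of \<beta> "\<beta> - \<alpha>"] form_commute[of \<alpha> "\<beta> - \<alpha>"] form_commute[of \<alpha> \<beta>]
    by (simp add: form_diff)
  then have "(of_int (nrm (\<beta> - \<alpha>)) :: complex) = of_int (nrm \<beta> - ip \<beta> \<alpha> * nrm \<alpha> + nrm \<alpha>)"
    using form_ip[OF a b] by (simp add: form_nrm a b r)
  then have e: "nrm (\<beta> - \<alpha>) = nrm \<beta> - ip \<beta> \<alpha> * nrm \<alpha> + nrm \<alpha>" by (simp only: of_int_eq_iff)
  have "2 * nrm \<alpha> \<le> ip \<beta> \<alpha> * nrm \<alpha>" "2 * nrm \<beta> \<le> ip \<alpha> \<beta> * nrm \<beta>"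
    using g nrm_pos[OF a] nrm_pos[OF b] by (simp_all add: mult_right_mono)
  then show False using e nrm_pos[OF r] ip_nrm[OF a b] by linarith
qed

text \<open>One of the two Cartan integers is 1, and then the difference of the coroots is,
  up to sign, the coroot of a reflected root.\<close>

lemma coroot_diff:
  assumes t: "\<theta> \<in> roots h" and b: "\<beta> \<in> roots h" and p: "ip \<theta> \<beta> > 0" and ne: "\<theta> \<noteq> \<beta>"
  shows "\<exists>\<delta>\<in>roots h. coroot h \<delta> = coroot h \<theta> - coroot h \<beta>"
proof -
  have p': "ip \<beta> \<theta> > 0" using ip_pos_sym[OF b t] p by simp
  have "ip \<theta> \<beta> = 1 \<or> ip \<beta> \<theta> = 1" using ip_both_ge_2[OF b t] ne p p' by force
  then show ?thesis
  proof
    assume 1: "ip \<theta> \<beta> = 1"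
    have "coroot h (sref \<theta> \<beta>) = coroot h \<beta> - coroot h \<theta>"
      using coroot_sref[OF t b] ip_of_int[OF b t] 1 by (simp add: scaleC_one)
    then have "coroot h (- sref \<theta> \<beta>) = coroot h \<theta> - coroot h \<beta>" using coroot_minus[OF sref_root[OF t b]] by simp
    then show ?thesis using uminus_roots[OF sref_root[OF t b]] by blast
  next
    assume 1: "ip \<beta> \<theta> = 1"
    have "coroot h (sref \<beta> \<theta>) = coroot h \<theta> - coroot h \<beta>"
      using coroot_sref[OF b t] ip_of_int[OF t b] 1 by (simp add: scaleC_one)
    then show ?thesis using sref_root[OF b t] by blast
  qed
qed

lemma root_add:
  assumes a: "\<alpha> \<in> roots h" and b: "\<beta> \<in> roots h" and n: "ip \<beta> \<alpha> < 0" and ne: "\<beta> \<noteq> - \<alpha>"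
  shows "\<beta> + \<alpha> \<in> roots h"
proof -
  have "\<beta> - - \<alpha> \<in> roots h"
    by (rule root_diff[OF uminus_roots[OF a] b ip_of_int[OF uminus_roots[OF a] b] _ ne])
      (simp add: ip_uminus_right a b n)
  then show ?thesis by simp
qed

lemma sum_list_apply: "sum_list (bs :: 'g weight list) t = (\<Sum>b\<leftarrow>bs. b t)"
  by (induction bs) simp_all

text \<open>A positive system is given by closure axioms, not by a linear functional, so
  positivity of sums needs an argument. If a sum of positive roots vanishes, pairing with
  one of them, \<open>b\<close>, finds another one, \<open>c\<close>, with negative Cartan
  integer. Then \<open>b + c\<close> is a positive root, and replacing the two by their sum
  gives a shorter vanishing sum.\<close>

lemma sum_list_P_nonzero:
  assumes "set bs \<subseteq> P" "bs \<noteq> []" shows "sum_list bs \<noteq> 0"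
  using assms
proof (induction "length bs" arbitrary: bs rule: less_induct)
  case less
  obtain b cs where bs: "bs = b # cs" using less.prems by (cases bs) auto
  have bP: "b \<in> P" and cP: "set cs \<subseteq> P" using less.prems bs by auto
  note br = P_roots[OF bP]
  show ?case
  proof
    assume z: "sum_list bs = 0"
    have "(\<Sum>c\<leftarrow>bs. c (coroot h b)) = 0" using sum_list_apply[of bs "coroot h b"] z by simp
    moreover have "(\<Sum>c\<leftarrow>bs. c (coroot h b)) = of_int (\<Sum>c\<leftarrow>bs. ip c b)"
      using less.prems(1) by (induction bs) (auto simp: ip_of_int br P_roots)
    ultimately have "(\<Sum>c\<leftarrow>bs. ip c b) = 0" by (simp only: of_int_eq_0_iff)
    then have "(\<Sum>c\<leftarrow>cs. ip c b) < 0" using bs ip_self[OF br] by simp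
    moreover have "(\<Sum>c\<leftarrow>cs. ip c b) \<ge> 0" if "\<forall>c\<in>set cs. ip c b \<ge> 0"
      using that by (induction cs) auto
    ultimately obtain c where c: "c \<in> set cs" "ip c b < 0" by force
    have cP': "c \<in> P" using c cP by blast
    have "c \<noteq> - b" using P_uminus[OF br] bP cP' by blast
    then have "c + b \<in> P" using P_add cP' bP root_add[OF br P_roots[OF cP'] c(2)] by blast
    moreover have "sum_list ((c + b) # remove1 c cs) = sum_list bs"
      using sum_list_map_remove1[OF c(1), of "\<lambda>x. x"] bs by (simp add: ac_simps)
    moreover have "length ((c + b) # remove1 c cs) < length bs"
      using bs c length_pos_if_in_set[OF c(1)] by (simp add: length_remove1)
    moreover have "set (remove1 c cs) \<subseteq> P" using set_remove1_subset[of c cs] cP by blast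
    ultimately show False using less.hyps[of "(c + b) # remove1 c cs"] z by simp
  qed
qed

definition below :: "('g weight \<times> 'g weight) set" where
  "below = {(\<gamma>, \<beta>). \<gamma> \<in> P \<and> \<beta> \<in> P \<and> \<beta> - \<gamma> \<in> P}"

text \<open>A cycle would express zero as a nonempty sum of positive roots.\<close>

lemma wf_below: "wf below"
proof (rule finite_acyclic_wf)
  show "finite below" by (rule finite_subset[of _ "P \<times> P"]) (auto simp: below_def finite_P)
  have tr: "\<exists>bs. bs \<noteq> [] \<and> set bs \<subseteq> P \<and> \<beta> - \<gamma> = sum_list bs" if "(\<gamma>, \<beta>) \<in> below\<^sup>+" for \<gamma> \<beta>
    using that
  proof (induction rule: trancl_induct)
    case (base \<beta>)
    then show ?case by (intro exI[of _ "[\<beta> - \<gamma>]"]) (auto simp: below_def)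
  next
    case (step \<beta> \<delta>)
    then obtain bs where bs: "bs \<noteq> []" "set bs \<subseteq> P" "\<beta> - \<gamma> = sum_list bs" by blast
    have "sum_list ((\<delta> - \<beta>) # bs) = (\<delta> - \<beta>) + (\<beta> - \<gamma>)" unfolding bs(3) by simp
    also have "\<dots> = \<delta> - \<gamma>" by (rule ext) simp
    finally have "\<delta> - \<gamma> = sum_list ((\<delta> - \<beta>) # bs)" ..
    moreover have "\<delta> - \<beta> \<in> P" using step(2) unfolding below_def by blast
    then have "set ((\<delta> - \<beta>) # bs) \<subseteq> P" using bs(2) by (simp only: list.set insert_subset simp_thms)
    ultimately show ?case by blast
  qed
  show "acyclic below" unfolding acyclic_def using tr sum_list_P_nonzero by fastforce
qed

lemma not_multiple:
  assumes "\<alpha> \<in> P" "\<beta> \<in> P" "\<beta> \<noteq> \<alpha>" shows "\<beta> \<noteq> wscale c \<alpha>"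
  using roots_proportional[OF P_roots[OF assms(1)] P_roots[OF assms(2)], of c] P_uminus[OF P_roots[OF assms(1)]] assms by auto

lemma string_down_P:
  assumes a: "\<alpha> \<in> simple_roots P" and b: "\<beta> \<in> P" and ne: "\<beta> \<noteq> \<alpha>" and m: "ip \<beta> \<alpha> = int m" and j: "j \<le> m"
  shows "\<beta> - wscale (of_nat j) \<alpha> \<in> P"
  using j
proof (induction j)
  case 0 then show ?case using b by simp
next
  case (Suc j)
  note aP = simple_P[OF a] and ar = P_roots[OF simple_P[OF a]] and br = P_roots[OF b]
  obtain e f where s: "sl2_triple \<alpha> e f (coroot h \<alpha>)" using coroot_sl2 ar by blast
  have "is_weight (\<beta> - wscale (of_nat (Suc j)) \<alpha>)"
    by (rule sl2_string_down[OF s _ _ Suc.prems]) (use br ip_of_int[OF ar br] m in \<open>auto simp: roots_iff\<close>)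
  moreover have "\<beta> - wscale (of_nat (Suc j)) \<alpha> \<noteq> 0" using not_multiple[OF aP b ne] by simp
  ultimately have r: "\<beta> - wscale (of_nat (Suc j)) \<alpha> \<in> roots h" by (simp add: roots_iff)
  show ?case
  proof (rule ccontr)
    assume n: "\<beta> - wscale (of_nat (Suc j)) \<alpha> \<notin> P"
    let ?b = "\<beta> - wscale (of_nat j) \<alpha>"
    have "- (\<beta> - wscale (of_nat (Suc j)) \<alpha>) \<in> P" using P_uminus[OF r] n by blast
    moreover have "\<alpha> = ?b + - (\<beta> - wscale (of_nat (Suc j)) \<alpha>)" by (rule ext) (simp add: algebra_simps)
    moreover have "?b \<in> P" by (rule Suc.IH[OF Suc_leD[OF Suc.prems]])
    ultimately show False using a unfolding simple_roots_def by blast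
  qed
qed

lemma string_up_P:
  assumes a: "\<alpha> \<in> P" and b: "\<beta> \<in> P" and ne: "\<beta> \<noteq> \<alpha>" and m: "ip \<beta> \<alpha> = - int m" and j: "j \<le> m"
  shows "\<beta> + wscale (of_nat j) \<alpha> \<in> P"
  using j
proof (induction j)
  case 0 then show ?case using b by simp
next
  case (Suc j)
  note ar = P_roots[OF a] and br = P_roots[OF b]
  obtain e f where s: "sl2_triple (- \<alpha>) e f (coroot h (- \<alpha>))" using coroot_sl2 uminus_roots[OF ar] by blast
  have wt: "is_weight (\<beta> - wscale (of_nat (Suc j)) (- \<alpha>))"
    by (rule sl2_string_down[OF s _ _ Suc.prems])
      (use br ip_of_int[OF uminus_roots[OF ar] br] ip_uminus_right[OF ar br] m in \<open>auto simp: roots_iff\<close>)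
  have "\<beta> \<noteq> wscale (- of_nat (Suc j)) \<alpha>" by (rule not_multiple[OF a b ne])
  moreover have "\<beta> - wscale (of_nat (Suc j)) (- \<alpha>) = \<beta> - wscale (- of_nat (Suc j)) \<alpha>"
    by (rule ext) (simp add: algebra_simps)
  ultimately have "\<beta> - wscale (of_nat (Suc j)) (- \<alpha>) \<noteq> 0" by (metis eq_iff_diff_eq_0)
  with wt have "\<beta> - wscale (of_nat (Suc j)) (- \<alpha>) \<in> roots h" by (simp add: roots_iff)
  moreover have "\<beta> - wscale (of_nat (Suc j)) (- \<alpha>) = \<beta> + wscale (of_nat j) \<alpha> + \<alpha>"
    by (rule ext) (simp add: algebra_simps)
  ultimately have "\<beta> + wscale (of_nat j) \<alpha> + \<alpha> \<in> roots h" by (simp only:)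
  then have "\<beta> + wscale (of_nat j) \<alpha> + \<alpha> \<in> P" by (rule P_add[OF Suc.IH[OF Suc_leD[OF Suc.prems]] a])
  moreover have "\<beta> + wscale (of_nat j) \<alpha> + \<alpha> = \<beta> + wscale (of_nat (Suc j)) \<alpha>"
    by (rule ext) (simp add: algebra_simps)
  ultimately show ?case by (simp only:)
qed

text \<open>The reflected root is reached along the root string in steps of
  \<open>\<alpha>\<close>. A step down cannot leave \<open>P\<close>, since otherwise
  \<open>\<alpha>\<close> would be a sum of two positive roots, and a step up cannot leave
  it because \<open>P\<close> is closed under sums that are roots.\<close>

lemma simple_reflection_P:
  assumes a: "\<alpha> \<in> simple_roots P" and b: "\<beta> \<in> P" and ne: "\<beta> \<noteq> \<alpha>"
  shows "sref \<alpha> \<beta> \<in> P"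
proof -
  note aP = simple_P[OF a] and ar = P_roots[OF simple_P[OF a]] and br = P_roots[OF b]
  show ?thesis
  proof (cases "ip \<beta> \<alpha> \<ge> 0")
    case True
    then have m: "ip \<beta> \<alpha> = int (nat (ip \<beta> \<alpha>))" by simp
    have "sref \<alpha> \<beta> = \<beta> - wscale (of_nat (nat (ip \<beta> \<alpha>))) \<alpha>"
      unfolding sref_def ip_of_int[OF ar br] using True by simp
    then show ?thesis using string_down_P[OF a b ne m order_refl] by (simp only:)
  next
    case False
    then have m: "ip \<beta> \<alpha> = - int (nat (- ip \<beta> \<alpha>))" by simp
    have "sref \<alpha> \<beta> = \<beta> + wscale (of_nat (nat (- ip \<beta> \<alpha>))) \<alpha>"
      unfolding sref_def ip_of_int[OF ar br] using False by (intro ext) simp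
    then show ?thesis using string_up_P[OF aP b ne m order_refl] by (simp only:)
  qed
qed

text \<open>Some summand in a decomposition of \<open>\<gamma>\<close> into simple roots has
  positive pairing.\<close>

lemma positive_pairing_simple:
  assumes g: "\<gamma> \<in> P" and b: "\<beta> \<in> roots h" and p: "ip \<gamma> \<beta> > 0"
  shows "\<exists>\<alpha>\<in>simple_roots P. ip \<alpha> \<beta> > 0"
  using wf_below g p
proof (induction \<gamma> rule: wf_induct_rule)
  case (less \<gamma>)
  show ?case
  proof (cases "\<gamma> \<in> simple_roots P")
    case False
    then obtain \<gamma>1 \<gamma>2 where g: "\<gamma>1 \<in> P" "\<gamma>2 \<in> P" "\<gamma> = \<gamma>1 + \<gamma>2" using less.prems by (auto simp: simple_roots_def)
    have "(of_int (ip \<gamma> \<beta>) :: complex) = of_int (ip \<gamma>1 \<beta> + ip \<gamma>2 \<beta>)"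
    proof -
      have "\<gamma> (coroot h \<beta>) = \<gamma>1 (coroot h \<beta>) + \<gamma>2 (coroot h \<beta>)" by (simp add: g(3))
      then show ?thesis
        unfolding ip_of_int[OF b P_roots[OF less.prems(1)]] ip_of_int[OF b P_roots[OF g(1)]] ip_of_int[OF b P_roots[OF g(2)]]
        by simp
    qed
    then have "ip \<gamma> \<beta> = ip \<gamma>1 \<beta> + ip \<gamma>2 \<beta>" by (simp only: of_int_eq_iff)
    then have "ip \<gamma>1 \<beta> > 0 \<or> ip \<gamma>2 \<beta> > 0" using less.prems by linarith
    moreover have "\<gamma> - \<gamma>1 = \<gamma>2" "\<gamma> - \<gamma>2 = \<gamma>1" by (simp_all add: g(3))
    then have "(\<gamma>1, \<gamma>) \<in> below" "(\<gamma>2, \<gamma>) \<in> below"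
      unfolding below_def using g(1,2) less.prems(1) by (simp_all only: mem_Collect_eq case_prod_conv simp_thms)
    ultimately show ?thesis using less.IH g by blast
  qed (use less.prems in blast)
qed

text \<open>Induction on positive roots that is adapted to coroots: a root that is not
  simple is made smaller by a simple reflection, and this subtracts a positive multiple of a
  simple coroot from its coroot.\<close>

lemma P_coroot_induct [consumes 1, case_names simple step]:
  assumes "\<beta> \<in> P"
    and S: "\<And>\<alpha>. \<alpha> \<in> simple_roots P \<Longrightarrow> Q \<alpha>"
    and St: "\<And>\<beta> \<beta>' \<alpha> k. \<beta> \<in> P \<Longrightarrow> \<beta>' \<in> P \<Longrightarrow> \<alpha> \<in> simple_roots P \<Longrightarrow> k > 0 \<Longrightarrow>
        coroot h \<beta> = coroot h \<beta>' + scaleC (of_nat k) (coroot h \<alpha>) \<Longrightarrow> Q \<beta>' \<Longrightarrow> Q \<beta>"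
  shows "Q \<beta>"
  using wf_trancl[OF wf_below] assms(1)
proof (induction \<beta> rule: wf_induct_rule)
  case (less \<beta>)
  note br = P_roots[OF less.prems]
  show ?case
  proof (cases "\<beta> \<in> simple_roots P")
    case False
    obtain \<alpha> where a: "\<alpha> \<in> simple_roots P" "ip \<alpha> \<beta> > 0"
      using positive_pairing_simple[OF less.prems br] ip_self[OF br] by auto
    note ar = P_roots[OF simple_P[OF a(1)]]
    have ne: "\<beta> \<noteq> \<alpha>" using a False by blast
    have p: "ip \<beta> \<alpha> > 0" using ip_pos_sym[OF ar br] a(2) by simp
    define m where "m = nat (ip \<beta> \<alpha>)"
    have m: "ip \<beta> \<alpha> = int m" "m > 0" using p by (simp_all add: m_def)
    \<comment> \<open>The reflected root differs from \<open>\<beta>\<close> by a multiple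
      of \<open>\<alpha>\<close>, which is in general not a root; it is below
      \<open>\<beta>\<close> by way of the other members of the string.\<close>
    have dn: "\<beta> - wscale (of_nat j) \<alpha> \<in> P" if "j \<le> m" for j by (rule string_down_P[OF a(1) less.prems ne m(1) that])
    have tr: "j \<le> m \<Longrightarrow> j > 0 \<Longrightarrow> (\<beta> - wscale (of_nat j) \<alpha>, \<beta>) \<in> below\<^sup>+" for j
    proof (induction j)
      case (Suc j)
      have "\<beta> - wscale (of_nat j) \<alpha> - (\<beta> - wscale (of_nat (Suc j)) \<alpha>) = \<alpha>"
        by (rule ext) (simp add: algebra_simps)
      then have st: "(\<beta> - wscale (of_nat (Suc j)) \<alpha>, \<beta> - wscale (of_nat j) \<alpha>) \<in> below"
        using dn[of j] dn[of "Suc j"] Suc.prems simple_P[OF a(1)] unfolding below_def by simp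
      show ?case
      proof (cases "j = 0")
        case True
        have "\<beta> - wscale (of_nat j) \<alpha> = \<beta>" using True by simp
        then show ?thesis using r_into_trancl[OF st] by (simp only:)
      next
        case False
        then have "(\<beta> - wscale (of_nat j) \<alpha>, \<beta>) \<in> below\<^sup>+" using Suc.IH[OF Suc_leD[OF Suc.prems(1)]] by blast
        with st show ?thesis by (rule trancl_into_trancl2)
      qed
    qed simp
    let ?b = "\<beta> - wscale (of_nat m) \<alpha>"
    have b': "?b = sref \<alpha> \<beta>" unfolding sref_def ip_of_int[OF ar br] using m by simp
    have "Q ?b" using less.IH tr[OF order_refl m(2)] dn[OF order_refl] by blast
    moreover have "coroot h \<beta> = coroot h ?b + scaleC (of_nat (nat (ip \<alpha> \<beta>))) (coroot h \<alpha>)"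
      unfolding b' coroot_sref[OF ar br] ip_of_int[OF br ar] using a(2) by simp
    moreover have "nat (ip \<alpha> \<beta>) > 0" using a(2) by simp
    ultimately show ?thesis using St[OF less.prems dn[OF order_refl] a(1)] by blast
  qed (use S in blast)
qed

text \<open>The sum of the positive roots takes the value 2 on every simple coroot, so it
  measures the height of coroots.\<close>

definition two_rho :: "'g weight" where "two_rho = (\<Sum>\<gamma>\<in>P. \<gamma>)"

lemma two_rho_dual: "two_rho \<in> dual_space h"
proof -
  have "finite A \<Longrightarrow> A \<subseteq> dual_space h \<Longrightarrow> (\<Sum>\<gamma>\<in>A. \<gamma>) \<in> dual_space h" for A :: "'g weight set"
    by (induction A rule: finite_induct) (simp_all add: dual_space_zero dual_space_add)
  then show ?thesis unfolding two_rho_def using finite_P P_roots root_dual by blast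
qed

lemma sum_fun_apply: "finite A \<Longrightarrow> (\<Sum>\<gamma>\<in>A. \<gamma>) t = (\<Sum>\<gamma>\<in>A. (\<gamma> :: 'g weight) t)"
  by (induction A rule: finite_induct) simp_all

lemma two_rho_simple:
  assumes a: "\<alpha> \<in> simple_roots P" shows "two_rho (coroot h \<alpha>) = 2"
proof -
  note aP = simple_P[OF a] and ar = P_roots[OF simple_P[OF a]]
  let ?s = "\<Sum>\<gamma>\<in>P - {\<alpha>}. \<gamma> (coroot h \<alpha>)"
  have inP: "sref \<alpha> \<gamma> \<in> P - {\<alpha>}" if "\<gamma> \<in> P - {\<alpha>}" for \<gamma>
  proof -
    have "sref \<alpha> \<gamma> \<noteq> \<alpha>"
    proof
      assume "sref \<alpha> \<gamma> = \<alpha>"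
      then have "\<gamma> = - \<alpha>" using sref_sref[OF ar, of \<gamma>] sref_self[OF ar] by simp
      then show False using that P_uminus[OF ar] aP by simp
    qed
    then show ?thesis using simple_reflection_P[OF a] that by simp
  qed
  have "?s = (\<Sum>\<gamma>\<in>P - {\<alpha>}. - \<gamma> (coroot h \<alpha>))"
    by (rule sum.reindex_bij_witness[where i = "sref \<alpha>" and j = "sref \<alpha>"])
      (use inP in \<open>simp_all add: sref_sref[OF ar] sref_apply root_coroot[OF ar]\<close>)
  then have "?s = 0" by (simp add: sum_negf)
  moreover have "two_rho (coroot h \<alpha>) = \<alpha> (coroot h \<alpha>) + ?s"
    unfolding two_rho_def using finite_P aP by (simp add: sum_fun_apply sum.remove)
  ultimately show ?thesis by (simp add: root_coroot[OF ar])
qed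

definition coheight :: "'g \<Rightarrow> real" where "coheight t = Re (two_rho t)"

lemma coheight_add: "s \<in> h \<Longrightarrow> t \<in> h \<Longrightarrow> coheight (s + t) = coheight s + coheight t"
  by (simp add: coheight_def dual_add two_rho_dual)
lemma coheight_nat: "t \<in> h \<Longrightarrow> coheight (scaleC (of_nat k) t) = real k * coheight t"
  by (simp add: coheight_def dual_scaleC two_rho_dual)
lemma coheight_minus: "t \<in> h \<Longrightarrow> coheight (- t) = - coheight t"
  by (simp add: coheight_def dual_space_uminus two_rho_dual)
lemma coheight_simple: "\<alpha> \<in> simple_roots P \<Longrightarrow> coheight (coroot h \<alpha>) = 2"
  by (simp add: coheight_def two_rho_simple)
lemma coheight_pos: "\<beta> \<in> P \<Longrightarrow> coheight (coroot h \<beta>) > 0"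
  by (induction rule: P_coroot_induct)
    (simp_all add: coheight_simple coheight_add coheight_nat coroot_h P_roots simple_P h_scaleC)

lemma coheight_pos_iff: "\<beta> \<in> roots h \<Longrightarrow> coheight (coroot h \<beta>) > 0 \<longleftrightarrow> \<beta> \<in> P"
  using coheight_pos[of \<beta>] coheight_pos[of "- \<beta>"] P_uminus[of \<beta>] coroot_minus[of \<beta>] coheight_minus[OF coroot_h, of \<beta>] by force

text \<open>The order on coroots in which highest coroots are maximal is the order defined
  by this cone.\<close>

definition coroot_cone :: "'g set" where
  "coroot_cone = {\<Sum>\<alpha>\<in>simple_roots P. scaleC (of_nat (c \<alpha>)) (coroot h \<alpha>) | c :: 'g weight \<Rightarrow> nat. True}"

lemma coroot_le_iff: "coroot_le h P \<beta> \<gamma> \<longleftrightarrow> coroot h \<gamma> - coroot h \<beta> \<in> coroot_cone"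
  unfolding coroot_le_def coroot_cone_def by (auto simp: diff_eq_eq add.commute)

lemma coroot_cone_add: "s \<in> coroot_cone \<Longrightarrow> t \<in> coroot_cone \<Longrightarrow> s + t \<in> coroot_cone"
proof -
  assume "s \<in> coroot_cone" "t \<in> coroot_cone"
  then obtain c d where "s = (\<Sum>\<alpha>\<in>simple_roots P. scaleC (of_nat (c \<alpha>)) (coroot h \<alpha>))"
    "t = (\<Sum>\<alpha>\<in>simple_roots P. scaleC (of_nat (d \<alpha>)) (coroot h \<alpha>))" by (auto simp: coroot_cone_def)
  then have "s + t = (\<Sum>\<alpha>\<in>simple_roots P. scaleC (of_nat (c \<alpha> + d \<alpha>)) (coroot h \<alpha>))"
    by (simp add: sum.distrib scaleC_add_left)
  then show ?thesis unfolding coroot_cone_def by (intro CollectI exI[of _ "\<lambda>\<alpha>. c \<alpha> + d \<alpha>"]) simp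
qed

lemma coroot_cone_simple: "\<alpha> \<in> simple_roots P \<Longrightarrow> scaleC (of_nat k) (coroot h \<alpha>) \<in> coroot_cone"
proof -
  assume a: "\<alpha> \<in> simple_roots P"
  have "(\<Sum>\<beta>\<in>simple_roots P. scaleC (of_nat (if \<beta> = \<alpha> then k else 0)) (coroot h \<beta>)) =
      (\<Sum>\<beta>\<in>simple_roots P. if \<beta> = \<alpha> then scaleC (of_nat k) (coroot h \<alpha>) else 0)"
    by (rule sum.cong) auto
  also have "\<dots> = scaleC (of_nat k) (coroot h \<alpha>)" using a finite_simple by simp
  finally show ?thesis unfolding coroot_cone_def by (intro CollectI exI[of _ "\<lambda>\<beta>. if \<beta> = \<alpha> then k else 0"]) simp
qed

lemma coroot_cone_0: "0 \<in> coroot_cone" unfolding coroot_cone_def by (intro CollectI exI[of _ "\<lambda>_. 0"]) simp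

lemma coroot_cone_coroot: "\<beta> \<in> P \<Longrightarrow> coroot h \<beta> \<in> coroot_cone"
proof (induction rule: P_coroot_induct)
  case (simple \<alpha>) then show ?case using coroot_cone_simple[of \<alpha> 1] by (simp add: scaleC_one)
next
  case (step \<beta> \<beta>' \<alpha> k) then show ?case using coroot_cone_add coroot_cone_simple by simp
qed

lemma coroot_cone_h: "t \<in> coroot_cone \<Longrightarrow> t \<in> h"
  unfolding coroot_cone_def
  by (auto intro!: complex_vector.subspace_sum[OF subspace_h] h_scaleC coroot_h P_roots simple_P)

lemma coroot_cone_coheight: "t \<in> coroot_cone \<Longrightarrow> coheight t \<ge> 0 \<and> (coheight t = 0 \<longrightarrow> t = 0)"
proof -
  assume "t \<in> coroot_cone"
  then obtain c where t: "t = (\<Sum>\<alpha>\<in>simple_roots P. scaleC (of_nat (c \<alpha>)) (coroot h \<alpha>))" by (auto simp: coroot_cone_def)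
  have "A \<subseteq> simple_roots P \<Longrightarrow> (\<Sum>\<alpha>\<in>A. scaleC (of_nat (c \<alpha>)) (coroot h \<alpha>)) \<in> h \<and>
     coheight (\<Sum>\<alpha>\<in>A. scaleC (of_nat (c \<alpha>)) (coroot h \<alpha>)) = (\<Sum>\<alpha>\<in>A. 2 * real (c \<alpha>))" if "finite A" for A
    using that
  proof (induction A rule: finite_induct)
    case empty
    have "two_rho 0 = 0" using dual_scaleC[OF two_rho_dual, of 0 0] complex_vector.subspace_0[OF subspace_h] by simp
    then show ?case using complex_vector.subspace_0[OF subspace_h] by (simp add: coheight_def)
  next
    case (insert \<alpha> A)
    then have "coroot h \<alpha> \<in> h" using coroot_h P_roots simple_P by blast
    then show ?case using insert by (simp add: coheight_add coheight_nat coheight_simple h_add h_scaleC)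
  qed
  from this[OF finite_simple order_refl] have e: "coheight t = (\<Sum>\<alpha>\<in>simple_roots P. 2 * real (c \<alpha>))" using t by simp
  have "t = 0" if "coheight t = 0"
  proof -
    have "\<forall>\<alpha>\<in>simple_roots P. 2 * real (c \<alpha>) = 0"
      using that e sum_nonneg_eq_0_iff[OF finite_simple, of "\<lambda>\<alpha>. 2 * real (c \<alpha>)"] by simp
    then show ?thesis unfolding t by simp
  qed
  moreover have "coheight t \<ge> 0" unfolding e by (rule sum_nonneg) simp
  ultimately show ?thesis by blast
qed

abbreviation hcr :: "'g weight set" where "hcr \<equiv> highest_coroot_roots h P"

lemma hcr_root: "\<theta> \<in> hcr \<Longrightarrow> \<theta> \<in> roots h" by (simp add: highest_coroot_roots_def)

lemma hcr_max:
  assumes t: "\<theta> \<in> hcr" and d: "\<delta> \<in> roots h" "coroot h \<delta> = coroot h \<theta> + s" and s: "s \<in> coroot_cone"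
  shows "s = 0"
proof -
  have "coroot_le h P \<theta> \<delta>" unfolding coroot_le_iff using d s by simp
  then have "\<delta> = \<theta>" using t d by (simp add: highest_coroot_roots_def)
  then show ?thesis using d by simp
qed

lemma coroot_nonzero: "\<beta> \<in> roots h \<Longrightarrow> coroot h \<beta> \<noteq> 0"
  using root_coroot[of \<beta>] dual_scaleC[OF root_dual, of \<beta> 0 0] complex_vector.subspace_0[OF subspace_h] by auto

text \<open>A coroot of maximal height among those above the given one.\<close>

lemma hcr_exists:
  assumes g: "\<gamma> \<in> roots h" shows "\<exists>\<theta>\<in>hcr. coroot h \<theta> - coroot h \<gamma> \<in> coroot_cone"
proof -
  let ?A = "{\<theta> \<in> roots h. coroot h \<theta> - coroot h \<gamma> \<in> coroot_cone}"
  have "finite ?A" "?A \<noteq> {}" using finite_roots g coroot_cone_0 by auto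
  then have "Max ((\<lambda>\<beta>. coheight (coroot h \<beta>)) ` ?A) \<in> (\<lambda>\<beta>. coheight (coroot h \<beta>)) ` ?A" by (intro Max_in) auto
  then obtain \<theta> where t: "\<theta> \<in> ?A" "coheight (coroot h \<theta>) = Max ((\<lambda>\<beta>. coheight (coroot h \<beta>)) ` ?A)" by auto
  have m: "coheight (coroot h \<beta>) \<le> coheight (coroot h \<theta>)" if "\<beta> \<in> ?A" for \<beta>
    unfolding t(2) by (rule Max_ge) (use \<open>finite ?A\<close> that in auto)
  have "\<beta> = \<theta>" if b: "\<beta> \<in> roots h" "coroot_le h P \<theta> \<beta>" for \<beta>
  proof -
    let ?s = "coroot h \<beta> - coroot h \<theta>"
    have s: "?s \<in> coroot_cone" using b by (simp add: coroot_le_iff)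
    have "coroot h \<beta> - coroot h \<gamma> = ?s + (coroot h \<theta> - coroot h \<gamma>)" by simp
    then have "coroot h \<beta> - coroot h \<gamma> \<in> coroot_cone" using coroot_cone_add[OF s, of "coroot h \<theta> - coroot h \<gamma>"] t by simp
    then have "\<beta> \<in> ?A" using b by blast
    then have "coheight (coroot h \<beta>) \<le> coheight (coroot h \<theta>)" by (rule m)
    moreover have "coheight (coroot h \<beta>) = coheight ?s + coheight (coroot h \<theta>)"
      using coheight_add[OF coroot_cone_h[OF s] coroot_h[of \<theta>]] t by simp
    ultimately have "?s = 0" using coroot_cone_coheight[OF s] by simp
    then show ?thesis using coroot_inj b t by simp
  qed
  then show ?thesis using t by (auto simp: highest_coroot_roots_def)
qed

lemma hcr_P: assumes t: "\<theta> \<in> hcr" shows "\<theta> \<in> P"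
proof (rule ccontr)
  note tr = hcr_root[OF t]
  assume "\<theta> \<notin> P"
  then have m: "- \<theta> \<in> P" using P_uminus[OF tr] by simp
  have "coroot h (- \<theta>) = coroot h \<theta> + (coroot h (- \<theta>) + coroot h (- \<theta>))" by (simp add: coroot_minus[OF tr])
  moreover have s: "coroot h (- \<theta>) + coroot h (- \<theta>) \<in> coroot_cone" using coroot_cone_add coroot_cone_coroot m by blast
  ultimately have "coroot h (- \<theta>) + coroot h (- \<theta>) = 0" using hcr_max[OF t uminus_roots[OF tr]] by blast
  then have "coheight (coroot h (- \<theta>)) + coheight (coroot h (- \<theta>)) = coheight 0"
    using coheight_add[OF coroot_h coroot_h, OF uminus_roots uminus_roots, OF tr tr] by simp
  moreover have "coheight 0 = 0" using coroot_cone_coheight[OF coroot_cone_0] coheight_nat[of 0 0] complex_vector.subspace_0[OF subspace_h] by simp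
  ultimately show False using coheight_pos[OF m] by simp
qed

text \<open>This is what makes the affine simple reflection permute the other positive
  affine roots. A negative pairing would make the sum of the coroots of
  \<open>\<theta>\<close> and \<open>\<beta>\<close> a coroot, and a pairing of 2 or more
  would make the negative of the reflected coroot exceed that of \<open>\<theta>\<close>;
  both contradict maximality.\<close>

lemma hcr_pairing:
  assumes t: "\<theta> \<in> hcr" and b: "\<beta> \<in> P" and ne: "\<beta> \<noteq> \<theta>"
  shows "ip \<theta> \<beta> = 0 \<or> (ip \<theta> \<beta> = 1 \<and> - sref \<theta> \<beta> \<in> P)"
proof -
  note tr = hcr_root[OF t] and br = P_roots[OF b]
  have "\<not> ip \<theta> \<beta> < 0"
  proof
    assume n: "ip \<theta> \<beta> < 0"
    have "\<theta> \<noteq> - \<beta>" using hcr_P[OF t] P_uminus[OF br] b by auto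
    then obtain \<delta> where d: "\<delta> \<in> roots h" "coroot h \<delta> = coroot h \<theta> - coroot h (- \<beta>)"
      using coroot_diff[OF tr uminus_roots[OF br]] ip_uminus_right[OF br tr] n by force
    then have "coroot h \<delta> = coroot h \<theta> + coroot h \<beta>" by (simp add: coroot_minus[OF br])
    then have "coroot h \<beta> = 0" using hcr_max[OF t d(1)] coroot_cone_coroot[OF b] by blast
    then show False using coroot_nonzero[OF br] by simp
  qed
  moreover have "ip \<theta> \<beta> = 1 \<and> - sref \<theta> \<beta> \<in> P" if p: "ip \<theta> \<beta> > 0"
  proof -
    obtain \<delta> where d: "\<delta> \<in> roots h" "coroot h \<delta> = coroot h \<theta> - coroot h \<beta>"
      using coroot_diff[OF tr br p] ne by blast
    have dP: "\<delta> \<in> P"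
    proof (rule ccontr)
      assume "\<delta> \<notin> P"
      then have "- \<delta> \<in> P" using P_uminus[OF d(1)] by simp
      moreover have "coroot h \<beta> = coroot h \<theta> + coroot h (- \<delta>)" using d(2) by (simp add: coroot_minus[OF d(1)])
      ultimately have "coroot h (- \<delta>) = 0" using hcr_max[OF t br] coroot_cone_coroot by blast
      then show False using coroot_nonzero[OF uminus_roots[OF d(1)]] by simp
    qed
    let ?e = "- sref \<theta> \<beta>"
    have er: "?e \<in> roots h" by (rule uminus_roots[OF sref_root[OF tr br]])
    define m where "m = nat (ip \<theta> \<beta> - 1)"
    have m: "ip \<theta> \<beta> = int m + 1" using p by (simp add: m_def)
    have "coroot h ?e = scaleC (of_int (ip \<theta> \<beta>)) (coroot h \<theta>) - coroot h \<beta>"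
      using coroot_minus[OF sref_root[OF tr br]] coroot_sref[OF tr br] ip_of_int[OF br tr] by simp
    also have "\<dots> = scaleC (of_nat m) (coroot h \<theta>) + coroot h \<delta>"
      unfolding m d(2) by (simp add: scaleC_add_left scaleC_one)
    finally have e: "coroot h ?e = scaleC (of_nat m) (coroot h \<theta>) + coroot h \<delta>" .
    have "m = 0"
    proof (rule ccontr)
      assume "m \<noteq> 0"
      then obtain k where k: "m = Suc k" by (cases m) auto
      have nt: "scaleC (of_nat j) (coroot h \<theta>) \<in> coroot_cone" for j
      proof (induction j)
        case 0 show ?case using coroot_cone_0 by simp
      next
        case (Suc j) then show ?case using coroot_cone_add[OF Suc coroot_cone_coroot[OF hcr_P[OF t]]]
          by (simp add: scaleC_add_left scaleC_one add.commute)
      qed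
      let ?s = "scaleC (of_nat k) (coroot h \<theta>) + coroot h \<delta>"
      have s: "?s \<in> coroot_cone" by (rule coroot_cone_add[OF nt coroot_cone_coroot[OF dP]])
      have "coroot h ?e = coroot h \<theta> + ?s" unfolding e k by (simp add: scaleC_add_left scaleC_one)
      then have "?s = 0" using hcr_max[OF t er _ s] by blast
      then have "coheight (scaleC (of_nat k) (coroot h \<theta>)) + coheight (coroot h \<delta>) = coheight 0"
        using coheight_add[OF coroot_cone_h[OF nt[of k]] coroot_h[OF d(1)]] by simp
      moreover have "coheight 0 = 0" using coheight_nat[of 0 0] complex_vector.subspace_0[OF subspace_h] by simp
      ultimately show False using coroot_cone_coheight[OF nt[of k]] coheight_pos[OF dP] by simp
    qed
    then have "ip \<theta> \<beta> = 1" "?e = \<delta>" using m e coroot_inj[OF er d(1)] by simp_all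
    then show ?thesis using dP by simp
  qed
  ultimately show ?thesis by linarith
qed

end


section \<open>The affine Weyl group acting on affine roots\<close>

text \<open>Nonnegativity for the lexicographic order on pairs. An affine root is positive
  if its level is positive or if the level is zero and the finite part is positive, and this
  order encodes both conditions at once.\<close>

definition lex_nonneg :: "real \<Rightarrow> real \<Rightarrow> bool" where "lex_nonneg x y \<longleftrightarrow> x > 0 \<or> (x = 0 \<and> y \<ge> 0)"

lemma lex_nonneg_add: "lex_nonneg x y \<Longrightarrow> lex_nonneg x' y' \<Longrightarrow> lex_nonneg (x + x') (y + y')" by (auto simp: lex_nonneg_def)
lemma lex_nonneg_nat: "lex_nonneg x y \<Longrightarrow> lex_nonneg (real n * x) (real n * y)"
  by (cases "n = 0") (auto simp: lex_nonneg_def)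
lemma lex_nonneg_left: "x \<ge> 0 \<Longrightarrow> lex_nonneg x 0" by (auto simp: lex_nonneg_def)

context triangular_decomposition
begin

abbreviation D :: "'g weight set" where "D \<equiv> dual_space h"
abbreviation B :: "('g weight \<Rightarrow> 'g weight) monoid" where "B \<equiv> BijGroup D"
abbreviation W :: "('g weight \<Rightarrow> 'g weight) monoid" where "W \<equiv> affine_weyl h"
abbreviation Wf :: "('g weight \<Rightarrow> 'g weight) set" where "Wf \<equiv> finite_weyl h"
abbreviation Q :: "'g weight set" where "Q \<equiv> group_closure (roots h)"

lemma B_carrier: "carrier B = Bij D" by (simp add: BijGroup_def)
lemma B_mult: "f \<in> Bij D \<Longrightarrow> g \<in> Bij D \<Longrightarrow> \<phi> \<in> D \<Longrightarrow> (f \<otimes>\<^bsub>B\<^esub> g) \<phi> = f (g \<phi>)"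
  by (simp add: BijGroup_def compose_def)
lemma B_mult_closed: "f \<in> Bij D \<Longrightarrow> g \<in> Bij D \<Longrightarrow> f \<otimes>\<^bsub>B\<^esub> g \<in> Bij D"
  by (simp add: BijGroup_def compose_Bij)
lemma B_one: "\<one>\<^bsub>B\<^esub> = (\<lambda>\<phi>\<in>D. \<phi>)" by (simp add: BijGroup_def)
lemma Bij_D: "f \<in> Bij D \<Longrightarrow> \<phi> \<in> D \<Longrightarrow> f \<phi> \<in> D" using Bij_imp_funcset by blast
lemma Bij_eqI: "f \<in> Bij D \<Longrightarrow> g \<in> Bij D \<Longrightarrow> (\<And>\<phi>. \<phi> \<in> D \<Longrightarrow> f \<phi> = g \<phi>) \<Longrightarrow> f = g"
  by (rule extensionalityI[of _ D]) (auto simp: Bij_def)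
lemma involution_Bij:
  assumes "\<And>\<phi>. \<phi> \<in> D \<Longrightarrow> f \<phi> \<in> D" "\<And>\<phi>. \<phi> \<in> D \<Longrightarrow> g \<phi> \<in> D" "\<And>\<phi>. \<phi> \<in> D \<Longrightarrow> f (g \<phi>) = \<phi>" "\<And>\<phi>. \<phi> \<in> D \<Longrightarrow> g (f \<phi>) = \<phi>"
  shows "restrict f D \<in> Bij D"
proof -
  have "bij_betw f D D" by (rule bij_betw_byWitness[where f' = g]) (use assms in auto)
  then have "bij_betw (restrict f D) D D" by (simp add: bij_betw_cong[of D "restrict f D" f])
  then show ?thesis by (simp add: Bij_def)
qed

lemma sref_D: "\<alpha> \<in> roots h \<Longrightarrow> \<phi> \<in> D \<Longrightarrow> sref \<alpha> \<phi> \<in> D"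
  unfolding sref_def by (rule dual_space_diff[OF _ dual_space_scale[OF root_dual]])

lemma reflection_eq: "reflection h \<alpha> = restrict (sref \<alpha>) D"
  unfolding reflection_def by (rule restrict_ext) (simp only: sref_def wscale_def)
lemma reflection_apply: "\<phi> \<in> D \<Longrightarrow> reflection h \<alpha> \<phi> = sref \<alpha> \<phi>" by (simp add: reflection_eq)
lemma reflection_Bij: "\<alpha> \<in> roots h \<Longrightarrow> reflection h \<alpha> \<in> Bij D"
  unfolding reflection_eq by (rule involution_Bij[where g = "sref \<alpha>"]) (simp_all add: sref_D sref_sref)
lemma reflection_sq: "\<alpha> \<in> roots h \<Longrightarrow> reflection h \<alpha> \<otimes>\<^bsub>B\<^esub> reflection h \<alpha> = \<one>\<^bsub>B\<^esub>"
  by (rule Bij_eqI) (simp_all add: B_mult_closed reflection_Bij B_mult reflection_apply sref_D sref_sref B_one id_Bij)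
lemma inv_reflection: "\<alpha> \<in> roots h \<Longrightarrow> inv\<^bsub>B\<^esub> (reflection h \<alpha>) = reflection h \<alpha>"
  by (rule group.inv_equality[OF group_BijGroup]) (simp_all add: reflection_sq B_carrier reflection_Bij)

lemma Wf_subgroup: "subgroup Wf B"
  unfolding finite_weyl_def
  by (rule group.generate_is_subgroup[OF group_BijGroup]) (auto simp: B_carrier reflection_Bij)

text \<open>The properties of the elements of the finite Weyl group used later. They are
  bundled so that one induction over the generating reflections proves them all.\<close>

definition lin_aut :: "('g weight \<Rightarrow> 'g weight) \<Rightarrow> bool" where
  "lin_aut u \<longleftrightarrow> u \<in> Bij D \<and> (\<forall>\<phi>\<in>D. \<forall>\<psi>\<in>D. u (\<phi> + \<psi>) = u \<phi> + u \<psi>) \<and>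
    (\<forall>c. \<forall>\<phi>\<in>D. u (wscale c \<phi>) = wscale c (u \<phi>)) \<and> (\<forall>\<beta>\<in>roots h. u \<beta> \<in> roots h) \<and>
    (\<forall>\<phi>\<in>D. \<forall>\<beta>\<in>roots h. (u \<phi>) (coroot h (u \<beta>)) = \<phi> (coroot h \<beta>))"

lemma lin_aut_reflection: assumes a: "\<alpha> \<in> roots h" shows "lin_aut (reflection h \<alpha>)"
  unfolding lin_aut_def
proof (intro conjI ballI allI)
  show "reflection h \<alpha> \<in> Bij D" by (rule reflection_Bij[OF a])
  fix \<phi> \<psi> assume d: "\<phi> \<in> D" "\<psi> \<in> D"
  show "reflection h \<alpha> (\<phi> + \<psi>) = reflection h \<alpha> \<phi> + reflection h \<alpha> \<psi>"
    unfolding reflection_apply[OF d(1)] reflection_apply[OF d(2)] reflection_apply[OF dual_space_add[OF d]]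
    by (rule ext) (simp add: sref_apply algebra_simps)
next
  fix c \<phi> assume d: "\<phi> \<in> D"
  show "reflection h \<alpha> (wscale c \<phi>) = wscale c (reflection h \<alpha> \<phi>)"
    unfolding reflection_apply[OF d] reflection_apply[OF dual_space_scale[OF d]]
    by (rule ext) (simp add: sref_apply algebra_simps)
next
  fix \<beta> assume b: "\<beta> \<in> roots h"
  show "reflection h \<alpha> \<beta> \<in> roots h" unfolding reflection_apply[OF root_dual[OF b]] by (rule sref_root[OF a b])
  fix \<phi> assume d: "\<phi> \<in> D"
  show "reflection h \<alpha> \<phi> (coroot h (reflection h \<alpha> \<beta>)) = \<phi> (coroot h \<beta>)"
    unfolding reflection_apply[OF d] reflection_apply[OF root_dual[OF b]] pairing_sref[OF a b sref_D[OF a d]] sref_sref[OF a] ..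
qed

lemma lin_aut_mult:
  assumes u: "lin_aut u" and u': "lin_aut u'" shows "lin_aut (u \<otimes>\<^bsub>B\<^esub> u')"
proof -
  have b: "u \<in> Bij D" "u' \<in> Bij D" using u u' unfolding lin_aut_def by blast+
  have ev: "(u \<otimes>\<^bsub>B\<^esub> u') \<phi> = u (u' \<phi>)" if "\<phi> \<in> D" for \<phi> by (rule B_mult[OF b that])
  have d: "u' \<phi> \<in> D" if "\<phi> \<in> D" for \<phi> by (rule Bij_D[OF b(2) that])
  show ?thesis unfolding lin_aut_def
  proof (intro conjI ballI allI)
    show "u \<otimes>\<^bsub>B\<^esub> u' \<in> Bij D" by (rule B_mult_closed[OF b])
    fix \<phi> \<psi> assume pd: "\<phi> \<in> D" "\<psi> \<in> D"
    show "(u \<otimes>\<^bsub>B\<^esub> u') (\<phi> + \<psi>) = (u \<otimes>\<^bsub>B\<^esub> u') \<phi> + (u \<otimes>\<^bsub>B\<^esub> u') \<psi>"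
      unfolding ev[OF pd(1)] ev[OF pd(2)] ev[OF dual_space_add[OF pd]]
      using u u' pd d[OF pd(1)] d[OF pd(2)] unfolding lin_aut_def by metis
  next
    fix c \<phi> assume pd: "\<phi> \<in> D"
    show "(u \<otimes>\<^bsub>B\<^esub> u') (wscale c \<phi>) = wscale c ((u \<otimes>\<^bsub>B\<^esub> u') \<phi>)"
      unfolding ev[OF pd] ev[OF dual_space_scale[OF pd]]
      using u u' pd d[OF pd] unfolding lin_aut_def by metis
  next
    fix \<beta> assume b: "\<beta> \<in> roots h"
    have b': "u' \<beta> \<in> roots h" using u' b unfolding lin_aut_def by blast
    show "(u \<otimes>\<^bsub>B\<^esub> u') \<beta> \<in> roots h" unfolding ev[OF root_dual[OF b]] using u b' unfolding lin_aut_def by blast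
    fix \<phi> assume pd: "\<phi> \<in> D"
    show "(u \<otimes>\<^bsub>B\<^esub> u') \<phi> (coroot h ((u \<otimes>\<^bsub>B\<^esub> u') \<beta>)) = \<phi> (coroot h \<beta>)"
      unfolding ev[OF pd] ev[OF root_dual[OF b]]
      using u u' b b' pd d[OF pd] unfolding lin_aut_def by metis
  qed
qed

lemma Wf_lin_aut: assumes "u \<in> Wf" shows "lin_aut u"
  using assms unfolding finite_weyl_def
proof (induction rule: generate.induct)
  case one
  show ?case unfolding lin_aut_def B_one
    by (simp add: id_Bij dual_space_add dual_space_scale root_dual)
next
  case (incl f) then show ?case using lin_aut_reflection by blast
next
  case (inv f) then show ?case using lin_aut_reflection inv_reflection by auto
next
  case (eng f g) then show ?case using lin_aut_mult by blast
qed

lemma Wf_Bij: "u \<in> Wf \<Longrightarrow> u \<in> Bij D" using Wf_lin_aut unfolding lin_aut_def by blast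
lemma Wf_D: "u \<in> Wf \<Longrightarrow> \<phi> \<in> D \<Longrightarrow> u \<phi> \<in> D" using Wf_Bij Bij_D by blast
lemma Wf_add: "u \<in> Wf \<Longrightarrow> \<phi> \<in> D \<Longrightarrow> \<psi> \<in> D \<Longrightarrow> u (\<phi> + \<psi>) = u \<phi> + u \<psi>"
  using Wf_lin_aut unfolding lin_aut_def by blast
lemma Wf_scale: "u \<in> Wf \<Longrightarrow> \<phi> \<in> D \<Longrightarrow> u (wscale c \<phi>) = wscale c (u \<phi>)"
  using Wf_lin_aut unfolding lin_aut_def by blast
lemma Wf_root: "u \<in> Wf \<Longrightarrow> \<beta> \<in> roots h \<Longrightarrow> u \<beta> \<in> roots h"
  using Wf_lin_aut unfolding lin_aut_def by blast
lemma Wf_pairing: "u \<in> Wf \<Longrightarrow> \<phi> \<in> D \<Longrightarrow> \<beta> \<in> roots h \<Longrightarrow> (u \<phi>) (coroot h (u \<beta>)) = \<phi> (coroot h \<beta>)"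
  using Wf_lin_aut unfolding lin_aut_def by blast
lemma Wf_zero: assumes "u \<in> Wf" shows "u 0 = 0"
  using Wf_scale[OF assms dual_space_zero, of 0] by simp
lemma Wf_minus: assumes u: "u \<in> Wf" and d: "\<phi> \<in> D" shows "u (- \<phi>) = - u \<phi>"
proof -
  have e: "- \<psi> = wscale (- 1) \<psi>" for \<psi> :: "'g weight" by (rule ext) simp
  show ?thesis unfolding e using Wf_scale[OF u d] .
qed
lemma Wf_diff: assumes u: "u \<in> Wf" and d: "\<phi> \<in> D" "\<psi> \<in> D" shows "u (\<phi> - \<psi>) = u \<phi> - u \<psi>"
  using Wf_add[OF u d(1) dual_space_minus[OF d(2)]] Wf_minus[OF u d(2)] by simp
lemma Wf_surj: assumes "u \<in> Wf" "\<phi> \<in> D" shows "\<exists>\<psi>\<in>D. u \<psi> = \<phi>"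
proof -
  have "u ` D = D" using Wf_Bij[OF assms(1)] by (simp add: Bij_def bij_betw_def)
  then have "\<phi> \<in> u ` D" using assms(2) by (simp only:)
  then show ?thesis by (elim imageE) metis
qed
lemma Wf_mult: "u \<in> Wf \<Longrightarrow> u' \<in> Wf \<Longrightarrow> u \<otimes>\<^bsub>B\<^esub> u' \<in> Wf" by (rule subgroup.m_closed[OF Wf_subgroup])
lemma Wf_one: "(\<lambda>\<phi>\<in>D. \<phi>) \<in> Wf" using subgroup.one_closed[OF Wf_subgroup] by (simp add: B_one)
lemma reflection_Wf: "\<alpha> \<in> roots h \<Longrightarrow> reflection h \<alpha> \<in> Wf"
  unfolding finite_weyl_def by (intro generate.incl) blast
lemma Wf_inverse: assumes u: "u \<in> Wf" shows "\<exists>u'\<in>Wf. \<forall>\<phi>\<in>D. u' (u \<phi>) = \<phi>"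
proof -
  have i: "inv\<^bsub>B\<^esub> u \<in> Wf" by (rule subgroup.m_inv_closed[OF Wf_subgroup u])
  have "inv\<^bsub>B\<^esub> u \<otimes>\<^bsub>B\<^esub> u = \<one>\<^bsub>B\<^esub>" using group.l_inv[OF group_BijGroup, of u D] Wf_Bij[OF u] by (simp add: B_carrier)
  then have "(inv\<^bsub>B\<^esub> u) (u \<phi>) = \<phi>" if "\<phi> \<in> D" for \<phi>
    using B_mult[OF Wf_Bij[OF i] Wf_Bij[OF u] that] that by (simp add: B_one)
  then show ?thesis using i by blast
qed

lemma Q_D: "\<mu> \<in> Q \<Longrightarrow> \<mu> \<in> D"
proof (induction rule: group_closure.induct)
  case (base s) then show ?case using root_dual dual_space_zero by blast
next
  case (diff s t) then show ?case by (intro dual_space_diff)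
qed
lemma Q_root: "\<beta> \<in> roots h \<Longrightarrow> \<beta> \<in> Q" by (rule group_closure.base) blast
lemma Wf_Q: assumes u: "u \<in> Wf" shows "\<mu> \<in> Q \<Longrightarrow> u \<mu> \<in> Q"
proof (induction rule: group_closure.induct)
  case (base s)
  then show ?case using Wf_zero[OF u] Wf_root[OF u] Q_root zero_in_group_closure by (metis insert_iff)
next
  case (diff s t)
  then show ?case unfolding Wf_diff[OF u Q_D[OF diff.hyps(1)] Q_D[OF diff.hyps(2)]] by (intro group_closure.diff)
qed
lemma Q_scale_int: assumes b: "\<beta> \<in> Q" shows "wscale (of_int k) \<beta> \<in> Q"
proof -
  have n: "wscale (of_nat n) \<beta> \<in> Q" for n
  proof (induction n)
    case 0
    have "wscale (of_nat 0) \<beta> = 0" by simp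
    then show ?case by (simp only: zero_in_group_closure)
  next
    case (Suc n)
    have "wscale (of_nat (Suc n)) \<beta> = wscale (of_nat n) \<beta> + \<beta>" by (rule ext) (simp add: algebra_simps)
    then show ?case using group_closure_add[OF Suc b] by (simp only:)
  qed
  show ?thesis
  proof (cases "k \<ge> 0")
    case True then show ?thesis using n[of "nat k"] by simp
  next
    case False
    then have "wscale (of_int k) \<beta> = - wscale (of_nat (nat (- k))) \<beta>" by (intro ext) simp
    then show ?thesis using n[of "nat (- k)"] by (simp only: group_closure_minus_iff)
  qed
qed

lemma ip_Q:
  assumes "\<mu> \<in> Q" and b: "\<beta> \<in> roots h" shows "\<mu> (coroot h \<beta>) = of_int (ip \<mu> \<beta>)"
proof -
  have "\<exists>n::int. \<mu> (coroot h \<beta>) = of_int n"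
    using assms(1)
  proof (induction rule: group_closure.induct)
    case (base s)
    show ?case
    proof (cases "s = 0")
      case True then show ?thesis by (intro exI[of _ 0]) simp
    next
      case False then show ?thesis using base pairing_int[OF b] by blast
    qed
  next
    case (diff s t)
    then obtain m n where "s (coroot h \<beta>) = of_int m" "t (coroot h \<beta>) = of_int n" by blast
    then show ?case by (intro exI[of _ "m - n"]) simp
  qed
  then show ?thesis by (auto simp: ip_def)
qed

lemma ip_eqI: "of_int n = \<mu> (coroot h \<beta>) \<Longrightarrow> ip \<mu> \<beta> = n"
  unfolding ip_def by (metis Re_complex_of_real floor_of_int of_real_of_int_eq)

lemma translation_apply: "\<phi> \<in> D \<Longrightarrow> translation h \<mu> \<phi> = \<phi> + \<mu>" by (simp add: translation_def)
lemma translation_Bij: "\<mu> \<in> D \<Longrightarrow> translation h \<mu> \<in> Bij D"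
  unfolding translation_def
  by (rule involution_Bij[where g = "\<lambda>\<phi>. \<phi> - \<mu>"]) (auto intro: dual_space_add dual_space_diff)

text \<open>The general element of the affine Weyl group: first \<open>u\<close>, then
  translation by \<open>\<mu>\<close>.\<close>

definition aff :: "'g weight \<Rightarrow> ('g weight \<Rightarrow> 'g weight) \<Rightarrow> 'g weight \<Rightarrow> 'g weight" where
  "aff \<mu> u = compose D (translation h \<mu>) u"

lemma aff_apply: "u \<in> Wf \<Longrightarrow> \<phi> \<in> D \<Longrightarrow> aff \<mu> u \<phi> = u \<phi> + \<mu>"
  by (simp add: aff_def compose_def translation_apply Wf_D)
lemma aff_Bij: "\<mu> \<in> Q \<Longrightarrow> u \<in> Wf \<Longrightarrow> aff \<mu> u \<in> Bij D"
  unfolding aff_def by (intro compose_Bij translation_Bij Q_D Wf_Bij)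
lemma W_carrier: "carrier W = {aff \<mu> u | \<mu> u. \<mu> \<in> Q \<and> u \<in> Wf}"
  by (simp add: affine_weyl_def aff_def)
lemma W_mult: "w \<otimes>\<^bsub>W\<^esub> w' = w \<otimes>\<^bsub>B\<^esub> w'" by (simp add: affine_weyl_def)
lemma W_one: "\<one>\<^bsub>W\<^esub> = (\<lambda>\<phi>\<in>D. \<phi>)" by (simp add: affine_weyl_def B_one)
lemma aff_W: "\<mu> \<in> Q \<Longrightarrow> u \<in> Wf \<Longrightarrow> aff \<mu> u \<in> carrier W" unfolding W_carrier by blast
lemma W_Bij: "w \<in> carrier W \<Longrightarrow> w \<in> Bij D" unfolding W_carrier using aff_Bij by blast
lemma W_D: "w \<in> carrier W \<Longrightarrow> \<phi> \<in> D \<Longrightarrow> w \<phi> \<in> D" using W_Bij Bij_D by blast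
lemma W_mult_apply: "w \<in> carrier W \<Longrightarrow> w' \<in> carrier W \<Longrightarrow> \<phi> \<in> D \<Longrightarrow> (w \<otimes>\<^bsub>W\<^esub> w') \<phi> = w (w' \<phi>)"
  unfolding W_mult by (rule B_mult[OF W_Bij W_Bij])

lemma aff_mult:
  assumes m: "\<mu> \<in> Q" "\<nu> \<in> Q" and u: "u \<in> Wf" "u' \<in> Wf"
  shows "aff \<mu> u \<otimes>\<^bsub>B\<^esub> aff \<nu> u' = aff (u \<nu> + \<mu>) (u \<otimes>\<^bsub>B\<^esub> u')"
proof (rule Bij_eqI)
  note q = group_closure_add[OF Wf_Q[OF u(1) m(2)] m(1)]
  show "aff \<mu> u \<otimes>\<^bsub>B\<^esub> aff \<nu> u' \<in> Bij D" by (intro B_mult_closed aff_Bij m u)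
  show "aff (u \<nu> + \<mu>) (u \<otimes>\<^bsub>B\<^esub> u') \<in> Bij D" by (intro aff_Bij q Wf_mult u)
  fix \<phi> assume d: "\<phi> \<in> D"
  have "(aff \<mu> u \<otimes>\<^bsub>B\<^esub> aff \<nu> u') \<phi> = u (u' \<phi> + \<nu>) + \<mu>"
    unfolding B_mult[OF aff_Bij[OF m(1) u(1)] aff_Bij[OF m(2) u(2)] d] aff_apply[OF u(2) d]
      aff_apply[OF u(1) dual_space_add[OF Wf_D[OF u(2) d] Q_D[OF m(2)]]] ..
  also have "\<dots> = aff (u \<nu> + \<mu>) (u \<otimes>\<^bsub>B\<^esub> u') \<phi>"
    unfolding aff_apply[OF Wf_mult[OF u] d] B_mult[OF Wf_Bij Wf_Bij, OF u d] Wf_add[OF u(1) Wf_D[OF u(2) d] Q_D[OF m(2)]]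
    by (simp only: add.assoc)
  finally show "(aff \<mu> u \<otimes>\<^bsub>B\<^esub> aff \<nu> u') \<phi> = aff (u \<nu> + \<mu>) (u \<otimes>\<^bsub>B\<^esub> u') \<phi>" .
qed

lemma aff_0: assumes u: "u \<in> Wf" shows "aff 0 u = u"
proof (rule Bij_eqI)
  show "aff 0 u \<in> Bij D" by (intro aff_Bij u) simp
  show "u \<in> Bij D" by (rule Wf_Bij[OF u])
qed (simp add: aff_apply[OF u])

lemma Wf_W: "u \<in> Wf \<Longrightarrow> u \<in> carrier W"
  using aff_W[of 0 u] by (simp add: aff_0)

lemma group_W: "group W"
proof (rule groupI)
  show "\<one>\<^bsub>W\<^esub> \<in> carrier W" unfolding W_one by (rule Wf_W[OF Wf_one])
  show cl: "x \<otimes>\<^bsub>W\<^esub> y \<in> carrier W" if xy: "x \<in> carrier W" "y \<in> carrier W" for x y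
  proof -
    obtain \<mu> u \<nu> u' where e: "x = aff \<mu> u" "y = aff \<nu> u'" and m: "\<mu> \<in> Q" "u \<in> Wf" "\<nu> \<in> Q" "u' \<in> Wf"
      using xy unfolding W_carrier by blast
    show ?thesis unfolding e W_mult aff_mult[OF m(1,3,2,4)]
      by (rule aff_W[OF group_closure_add[OF Wf_Q[OF m(2,3)] m(1)] Wf_mult[OF m(2,4)]])
  qed
  show "x \<otimes>\<^bsub>W\<^esub> y \<otimes>\<^bsub>W\<^esub> z = x \<otimes>\<^bsub>W\<^esub> (y \<otimes>\<^bsub>W\<^esub> z)" if "x \<in> carrier W" "y \<in> carrier W" "z \<in> carrier W" for x y z
    unfolding W_mult
    by (rule monoid.m_assoc[OF group.is_monoid[OF group_BijGroup]]) (simp_all only: B_carrier W_Bij that)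
  show "\<one>\<^bsub>W\<^esub> \<otimes>\<^bsub>W\<^esub> x = x" if "x \<in> carrier W" for x
    unfolding W_mult W_one B_one[symmetric]
    by (rule monoid.l_one[OF group.is_monoid[OF group_BijGroup]]) (simp only: B_carrier W_Bij that)
  show "\<exists>y\<in>carrier W. y \<otimes>\<^bsub>W\<^esub> x = \<one>\<^bsub>W\<^esub>" if xw: "x \<in> carrier W" for x
  proof -
    obtain \<mu> u where e: "x = aff \<mu> u" and m: "\<mu> \<in> Q" "u \<in> Wf" using xw unfolding W_carrier by blast
    obtain u' where u': "u' \<in> Wf" "\<And>\<phi>. \<phi> \<in> D \<Longrightarrow> u' (u \<phi>) = \<phi>" using Wf_inverse[OF m(2)] by blast
    have q: "- u' \<mu> \<in> Q" using Wf_Q[OF u'(1) m(1)] by simp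
    have "u' \<otimes>\<^bsub>B\<^esub> u = (\<lambda>\<phi>\<in>D. \<phi>)"
      by (rule Bij_eqI) (simp_all add: B_mult_closed Wf_Bij u' m id_Bij B_mult)
    then have "aff (- u' \<mu>) u' \<otimes>\<^bsub>W\<^esub> x = aff 0 (\<lambda>\<phi>\<in>D. \<phi>)"
      unfolding e W_mult aff_mult[OF q m(1) u'(1) m(2)] by simp
    then show ?thesis using aff_W[OF q u'(1)] unfolding W_one aff_0[OF Wf_one] by blast
  qed
qed

text \<open>The projection of the affine group onto the finite one, recovered from the map
  alone.\<close>

definition linp :: "('g weight \<Rightarrow> 'g weight) \<Rightarrow> 'g weight \<Rightarrow> 'g weight" where
  "linp w = (\<lambda>\<phi>\<in>D. w \<phi> - w 0)"

lemma linp_aff: assumes m: "\<mu> \<in> Q" and u: "u \<in> Wf" shows "linp (aff \<mu> u) = u" and "aff \<mu> u 0 = \<mu>"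
proof -
  show 0: "aff \<mu> u 0 = \<mu>" using aff_apply[OF u dual_space_zero] Wf_zero[OF u] by simp
  show "linp (aff \<mu> u) = u"
  proof (rule extensionalityI[of _ D])
    show "u \<in> extensional D" using Wf_Bij[OF u] by (simp add: Bij_def)
    fix \<phi> assume "\<phi> \<in> D"
    then show "linp (aff \<mu> u) \<phi> = u \<phi>" unfolding linp_def 0 by (simp add: aff_apply[OF u])
  qed (simp add: linp_def)
qed

lemma linp_Wf: "w \<in> carrier W \<Longrightarrow> linp w \<in> Wf" unfolding W_carrier using linp_aff by auto
lemma W_zero_Q: "w \<in> carrier W \<Longrightarrow> w 0 \<in> Q" unfolding W_carrier using linp_aff by auto
lemma W_apply: "w \<in> carrier W \<Longrightarrow> \<phi> \<in> D \<Longrightarrow> w \<phi> = linp w \<phi> + w 0" by (simp add: linp_def)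
lemma linp_of_Wf: "u \<in> Wf \<Longrightarrow> linp u = u" using linp_aff(1)[of 0 u] aff_0 by simp

lemma linp_mult:
  assumes w: "w \<in> carrier W" "w' \<in> carrier W" shows "linp (w \<otimes>\<^bsub>W\<^esub> w') = linp w \<otimes>\<^bsub>W\<^esub> linp w'"
proof -
  obtain \<mu> u \<nu> u' where e: "w = aff \<mu> u" "w' = aff \<nu> u'" and m: "\<mu> \<in> Q" "u \<in> Wf" "\<nu> \<in> Q" "u' \<in> Wf"
    using w unfolding W_carrier by blast
  show ?thesis unfolding e W_mult aff_mult[OF m(1,3,2,4)] linp_aff(1)[OF m(1,2)] linp_aff(1)[OF m(3,4)]
    by (rule linp_aff(1)[OF group_closure_add[OF Wf_Q[OF m(2,3)] m(1)] Wf_mult[OF m(2,4)]])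
qed

text \<open>The pair \<open>(\<beta>, k)\<close> stands for the affine function that sends
  \<open>\<phi>\<close> to \<open>\<phi> (coroot h \<beta>) + k\<close>. The definitions
  below express how the affine group acts on these functions; \<open>asimple\<close>
  consists of the walls of the fundamental alcove.\<close>

type_synonym (in -) 'a aroot = "'a weight \<times> int"

definition aact :: "('g weight \<Rightarrow> 'g weight) \<Rightarrow> 'g aroot \<Rightarrow> 'g aroot" where
  "aact w a = (linp w (fst a), snd a - ip (w 0) (linp w (fst a)))"
definition aneg :: "'g aroot \<Rightarrow> 'g aroot" where "aneg a = (- fst a, - snd a)"
definition arefl :: "'g aroot \<Rightarrow> 'g weight \<Rightarrow> 'g weight" where
  "arefl a = (\<lambda>\<phi>\<in>D. \<phi> - wscale (\<phi> (coroot h (fst a)) + of_int (snd a)) (fst a))"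
definition aroots :: "'g aroot set" where "aroots = {(\<beta>, k). \<beta> \<in> roots h}"
definition apos :: "'g aroot set" where "apos = {(\<beta>, k). \<beta> \<in> roots h \<and> (k > 0 \<or> k = 0 \<and> \<beta> \<in> P)}"
definition asimple :: "'g aroot set" where
  "asimple = (\<lambda>\<alpha>. (\<alpha>, 0)) ` simple_roots P \<union> (\<lambda>\<theta>. (- \<theta>, 1)) ` hcr"
definition afin :: "'g aroot set" where "afin = {(\<beta>, k). \<beta> \<in> roots h \<and> k = 0}"

lemma aact_pair: "aact w (\<beta>, k) = (linp w \<beta>, k - ip (w 0) (linp w \<beta>))" by (simp add: aact_def)
lemma arefl_apply: "\<phi> \<in> D \<Longrightarrow> arefl (\<beta>, k) \<phi> = \<phi> - wscale (\<phi> (coroot h \<beta>) + of_int k) \<beta>"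
  by (simp add: arefl_def)

lemma arefl_aff:
  assumes b: "\<beta> \<in> roots h" shows "arefl (\<beta>, k) = aff (wscale (of_int (- k)) \<beta>) (reflection h \<beta>)"
proof (rule extensionalityI[of _ D])
  show "aff (wscale (of_int (- k)) \<beta>) (reflection h \<beta>) \<in> extensional D"
    using aff_Bij[OF Q_scale_int[OF Q_root[OF b]] reflection_Wf[OF b]] unfolding Bij_def by blast
  fix \<phi> assume d: "\<phi> \<in> D"
  show "arefl (\<beta>, k) \<phi> = aff (wscale (of_int (- k)) \<beta>) (reflection h \<beta>) \<phi>"
    unfolding arefl_apply[OF d] aff_apply[OF reflection_Wf[OF b] d] reflection_apply[OF d]
    by (rule ext) (simp add: sref_apply algebra_simps)
qed (simp add: arefl_def)

lemma arefl_W: "\<beta> \<in> roots h \<Longrightarrow> arefl (\<beta>, k) \<in> carrier W"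
  unfolding arefl_aff by (intro aff_W Q_scale_int Q_root reflection_Wf)
lemma linp_arefl: "\<beta> \<in> roots h \<Longrightarrow> linp (arefl (\<beta>, k)) = reflection h \<beta>"
  unfolding arefl_aff by (intro linp_aff Q_scale_int Q_root reflection_Wf)
lemma arefl_zero: "\<beta> \<in> roots h \<Longrightarrow> arefl (\<beta>, k) 0 = wscale (of_int (- k)) \<beta>"
  unfolding arefl_aff by (intro linp_aff Q_scale_int Q_root reflection_Wf)
lemma arefl_finite: "\<beta> \<in> roots h \<Longrightarrow> arefl (\<beta>, 0) = reflection h \<beta>"
  using arefl_aff[of \<beta> 0] aff_0[OF reflection_Wf] by simp

lemma aact_arefl:
  assumes t: "\<theta> \<in> roots h" and b: "\<beta> \<in> roots h"
  shows "aact (arefl (\<theta>, j)) (\<beta>, k) = (sref \<theta> \<beta>, k - j * ip \<theta> \<beta>)"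
proof -
  have "ip (wscale (of_int (- j)) \<theta>) (sref \<theta> \<beta>) = j * ip \<theta> \<beta>"
  proof (rule ip_eqI)
    have "wscale (of_int (- j)) \<theta> (coroot h (sref \<theta> \<beta>)) = of_int (- j) * (- \<theta>) (coroot h \<beta>)"
      unfolding wscale_apply pairing_sref[OF t b root_dual[OF t]] sref_self[OF t] ..
    then show "of_int (j * ip \<theta> \<beta>) = wscale (of_int (- j)) \<theta> (coroot h (sref \<theta> \<beta>))"
      using ip_of_int[OF b t] by simp
  qed
  then show ?thesis unfolding aact_pair linp_arefl[OF t] arefl_zero[OF t] reflection_apply[OF root_dual[OF b]] by simp
qed

lemma aact_mult:
  assumes w: "w \<in> carrier W" "w' \<in> carrier W" and b: "\<beta> \<in> roots h"
  shows "aact (w \<otimes>\<^bsub>W\<^esub> w') (\<beta>, k) = aact w (aact w' (\<beta>, k))"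
proof -
  note u = linp_Wf[OF w(1)] and u' = linp_Wf[OF w(2)]
  have b': "linp w' \<beta> \<in> roots h" and b'': "linp w (linp w' \<beta>) \<in> roots h" using Wf_root u u' b by blast+
  have l: "linp (w \<otimes>\<^bsub>W\<^esub> w') \<beta> = linp w (linp w' \<beta>)"
    unfolding linp_mult[OF w] by (rule W_mult_apply[OF Wf_W[OF u] Wf_W[OF u'] root_dual[OF b]])
  have z: "(w \<otimes>\<^bsub>W\<^esub> w') 0 = linp w (w' 0) + w 0"
    unfolding W_mult_apply[OF w dual_space_zero] by (rule W_apply[OF w(1) W_D[OF w(2) dual_space_zero]])
  have "ip ((w \<otimes>\<^bsub>W\<^esub> w') 0) (linp w (linp w' \<beta>)) = ip (w' 0) (linp w' \<beta>) + ip (w 0) (linp w (linp w' \<beta>))"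
  proof (rule ip_eqI)
    show "of_int (ip (w' 0) (linp w' \<beta>) + ip (w 0) (linp w (linp w' \<beta>))) = (w \<otimes>\<^bsub>W\<^esub> w') 0 (coroot h (linp w (linp w' \<beta>)))"
      unfolding z plus_fun_apply Wf_pairing[OF u Q_D[OF W_zero_Q[OF w(2)]] b']
        ip_Q[OF W_zero_Q[OF w(2)] b'] ip_Q[OF W_zero_Q[OF w(1)] b''] by simp
  qed
  then show ?thesis unfolding aact_pair l by simp
qed

text \<open>Real parts of complex-linear forms on \<open>h\<close> have these properties,
  and they determine the values on nonnegative integral combinations of coroots.\<close>

definition hlin :: "('g \<Rightarrow> real) \<Rightarrow> bool" where
  "hlin f \<longleftrightarrow> (\<forall>s\<in>h. \<forall>t\<in>h. f (s + t) = f s + f t) \<and> (\<forall>n. \<forall>t\<in>h. f (scaleC (of_nat n) t) = real n * f t)"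

lemma hlinD: assumes "hlin f"
  shows "s \<in> h \<Longrightarrow> t \<in> h \<Longrightarrow> f (s + t) = f s + f t" "t \<in> h \<Longrightarrow> f (scaleC (of_nat n) t) = real n * f t"
  using assms unfolding hlin_def by blast+

text \<open>The image of \<open>(\<beta>, k)\<close> has level \<open>k\<close> minus a
  linear function of the coroot of \<open>\<beta>\<close>, and its finite part is positive
  if the height of its coroot is. Pulling both functionals back along the linear part of
  \<open>w\<close> turns positivity of the image into a lexicographic condition that is
  additive in coroots, which makes it possible to test it on simple roots.\<close>

lemma aact_pos_lex:
  assumes w: "w \<in> carrier W"
  shows "\<exists>f1 f2. hlin f1 \<and> hlin f2 \<and>
    (\<forall>\<beta>\<in>roots h. \<forall>k. aact w (\<beta>, k) \<in> apos \<longleftrightarrow> lex_nonneg (of_int k + f1 (coroot h \<beta>)) (f2 (coroot h \<beta>))) \<and>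
    (\<forall>\<beta>\<in>roots h. linp w \<beta> \<in> P \<longleftrightarrow> f2 (coroot h \<beta>) > 0) \<and> (\<forall>\<beta>\<in>roots h. f2 (coroot h \<beta>) \<noteq> 0)"
proof -
  note u = linp_Wf[OF w]
  \<comment> \<open>Pulling back the translation part and the height functional along the
    linear part.\<close>
  obtain \<psi> where psi: "\<psi> \<in> D" "linp w \<psi> = w 0" using Wf_surj[OF u Q_D[OF W_zero_Q[OF w]]] by blast
  obtain \<rho> where rho: "\<rho> \<in> D" "linp w \<rho> = two_rho" using Wf_surj[OF u two_rho_dual] by blast
  let ?f1 = "\<lambda>t. - Re (\<psi> t)" and ?f2 = "\<lambda>t. Re (\<rho> t)"
  have f2: "?f2 (coroot h \<beta>) = coheight (coroot h (linp w \<beta>))" if b: "\<beta> \<in> roots h" for \<beta>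
    unfolding coheight_def using Wf_pairing[OF u rho(1) b] rho(2) by simp
  have pos: "linp w \<beta> \<in> P \<longleftrightarrow> ?f2 (coroot h \<beta>) > 0" if b: "\<beta> \<in> roots h" for \<beta>
    unfolding f2[OF b] using coheight_pos_iff[OF Wf_root[OF u b]] by simp
  have ne: "?f2 (coroot h \<beta>) \<noteq> 0" if b: "\<beta> \<in> roots h" for \<beta>
  proof -
    have m: "linp w (- \<beta>) = - linp w \<beta>" by (rule Wf_minus[OF u root_dual[OF b]])
    have "?f2 (coroot h (- \<beta>)) = - ?f2 (coroot h \<beta>)"
      unfolding coroot_minus[OF b] dual_space_uminus[OF rho(1)] by simp
    then show ?thesis using pos[OF b] pos[OF uminus_roots[OF b]] P_uminus[OF Wf_root[OF u b]] m by force
  qed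
  have ap: "aact w (\<beta>, k) \<in> apos \<longleftrightarrow> lex_nonneg (of_int k + ?f1 (coroot h \<beta>)) (?f2 (coroot h \<beta>))" if b: "\<beta> \<in> roots h" for \<beta> k
  proof -
    have "of_int (ip (w 0) (linp w \<beta>)) = (w 0) (coroot h (linp w \<beta>))" by (rule ip_Q[OF W_zero_Q[OF w] Wf_root[OF u b], symmetric])
    also have "\<dots> = \<psi> (coroot h \<beta>)" using Wf_pairing[OF u psi(1) b] psi(2) by simp
    finally have "Re (\<psi> (coroot h \<beta>)) = of_int (ip (w 0) (linp w \<beta>))" by (metis Re_complex_of_real of_real_of_int_eq)
    moreover have "(0 < x) = (0 < real_of_int x)" "(x = 0) = (real_of_int x = 0)" for x by simp_all
    ultimately show ?thesis
      unfolding aact_pair apos_def lex_nonneg_def using Wf_root[OF u b] pos[OF b] ne[OF b] by auto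
  qed
  have "hlin ?f1" "hlin ?f2" unfolding hlin_def
    by (simp_all add: dual_add[OF psi(1)] dual_add[OF rho(1)] dual_scaleC[OF psi(1)] dual_scaleC[OF rho(1)])
  then show ?thesis using ap pos ne by (intro exI[of _ ?f1] exI[of _ ?f2]) blast
qed

lemma lex_nonneg_cone:
  assumes l: "hlin f1" "hlin f2"
    and s: "\<And>\<alpha>. \<alpha> \<in> simple_roots P \<Longrightarrow> lex_nonneg (f1 (coroot h \<alpha>)) (f2 (coroot h \<alpha>))"
    and t: "t \<in> coroot_cone"
  shows "lex_nonneg (f1 t) (f2 t)"
proof -
  note f = hlinD(1)[OF l(1)] hlinD(1)[OF l(2)] hlinD(2)[OF l(1)] hlinD(2)[OF l(2)]
  obtain c where c: "t = (\<Sum>\<alpha>\<in>simple_roots P. scaleC (of_nat (c \<alpha>)) (coroot h \<alpha>))" using t by (auto simp: coroot_cone_def)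
  have h0: "0 \<in> h" by (rule complex_vector.subspace_0[OF subspace_h])
  have z: "f1 0 = 0" "f2 0 = 0" using f(3)[OF h0, of 0] f(4)[OF h0, of 0] by simp_all
  have "A \<subseteq> simple_roots P \<Longrightarrow> (\<Sum>\<alpha>\<in>A. scaleC (of_nat (c \<alpha>)) (coroot h \<alpha>)) \<in> h \<and>
     lex_nonneg (f1 (\<Sum>\<alpha>\<in>A. scaleC (of_nat (c \<alpha>)) (coroot h \<alpha>))) (f2 (\<Sum>\<alpha>\<in>A. scaleC (of_nat (c \<alpha>)) (coroot h \<alpha>)))" if "finite A" for A
    using that
  proof (induction A rule: finite_induct)
    case empty then show ?case using h0 z by (simp add: lex_nonneg_def)
  next
    case (insert \<alpha> A)
    have a: "\<alpha> \<in> simple_roots P" using insert.prems by blast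
    then have ch: "coroot h \<alpha> \<in> h" using coroot_h P_roots simple_P by blast
    have IH: "(\<Sum>\<alpha>\<in>A. scaleC (of_nat (c \<alpha>)) (coroot h \<alpha>)) \<in> h"
     "lex_nonneg (f1 (\<Sum>\<alpha>\<in>A. scaleC (of_nat (c \<alpha>)) (coroot h \<alpha>))) (f2 (\<Sum>\<alpha>\<in>A. scaleC (of_nat (c \<alpha>)) (coroot h \<alpha>)))"
      using insert by auto
    show ?case
      using insert.hyps h_add[OF h_scaleC[OF ch] IH(1)] lex_nonneg_add[OF lex_nonneg_nat[OF s[OF a]] IH(2)]
      by (simp add: f(1)[OF h_scaleC[OF ch] IH(1)] f(2)[OF h_scaleC[OF ch] IH(1)] f(3)[OF ch] f(4)[OF ch])
  qed
  from this[OF finite_simple order_refl] show ?thesis using c by simp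
qed

lemma affine_detect_finite:
  assumes w: "w \<in> carrier W" and b: "\<beta> \<in> P" and n: "aact w (\<beta>, 0) \<notin> apos"
  shows "\<exists>\<alpha>\<in>simple_roots P. aact w (\<alpha>, 0) \<notin> apos"
proof (rule ccontr)
  assume no: "\<not> ?thesis"
  obtain f1 f2 where l: "hlin f1" "hlin f2"
    and ap: "\<And>\<beta> k. \<beta> \<in> roots h \<Longrightarrow> aact w (\<beta>, k) \<in> apos \<longleftrightarrow> lex_nonneg (of_int k + f1 (coroot h \<beta>)) (f2 (coroot h \<beta>))"
    using aact_pos_lex[OF w] by blast
  have "lex_nonneg (f1 (coroot h \<alpha>)) (f2 (coroot h \<alpha>))" if "\<alpha> \<in> simple_roots P" for \<alpha>
    using no that ap[of \<alpha> 0] P_roots[OF simple_P[OF that]] by simp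
  then have "lex_nonneg (f1 (coroot h \<beta>)) (f2 (coroot h \<beta>))"
    by (rule lex_nonneg_cone[OF l _ coroot_cone_coroot[OF b]])
  then show False using n ap[OF P_roots[OF b], of 0] by simp
qed

text \<open>A positive affine root is a nonnegative combination of simple ones: if
  \<open>\<beta>\<close> is negative and \<open>k\<close> is at least 1, choose a highest
  coroot above that of \<open>- \<beta>\<close>; then \<open>(\<beta>, k)\<close> is the
  simple root \<open>(- \<theta>, 1)\<close>, plus simple coroots, plus a nonnegative
  level.\<close>

lemma affine_detect:
  assumes w: "w \<in> carrier W" and b: "b \<in> apos" and n: "aact w b \<notin> apos"
  shows "\<exists>a\<in>asimple. aact w a \<notin> apos"
proof (rule ccontr)
  assume no: "\<not> ?thesis"
  obtain f1 f2 where l: "hlin f1" "hlin f2"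
    and ap: "\<And>\<beta> k. \<beta> \<in> roots h \<Longrightarrow> aact w (\<beta>, k) \<in> apos \<longleftrightarrow> lex_nonneg (of_int k + f1 (coroot h \<beta>)) (f2 (coroot h \<beta>))"
    using aact_pos_lex[OF w] by blast
  obtain \<beta> k where bk: "b = (\<beta>, k)" "\<beta> \<in> roots h" "k > 0 \<or> k = 0 \<and> \<beta> \<in> P" using b by (auto simp: apos_def)
  have s: "lex_nonneg (f1 (coroot h \<alpha>)) (f2 (coroot h \<alpha>))" if a: "\<alpha> \<in> simple_roots P" for \<alpha>
  proof -
    have "(\<alpha>, 0) \<in> asimple" using a by (simp add: asimple_def)
    then show ?thesis using no ap[OF P_roots[OF simple_P[OF a]], of 0] by auto
  qed
  have "lex_nonneg (of_int k + f1 (coroot h \<beta>)) (f2 (coroot h \<beta>))"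
  proof (cases "\<beta> \<in> P")
    case True
    have "lex_nonneg (f1 (coroot h \<beta>)) (f2 (coroot h \<beta>))" by (rule lex_nonneg_cone[OF l s coroot_cone_coroot[OF True]])
    moreover have "lex_nonneg (of_int k) 0" using bk by (intro lex_nonneg_left) auto
    ultimately show ?thesis using lex_nonneg_add by force
  next
    case False
    then have k: "k \<ge> 1" using bk by auto
    let ?g = "- \<beta>"
    note gr = uminus_roots[OF bk(2)]
    obtain \<theta> where t: "\<theta> \<in> hcr" "coroot h \<theta> - coroot h ?g \<in> coroot_cone" using hcr_exists[OF gr] by blast
    note tr = hcr_root[OF t(1)]
    have th: "coroot h \<theta> \<in> h" "coroot h (- \<theta>) \<in> h" "coroot h \<beta> \<in> h" using coroot_h tr uminus_roots[OF tr] bk(2) by blast+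
    have "(- \<theta>, 1) \<in> asimple" using t by (simp add: asimple_def)
    then have 1: "lex_nonneg (1 + f1 (coroot h (- \<theta>))) (f2 (coroot h (- \<theta>)))" using no ap[OF uminus_roots[OF tr], of 1] by auto
    have 2: "lex_nonneg (f1 (coroot h \<theta> - coroot h ?g)) (f2 (coroot h \<theta> - coroot h ?g))"
      by (rule lex_nonneg_cone[OF l s t(2)])
    have 3: "lex_nonneg (of_int (k - 1)) 0" using k by (intro lex_nonneg_left) auto
    have e: "coroot h \<beta> = coroot h (- \<theta>) + (coroot h \<theta> - coroot h ?g)"
      by (simp add: coroot_minus[OF tr] coroot_minus[OF bk(2)])
    have f': "f1 (coroot h \<beta>) = f1 (coroot h (- \<theta>)) + f1 (coroot h \<theta> - coroot h ?g)"
      "f2 (coroot h \<beta>) = f2 (coroot h (- \<theta>)) + f2 (coroot h \<theta> - coroot h ?g)"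
      unfolding e by (rule hlinD(1)[OF l(1) th(2) coroot_cone_h[OF t(2)]], rule hlinD(1)[OF l(2) th(2) coroot_cone_h[OF t(2)]])
    show ?thesis using lex_nonneg_add[OF lex_nonneg_add[OF 1 2] 3] unfolding f' by (simp add: algebra_simps)
  qed
  then show False using n ap[OF bk(2), of k] bk(1) by simp
qed

lemma asimple_apos: "asimple \<subseteq> apos"
  by (auto simp: asimple_def apos_def simple_P P_roots hcr_root uminus_roots)

text \<open>For the affine reflection, the level of \<open>(\<beta>, k)\<close> changes by
  the pairing of \<open>\<theta>\<close> with \<open>\<beta>\<close>, which by
  \<open>hcr_pairing\<close> is at most 1 in absolute value except for
  \<open>\<beta>\<close> equal to \<open>\<theta>\<close> or its negative.\<close>

lemma asimple_perm:
  assumes a: "a \<in> asimple" and b: "b \<in> apos" and ne: "b \<noteq> a"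
  shows "aact (arefl a) b \<in> apos"
proof -
  obtain \<beta> k where bk: "b = (\<beta>, k)" and br: "\<beta> \<in> roots h" and k: "k > 0 \<or> k = 0 \<and> \<beta> \<in> P" using b by (auto simp: apos_def)
  from a consider \<alpha> where "\<alpha> \<in> simple_roots P" "a = (\<alpha>, 0)" | \<theta> where "\<theta> \<in> hcr" "a = (- \<theta>, 1)"
    unfolding asimple_def by blast
  then show ?thesis
  proof cases
    case 1
    note ar = P_roots[OF simple_P[OF 1(1)]]
    show ?thesis unfolding 1(2) bk aact_arefl[OF ar br] apos_def
      using sref_root[OF ar br] simple_reflection_P[OF 1(1)] k ne 1(2) bk by auto
  next
    case 2
    note tr = hcr_root[OF 2(1)] and tP = hcr_P[OF 2(1)]
    have sm: "sref (- \<theta>) \<beta> = sref \<theta> \<beta>"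
      unfolding sref_def coroot_minus[OF tr] dual_space_uminus[OF root_dual[OF br]] by (rule ext) simp
    have ac: "aact (arefl a) b = (sref \<theta> \<beta>, k + ip \<theta> \<beta>)"
      unfolding 2(2) bk aact_arefl[OF uminus_roots[OF tr] br] sm ip_uminus_left[OF br tr] by simp
    have sr: "sref \<theta> \<beta> \<in> roots h" by (rule sref_root[OF tr br])
    \<comment> \<open>Orthogonality is symmetric although the Cartan integers are
      not.\<close>
    have s0: "sref \<theta> \<gamma> = \<gamma>" if "\<gamma> \<in> roots h" "ip \<theta> \<gamma> = 0" for \<gamma>
    proof -
      have "ip \<gamma> \<theta> * nrm \<theta> = 0" using ip_nrm[OF tr that(1)] that(2) by simp
      then have "ip \<gamma> \<theta> = 0" using nrm_pos[OF tr] by simp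
      then show ?thesis unfolding sref_def ip_of_int[OF tr that(1)] by simp
    qed
    show ?thesis
    proof (cases "\<beta> \<in> P")
      case True
      show ?thesis
      proof (cases "\<beta> = \<theta>")
        case t: True
        then show ?thesis unfolding ac apos_def using sr ip_self[OF tr] k by auto
      next
        case False
        from hcr_pairing[OF 2(1) True False] show ?thesis
        proof
          assume z: "ip \<theta> \<beta> = 0"
          then show ?thesis unfolding ac s0[OF br z] using b bk by simp
        next
          assume "ip \<theta> \<beta> = 1 \<and> - sref \<theta> \<beta> \<in> P"
          then show ?thesis unfolding ac apos_def using sr k by auto
        qed
      qed
    next
      case False
      then have gP: "- \<beta> \<in> P" and k1: "k \<ge> 1" using P_uminus[OF br] k by auto
      note gr = uminus_roots[OF br]
      have ipm: "ip \<theta> \<beta> = - ip \<theta> (- \<beta>)" using ip_uminus_right[OF br tr] by simp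
      show ?thesis
      proof (cases "- \<beta> = \<theta>")
        case t: True
        then have be: "\<beta> = - \<theta>" by auto
        then have "k \<noteq> 1" using ne bk 2(2) by auto
        moreover have "sref \<theta> \<beta> = \<theta>" unfolding be sref_uminus sref_self[OF tr] by simp
        moreover have "ip \<theta> \<beta> = - 2" using ipm t ip_self[OF tr] by simp
        ultimately show ?thesis unfolding ac apos_def using k1 tr tP by auto
      next
        case f: False
        from hcr_pairing[OF 2(1) gP f] show ?thesis
        proof
          assume "ip \<theta> (- \<beta>) = 0"
          then have z: "ip \<theta> \<beta> = 0" using ipm by simp
          then show ?thesis unfolding ac s0[OF br z] using b bk by simp
        next
          assume "ip \<theta> (- \<beta>) = 1 \<and> - sref \<theta> (- \<beta>) \<in> P"
          then have "ip \<theta> \<beta> = - 1" "sref \<theta> \<beta> \<in> P" using ipm by (simp_all add: sref_uminus)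
          then show ?thesis unfolding ac apos_def using sr k1 by auto
        qed
      qed
    qed
  qed
qed

lemma arefl_sq: assumes b: "\<beta> \<in> roots h" shows "arefl (\<beta>, k) \<otimes>\<^bsub>W\<^esub> arefl (\<beta>, k) = \<one>\<^bsub>W\<^esub>"
proof (rule Bij_eqI)
  note r = arefl_W[OF b, of k]
  show "arefl (\<beta>, k) \<otimes>\<^bsub>W\<^esub> arefl (\<beta>, k) \<in> Bij D" unfolding W_mult by (intro B_mult_closed W_Bij r)
  show "\<one>\<^bsub>W\<^esub> \<in> Bij D" unfolding W_one by (rule id_Bij)
  fix \<phi> assume d: "\<phi> \<in> D"
  have d': "arefl (\<beta>, k) \<phi> \<in> D" by (rule W_D[OF r d])
  show "(arefl (\<beta>, k) \<otimes>\<^bsub>W\<^esub> arefl (\<beta>, k)) \<phi> = \<one>\<^bsub>W\<^esub> \<phi>"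
    unfolding W_mult_apply[OF r r d] arefl_apply[OF d'] unfolding arefl_apply[OF d]
    by (rule ext) (simp add: root_coroot[OF b] d W_one algebra_simps)
qed

lemma arefl_aact:
  assumes w: "w \<in> carrier W" and b: "\<beta> \<in> roots h"
  shows "arefl (aact w (\<beta>, k)) = w \<otimes>\<^bsub>W\<^esub> arefl (\<beta>, k) \<otimes>\<^bsub>W\<^esub> inv\<^bsub>W\<^esub> w"
proof -
  interpret G: group W by (rule group_W)
  note u = linp_Wf[OF w] and r = arefl_W[OF b, of k]
  note b' = Wf_root[OF u b]
  have r': "arefl (aact w (\<beta>, k)) \<in> carrier W" unfolding aact_pair by (rule arefl_W[OF b'])
  have "arefl (aact w (\<beta>, k)) \<otimes>\<^bsub>W\<^esub> w = w \<otimes>\<^bsub>W\<^esub> arefl (\<beta>, k)"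
  proof (rule Bij_eqI)
    show "arefl (aact w (\<beta>, k)) \<otimes>\<^bsub>W\<^esub> w \<in> Bij D" "w \<otimes>\<^bsub>W\<^esub> arefl (\<beta>, k) \<in> Bij D"
      using r' w r by (auto intro: W_Bij)
    fix \<phi> assume d: "\<phi> \<in> D"
    let ?c = "\<phi> (coroot h \<beta>) + of_int k"
    have "(w \<phi>) (coroot h (linp w \<beta>)) = \<phi> (coroot h \<beta>) + of_int (ip (w 0) (linp w \<beta>))"
      unfolding W_apply[OF w d] plus_fun_apply Wf_pairing[OF u d b] ip_Q[OF W_zero_Q[OF w] b'] ..
    then have 1: "arefl (aact w (\<beta>, k)) (w \<phi>) = w \<phi> - wscale ?c (linp w \<beta>)"
      unfolding aact_pair arefl_apply[OF W_D[OF w d]] by simp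
    note cd = dual_space_scale[OF root_dual[OF b], of ?c]
    have "w (\<phi> - wscale ?c \<beta>) = linp w \<phi> - wscale ?c (linp w \<beta>) + w 0"
      unfolding W_apply[OF w dual_space_diff[OF d cd]] Wf_diff[OF u d cd] Wf_scale[OF u root_dual[OF b]] ..
    then have 2: "w (arefl (\<beta>, k) \<phi>) = w \<phi> - wscale ?c (linp w \<beta>)"
      unfolding arefl_apply[OF d] W_apply[OF w d] by (simp add: algebra_simps)
    show "(arefl (aact w (\<beta>, k)) \<otimes>\<^bsub>W\<^esub> w) \<phi> = (w \<otimes>\<^bsub>W\<^esub> arefl (\<beta>, k)) \<phi>"
      unfolding W_mult_apply[OF r' w d] W_mult_apply[OF w r d] 1 2 ..
  qed
  then show ?thesis using w r r' by (metis G.inv_solve_right' G.m_closed)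
qed

text \<open>The translation by a root is the product of two reflections in parallel
  hyperplanes.\<close>

lemma generate_W: "carrier W = generate W (arefl ` aroots)"
proof
  interpret G: group W by (rule group_W)
  have sub: "arefl ` aroots \<subseteq> carrier W" by (auto simp: aroots_def arefl_W)
  show "generate W (arefl ` aroots) \<subseteq> carrier W" by (rule G.generate_incl[OF sub])
  let ?G = "generate W (arefl ` aroots)"
  have r: "arefl (\<beta>, k) \<in> ?G" if "\<beta> \<in> roots h" for \<beta> k
    by (rule generate.incl) (use that in \<open>auto simp: aroots_def\<close>)
  have uG: "u \<in> ?G" if "u \<in> Wf" for u
    using that unfolding finite_weyl_def
  proof (induction rule: generate.induct)
    case one
    have "\<one>\<^bsub>B\<^esub> = \<one>\<^bsub>W\<^esub>" by (simp only: W_one B_one)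
    then show ?case using generate.one[of W] by (simp only:)
  next
    case (incl f) then show ?case using r[of _ 0] arefl_finite by auto
  next
    case (inv f) then show ?case using r[of _ 0] arefl_finite inv_reflection by auto
  next
    case (eng f g) then show ?case using generate.eng[of f W _ g] by (simp add: W_mult)
  qed
  let ?i = "\<lambda>\<phi>\<in>D. \<phi>"
  have tm: "aff \<mu> ?i \<otimes>\<^bsub>W\<^esub> aff \<nu> ?i = aff (\<nu> + \<mu>) ?i" if "\<mu> \<in> Q" "\<nu> \<in> Q" for \<mu> \<nu>
  proof -
    have "?i \<otimes>\<^bsub>B\<^esub> ?i = ?i" by (rule Bij_eqI) (simp_all add: B_mult_closed id_Bij B_mult)
    then show ?thesis unfolding W_mult aff_mult[OF that Wf_one Wf_one] using Q_D[OF that(2)] by simp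
  qed
  have t: "aff \<mu> ?i \<in> ?G" if "\<mu> \<in> Q" for \<mu>
    using that
  proof (induction rule: group_closure.induct)
    case (base s)
    show ?case
    proof (cases "s = 0")
      case True
      show ?thesis unfolding True aff_0[OF Wf_one] by (rule uG[OF Wf_one])
    next
      case False
      then have s: "s \<in> roots h" using base by blast
      \<comment> \<open>Reflections in parallel hyperplanes compose to a
        translation.\<close>
      have "arefl (s, -1) \<otimes>\<^bsub>W\<^esub> arefl (s, 0) = aff s ?i"
      proof (rule Bij_eqI)
        show "arefl (s, -1) \<otimes>\<^bsub>W\<^esub> arefl (s, 0) \<in> Bij D" by (rule W_Bij[OF G.m_closed[OF arefl_W[OF s] arefl_W[OF s]]])
        show "aff s ?i \<in> Bij D" by (rule aff_Bij[OF Q_root[OF s] Wf_one])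
        fix \<phi> assume d: "\<phi> \<in> D"
        have d': "arefl (s, 0) \<phi> \<in> D" by (rule W_D[OF arefl_W[OF s] d])
        show "(arefl (s, -1) \<otimes>\<^bsub>W\<^esub> arefl (s, 0)) \<phi> = aff s ?i \<phi>"
          unfolding W_mult_apply[OF arefl_W[OF s] arefl_W[OF s] d] arefl_apply[OF d'] aff_apply[OF Wf_one d]
          unfolding arefl_apply[OF d]
          by (rule ext) (simp add: root_coroot[OF s] d algebra_simps)
      qed
      then show ?thesis using generate.eng[OF r[OF s, of "-1"] r[OF s, of 0]] by (simp only:)
    qed
  next
    case (diff s t)
    have tt: "aff t ?i \<in> carrier W" "aff (- t) ?i \<in> carrier W" using diff by (auto intro!: aff_W Wf_one)
    have "aff (- t) ?i \<otimes>\<^bsub>W\<^esub> aff t ?i = \<one>\<^bsub>W\<^esub>" using tm[of "- t" t] diff aff_0[OF Wf_one] by (simp add: W_one)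
    then have "inv\<^bsub>W\<^esub> (aff t ?i) = aff (- t) ?i" using tt by (intro G.inv_equality)
    then have "aff (- t) ?i \<in> ?G" using G.generate_m_inv_closed[OF sub diff.IH(2)] by (simp only:)
    then have "aff (- t) ?i \<otimes>\<^bsub>W\<^esub> aff s ?i \<in> ?G" using diff.IH(1) by (rule generate.eng)
    moreover have "aff (- t) ?i \<otimes>\<^bsub>W\<^esub> aff s ?i = aff (s - t) ?i" using tm[of "- t" s] diff by simp
    ultimately show ?case by (simp only:)
  qed
  show "carrier W \<subseteq> ?G"
  proof
    fix w assume "w \<in> carrier W"
    then obtain \<mu> u where e: "w = aff \<mu> u" and m: "\<mu> \<in> Q" "u \<in> Wf" unfolding W_carrier by blast
    have "aff \<mu> ?i \<otimes>\<^bsub>W\<^esub> aff 0 u = aff \<mu> u"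
    proof -
      have "?i \<otimes>\<^bsub>B\<^esub> u = u" by (rule Bij_eqI) (simp_all add: B_mult_closed id_Bij B_mult Wf_Bij m Wf_D)
      moreover have "?i 0 + \<mu> = \<mu>" unfolding restrict_apply'[OF dual_space_zero] by simp
      ultimately show ?thesis unfolding W_mult aff_mult[OF m(1) zero_in_group_closure Wf_one m(2)] by (simp only:)
    qed
    then show "w \<in> ?G" using generate.eng[OF t[OF m(1)] uG[OF m(2)]] aff_0[OF m(2)] e by simp
  qed
qed

lemma aact_one: "\<beta> \<in> roots h \<Longrightarrow> aact \<one>\<^bsub>W\<^esub> (\<beta>, k) = (\<beta>, k)"
proof -
  assume b: "\<beta> \<in> roots h"
  have "linp (\<lambda>\<phi>\<in>D. \<phi>) = (\<lambda>\<phi>\<in>D. \<phi>)" by (rule linp_of_Wf[OF Wf_one])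
  then show ?thesis
    unfolding aact_pair W_one by (simp only: restrict_apply'[OF root_dual[OF b]] restrict_apply'[OF dual_space_zero]) (simp add: ip_def)
qed

lemma aact_Wf: "u \<in> Wf \<Longrightarrow> aact u (\<beta>, k) = (u \<beta>, k)"
  unfolding aact_pair by (simp add: linp_of_Wf Wf_zero ip_def)

lemma affine_reflection_action: "parabolic_action W aroots apos asimple aneg aact arefl afin ((\<lambda>\<alpha>. (\<alpha>, 0)) ` simple_roots P) Wf"
proof -
  interpret G: group W by (rule group_W)
  show ?thesis
  proof unfold_locales
    show "apos \<subseteq> aroots" by (auto simp: apos_def aroots_def)
    show "aneg a \<in> aroots" "aneg (aneg a) = a" if "a \<in> aroots" for a
      using that by (auto simp: aneg_def aroots_def uminus_roots)
    show "(aneg a \<in> apos) = (a \<notin> apos)" if "a \<in> aroots" for a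
      using that by (auto simp: aneg_def aroots_def apos_def uminus_roots P_uminus)
    show "aact w a \<in> aroots" if "w \<in> carrier W" "a \<in> aroots" for w a
      using that by (auto simp: aact_def aroots_def intro: Wf_root linp_Wf)
    show "aact \<one>\<^bsub>W\<^esub> a = a" if "a \<in> aroots" for a using that aact_one by (auto simp: aroots_def)
    show "aact (w \<otimes>\<^bsub>W\<^esub> w') a = aact w (aact w' a)" if "w \<in> carrier W" "w' \<in> carrier W" "a \<in> aroots" for w w' a
      using that aact_mult by (auto simp: aroots_def)
    show "aact w (aneg a) = aneg (aact w a)" if w: "w \<in> carrier W" and a: "a \<in> aroots" for w a
    proof -
      obtain \<beta> k where bk: "a = (\<beta>, k)" "\<beta> \<in> roots h" using a by (auto simp: aroots_def)
      note u = linp_Wf[OF w]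
      have m: "linp w (- \<beta>) = - linp w \<beta>" by (rule Wf_minus[OF u root_dual[OF bk(2)]])
      have "ip (w 0) (- linp w \<beta>) = - ip (w 0) (linp w \<beta>)"
      proof (rule ip_eqI)
        show "of_int (- ip (w 0) (linp w \<beta>)) = w 0 (coroot h (- linp w \<beta>))"
          unfolding coroot_minus[OF Wf_root[OF u bk(2)]] dual_space_uminus[OF Q_D[OF W_zero_Q[OF w]]]
          using ip_Q[OF W_zero_Q[OF w] Wf_root[OF u bk(2)]] by simp
      qed
      then show ?thesis unfolding bk(1) by (simp add: aneg_def aact_def m)
    qed
    show "arefl a \<in> carrier W" "arefl a \<otimes>\<^bsub>W\<^esub> arefl a = \<one>\<^bsub>W\<^esub>" if "a \<in> aroots" for a
      using that arefl_W arefl_sq by (auto simp: aroots_def)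
    show "arefl (aact w a) = w \<otimes>\<^bsub>W\<^esub> arefl a \<otimes>\<^bsub>W\<^esub> inv\<^bsub>W\<^esub> w" if "w \<in> carrier W" "a \<in> aroots" for w a
      using that arefl_aact by (auto simp: aroots_def)
    show "arefl (aneg a) = arefl a" if a: "a \<in> aroots" for a
    proof -
      obtain \<beta> k where bk: "a = (\<beta>, k)" "\<beta> \<in> roots h" using a by (auto simp: aroots_def)
      show ?thesis
      proof (rule extensionalityI[of _ D])
        fix \<phi> assume d: "\<phi> \<in> D"
        show "arefl (aneg a) \<phi> = arefl a \<phi>"
          unfolding bk(1) aneg_def fst_conv snd_conv arefl_apply[OF d] coroot_minus[OF bk(2)] dual_space_uminus[OF d]
          by (rule ext) (simp add: algebra_simps)
      qed (simp_all add: arefl_def)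
    qed
    show "aact (arefl a) a = aneg a" if a: "a \<in> aroots" for a
    proof -
      obtain \<beta> k where bk: "a = (\<beta>, k)" "\<beta> \<in> roots h" using a by (auto simp: aroots_def)
      show ?thesis unfolding bk(1) aact_arefl[OF bk(2) bk(2)] sref_self[OF bk(2)] ip_self[OF bk(2)] by (simp add: aneg_def)
    qed
    show "a = b" if ab: "a \<in> apos" "b \<in> apos" "aact (arefl b) a = aneg a" for a b
    proof -
      obtain \<alpha> i where a: "a = (\<alpha>, i)" "\<alpha> \<in> roots h" "i > 0 \<or> i = 0 \<and> \<alpha> \<in> P" using ab by (auto simp: apos_def)
      obtain \<beta> j where b: "b = (\<beta>, j)" "\<beta> \<in> roots h" "j > 0 \<or> j = 0 \<and> \<beta> \<in> P" using ab by (auto simp: apos_def)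
      have e: "sref \<beta> \<alpha> = - \<alpha>" "i - j * ip \<beta> \<alpha> = - i"
        using ab(3) unfolding a(1) b(1) aact_arefl[OF b(2) a(2)] aneg_def by simp_all
      have "\<alpha> x = wscale (\<alpha> (coroot h \<beta>) / 2) \<beta> x" for x
        using fun_cong[OF e(1), of x] by (simp add: sref_apply field_simps)
      then have "wscale (\<alpha> (coroot h \<beta>) / 2) \<beta> = \<alpha>" by (intro ext) simp
      then consider "\<alpha> = \<beta>" | "\<alpha> = - \<beta>" using roots_proportional[OF b(2) a(2)] by blast
      then show ?thesis
      proof cases
        case 1
        then show ?thesis using e(2) ip_self[OF b(2)] a(1) b(1) by simp
      next
        case 2
        then have "ip \<beta> \<alpha> = - 2" using ip_uminus_right[OF b(2) b(2)] ip_self[OF b(2)] by simp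
        then have "i = - j" using e(2) by simp
        then have "\<alpha> \<in> P" "\<beta> \<in> P" using a(3) b(3) by auto
        then show ?thesis using P_uminus[OF b(2)] 2 by simp
      qed
    qed
    show "asimple \<subseteq> apos" by (rule asimple_apos)
    show "aact (arefl a) b \<in> apos" if "a \<in> asimple" "b \<in> apos" "b \<noteq> a" for a b using that by (rule asimple_perm)
    show "\<exists>a\<in>asimple. aact w a \<notin> apos" if "w \<in> carrier W" "b \<in> apos" "aact w b \<notin> apos" for w b
      using that by (rule affine_detect)
    show "finite {b \<in> apos. aact w b \<notin> apos}" if w: "w \<in> carrier W" for w
    proof (rule finite_subset)
      \<comment> \<open>An inversion has level at most the amount by which \<open>w\<close>
        lowers it, which bounds it in terms of the finite part.\<close>
      show "{b \<in> apos. aact w b \<notin> apos} \<subseteq> (SIGMA \<beta>:roots h. {0..ip (w 0) (linp w \<beta>)})"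
        using Wf_root[OF linp_Wf[OF w]] by (auto simp: apos_def aact_pair)
      show "finite (SIGMA \<beta>:roots h. {0..ip (w 0) (linp w \<beta>)})" using finite_roots by simp
    qed
    show "carrier W = generate W (arefl ` aroots)" by (rule generate_W)
    show "Wf \<subseteq> carrier W" using Wf_W by blast
    show "x \<otimes>\<^bsub>W\<^esub> y \<in> Wf" if "x \<in> Wf" "y \<in> Wf" for x y using that Wf_mult by (simp add: W_mult)
    show "\<one>\<^bsub>W\<^esub> \<in> Wf" using Wf_one by (simp add: W_one)
    show "inv\<^bsub>W\<^esub> x \<in> Wf" if x: "x \<in> Wf" for x
    proof -
      obtain u' where u': "u' \<in> Wf" "\<And>\<phi>. \<phi> \<in> D \<Longrightarrow> u' (x \<phi>) = \<phi>" using Wf_inverse[OF x] by blast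
      have "u' \<otimes>\<^bsub>W\<^esub> x = \<one>\<^bsub>W\<^esub>" unfolding W_mult W_one
        by (rule Bij_eqI) (simp_all add: B_mult_closed Wf_Bij u' x id_Bij B_mult)
      then have "inv\<^bsub>W\<^esub> x = u'" using G.inv_equality Wf_W x u'(1) by blast
      then show ?thesis using u' by simp
    qed
    show "afin \<subseteq> aroots" by (auto simp: afin_def aroots_def)
    show "(\<lambda>\<alpha>. (\<alpha>, 0)) ` simple_roots P \<subseteq> asimple" by (auto simp: asimple_def)
    show "(\<lambda>\<alpha>. (\<alpha>, 0)) ` simple_roots P \<subseteq> afin" by (auto simp: afin_def simple_P P_roots)
    show "arefl a \<in> Wf" if "a \<in> (\<lambda>\<alpha>. (\<alpha>, 0)) ` simple_roots P" for a
      using that arefl_finite reflection_Wf P_roots simple_P by auto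
    show "aact u b \<in> afin" if "u \<in> Wf" "b \<in> afin" for u b
      using that aact_Wf Wf_root by (auto simp: afin_def)
    show "aact u b \<in> apos" if "u \<in> Wf" "b \<in> apos" "b \<notin> afin" for u b
      using that aact_Wf Wf_root by (auto simp: afin_def apos_def)
    show "\<exists>a\<in>(\<lambda>\<alpha>. (\<alpha>, 0)) ` simple_roots P. aact w a \<notin> apos"
      if t: "w \<in> carrier W" "b \<in> apos" "b \<in> afin" "aact w b \<notin> apos" for w b
    proof -
      obtain \<beta> where b: "b = (\<beta>, 0)" "\<beta> \<in> P" using t(2,3) by (auto simp: afin_def apos_def)
      then show ?thesis using affine_detect_finite[OF t(1) b(2)] t(4) by blast
    qed
  qed
qed

lemma affine_simple_reflections_eq: "affine_simple_reflections h P = arefl ` asimple"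
proof -
  have 1: "reflection h \<alpha> = arefl (\<alpha>, 0)" if "\<alpha> \<in> simple_roots P" for \<alpha>
    using arefl_finite that simple_P P_roots by simp
  have 2: "compose D (translation h \<theta>) (reflection h \<theta>) = arefl (- \<theta>, 1)" if "\<theta> \<in> hcr" for \<theta>
  proof (rule extensionalityI[of _ D])
    note tr = hcr_root[OF that]
    fix \<phi> assume d: "\<phi> \<in> D"
    have "compose D (translation h \<theta>) (reflection h \<theta>) \<phi> = sref \<theta> \<phi> + \<theta>"
      using d by (simp add: compose_def reflection_apply translation_apply sref_D tr)
    also have "\<dots> = arefl (- \<theta>, 1) \<phi>"
      unfolding arefl_apply[OF d] coroot_minus[OF tr] dual_space_uminus[OF d]
      by (rule ext) (simp add: sref_apply algebra_simps)
    finally show "compose D (translation h \<theta>) (reflection h \<theta>) \<phi> = arefl (- \<theta>, 1) \<phi>" .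
  qed (simp_all add: arefl_def compose_def)
  show ?thesis unfolding affine_simple_reflections_def asimple_def image_Un image_image using 1 2 by simp
qed

end


section \<open>Coefficients in the Hecke algebra\<close>

lemma lookup_hecke_scale: "Poly_Mapping.lookup (hecke_scale a b) w = a * Poly_Mapping.lookup b w"
  by (simp add: hecke_scale_def Poly_Mapping.map.rep_eq when_def)

lemma hecke_scale_add_right: "hecke_scale a (b + c) = hecke_scale a b + hecke_scale a c"
  by (rule poly_mapping_eqI) (simp add: lookup_hecke_scale lookup_add algebra_simps)
lemma hecke_scale_add_left: "hecke_scale (a + a') b = hecke_scale a b + hecke_scale a' b"
  by (rule poly_mapping_eqI) (simp add: lookup_hecke_scale lookup_add algebra_simps)
lemma hecke_scale_scale: "hecke_scale a (hecke_scale a' b) = hecke_scale (a * a') b"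
  by (rule poly_mapping_eqI) (simp add: lookup_hecke_scale algebra_simps)
lemma hecke_scale_1 [simp]: "hecke_scale 1 b = b"
  by (rule poly_mapping_eqI) (simp add: lookup_hecke_scale)
lemma hecke_scale_0 [simp]: "hecke_scale 0 b = 0"
  by (rule poly_mapping_eqI) (simp add: lookup_hecke_scale)
lemma hecke_scale_zero [simp]: "hecke_scale a 0 = 0"
  by (rule poly_mapping_eqI) (simp add: lookup_hecke_scale)
lemma keys_hecke_scale: "Poly_Mapping.keys (hecke_scale a b) \<subseteq> Poly_Mapping.keys b"
  by (auto simp: in_keys_iff lookup_hecke_scale)
lemma lookup_hecke_basis: "Poly_Mapping.lookup (hecke_basis x) y = (if x = y then 1 else 0)"
  by (simp add: hecke_basis_def lookup_single when_def)
lemma keys_hecke_basis: "Poly_Mapping.keys (hecke_basis x) = {x}"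
  by (simp add: hecke_basis_def)

lemma hecke_induct:
  assumes X: "Poly_Mapping.keys b \<subseteq> X" and P0: "P 0"
    and PT: "\<And>a w. w \<in> X \<Longrightarrow> P (hecke_scale a (hecke_basis w))"
    and PA: "\<And>b c. Poly_Mapping.keys b \<subseteq> X \<Longrightarrow> Poly_Mapping.keys c \<subseteq> X \<Longrightarrow> P b \<Longrightarrow> P c \<Longrightarrow> P (b + c)"
  shows "P b"
proof -
  let ?f = "\<lambda>w. hecke_scale (Poly_Mapping.lookup b w) (hecke_basis w)"
  have fk: "Poly_Mapping.keys (?f w) \<subseteq> {w}" for w
    using keys_hecke_scale[of _ "hecke_basis w"] unfolding keys_hecke_basis by blast
  have "K \<subseteq> X \<Longrightarrow> Poly_Mapping.keys (\<Sum>w\<in>K. ?f w) \<subseteq> X \<and> P (\<Sum>w\<in>K. ?f w)" if "finite K" for K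
    using that
  proof (induction K rule: finite_induct)
    case empty then show ?case using P0 by simp
  next
    case (insert w K)
    have "Poly_Mapping.keys (?f w) \<subseteq> X" using fk[of w] insert.prems by blast
    then show ?case using insert PT PA[of "?f w" "\<Sum>w\<in>K. ?f w"] keys_add[of "?f w" "\<Sum>w\<in>K. ?f w"] by auto
  qed
  from this[OF finite_keys X] have "P (\<Sum>w\<in>Poly_Mapping.keys b. ?f w)" by blast
  moreover have "(\<Sum>w\<in>Poly_Mapping.keys b. ?f w) = b"
  proof (rule poly_mapping_eqI)
    fix y
    have "Poly_Mapping.lookup (\<Sum>w\<in>Poly_Mapping.keys b. ?f w) y = (\<Sum>w\<in>Poly_Mapping.keys b. if w = y then Poly_Mapping.lookup b y else 0)"
      unfolding lookup_sum by (rule sum.cong) (auto simp: lookup_hecke_scale lookup_hecke_basis)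
    then show "Poly_Mapping.lookup (\<Sum>w\<in>Poly_Mapping.keys b. ?f w) y = Poly_Mapping.lookup b y"
      by (simp add: in_keys_iff)
  qed
  ultimately show ?thesis by simp
qed

definition lin_ext :: "('w \<Rightarrow> laurent) \<Rightarrow> 'w hecke \<Rightarrow> laurent" where
  "lin_ext f b = (\<Sum>w\<in>Poly_Mapping.keys b. Poly_Mapping.lookup b w * f w)"

lemma lin_ext_superset:
  assumes "finite K" "Poly_Mapping.keys b \<subseteq> K" shows "lin_ext f b = (\<Sum>w\<in>K. Poly_Mapping.lookup b w * f w)"
  unfolding lin_ext_def by (rule sum.mono_neutral_left) (use assms in \<open>auto simp: in_keys_iff\<close>)
lemma lin_ext_add: "lin_ext f (b + c) = lin_ext f b + lin_ext f c"
proof -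
  let ?K = "Poly_Mapping.keys b \<union> Poly_Mapping.keys c"
  have K: "finite ?K" "Poly_Mapping.keys (b + c) \<subseteq> ?K" by (simp_all add: keys_add)
  show ?thesis unfolding lin_ext_superset[OF K] lin_ext_superset[OF K(1), of b] lin_ext_superset[OF K(1), of c]
      lin_ext_superset[OF K(1), OF Un_upper1] lin_ext_superset[OF K(1), OF Un_upper2]
    by (simp add: lookup_add sum.distrib algebra_simps)
qed
lemma lin_ext_scale: "lin_ext f (hecke_scale a b) = a * lin_ext f b"
  unfolding lin_ext_superset[OF finite_keys keys_hecke_scale]
  by (simp add: lin_ext_def lookup_hecke_scale sum_distrib_left mult.assoc)
lemma lin_ext_basis: "lin_ext f (hecke_basis w) = f w"
  by (simp add: lin_ext_def keys_hecke_basis lookup_hecke_basis)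
lemma lin_ext_0: "lin_ext f 0 = 0" by (simp add: lin_ext_def)

lemma v_v_inv: "v * v_inv = 1" "v_inv * v = 1" by (simp_all add: v_def v_inv_def mult_single)
lemma v_power: "v ^ n = Poly_Mapping.single (int n) 1"
  by (induction n) (simp_all add: v_def mult_single add.commute)
lemma v_inv_power: "v_inv ^ n = Poly_Mapping.single (- int n) 1"
  by (induction n) (simp_all add: v_inv_def mult_single add.commute)

text \<open>\<open>vge m a\<close> and \<open>vle m a\<close> bound the exponents of
  \<open>v\<close> that occur in the Laurent polynomial \<open>a\<close>; both hold for
  zero, for every bound.\<close>

definition vge :: "int \<Rightarrow> laurent \<Rightarrow> bool" where "vge m a \<longleftrightarrow> (\<forall>k\<in>Poly_Mapping.keys a. m \<le> k)"
definition vle :: "int \<Rightarrow> laurent \<Rightarrow> bool" where "vle m a \<longleftrightarrow> (\<forall>k\<in>Poly_Mapping.keys a. k \<le> m)"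

lemma vge_0 [simp]: "vge m 0" by (simp add: vge_def)
lemma vle_0 [simp]: "vle m 0" by (simp add: vle_def)
lemma vge_add: "vge m a \<Longrightarrow> vge m b \<Longrightarrow> vge m (a + b)" using keys_add[of a b] by (auto simp: vge_def)
lemma vle_add: "vle m a \<Longrightarrow> vle m b \<Longrightarrow> vle m (a + b)" using keys_add[of a b] by (auto simp: vle_def)
lemma vge_minus: "vge m a \<Longrightarrow> vge m (- a)" by (simp add: vge_def)
lemma vle_minus: "vle m a \<Longrightarrow> vle m (- a)" by (simp add: vle_def)
lemma vge_mult: "vge m a \<Longrightarrow> vge n b \<Longrightarrow> vge (m + n) (a * b)"
  using keys_mult[of a b] unfolding vge_def by fastforce
lemma vle_mult: "vle m a \<Longrightarrow> vle n b \<Longrightarrow> vle (m + n) (a * b)"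
  using keys_mult[of a b] unfolding vle_def by fastforce
lemma vge_mono: "vge m a \<Longrightarrow> n \<le> m \<Longrightarrow> vge n a" by (auto simp: vge_def)
lemma vle_mono: "vle m a \<Longrightarrow> m \<le> n \<Longrightarrow> vle n a" by (auto simp: vle_def)
lemma vge_sum: "(\<And>x. x \<in> A \<Longrightarrow> vge m (f x)) \<Longrightarrow> vge m (\<Sum>x\<in>A. f x)"
  by (induction A rule: infinite_finite_induct) (simp_all add: vge_add)
lemma vle_sum: "(\<And>x. x \<in> A \<Longrightarrow> vle m (f x)) \<Longrightarrow> vle m (\<Sum>x\<in>A. f x)"
  by (induction A rule: infinite_finite_induct) (simp_all add: vle_add)
lemma vge_1 [simp]: "vge 0 1" by (simp add: vge_def)
lemma vle_1 [simp]: "vle 0 1" by (simp add: vle_def)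
lemma vge_v: "vge 1 v" by (simp add: vge_def v_def)
lemma vle_v: "vle 1 v" by (simp add: vle_def v_def)
lemma vge_v_inv: "vge (-1) v_inv" by (simp add: vge_def v_inv_def)
lemma vle_v_inv: "vle (-1) v_inv" by (simp add: vle_def v_inv_def)
lemma vge_of_int: "vge 0 (of_int n)" by (simp add: vge_def flip: single_of_int)
lemma vge_minus_v_power: "vge 0 ((- v) ^ n)"
proof (induction n)
  case (Suc n) then show ?case using vge_mono[OF vge_mult[OF vge_minus[OF vge_v] Suc], of 0] by simp
qed simp

definition barl :: "laurent \<Rightarrow> laurent" where "barl a = Poly_Mapping.map_key uminus a"

lemma lookup_barl: "Poly_Mapping.lookup (barl a) k = Poly_Mapping.lookup a (- k)"
  by (simp add: barl_def map_key.rep_eq)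
lemma barl_add: "barl (a + b) = barl a + barl b"
  by (rule poly_mapping_eqI) (simp add: lookup_barl lookup_add)
lemma barl_minus: "barl (- a) = - barl a"
  by (rule poly_mapping_eqI) (simp add: lookup_barl)
lemma barl_diff: "barl (a - b) = barl a - barl b"
  by (rule poly_mapping_eqI) (simp add: lookup_barl lookup_minus)
lemma barl_barl [simp]: "barl (barl a) = a"
  by (rule poly_mapping_eqI) (simp add: lookup_barl)
lemma barl_0 [simp]: "barl 0 = 0"
  by (rule poly_mapping_eqI) (simp add: lookup_barl)
lemma barl_single: "barl (Poly_Mapping.single k n) = Poly_Mapping.single (- k) n"
  by (rule poly_mapping_eqI) (auto simp: lookup_barl lookup_single when_def)
lemma barl_1 [simp]: "barl 1 = 1" using barl_single[of 0 1] by simp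
lemma barl_of_int [simp]: "barl (of_int n) = of_int n" 
proof -
  have "Poly_Mapping.single 0 n = (of_int n :: laurent)" using single_of_int[of n, where 'b = int] by simp
  then show ?thesis using barl_single[of 0 n] by simp
qed
lemma barl_v: "barl v = v_inv" "barl v_inv = v" by (simp_all add: v_def v_inv_def barl_single)

lemma laurent_single_induct:
  assumes "\<And>k n. P (Poly_Mapping.single k n)" "\<And>a b. P a \<Longrightarrow> P b \<Longrightarrow> P (a + b)"
  shows "P (a :: laurent)"
proof -
  have "P (\<Sum>k\<in>K. Poly_Mapping.single k (Poly_Mapping.lookup a k))" if "finite K" for K
    using that by (induction K rule: finite_induct) (use assms assms(1)[of 0 0] in auto)
  moreover have "(\<Sum>k\<in>Poly_Mapping.keys a. Poly_Mapping.single k (Poly_Mapping.lookup a k)) = a"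
    by (rule poly_mapping_eqI) (simp add: lookup_sum lookup_single when_def in_keys_iff)
  ultimately show ?thesis by (metis finite_keys)
qed

lemma barl_mult: "barl (a * b) = barl a * barl b"
proof (induction a rule: laurent_single_induct)
  case (1 k n)
  show ?case
  proof (induction b rule: laurent_single_induct)
    case (1 k' n') show ?case by (simp add: mult_single barl_single add.commute)
  next
    case (2 a b) then show ?case by (simp add: distrib_left barl_add)
  qed
next
  case (2 a b) then show ?case by (simp add: distrib_right barl_add)
qed

lemma barl_power: "barl (a ^ n) = barl a ^ n"
  by (induction n) (simp_all add: barl_mult)

lemma barl_vge: "vge 0 a \<Longrightarrow> vle 0 (barl a)"
proof -
  assume a: "vge 0 a"
  show ?thesis unfolding vle_def
  proof
    fix k assume "k \<in> Poly_Mapping.keys (barl a)"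
    then have "- k \<in> Poly_Mapping.keys a" by (simp add: in_keys_iff lookup_barl)
    then have "0 \<le> - k" using a unfolding vge_def by blast
    then show "k \<le> 0" by simp
  qed
qed

lemma lookup_laurent_of_poly:
  "Poly_Mapping.lookup (laurent_of_poly p) k = (if k \<ge> 0 then coeff p (nat k) else 0)"
proof -
  let ?q = "map_poly of_int p :: laurent poly"
  have c: "coeff ?q i = of_int (coeff p i)" for i by (simp add: coeff_map_poly)
  have "degree ?q \<le> degree p" by (rule degree_le) (simp add: c coeff_eq_0)
  then have "laurent_of_poly p = (\<Sum>i\<le>degree p. coeff ?q i * v ^ i)"
    unfolding laurent_of_poly_def poly_altdef
    by (intro sum.mono_neutral_left) (auto simp: coeff_eq_0)
  also have "\<dots> = (\<Sum>i\<le>degree p. Poly_Mapping.single (int i) (coeff p i))"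
    unfolding c v_power by (rule sum.cong) (simp_all add: mult_single flip: single_of_int)
  finally have "Poly_Mapping.lookup (laurent_of_poly p) k = (\<Sum>i\<le>degree p. coeff p i when int i = k)"
    by (simp add: lookup_sum lookup_single)
  also have "\<dots> = (\<Sum>i\<le>degree p. if i = nat k then (if k \<ge> 0 then coeff p (nat k) else 0) else 0)"
    by (rule sum.cong) (auto simp: when_def)
  also have "\<dots> = (if k \<ge> 0 then coeff p (nat k) else 0)"
    by (auto simp: coeff_eq_0)
  finally show ?thesis .
qed

lemma vge_0_iff: "vge 0 a \<longleftrightarrow> (\<exists>p. a = laurent_of_poly p)"
proof
  assume a: "vge 0 a"
  define N where "N = nat (Max (insert 0 (Poly_Mapping.keys a)))"
  have N: "k \<le> int N" if "k \<in> Poly_Mapping.keys a" for k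
    using Max_ge[of "insert 0 (Poly_Mapping.keys a)" k] that by (simp add: N_def)
  let ?p = "Abs_poly (\<lambda>i. Poly_Mapping.lookup a (int i))"
  have z: "Poly_Mapping.lookup a (int i) = 0" if "i > N" for i using N[of "int i"] that by (force simp: in_keys_iff)
  have c: "coeff ?p i = Poly_Mapping.lookup a (int i)" for i using coeff_Abs_poly[of N, OF z] by simp
  have "a = laurent_of_poly ?p"
  proof (rule poly_mapping_eqI)
    fix k
    show "Poly_Mapping.lookup a k = Poly_Mapping.lookup (laurent_of_poly ?p) k"
      using a unfolding lookup_laurent_of_poly c by (auto simp: vge_def in_keys_iff)
  qed
  then show "\<exists>p. a = laurent_of_poly p" ..
qed (auto simp: vge_def in_keys_iff lookup_laurent_of_poly split: if_splits)

lemma vge_1_iff: "vge 1 a \<longleftrightarrow> (\<exists>p. a = v * laurent_of_poly p)"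
proof
  assume "vge 1 a"
  then have "vge 0 (v_inv * a)" using vge_mult[OF vge_v_inv, of 1 a] by simp
  then obtain p where "v_inv * a = laurent_of_poly p" using vge_0_iff by blast
  then have "v * laurent_of_poly p = v * (v_inv * a)" by simp
  also have "\<dots> = a" by (simp add: mult.assoc[symmetric] v_v_inv)
  finally show "\<exists>p. a = v * laurent_of_poly p" by metis
next
  assume "\<exists>p. a = v * laurent_of_poly p"
  then obtain p where p: "a = v * laurent_of_poly p" by blast
  have "vge 0 (laurent_of_poly p)" unfolding vge_0_iff by blast
  from vge_mult[OF vge_v this] show "vge 1 a" unfolding p by simp
qed

lemma vge_0_vle_poly:
  assumes "vge 0 a" "vle (int n) a" shows "\<exists>p. a = laurent_of_poly p \<and> degree p \<le> n"
proof -
  obtain p where p: "a = laurent_of_poly p" using assms(1) vge_0_iff by blast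
  have "coeff p i = 0" if "i > n" for i
  proof (rule ccontr)
    assume "coeff p i \<noteq> 0"
    then have "int i \<in> Poly_Mapping.keys a" unfolding p in_keys_iff lookup_laurent_of_poly by simp
    then have "int i \<le> int n" using assms(2) unfolding vle_def by blast
    then show False using that by simp
  qed
  then show ?thesis using p degree_le by blast
qed

lemma vge_1_vle_0: "vge 1 a \<Longrightarrow> vle 0 a \<Longrightarrow> a = 0"
  unfolding vge_def vle_def by (metis keys_eq_empty all_not_in_conv not_one_le_zero order_trans)

lemma vge_1_if_constant_0:
  assumes "vge 0 a" "Poly_Mapping.lookup a 0 = 0" shows "vge 1 a"
  unfolding vge_def
proof
  fix k assume k: "k \<in> Poly_Mapping.keys a"
  then have "k \<ge> 0" using assms(1) unfolding vge_def by blast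
  moreover have "k \<noteq> 0" using k assms(2) by (auto simp: in_keys_iff)
  ultimately show "1 \<le> k" by simp
qed


section \<open>The Hecke algebra and its bar involution\<close>

locale hecke_action = parabolic_action +
  fixes H :: "'a hecke ring"
  assumes hecke: "hecke_algebra G S H"
begin

lemma H_ring: "ring H" using hecke by (simp add: hecke_algebra_def)

sublocale H: ring H by (rule H_ring)

abbreviation hmult :: "'a hecke \<Rightarrow> 'a hecke \<Rightarrow> 'a hecke" (infixl "\<cdot>" 70) where "b \<cdot> c \<equiv> b \<otimes>\<^bsub>H\<^esub> c"
abbreviation HC :: "'a hecke set" where "HC \<equiv> carrier H"
abbreviation T :: "'a \<Rightarrow> 'a hecke" where "T \<equiv> hecke_basis"
abbreviation coef :: "'a hecke \<Rightarrow> 'a \<Rightarrow> laurent" where "coef \<equiv> Poly_Mapping.lookup"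

lemma HC_iff: "b \<in> HC \<longleftrightarrow> Poly_Mapping.keys b \<subseteq> carrier G" using hecke by (simp add: hecke_algebra_def)
lemma H_add: "b \<oplus>\<^bsub>H\<^esub> c = b + c" using hecke by (simp add: hecke_algebra_def)
lemma H_zero: "\<zero>\<^bsub>H\<^esub> = 0" using hecke by (simp add: hecke_algebra_def)
lemma H_one: "\<one>\<^bsub>H\<^esub> = T \<one>" using hecke by (simp add: hecke_algebra_def)
lemma scale_mult: "b \<in> HC \<Longrightarrow> c \<in> HC \<Longrightarrow> hecke_scale a b \<cdot> c = hecke_scale a (b \<cdot> c)"
  using hecke by (simp add: hecke_algebra_def)
lemma mult_scale: "b \<in> HC \<Longrightarrow> c \<in> HC \<Longrightarrow> b \<cdot> hecke_scale a c = hecke_scale a (b \<cdot> c)"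
  using hecke by (simp add: hecke_algebra_def)
lemma T_mult: "x \<in> carrier G \<Longrightarrow> y \<in> carrier G \<Longrightarrow> len (x \<otimes> y) = len x + len y \<Longrightarrow> T x \<cdot> T y = T (x \<otimes> y)"
  using hecke by (simp add: hecke_algebra_def)
lemma T_quadratic: "a \<in> \<Delta> \<Longrightarrow> T (refl a) \<cdot> T (refl a) = hecke_scale (v_inv - v) (T (refl a)) + T \<one>"
  using hecke unfolding hecke_algebra_def by auto

lemma T_HC: "w \<in> carrier G \<Longrightarrow> T w \<in> HC" by (simp add: HC_iff keys_hecke_basis)
lemma add_HC: "b \<in> HC \<Longrightarrow> c \<in> HC \<Longrightarrow> b + c \<in> HC" using keys_add[of b c] by (auto simp: HC_iff)
lemma zero_HC: "0 \<in> HC" by (simp add: HC_iff)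
lemma scale_HC: "b \<in> HC \<Longrightarrow> hecke_scale a b \<in> HC" using keys_hecke_scale[of a b] by (auto simp: HC_iff)
lemma mult_HC: "b \<in> HC \<Longrightarrow> c \<in> HC \<Longrightarrow> b \<cdot> c \<in> HC" by (rule H.m_closed)
lemma add_mult: "b \<in> HC \<Longrightarrow> c \<in> HC \<Longrightarrow> d \<in> HC \<Longrightarrow> (b + c) \<cdot> d = b \<cdot> d + c \<cdot> d"
  using H.l_distr[of b c d] by (simp add: H_add)
lemma mult_add: "b \<in> HC \<Longrightarrow> c \<in> HC \<Longrightarrow> d \<in> HC \<Longrightarrow> d \<cdot> (b + c) = d \<cdot> b + d \<cdot> c"
  using H.r_distr[of b c d] by (simp add: H_add)
lemma mult_assoc: "b \<in> HC \<Longrightarrow> c \<in> HC \<Longrightarrow> d \<in> HC \<Longrightarrow> b \<cdot> c \<cdot> d = b \<cdot> (c \<cdot> d)" by (rule H.m_assoc)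
lemma zero_mult: "b \<in> HC \<Longrightarrow> 0 \<cdot> b = 0" using H.l_null[of b] by (simp add: H_zero)
lemma mult_zero: "b \<in> HC \<Longrightarrow> b \<cdot> 0 = 0" using H.r_null[of b] by (simp add: H_zero)
lemma mult_one: "b \<in> HC \<Longrightarrow> b \<cdot> T \<one> = b" using H.r_one[of b] by (simp add: H_one)
lemma one_mult: "b \<in> HC \<Longrightarrow> T \<one> \<cdot> b = b" using H.l_one[of b] by (simp add: H_one)

lemma HC_induct [consumes 1, case_names zero basis add]:
  assumes "b \<in> HC" "P 0" "\<And>a w. w \<in> carrier G \<Longrightarrow> P (hecke_scale a (T w))"
    "\<And>b c. b \<in> HC \<Longrightarrow> c \<in> HC \<Longrightarrow> P b \<Longrightarrow> P c \<Longrightarrow> P (b + c)"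
  shows "P b"
  by (rule hecke_induct[of b "carrier G" P]) (use assms in \<open>simp_all add: HC_iff\<close>)

lemma simple_car: "a \<in> \<Delta> \<Longrightarrow> refl a \<in> carrier G" by (simp add: refl_carrier simple_R)
lemma T_simple_HC: "a \<in> \<Delta> \<Longrightarrow> T (refl a) \<in> HC" by (simp add: T_HC simple_car)

lemma T_mult_simple:
  assumes w: "w \<in> carrier G" and a: "a \<in> \<Delta>"
  shows "T w \<cdot> T (refl a) = T (w \<otimes> refl a) + (if act w a \<in> Pos then 0 else hecke_scale (v_inv - v) (T w))"
proof -
  note ra = simple_car[OF a] and aR = simple_R[OF a]
  have up: "T w \<cdot> T (refl a) = T (w \<otimes> refl a)" if "w \<in> carrier G" "act w a \<in> Pos" for w
    using that len_mult_simple[OF that(1) a that(2)] len_refl[OF a] by (intro T_mult) (simp_all add: ra)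
  show ?thesis
  proof (cases "act w a \<in> Pos")
    case True then show ?thesis using up w by simp
  next
    case False
    let ?w = "w \<otimes> refl a"
    have w': "?w \<in> carrier G" "act ?w a \<in> Pos" "?w \<otimes> refl a = w"
      using w ra aR False by (simp_all add: act_mult_refl_self_Pos mult_refl_refl)
    have tw: "T w = T ?w \<cdot> T (refl a)" using up[OF w'(1,2)] w'(3) by simp
    have "T w \<cdot> T (refl a) = T ?w \<cdot> (T (refl a) \<cdot> T (refl a))"
      unfolding tw by (rule mult_assoc) (simp_all add: T_HC w' ra)
    also have "\<dots> = hecke_scale (v_inv - v) (T ?w \<cdot> T (refl a)) + T ?w"
      unfolding T_quadratic[OF a] using w' ra
      by (simp add: mult_add mult_scale mult_one T_HC scale_HC del: one_closed) (simp add: T_HC)?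
    finally show ?thesis using False tw by (simp add: add.commute)
  qed
qed

lemma simple_T_mult:
  assumes w: "w \<in> carrier G" and a: "a \<in> \<Delta>"
  shows "T (refl a) \<cdot> T w = T (refl a \<otimes> w) + (if act (inv w) a \<in> Pos then 0 else hecke_scale (v_inv - v) (T w))"
proof -
  note ra = simple_car[OF a] and aR = simple_R[OF a]
  have up: "T (refl a) \<cdot> T w = T (refl a \<otimes> w)" if "w \<in> carrier G" "act (inv w) a \<in> Pos" for w
    using that len_simple_mult[OF that(1) a that(2)] len_refl[OF a] by (intro T_mult) (simp_all add: ra)
  show ?thesis
  proof (cases "act (inv w) a \<in> Pos")
    case True then show ?thesis using up w by simp
  next
    case False
    let ?w = "refl a \<otimes> w"
    have w': "?w \<in> carrier G" "act (inv ?w) a \<in> Pos" "refl a \<otimes> ?w = w"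
      using w ra aR False by (simp_all add: inv_mult_group inv_refl act_mult_refl_self_Pos refl_refl_mult)
    have tw: "T w = T (refl a) \<cdot> T ?w" using up[OF w'(1,2)] w'(3) by simp
    have "T (refl a) \<cdot> T w = (T (refl a) \<cdot> T (refl a)) \<cdot> T ?w"
      unfolding tw by (rule mult_assoc[symmetric]) (simp_all add: T_HC w' ra)
    also have "\<dots> = hecke_scale (v_inv - v) (T (refl a) \<cdot> T ?w) + T ?w"
      unfolding T_quadratic[OF a] using w' ra
      by (simp add: add_mult scale_mult one_mult T_HC scale_HC)
    finally show ?thesis using False tw by (simp add: add.commute)
  qed
qed

text \<open>The inverse of the generator of a simple reflection, from the quadratic
  relation.\<close>

definition Ti :: "'c \<Rightarrow> 'a hecke" where "Ti a = T (refl a) + hecke_scale (v - v_inv) (T \<one>)"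

lemma Ti_HC: "a \<in> \<Delta> \<Longrightarrow> Ti a \<in> HC" by (simp add: Ti_def add_HC scale_HC T_HC simple_car)

lemma mult_Ti: "b \<in> HC \<Longrightarrow> a \<in> \<Delta> \<Longrightarrow> b \<cdot> Ti a = b \<cdot> T (refl a) + hecke_scale (v - v_inv) b"
  by (simp add: Ti_def mult_add mult_scale mult_one T_HC scale_HC simple_car)

lemma T_Ti: assumes a: "a \<in> \<Delta>" shows "T (refl a) \<cdot> Ti a = T \<one>" and "Ti a \<cdot> T (refl a) = T \<one>"
proof -
  have z: "hecke_scale (v_inv - v) b + T \<one> + hecke_scale (v - v_inv) b = T \<one>" for b
  proof -
    have "hecke_scale (v_inv - v) b + hecke_scale (v - v_inv) b = 0"
      by (simp add: hecke_scale_add_left[symmetric])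
    then show ?thesis by (simp add: algebra_simps)
  qed
  show "T (refl a) \<cdot> Ti a = T \<one>"
    unfolding mult_Ti[OF T_simple_HC[OF a] a] T_quadratic[OF a] by (rule z)
  have "Ti a \<cdot> T (refl a) = T (refl a) \<cdot> T (refl a) + hecke_scale (v - v_inv) (T (refl a))"
    using a by (simp add: Ti_def add_mult scale_mult one_mult T_HC scale_HC simple_car)
  then show "Ti a \<cdot> T (refl a) = T \<one>" unfolding T_quadratic[OF a] by (simp only: z)
qed

lemma T_Units: "w \<in> carrier G \<Longrightarrow> T w \<in> Units H"
proof (induction "len w" arbitrary: w rule: less_induct)
  case less
  show ?case
  proof (cases "w = \<one>")
    case True then show ?thesis using H.Units_one_closed by (simp add: H_one)
  next
    case False
    then obtain a where a: "a \<in> \<Delta>" "act w a \<notin> Pos" using right_descent less.prems by blast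
    let ?w = "w \<otimes> refl a"
    have w': "?w \<in> carrier G" "act ?w a \<in> Pos" "?w \<otimes> refl a = w"
      using less.prems a simple_car simple_R by (simp_all add: act_mult_refl_self_Pos mult_refl_refl)
    have "len ?w < len w" using len_mult_simple'[OF less.prems a] by simp
    then have u: "T ?w \<in> Units H" using less.hyps w' by blast
    have "T (refl a) \<in> Units H"
      using T_Ti[OF a(1)] Ti_HC[OF a(1)] T_simple_HC[OF a(1)] unfolding Units_def H_one by blast
    then have "T ?w \<cdot> T (refl a) \<in> Units H" using u by simp
    then show ?thesis using T_mult_simple[OF w'(1) a(1)] w' by simp
  qed
qed

definition Tbar :: "'a \<Rightarrow> 'a hecke" where "Tbar w = inv\<^bsub>H\<^esub> (T (inv w))"

lemma Tbar_HC: "w \<in> carrier G \<Longrightarrow> Tbar w \<in> HC"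
  using T_Units[of "inv w"] by (simp add: Tbar_def)
lemma Tbar_one: "Tbar \<one> = T \<one>" using H.inv_one by (simp add: Tbar_def H_one)
lemma T_inv_Tbar: "w \<in> carrier G \<Longrightarrow> T (inv w) \<cdot> Tbar w = T \<one>" "w \<in> carrier G \<Longrightarrow> Tbar w \<cdot> T (inv w) = T \<one>"
  using H.Units_r_inv[OF T_Units[of "inv w"]] H.Units_l_inv[OF T_Units[of "inv w"]] by (simp_all add: Tbar_def H_one)

lemma Tbar_unique:
  assumes "w \<in> carrier G" "b \<in> HC" "b \<cdot> T (inv w) = T \<one>" shows "Tbar w = b"
proof -
  have "Tbar w = (b \<cdot> T (inv w)) \<cdot> Tbar w" using assms by (simp add: one_mult Tbar_HC)
  also have "\<dots> = b \<cdot> (T (inv w) \<cdot> Tbar w)" using assms by (intro mult_assoc) (simp_all add: T_HC Tbar_HC)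
  finally show ?thesis using assms by (simp add: T_inv_Tbar mult_one)
qed

lemma Tbar_mult:
  assumes x: "x \<in> carrier G" "y \<in> carrier G" and l: "len (x \<otimes> y) = len x + len y"
  shows "Tbar (x \<otimes> y) = Tbar x \<cdot> Tbar y"
proof (rule Tbar_unique)
  have "len (inv y \<otimes> inv x) = len (inv y) + len (inv x)"
    using l len_inv[of "x \<otimes> y"] len_inv[of x] len_inv[of y] x by (simp add: inv_mult_group)
  then have e: "T (inv (x \<otimes> y)) = T (inv y) \<cdot> T (inv x)" using x by (simp add: inv_mult_group T_mult)
  have c: "Tbar x \<in> HC" "Tbar y \<in> HC" "T (inv y) \<in> HC" "T (inv x) \<in> HC" using x by (simp_all add: Tbar_HC T_HC)
  have "(Tbar x \<cdot> Tbar y) \<cdot> (T (inv y) \<cdot> T (inv x)) = Tbar x \<cdot> ((Tbar y \<cdot> T (inv y)) \<cdot> T (inv x))"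
    using c by (simp add: mult_assoc mult_HC)
  also have "\<dots> = T \<one>" using c x by (simp add: T_inv_Tbar one_mult)
  finally show "(Tbar x \<cdot> Tbar y) \<cdot> T (inv (x \<otimes> y)) = T \<one>" unfolding e .
qed (use x in \<open>simp_all add: Tbar_HC mult_HC\<close>)

lemma Tbar_simple: assumes a: "a \<in> \<Delta>" shows "Tbar (refl a) = Ti a"
  by (rule Tbar_unique) (use a T_Ti in \<open>simp_all add: simple_car Ti_HC inv_refl simple_R\<close>)

lemma Tbar_mult_simple:
  assumes "w \<in> carrier G" "a \<in> \<Delta>" "act w a \<in> Pos" shows "Tbar (w \<otimes> refl a) = Tbar w \<cdot> Ti a"
  using Tbar_mult[of w "refl a"] assms len_mult_simple[OF assms] len_refl[OF assms(2)]
  by (simp add: simple_car Tbar_simple)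

text \<open>The bar involution, defined on the standard basis. That it is multiplicative is
  checked on right multiplication by the generators of simple reflections.\<close>

definition hbar :: "'a hecke \<Rightarrow> 'a hecke" where
  "hbar b = (\<Sum>w\<in>Poly_Mapping.keys b. hecke_scale (barl (coef b w)) (Tbar w))"

lemma hbar_superset:
  assumes "finite K" "Poly_Mapping.keys b \<subseteq> K" shows "hbar b = (\<Sum>w\<in>K. hecke_scale (barl (coef b w)) (Tbar w))"
  unfolding hbar_def by (rule sum.mono_neutral_left) (use assms in \<open>auto simp: in_keys_iff\<close>)
lemma hbar_add: "hbar (b + c) = hbar b + hbar c"
proof -
  let ?K = "Poly_Mapping.keys b \<union> Poly_Mapping.keys c"
  have K: "finite ?K" "Poly_Mapping.keys (b + c) \<subseteq> ?K" by (simp_all add: keys_add)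
  show ?thesis unfolding hbar_superset[OF K] hbar_superset[OF K(1), OF Un_upper1] hbar_superset[OF K(1), OF Un_upper2]
    by (simp add: lookup_add barl_add hecke_scale_add_left sum.distrib)
qed
lemma hecke_scale_sum: "hecke_scale a (\<Sum>x\<in>K. f x) = (\<Sum>x\<in>K. hecke_scale a (f x))"
  by (induction K rule: infinite_finite_induct) (simp_all add: hecke_scale_add_right)
lemma hbar_scale: "hbar (hecke_scale a b) = hecke_scale (barl a) (hbar b)"
  unfolding hbar_superset[OF finite_keys keys_hecke_scale]
  by (simp add: hbar_def lookup_hecke_scale barl_mult hecke_scale_sum hecke_scale_scale)
lemma hbar_T: "hbar (T w) = Tbar w"
  by (simp add: hbar_def keys_hecke_basis lookup_hecke_basis)
lemma hbar_0: "hbar 0 = 0" by (simp add: hbar_def)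
lemma hbar_HC: "b \<in> HC \<Longrightarrow> hbar b \<in> HC"
  by (induction rule: HC_induct) (simp_all add: hbar_0 hbar_scale hbar_T hbar_add zero_HC scale_HC Tbar_HC add_HC)

lemma hbar_mult_simple:
  assumes b: "b \<in> HC" and a: "a \<in> \<Delta>" shows "hbar (b \<cdot> T (refl a)) = hbar b \<cdot> Ti a"
  using b
proof (induction rule: HC_induct)
  case zero then show ?case using a by (simp add: hbar_0 zero_mult T_simple_HC Ti_HC)
next
  case (add b c) then show ?case using a by (simp add: add_mult T_simple_HC Ti_HC hbar_add hbar_HC)
next
  case (basis c w)
  have "hbar (T w \<cdot> T (refl a)) = Tbar w \<cdot> Ti a"
  proof (cases "act w a \<in> Pos")
    case True
    then show ?thesis using T_mult_simple[OF basis a] Tbar_mult_simple[OF basis a] by (simp add: hbar_T)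
  next
    case False
    let ?w = "w \<otimes> refl a"
    have w': "?w \<in> carrier G" "act ?w a \<in> Pos" "?w \<otimes> refl a = w"
      using basis a False simple_car simple_R by (simp_all add: act_mult_refl_self_Pos mult_refl_refl)
    have tw: "Tbar w = Tbar ?w \<cdot> Ti a" using Tbar_mult_simple[OF w'(1) a w'(2)] w'(3) by simp
    have TiTi: "Ti a \<cdot> Ti a = T \<one> + hecke_scale (v - v_inv) (Ti a)"
      using mult_Ti[OF Ti_HC a, of a] a T_Ti(2)[OF a] by simp
    have "Tbar w \<cdot> Ti a = Tbar ?w \<cdot> (Ti a \<cdot> Ti a)" unfolding tw using w' a by (intro mult_assoc) (simp_all add: Tbar_HC Ti_HC)
    also have "\<dots> = Tbar ?w + hecke_scale (v - v_inv) (Tbar ?w \<cdot> Ti a)"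
      unfolding TiTi using w' a by (simp add: mult_add mult_scale mult_one Tbar_HC Ti_HC T_HC scale_HC)
    also have "\<dots> = hbar (T w \<cdot> T (refl a))"
      unfolding T_mult_simple[OF basis a] tw[symmetric] using False by (simp add: hbar_add hbar_scale hbar_T barl_diff barl_v)
    finally show ?thesis by simp
  qed
  then show ?case using basis a by (simp add: scale_mult hbar_scale hbar_T T_HC T_simple_HC Tbar_HC Ti_HC)
qed

lemma hbar_mult_T: assumes b: "b \<in> HC" shows "w \<in> carrier G \<Longrightarrow> hbar (b \<cdot> T w) = hbar b \<cdot> Tbar w"
proof (induction "len w" arbitrary: w rule: less_induct)
  case less
  show ?case
  proof (cases "w = \<one>")
    case True then show ?thesis using b by (simp add: mult_one Tbar_one hbar_HC)
  next
    case False
    then obtain a where a: "a \<in> \<Delta>" "act w a \<notin> Pos" using right_descent less.prems by blast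
    let ?w = "w \<otimes> refl a"
    have w': "?w \<in> carrier G" "act ?w a \<in> Pos" "?w \<otimes> refl a = w"
      using less.prems a simple_car simple_R by (simp_all add: act_mult_refl_self_Pos mult_refl_refl)
    have l: "len ?w < len w" using len_mult_simple'[OF less.prems a] by simp
    have tw: "T w = T ?w \<cdot> T (refl a)" using T_mult_simple[OF w'(1) a(1)] w' by simp
    have tb: "Tbar w = Tbar ?w \<cdot> Ti a" using Tbar_mult_simple[OF w'(1) a(1) w'(2)] w'(3) by simp
    have "hbar (b \<cdot> T w) = hbar ((b \<cdot> T ?w) \<cdot> T (refl a))"
      unfolding tw using b w' a by (simp add: mult_assoc T_HC T_simple_HC)
    also have "\<dots> = hbar (b \<cdot> T ?w) \<cdot> Ti a" using b w' a by (intro hbar_mult_simple) (simp_all add: mult_HC T_HC)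
    also have "\<dots> = (hbar b \<cdot> Tbar ?w) \<cdot> Ti a" using less.hyps[OF l w'(1)] by simp
    also have "\<dots> = hbar b \<cdot> Tbar w" unfolding tb using b w' a by (intro mult_assoc) (simp_all add: hbar_HC Tbar_HC Ti_HC)
    finally show ?thesis .
  qed
qed

lemma hbar_mult: assumes b: "b \<in> HC" and c: "c \<in> HC" shows "hbar (b \<cdot> c) = hbar b \<cdot> hbar c"
  using c
proof (induction rule: HC_induct)
  case zero then show ?case using b by (simp add: mult_zero hbar_0 hbar_HC)
next
  case (basis a w) then show ?case using b by (simp add: mult_scale T_HC hbar_scale hbar_mult_T hbar_T Tbar_HC hbar_HC)
next
  case (add c d) then show ?case using b by (simp add: mult_add hbar_add hbar_HC)
qed

lemma hbar_Tbar: assumes w: "w \<in> carrier G" shows "hbar (Tbar w) = T w"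
proof -
  have "hbar (Tbar w) \<cdot> hbar (T (inv w)) = T \<one>"
    using hbar_mult[OF Tbar_HC[OF w] T_HC[of "inv w"]] w by (simp add: T_inv_Tbar hbar_T Tbar_one)
  then have "hbar (Tbar w) \<cdot> Tbar (inv w) = T \<one>" by (simp add: hbar_T)
  then have "hbar (Tbar w) \<cdot> (Tbar (inv w) \<cdot> T w) = T \<one> \<cdot> T w"
    using w by (simp add: mult_assoc[symmetric] hbar_HC Tbar_HC T_HC)
  then show ?thesis using w T_inv_Tbar(2)[of "inv w"] by (simp add: one_mult mult_one hbar_HC Tbar_HC T_HC)
qed

lemma hbar_hbar: "b \<in> HC \<Longrightarrow> hbar (hbar b) = b"
  by (induction rule: HC_induct) (simp_all add: hbar_0 hbar_scale hbar_T hbar_add hbar_Tbar)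

text \<open>A ring homomorphism on the Hecke algebra is only prescribed at \<open>v\<close>;
  this determines it on all scalars.\<close>

lemma laurent_generated:
  assumes "P 1" "P v" "P v_inv" "\<And>a b. P a \<Longrightarrow> P b \<Longrightarrow> P (a + b)" "\<And>a b. P a \<Longrightarrow> P b \<Longrightarrow> P (a * b)" "\<And>a. P a \<Longrightarrow> P (- a)"
  shows "P (a :: laurent)"
proof (induction a rule: laurent_single_induct)
  case (1 k n)
  have P0: "P 0" using assms(4)[OF assms(1) assms(6)[OF assms(1)]] by simp
  have pn: "P (of_nat m)" for m by (induction m) (simp_all add: P0 assms)
  have pi: "P (of_int m)" for m by (cases m rule: int_cases2) (simp_all add: pn assms)
  have pv: "P (v ^ m)" "P (v_inv ^ m)" for m by (induction m) (simp_all add: assms)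
  have s': "Poly_Mapping.single 0 n = (of_int n :: laurent)" using single_of_int[of n, where 'b = int] by simp
  note s = s'[symmetric]
  show ?case
  proof (cases "k \<ge> 0")
    case True
    have "Poly_Mapping.single k n = of_int n * v ^ nat k" unfolding s v_power using True by (simp add: mult_single)
    then show ?thesis using assms(5)[OF pi pv(1)] by simp
  next
    case False
    have "Poly_Mapping.single k n = of_int n * v_inv ^ nat (- k)" unfolding s v_inv_power using False by (simp add: mult_single)
    then show ?thesis using assms(5)[OF pi pv(2)] by simp
  qed
next
  case (2 a b) then show ?case by (rule assms(4))
qed

text \<open>The bar involution is introduced by a definite description, so the candidate
  must be shown to have the required properties and to be the only one.\<close>

lemma hecke_bar_eq: "hecke_bar G H = restrict hbar HC"
  unfolding hecke_bar_def
proof (rule the_equality)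
  have one: "hbar (T \<one>) = T \<one>" by (simp add: hbar_T Tbar_one)
  show "restrict hbar HC \<in> extensional HC \<and> restrict hbar HC \<in> ring_hom H H \<and>
    (\<forall>b\<in>HC. restrict hbar HC (restrict hbar HC b) = b) \<and>
    restrict hbar HC (hecke_scale v \<one>\<^bsub>H\<^esub>) = hecke_scale v_inv \<one>\<^bsub>H\<^esub> \<and>
    (\<forall>x\<in>carrier G. restrict hbar HC (hecke_basis x) = inv\<^bsub>H\<^esub> (hecke_basis (inv x)))"
  proof (intro conjI ballI)
    show "restrict hbar HC \<in> ring_hom H H"
      by (rule ring_hom_memI) (simp_all add: hbar_HC mult_HC hbar_mult H_add add_HC hbar_add H_one T_HC one)
    show "restrict hbar HC (hecke_scale v \<one>\<^bsub>H\<^esub>) = hecke_scale v_inv \<one>\<^bsub>H\<^esub>"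
      by (simp add: H_one scale_HC T_HC hbar_scale one barl_v)
  qed (simp_all add: hbar_HC hbar_hbar T_HC hbar_T Tbar_def)
next
  fix d assume d: "d \<in> extensional HC \<and> d \<in> ring_hom H H \<and> (\<forall>b\<in>HC. d (d b) = b) \<and>
    d (hecke_scale v \<one>\<^bsub>H\<^esub>) = hecke_scale v_inv \<one>\<^bsub>H\<^esub> \<and>
    (\<forall>x\<in>carrier G. d (hecke_basis x) = inv\<^bsub>H\<^esub> (hecke_basis (inv x)))"
  let ?o = "T \<one>"
  have oHC: "?o \<in> HC" by (simp add: T_HC)
  have dm: "d (b \<cdot> c) = d b \<cdot> d c" "d (b + c) = d b + d c" if "b \<in> HC" "c \<in> HC" for b c
    using d that ring_hom_mult[of d H H b c] ring_hom_add[of d H H b c] by (simp_all add: H_add)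
  have d1: "d ?o = ?o" using d ring_hom_one[of d H H] by (simp add: H_one)
  have dv: "d (hecke_scale v ?o) = hecke_scale v_inv ?o" using d by (simp add: H_one)
  have dvi: "d (hecke_scale v_inv ?o) = hecke_scale v ?o"
    using d dv scale_HC[OF oHC, of v] by metis
  have d0: "d 0 = 0" using dm(2)[OF zero_HC zero_HC] by simp
  have ds: "d (hecke_scale a ?o) = hecke_scale (barl a) ?o" for a
  proof (induction a rule: laurent_generated)
    case 1 then show ?case using d1 by simp
  next
    case 2 then show ?case using dv by (simp add: barl_v)
  next
    case 3 then show ?case using dvi by (simp add: barl_v)
  next
    case (4 a b) then show ?case using dm(2)[OF scale_HC[OF oHC, of a] scale_HC[OF oHC, of b]]
      by (simp add: hecke_scale_add_left barl_add)
  next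
    case (5 a b)
    have e: "hecke_scale c ?o \<cdot> hecke_scale c' ?o = hecke_scale (c * c') ?o" for c c'
      by (simp add: scale_mult mult_scale oHC scale_HC one_mult hecke_scale_scale mult.commute)
    show ?case using dm(1)[OF scale_HC[OF oHC, of a] scale_HC[OF oHC, of b]] 5 by (simp add: e barl_mult)
  next
    case (6 a)
    have "hecke_scale (- a) ?o + hecke_scale a ?o = 0" by (simp add: hecke_scale_add_left[symmetric])
    then have "d (hecke_scale (- a) ?o) + d (hecke_scale a ?o) = 0"
      using dm(2)[OF scale_HC[OF oHC, of "- a"] scale_HC[OF oHC, of a]] d0 by simp
    then have "d (hecke_scale (- a) ?o) = - hecke_scale (barl a) ?o" using 6 by (simp add: eq_neg_iff_add_eq_0)
    also have "\<dots> = hecke_scale (barl (- a)) ?o"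
    proof -
      have "hecke_scale (barl (- a)) ?o + hecke_scale (barl a) ?o = 0"
        by (simp add: hecke_scale_add_left[symmetric] barl_minus)
      then show ?thesis by (metis eq_neg_iff_add_eq_0)
    qed
    finally show ?case .
  qed
  have "d b = hbar b" if "b \<in> HC" for b
    using that
  proof (induction rule: HC_induct)
    case zero then show ?case by (simp add: d0 hbar_0)
  next
    case (add b c) then show ?case by (simp add: dm hbar_add)
  next
    case (basis a w)
    have e: "hecke_scale c ?o \<cdot> b = hecke_scale c b" if "b \<in> HC" for c b using that by (simp add: scale_mult one_mult oHC)
    have "d (hecke_scale a (T w)) = d (hecke_scale a ?o \<cdot> T w)" using e basis T_HC by simp
    also have "\<dots> = hecke_scale (barl a) ?o \<cdot> Tbar w" using dm(1)[OF scale_HC[OF oHC] T_HC[OF basis]] ds d basis by (simp add: Tbar_def)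
    finally show ?case using e[OF Tbar_HC[OF basis]] by (simp add: hbar_scale hbar_T)
  qed
  then show "d = restrict hbar HC" using d by (intro extensionalityI[of _ HC]) auto
qed

section \<open>The Kazhdan-Lusztig basis\<close>

lemma coef_mult_simple:
  assumes b: "b \<in> HC" and a: "a \<in> \<Delta>" and y: "y \<in> carrier G"
  shows "coef (b \<cdot> T (refl a)) y = coef b (y \<otimes> refl a) + (if act y a \<in> Pos then 0 else (v_inv - v) * coef b y)"
  using b
proof (induction rule: HC_induct)
  case zero then show ?case using a by (simp add: zero_mult T_simple_HC)
next
  case (add b c) then show ?case using a by (simp add: add_mult T_simple_HC lookup_add algebra_simps)
next
  case (basis c w)
  note ra = simple_car[OF a] and aR = simple_R[OF a]
  have eq: "w \<otimes> refl a = y \<longleftrightarrow> w = y \<otimes> refl a"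
    using mult_refl_refl[OF basis aR] mult_refl_refl[OF y aR] by metis
  have "coef (T w \<cdot> T (refl a)) y = coef (T w) (y \<otimes> refl a) + (if act y a \<in> Pos then 0 else (v_inv - v) * coef (T w) y)"
    unfolding T_mult_simple[OF basis a] by (auto simp: lookup_add lookup_hecke_basis lookup_hecke_scale eq)
  then show ?case using basis a by (simp add: scale_mult T_HC T_simple_HC lookup_hecke_scale algebra_simps)
qed

text \<open>Unitriangularity with respect to length, from which the uniqueness of the
  Kazhdan-Lusztig basis follows. The induction step is multiplication by the inverse of a
  generator, which changes the length by at most one.\<close>

lemma coef_Tbar:
  "w \<in> carrier G \<Longrightarrow> coef (Tbar w) w = 1 \<and> (\<forall>y. coef (Tbar w) y \<noteq> 0 \<longrightarrow> y = w \<or> len y < len w)"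
proof (induction "len w" arbitrary: w rule: less_induct)
  case less
  show ?case
  proof (cases "w = \<one>")
    case True then show ?thesis by (simp add: Tbar_one lookup_hecke_basis)
  next
    case False
    then obtain a where a: "a \<in> \<Delta>" "act w a \<notin> Pos" using right_descent less.prems by blast
    let ?w = "w \<otimes> refl a"
    have w': "?w \<in> carrier G" "act ?w a \<in> Pos" "?w \<otimes> refl a = w"
      using less.prems a simple_car simple_R by (simp_all add: act_mult_refl_self_Pos mult_refl_refl)
    have l: "len w = Suc (len ?w)" using len_mult_simple'[OF less.prems a] by simp
    have IH: "coef (Tbar ?w) ?w = 1" "\<And>y. coef (Tbar ?w) y \<noteq> 0 \<Longrightarrow> y = ?w \<or> len y < len ?w"
      using less.hyps[of ?w] w' l by auto
    have tb: "Tbar w = Tbar ?w \<cdot> T (refl a) + hecke_scale (v - v_inv) (Tbar ?w)"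
      using Tbar_mult_simple[OF w'(1) a(1) w'(2)] w'(3) mult_Ti[OF Tbar_HC[OF w'(1)] a(1)] by simp
    have cf: "coef (Tbar w) y = coef (Tbar ?w) (y \<otimes> refl a) + (if act y a \<in> Pos then 0 else (v_inv - v) * coef (Tbar ?w) y)
        + (v - v_inv) * coef (Tbar ?w) y" if "y \<in> carrier G" for y
      unfolding tb by (simp add: lookup_add lookup_hecke_scale coef_mult_simple[OF Tbar_HC[OF w'(1)] a(1) that])
    have "w \<noteq> ?w" using l by (metis n_not_Suc_n)
    then have z: "coef (Tbar ?w) w = 0" using IH(2)[of w] l by (metis Suc_lessD less_irrefl lessI)
    have "coef (Tbar w) w = 1" using cf[OF less.prems] z IH(1) by simp
    moreover have "y = w \<or> len y < len w" if y: "coef (Tbar w) y \<noteq> 0" for y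
    proof -
      have yc: "y \<in> carrier G" using Tbar_HC[OF less.prems] y by (auto simp: HC_iff in_keys_iff)
      have "coef (Tbar w) y = 0" if "coef (Tbar ?w) (y \<otimes> refl a) = 0" "coef (Tbar ?w) y = 0"
        unfolding cf[OF yc] that by simp
      then have "coef (Tbar ?w) (y \<otimes> refl a) \<noteq> 0 \<or> coef (Tbar ?w) y \<noteq> 0" using y by blast
      then show ?thesis
      proof
        assume "coef (Tbar ?w) y \<noteq> 0" then show ?thesis using IH(2)[of y] l by auto
      next
        assume "coef (Tbar ?w) (y \<otimes> refl a) \<noteq> 0"
        then have "y \<otimes> refl a = ?w \<or> len (y \<otimes> refl a) < len ?w" by (rule IH(2))
        then show ?thesis
        proof
          assume e: "y \<otimes> refl a = ?w"
          have "y \<otimes> refl a \<otimes> refl a = w" unfolding e by (rule w'(3))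
          then have "y = w" unfolding mult_refl_refl[OF yc simple_R[OF a(1)]] .
          then show ?thesis ..
        next
          assume "len (y \<otimes> refl a) < len ?w"
          moreover have "len y \<le> Suc (len (y \<otimes> refl a))"
            using len_mult_simple[OF yc a(1)] len_mult_simple'[OF yc a(1)] by (cases "act y a \<in> Pos") auto
          ultimately show ?thesis using l by simp
        qed
      qed
    qed
    ultimately show ?thesis by blast
  qed
qed

text \<open>At an element of maximal length in the support, the coefficient is itself
  invariant under the bar involution, but it only has positive powers of
  \<open>v\<close>.\<close>

lemma bar_invariant_zero:
  assumes b: "b \<in> HC" and inv: "hbar b = b" and p: "\<And>y. vge 1 (coef b y)"
  shows "b = 0"
proof (rule ccontr)
  assume "b \<noteq> 0"
  then have ne: "Poly_Mapping.keys b \<noteq> {}" by simp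
  let ?L = "Max (len ` Poly_Mapping.keys b)"
  have "?L \<in> len ` Poly_Mapping.keys b" using ne by (intro Max_in) auto
  then obtain y where y: "y \<in> Poly_Mapping.keys b" "len y = ?L" by auto
  have m: "len w \<le> len y" if "w \<in> Poly_Mapping.keys b" for w
    unfolding y(2) by (rule Max_ge) (use that in auto)
  have wc: "w \<in> carrier G" if "w \<in> Poly_Mapping.keys b" for w using b that by (auto simp: HC_iff)
  have z: "coef (hecke_scale (barl (coef b w)) (Tbar w)) y = (if w = y then barl (coef b y) else 0)"
    if "w \<in> Poly_Mapping.keys b" for w
    using coef_Tbar[OF wc[OF that]] m[OF that] by (auto simp: lookup_hecke_scale)
  have "coef b y = coef (hbar b) y" using inv by simp
  also have "\<dots> = (\<Sum>w\<in>Poly_Mapping.keys b. if w = y then barl (coef b y) else 0)"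
    unfolding hbar_def lookup_sum by (rule sum.cong) (simp_all add: z)
  also have "\<dots> = barl (coef b y)" using y by simp
  finally have e: "coef b y = barl (coef b y)" .
  have "vle 0 (barl (coef b y))" by (rule barl_vge[OF vge_mono[OF p]]) simp
  then have "coef b y = 0" using vge_1_vle_0[OF p] e by simp
  then show False using y by (simp add: in_keys_iff)
qed

definition is_kl :: "'a \<Rightarrow> 'a hecke \<Rightarrow> bool" where
  "is_kl x b \<longleftrightarrow> b \<in> HC \<and> hbar b = b \<and> coef b x = 1 \<and>
    (\<forall>y. y \<noteq> x \<and> coef b y \<noteq> 0 \<longrightarrow> bless y x) \<and> (\<forall>y. y \<noteq> x \<longrightarrow> vge 1 (coef b y))"

lemma is_kl_vge_0: "is_kl x b \<Longrightarrow> vge 0 (coef b y)"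
  using vge_mono[of 1 "coef b y" 0] by (cases "y = x") (auto simp: is_kl_def)

lemma is_kl_ble: "is_kl x b \<Longrightarrow> coef b y \<noteq> 0 \<Longrightarrow> ble y x"
  using bless_ble[of y x] by (cases "y = x") (auto simp: is_kl_def)

lemma is_kl_unique: assumes "is_kl x b" "is_kl x c" shows "b = c"
proof -
  let ?d = "b + hecke_scale (- 1) c"
  have cf: "coef ?d y = coef b y - coef c y" for y by (simp add: lookup_add lookup_hecke_scale)
  have "?d = 0"
  proof (rule bar_invariant_zero)
    show "?d \<in> HC" using assms by (simp add: is_kl_def add_HC scale_HC)
    show "hbar ?d = ?d" using assms by (simp add: is_kl_def hbar_add hbar_scale barl_minus)
    show "vge 1 (coef ?d y)" for y
    proof (cases "y = x")
      case True then show ?thesis unfolding cf using assms by (simp add: is_kl_def)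
    next
      case False
      then have "vge 1 (coef b y)" "vge 1 (coef c y)" using assms by (simp_all add: is_kl_def)
      then show ?thesis unfolding cf diff_conv_add_uminus by (intro vge_add vge_minus)
    qed
  qed
  then have "coef b y - coef c y = 0" for y using cf[of y] by simp
  then show ?thesis by (intro poly_mapping_eqI) simp
qed

text \<open>The construction of Kazhdan and Lusztig. For \<open>x = x' s > x'\<close>,
  multiply the element for \<open>x'\<close> by \<open>T s + v\<close>, which is bar
  invariant. The result has coefficients without negative powers of \<open>v\<close>; their
  constant terms are removed by subtracting integral multiples of the elements for smaller
  \<open>y\<close>. The lifting property keeps the support below \<open>x\<close>.\<close>

lemma is_kl_exists: "x \<in> carrier G \<Longrightarrow> \<exists>b. is_kl x b"
proof (induction "len x" arbitrary: x rule: less_induct)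
  case less
  show ?case
  proof (cases "x = \<one>")
    case True
    have "is_kl \<one> (T \<one>)" by (simp add: is_kl_def T_HC hbar_T Tbar_one lookup_hecke_basis)
    then show ?thesis using True by blast
  next
    case False
    then obtain a where a: "a \<in> \<Delta>" "act x a \<notin> Pos" using right_descent less.prems by blast
    note ra = simple_car[OF a(1)] and aR = simple_R[OF a(1)]
    let ?x = "x \<otimes> refl a"
    have x': "?x \<in> carrier G" "act ?x a \<in> Pos" "?x \<otimes> refl a = x"
      using less.prems a ra aR by (simp_all add: act_mult_refl_self_Pos mult_refl_refl)
    have l: "len x = Suc (len ?x)" using len_mult_simple'[OF less.prems a] by simp
    obtain b where b: "is_kl ?x b" using less.hyps[of ?x] x' l by auto
    have bH: "b \<in> HC" and bb: "hbar b = b" using b by (simp_all add: is_kl_def)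
    \<comment> \<open>Right multiplication of the element for \<open>x'\<close> by the
      Kazhdan-Lusztig generator.\<close>
    define c where "c = b \<cdot> T (refl a) + hecke_scale v b"
    have cH: "c \<in> HC" unfolding c_def using bH a by (simp add: add_HC mult_HC scale_HC T_simple_HC)
    have cbar: "hbar c = c"
    proof -
      have "hbar c = b \<cdot> T (refl a) + (hecke_scale (v - v_inv) b + hecke_scale v_inv b)"
        unfolding c_def using bH a(1) by (simp add: hbar_add hbar_mult_simple bb mult_Ti hbar_scale barl_v add.assoc)
      then show ?thesis unfolding c_def by (simp add: hecke_scale_add_left[symmetric])
    qed
    have cf: "coef c y = coef b (y \<otimes> refl a) + (if act y a \<in> Pos then v else v_inv) * coef b y" if "y \<in> carrier G" for y
      unfolding c_def by (simp add: lookup_add lookup_hecke_scale coef_mult_simple[OF bH a(1) that] algebra_simps)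
    have st: "bstep ?x x" using bstep_simple[OF x'(1) a(1) x'(2)] x'(3) by simp
    have c_car: "y \<in> carrier G" if "coef c y \<noteq> 0" for y using cH that by (auto simp: HC_iff in_keys_iff)
    have c_ble: "ble y x" if y: "coef c y \<noteq> 0" for y
    proof -
      note yc = c_car[OF y]
      have "coef b (y \<otimes> refl a) \<noteq> 0 \<or> coef b y \<noteq> 0" using cf[OF yc] y by auto
      then show ?thesis
      proof
        assume "coef b y \<noteq> 0"
        then have "ble y ?x" by (rule is_kl_ble[OF b])
        then show ?thesis using st by (rule rtranclp.rtrancl_into_rtrancl)
      next
        assume "coef b (y \<otimes> refl a) \<noteq> 0"
        then have "ble (y \<otimes> refl a) ?x" by (rule is_kl_ble[OF b])
        from ble_lift[OF this a(1)] have "ble y ?x \<or> ble y x"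
          using mult_refl_refl[OF yc aR] x'(3) by simp
        then show ?thesis using st by (auto intro: rtranclp.rtrancl_into_rtrancl)
      qed
    qed
    have c0: "vge 0 (coef c y)" for y
    proof (cases "y \<in> carrier G")
      case yc: True
      have 1: "vge 0 (coef b (y \<otimes> refl a))" by (rule is_kl_vge_0[OF b])
      have 2: "vge 0 ((if act y a \<in> Pos then v else v_inv) * coef b y)"
      proof (cases "act y a \<in> Pos")
        case True
        then show ?thesis using vge_mono[OF vge_mult[OF vge_v is_kl_vge_0[OF b]], of 0] by simp
      next
        case False
        then have "y \<noteq> ?x" using x'(2) by auto
        then have "vge 1 (coef b y)" using b by (simp add: is_kl_def)
        then show ?thesis using vge_mult[OF vge_v_inv, of 1] False by simp
      qed
      show ?thesis unfolding cf[OF yc] by (rule vge_add[OF 1 2])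
    next
      case False then have "coef c y = 0" using c_car by blast
      then show ?thesis by simp
    qed
    have bx: "coef b x = 0"
    proof (rule ccontr)
      assume n: "coef b x \<noteq> 0"
      have "x \<noteq> ?x" using l by (metis n_not_Suc_n)
      then have "bless x ?x" using b n unfolding is_kl_def by blast
      then show False using bless_len[of x ?x] l by simp
    qed
    have cx: "coef c x = 1" using cf[OF less.prems] bx b by (simp add: is_kl_def)
    define Y where "Y = {y \<in> Poly_Mapping.keys c. y \<noteq> x}"
    \<comment> \<open>The constant terms that have to be cancelled.\<close>
    define \<mu> where "\<mu> y = Poly_Mapping.lookup (coef c y) 0" for y
    have Yf: "finite Y" by (simp add: Y_def)
    have Yx: "bless y x" if "y \<in> Y" for y
      using that ble_neq_bless[OF c_ble] by (auto simp: Y_def in_keys_iff)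
    have "\<forall>y\<in>Y. \<exists>d. is_kl y d" using less.hyps bless_len[OF Yx] bless_carrier[OF Yx] by blast
    then obtain k where k: "\<And>y. y \<in> Y \<Longrightarrow> is_kl y (k y)" by metis
    define d where "d = c + (\<Sum>y\<in>Y. hecke_scale (- of_int (\<mu> y)) (k y))"
    have df: "coef d z = coef c z - (\<Sum>y\<in>Y. of_int (\<mu> y) * coef (k y) z)" for z
      unfolding d_def by (simp add: lookup_add lookup_sum lookup_hecke_scale sum_negf)
    have sumH: "(\<Sum>y\<in>K. hecke_scale (- of_int (\<mu> y)) (k y)) \<in> HC \<and>
        hbar (\<Sum>y\<in>K. hecke_scale (- of_int (\<mu> y)) (k y)) = (\<Sum>y\<in>K. hecke_scale (- of_int (\<mu> y)) (k y))"
      if "finite K" "K \<subseteq> Y" for K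
      using that
    proof (induction K rule: finite_induct)
      case empty then show ?case by (simp add: zero_HC hbar_0)
    next
      case (insert y K)
      then show ?case using k[of y] by (simp add: is_kl_def add_HC scale_HC hbar_add hbar_scale barl_minus)
    qed
    have "is_kl x d" unfolding is_kl_def
    proof (intro conjI allI impI)
      show "d \<in> HC" "hbar d = d" unfolding d_def using sumH[OF Yf order_refl] cH cbar by (simp_all add: add_HC hbar_add)
      have "coef (k y) x = 0" if "y \<in> Y" for y
      proof (rule ccontr)
        assume n: "coef (k y) x \<noteq> 0"
        have ll: "len y < len x" by (rule bless_len[OF Yx[OF that]])
        then have "x \<noteq> y" by auto
        then have "bless x y" using k[OF that] n unfolding is_kl_def by blast
        then show False using bless_len[of x y] ll by simp
      qed
      then show "coef d x = 1" unfolding df cx by simp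
    next
      fix z assume z: "z \<noteq> x \<and> coef d z \<noteq> 0"
      show "bless z x"
      proof (cases "coef c z = 0")
        case False then show ?thesis using ble_neq_bless[OF c_ble] z by blast
      next
        case True
        then have "(\<Sum>y\<in>Y. of_int (\<mu> y) * coef (k y) z) \<noteq> 0" using z df by auto
        then obtain y where y: "y \<in> Y" "coef (k y) z \<noteq> 0" by (metis (no_types, lifting) mult_zero_right sum.neutral)
        have "ble z y" by (rule is_kl_ble[OF k[OF y(1)] y(2)])
        moreover have "ble y x" by (rule bless_ble[OF Yx[OF y(1)]])
        ultimately have "ble z x" by (rule rtranclp_trans)
        then show ?thesis using ble_neq_bless[of z x] z by simp
      qed
    next
      fix z assume z: "z \<noteq> x"
      have vs: "vge 1 (\<Sum>y\<in>Y - {z}. of_int (\<mu> y) * coef (k y) z)"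
      proof (rule vge_sum)
        fix y assume "y \<in> Y - {z}"
        then have "y \<in> Y" "z \<noteq> y" by auto
        then have "vge 1 (coef (k y) z)" using k[of y] by (simp add: is_kl_def)
        then show "vge 1 (of_int (\<mu> y) * coef (k y) z)" using vge_mult[OF vge_of_int, of 1] by simp
      qed
      show "vge 1 (coef d z)"
      proof (cases "z \<in> Y")
        case True
        have "(\<Sum>y\<in>Y. of_int (\<mu> y) * coef (k y) z) = of_int (\<mu> z) + (\<Sum>y\<in>Y - {z}. of_int (\<mu> y) * coef (k y) z)"
          using k[OF True] Yf True by (simp add: sum.remove is_kl_def)
        then have e: "coef d z = (coef c z - of_int (\<mu> z)) + - (\<Sum>y\<in>Y - {z}. of_int (\<mu> y) * coef (k y) z)" by (simp add: df)
        have "vge 1 (coef c z - of_int (\<mu> z))"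
        proof (rule vge_1_if_constant_0)
          show "vge 0 (coef c z - of_int (\<mu> z))"
            unfolding diff_conv_add_uminus by (intro vge_add vge_minus c0 vge_of_int)
          show "Poly_Mapping.lookup (coef c z - of_int (\<mu> z)) 0 = 0"
            by (simp add: lookup_minus lookup_of_int \<mu>_def)
        qed
        then show ?thesis unfolding e by (intro vge_add vge_minus vs)
      next
        case False
        then have "coef c z = 0" using z by (auto simp: Y_def in_keys_iff)
        then have e: "coef d z = - (\<Sum>y\<in>Y - {z}. of_int (\<mu> y) * coef (k y) z)" using False by (simp add: df)
        show ?thesis unfolding e by (intro vge_minus vs)
      qed
    qed
    then show ?thesis by blast
  qed
qed

lemma kl_basis_is_kl: assumes x: "x \<in> carrier G" shows "is_kl x (kl_basis G S H x)"
proof -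
  obtain b where b: "is_kl x b" using is_kl_exists[OF x] by blast
  have eq: "is_kl x c \<longleftrightarrow> c \<in> HC \<and> hecke_bar G H c = c \<and> coef c x = 1 \<and>
      (\<forall>y. y \<noteq> x \<and> coef c y \<noteq> 0 \<longrightarrow> bless y x) \<and> (\<forall>y. y \<noteq> x \<longrightarrow> (\<exists>p. coef c y = v * laurent_of_poly p))" for c
    unfolding is_kl_def hecke_bar_eq vge_1_iff by auto
  have "kl_basis G S H x = b"
    unfolding kl_basis_def eq[symmetric] using b is_kl_unique by (intro the_equality) auto
  then show ?thesis using b by simp
qed

end


section \<open>Coordinates on the antispherical module\<close>

lemma tensor_relations_sub:
  "f \<in> tensor_relations G S U H \<Longrightarrow> g \<in> tensor_relations G S U H \<Longrightarrow> f - g \<in> tensor_relations G S U H"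
  unfolding tensor_relations_def by (rule group_closure.diff)

lemma tensor_class_eq_iff:
  "tensor_class G S U H f = tensor_class G S U H g \<longleftrightarrow> f - g \<in> tensor_relations G S U H"
proof
  assume e: "tensor_class G S U H f = tensor_class G S U H g"
  have "f \<in> tensor_class G S U H f" by (simp add: tensor_class_def tensor_relations_def)
  then show "f - g \<in> tensor_relations G S U H" unfolding e by (simp add: tensor_class_def)
next
  assume r: "f - g \<in> tensor_relations G S U H"
  have "k - f \<in> tensor_relations G S U H \<longleftrightarrow> k - g \<in> tensor_relations G S U H" for k
  proof -
    have 1: "k - g = (k - f) - (- (f - g))" "k - f = (k - g) - (f - g)" by simp_all
    have 2: "- (f - g) \<in> tensor_relations G S U H"
      using r unfolding tensor_relations_def by (simp only: group_closure_minus_iff)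
    show ?thesis using 1 2 r tensor_relations_sub by metis
  qed
  then show "tensor_class G S U H f = tensor_class G S U H g" by (simp add: tensor_class_def)
qed

text \<open>The input from geometry. \<open>fpart\<close> is a retraction of the group onto
  \<open>U\<close>, for the affine Weyl group the linear part. The condition
  \<open>fpart_increase\<close> says that crossing the same kind of wall upwards from two
  dominant alcoves increases the length of the relative finite part.\<close>

locale antispherical = hecke_action +
  fixes fpart :: "'a \<Rightarrow> 'a"
  assumes fpart_U: "w \<in> carrier G \<Longrightarrow> fpart w \<in> U"
    and fpart_mult: "w \<in> carrier G \<Longrightarrow> w' \<in> carrier G \<Longrightarrow> fpart (w \<otimes> w') = fpart w \<otimes> fpart w'"
    and fpart_id: "u \<in> U \<Longrightarrow> fpart u = u"
    and fpart_increase: "y \<in> Wp \<Longrightarrow> z \<in> Wp \<Longrightarrow> a \<in> \<Delta> \<Longrightarrow> act y a \<in> Pos \<Longrightarrow> act z a \<in> Pos \<Longrightarrow>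
      y \<otimes> refl a \<in> Wp \<Longrightarrow> z \<otimes> refl a \<in> Wp \<Longrightarrow>
      len (fpart (y \<otimes> inv z)) < len (fpart (y \<otimes> refl a \<otimes> inv z))"
begin

text \<open>The decomposition into a finite part and a shortest representative, chosen by
  description but unique by \<open>coset_unique\<close>.\<close>

definition cosetpair :: "'a \<Rightarrow> 'a \<times> 'a" where
  "cosetpair w = (SOME p. fst p \<in> U \<and> snd p \<in> Wp \<and> w = fst p \<otimes> snd p)"
definition upart :: "'a \<Rightarrow> 'a" where "upart w = fst (cosetpair w)"
definition xpart :: "'a \<Rightarrow> 'a" where "xpart w = snd (cosetpair w)"

lemma parts: assumes "w \<in> carrier G" shows "upart w \<in> U" "xpart w \<in> Wp" "w = upart w \<otimes> xpart w"
proof -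
  obtain u x where "u \<in> U" "x \<in> Wp" "w = u \<otimes> x" using coset_decomp[OF assms] by blast
  then have "\<exists>p. fst p \<in> U \<and> snd p \<in> Wp \<and> w = fst p \<otimes> snd p" by (intro exI[of _ "(u, x)"]) simp
  from someI_ex[OF this] show "upart w \<in> U" "xpart w \<in> Wp" "w = upart w \<otimes> xpart w"
    by (simp_all add: upart_def xpart_def cosetpair_def)
qed

lemma parts_mult: assumes "u \<in> U" "x \<in> Wp" shows "upart (u \<otimes> x) = u" "xpart (u \<otimes> x) = x"
proof -
  have c: "u \<otimes> x \<in> carrier G" using assms U_carrier Wp_carrier by simp
  from coset_unique[OF parts(1)[OF c] assms(1) parts(2)[OF c] assms(2) parts(3)[OF c, symmetric]]
  show "upart (u \<otimes> x) = u" "xpart (u \<otimes> x) = x" by simp_all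
qed

text \<open>The coefficient of $N_z$ in $1 \otimes b$, as a linear functional on the Hecke
  algebra: for \<open>w = u x\<close> with \<open>u\<close> in \<open>U\<close> and
  \<open>x\<close> a shortest representative, $1 \otimes H_w = (-v)^{\ell(u)} N_x$.\<close>

definition ncoef :: "'a \<Rightarrow> 'a hecke \<Rightarrow> laurent" where
  "ncoef z = lin_ext (\<lambda>w. if xpart w = z then (- v) ^ len (upart w) else 0)"

lemma ncoef_add: "ncoef z (b + c) = ncoef z b + ncoef z c" by (simp add: ncoef_def lin_ext_add)
lemma ncoef_scale: "ncoef z (hecke_scale a b) = a * ncoef z b" by (simp add: ncoef_def lin_ext_scale)
lemma ncoef_0: "ncoef z 0 = 0" by (simp add: ncoef_def lin_ext_0)
lemma ncoef_T: "u \<in> U \<Longrightarrow> x \<in> Wp \<Longrightarrow> ncoef z (T (u \<otimes> x)) = (if x = z then (- v) ^ len u else 0)"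
  unfolding ncoef_def lin_ext_basis by (simp only: parts_mult)
lemma ncoef_T': "x \<in> Wp \<Longrightarrow> ncoef z (T x) = (if x = z then 1 else 0)"
  using ncoef_T[OF U_one, of x z] Wp_carrier by (simp add: len_one)

text \<open>The functional is well defined on the tensor product if left multiplication by
  \<open>T (refl a)\<close> acts by \<open>- v\<close>. The generator only changes the
  finite part of \<open>w\<close>, so this is the computation in the one-dimensional
  representation of the Hecke algebra of \<open>U\<close>.\<close>

lemma ncoef_simple_mult:
  assumes b: "b \<in> HC" and a: "a \<in> \<Delta>f" shows "ncoef z (T (refl a) \<cdot> b) = - v * ncoef z b"
  using b
proof (induction rule: HC_induct)
  case zero then show ?case using simplef[OF a] by (simp add: mult_zero T_HC ncoef_0)
next
  case (add b c) then show ?case using simplef[OF a] by (simp add: mult_add T_HC ncoef_add algebra_simps)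
next
  case (basis c w)
  note sa = simplef[OF a]
  obtain u x where ux: "u \<in> U" "x \<in> Wp" "w = u \<otimes> x" using coset_decomp[OF basis] by blast
  have uc: "u \<in> carrier G" "x \<in> carrier G" using ux U_carrier Wp_carrier by auto
  have su: "refl a \<otimes> u \<in> U" using U_mult refl_U a ux by blast
  have sw: "refl a \<otimes> w = (refl a \<otimes> u) \<otimes> x" using sa uc ux by (simp add: m_assoc)
  have lw: "len w = len u + len x" "len (refl a \<otimes> w) = len (refl a \<otimes> u) + len x"
    using len_U_Wp ux su sw by auto
  have "ncoef z (T (refl a) \<cdot> T w) = - v * ncoef z (T w)"
  proof (cases "act (inv w) a \<in> Pos")
    case True
    then have "len (refl a \<otimes> w) = Suc (len w)" using len_simple_mult[OF basis] sa by blast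
    then have "len (refl a \<otimes> u) = Suc (len u)" using lw by simp
    then show ?thesis using True simple_T_mult[OF basis, of a] sa sw ncoef_T[OF su ux(2)] ncoef_T[OF ux(1,2)] ux(3) by simp
  next
    case False
    then have "len w = Suc (len (refl a \<otimes> w))" using len_simple_mult'[OF basis] sa by blast
    then have l: "len u = Suc (len (refl a \<otimes> u))" using lw by simp
    \<comment> \<open>\<open>- v\<close> is a root of the quadratic relation.\<close>
    have "(- v) ^ n + (v_inv - v) * (- v) ^ Suc n = - v * (- v) ^ Suc n" for n
    proof -
      have "(- v) ^ n + (v_inv - v) * (- v) ^ Suc n = (- v) ^ n * (1 - v_inv * v + v * v)"
        unfolding power_Suc by (simp only: ring_distribs mult_minus_left mult_minus_right mult.left_commute mult.commute[of _ "(- v) ^ n"] diff_conv_add_uminus minus_mult_minus mult_1_right) simp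
      also have "\<dots> = - v * (- v) ^ Suc n" by (simp add: v_v_inv algebra_simps)
      finally show ?thesis .
    qed
    then show ?thesis
      using False simple_T_mult[OF basis, of a] sa sw ncoef_T[OF su ux(2)] ncoef_T[OF ux(1,2)] ux(3) l
      by (simp add: ncoef_add ncoef_scale del: power_Suc)
  qed
  then show ?case using basis sa by (simp add: mult_scale T_HC ncoef_scale algebra_simps)
qed

lemma ncoef_U_mult: "u \<in> U \<Longrightarrow> b \<in> HC \<Longrightarrow> ncoef z (T u \<cdot> b) = (- v) ^ len u * ncoef z b"
proof (induction "len u" arbitrary: u b rule: less_induct)
  case less
  note uc = U_carrier[OF less.prems(1)]
  show ?case
  proof (cases "u = \<one>")
    case True then show ?thesis using less.prems by (simp add: one_mult len_one)
  next
    case False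
    then obtain a where a: "a \<in> \<Delta>f" "act (inv u) a \<notin> Pos" using U_left_descent less.prems by blast
    note sa = simplef[OF a(1)]
    let ?u = "refl a \<otimes> u"
    have u': "?u \<in> U" using U_mult refl_U a less.prems by blast
    note uc' = U_carrier[OF u']
    have l: "len u = Suc (len ?u)" using len_simple_mult'[OF uc] sa a by blast
    have e: "refl a \<otimes> ?u = u" using refl_refl_mult[OF uc] sa by blast
    have "act (inv ?u) a \<in> Pos"
      using uc sa a(2) act_mult_refl_self_Pos[of "inv u" a] by (simp add: inv_mult_group inv_refl)
    then have "T (refl a) \<cdot> T ?u = T u" using simple_T_mult[OF uc', of a] sa e by simp
    then have "ncoef z (T u \<cdot> b) = ncoef z (T (refl a) \<cdot> (T ?u \<cdot> b))"
      using mult_assoc[of "T (refl a)" "T ?u" b] sa uc' less.prems T_HC by simp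
    also have "\<dots> = - v * ((- v) ^ len ?u * ncoef z b)"
      using ncoef_simple_mult[OF mult_HC[OF T_HC[OF uc'] less.prems(2)] a(1)] less.hyps[OF _ u' less.prems(2)] l by simp
    finally show ?thesis using l by simp
  qed
qed

lemma sign_character_lin: "sign_character G S = lin_ext (\<lambda>w. (- v) ^ len w)"
  by (rule ext) (simp add: sign_character_def lin_ext_def)

lemma ncoef_parabolic:
  assumes k: "k \<in> parabolic_hecke U" and b: "b \<in> HC"
  shows "ncoef z (k \<cdot> b) = sign_character G S k * ncoef z b"
proof -
  have ku: "Poly_Mapping.keys k \<subseteq> U" using k by (simp add: parabolic_hecke_def)
  have "k \<in> HC \<and> ncoef z (k \<cdot> b) = sign_character G S k * ncoef z b"
  proof (rule hecke_induct[OF ku])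
    show "0 \<in> HC \<and> ncoef z (0 \<cdot> b) = sign_character G S 0 * ncoef z b"
      using b by (simp add: zero_HC zero_mult ncoef_0 sign_character_lin lin_ext_0)
  next
    fix a w assume w: "w \<in> U"
    show "hecke_scale a (T w) \<in> HC \<and> ncoef z (hecke_scale a (T w) \<cdot> b) = sign_character G S (hecke_scale a (T w)) * ncoef z b"
      using b w U_carrier[OF w]
      by (simp add: scale_HC T_HC scale_mult ncoef_scale ncoef_U_mult sign_character_lin lin_ext_scale lin_ext_basis mult.assoc)
  next
    fix c d assume "c \<in> HC \<and> ncoef z (c \<cdot> b) = sign_character G S c * ncoef z b"
      "d \<in> HC \<and> ncoef z (d \<cdot> b) = sign_character G S d * ncoef z b"
    then show "c + d \<in> HC \<and> ncoef z ((c + d) \<cdot> b) = sign_character G S (c + d) * ncoef z b"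
      using b by (simp add: add_HC add_mult ncoef_add sign_character_lin lin_ext_add algebra_simps)
  qed
  then show ?thesis ..
qed

section \<open>The antispherical module as a tensor product\<close>

abbreviation Rel :: "'a pre_tensor set" where "Rel \<equiv> tensor_relations G S U H"

lemma Rel_0: "0 \<in> Rel" by (simp add: tensor_relations_def)
lemma Rel_minus: "f \<in> Rel \<Longrightarrow> - f \<in> Rel" by (simp add: tensor_relations_def)
lemma Rel_add: "f \<in> Rel \<Longrightarrow> g \<in> Rel \<Longrightarrow> f + g \<in> Rel"
  unfolding tensor_relations_def by (rule group_closure_add)
lemma Rel_sum: "(\<And>x. x \<in> K \<Longrightarrow> f x \<in> Rel) \<Longrightarrow> (\<Sum>x\<in>K. f x) \<in> Rel"
  by (induction K rule: infinite_finite_induct) (simp_all add: Rel_0 Rel_add)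
lemma Rel_left: "b \<in> HC \<Longrightarrow> pure_tensor (a + a') b - pure_tensor a b - pure_tensor a' b \<in> Rel"
  unfolding tensor_relations_def by (rule group_closure.base) blast
lemma Rel_right: "b \<in> HC \<Longrightarrow> b' \<in> HC \<Longrightarrow> pure_tensor a (b + b') - pure_tensor a b - pure_tensor a b' \<in> Rel"
  unfolding tensor_relations_def by (rule group_closure.base) blast
lemma Rel_balanced: "k \<in> parabolic_hecke U \<Longrightarrow> b \<in> HC \<Longrightarrow>
    pure_tensor (a * sign_character G S k) b - pure_tensor a (k \<cdot> b) \<in> Rel"
  unfolding tensor_relations_def by (rule group_closure.base) blast

lemma Rel_zero_left: assumes "b \<in> HC" shows "pure_tensor 0 b \<in> Rel"
  using Rel_minus[OF Rel_left[OF assms, of 0 0]] by simp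
lemma Rel_zero_right: "pure_tensor a 0 \<in> Rel"
  using Rel_minus[OF Rel_right[OF zero_HC zero_HC, of a]] by simp

text \<open>The elements $N_z$ span: the Hecke algebra element of the finite part can be
  moved across the tensor sign.\<close>

lemma pure_tensor_expand:
  assumes K: "finite K" "K \<subseteq> Wp" and b: "\<And>w. w \<in> Poly_Mapping.keys b \<Longrightarrow> w \<in> carrier G \<and> xpart w \<in> K"
  shows "pure_tensor 1 b - (\<Sum>z\<in>K. pure_tensor (ncoef z b) (T z)) \<in> Rel"
proof -
  let ?E = "\<lambda>b. \<Sum>z\<in>K. pure_tensor (ncoef z b) (T z)"
  let ?X = "{w \<in> carrier G. xpart w \<in> K}"
  have TH: "T z \<in> HC" if "z \<in> K" for z using that K Wp_carrier T_HC by blast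
  have "b \<in> HC \<and> pure_tensor 1 b - ?E b \<in> Rel"
  proof (rule hecke_induct[of b ?X])
    show "Poly_Mapping.keys b \<subseteq> ?X" using b by blast
    have "?E 0 \<in> Rel" by (intro Rel_sum) (simp add: ncoef_0 Rel_zero_left TH)
    then show "0 \<in> HC \<and> pure_tensor 1 0 - ?E 0 \<in> Rel"
      using tensor_relations_sub[OF Rel_zero_right] zero_HC by blast
  next
    fix a w assume "w \<in> ?X"
    then have w: "w \<in> carrier G" "xpart w \<in> K" by auto
    define u x where "u = upart w" and "x = xpart w"
    have ux: "u \<in> U" "x \<in> Wp" "w = u \<otimes> x" "x \<in> K" using parts[OF w(1)] w(2) by (simp_all add: u_def x_def)
    have uc: "u \<in> carrier G" "x \<in> carrier G" using ux U_carrier Wp_carrier by auto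
    let ?k = "hecke_scale a (T u)"
    have k: "?k \<in> parabolic_hecke U" "sign_character G S ?k = a * (- v) ^ len u"
      using keys_hecke_scale[of a "T u"] ux(1)
      by (auto simp: parabolic_hecke_def keys_hecke_basis sign_character_lin lin_ext_scale lin_ext_basis)
    have kx: "?k \<cdot> T x = hecke_scale a (T w)"
      using T_mult[OF uc] len_U_Wp[OF ux(1,2)] ux(3) uc by (simp add: scale_mult T_HC)
    have "pure_tensor (a * (- v) ^ len u) (T x) - pure_tensor 1 (hecke_scale a (T w)) \<in> Rel"
      using Rel_balanced[OF k(1) T_HC[OF uc(2)], of 1] unfolding kx k(2) by simp
    from Rel_minus[OF this]
    have 1: "pure_tensor 1 (hecke_scale a (T w)) - pure_tensor (a * (- v) ^ len u) (T x) \<in> Rel" by simp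
    have ph: "ncoef z (hecke_scale a (T w)) = (if x = z then a * (- v) ^ len u else 0)" for z
      unfolding ux(3) ncoef_scale ncoef_T[OF ux(1,2)] by simp
    have "?E (hecke_scale a (T w)) = pure_tensor (a * (- v) ^ len u) (T x) + (\<Sum>z\<in>K - {x}. pure_tensor 0 (T z))"
    proof -
      have "(\<Sum>z\<in>K - {x}. pure_tensor (if x = z then a * (- v) ^ len u else 0) (T z)) = (\<Sum>z\<in>K - {x}. pure_tensor 0 (T z))"
        by (rule sum.cong[OF refl]) (metis DiffD2 singletonI)
      then show ?thesis unfolding sum.remove[OF K(1) ux(4)] ph by (simp only: if_True simp_thms)
    qed
    moreover have "(\<Sum>z\<in>K - {x}. pure_tensor 0 (T z)) \<in> Rel" by (intro Rel_sum Rel_zero_left TH) blast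
    ultimately have "pure_tensor 1 (hecke_scale a (T w)) - ?E (hecke_scale a (T w)) \<in> Rel"
      using tensor_relations_sub[OF 1] by (simp add: algebra_simps)
    then show "hecke_scale a (T w) \<in> HC \<and> pure_tensor 1 (hecke_scale a (T w)) - ?E (hecke_scale a (T w)) \<in> Rel"
      using w by (simp add: scale_HC T_HC)
  next
    fix c d assume c: "c \<in> HC \<and> pure_tensor 1 c - ?E c \<in> Rel" and d: "d \<in> HC \<and> pure_tensor 1 d - ?E d \<in> Rel"
    have 1: "pure_tensor 1 (c + d) - pure_tensor 1 c - pure_tensor 1 d \<in> Rel" using Rel_right c d by blast
    have 2: "(\<Sum>z\<in>K. pure_tensor (ncoef z (c + d)) (T z) - pure_tensor (ncoef z c) (T z) - pure_tensor (ncoef z d) (T z)) \<in> Rel"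
      unfolding ncoef_add by (intro Rel_sum Rel_left TH)
    have 3: "(pure_tensor 1 (c + d) - pure_tensor 1 c - pure_tensor 1 d) + ((pure_tensor 1 c - ?E c) + (pure_tensor 1 d - ?E d)) \<in> Rel"
      using Rel_add[OF 1 Rel_add] c d by blast
    have "(\<Sum>z\<in>K. pure_tensor (ncoef z (c + d)) (T z) - pure_tensor (ncoef z c) (T z) - pure_tensor (ncoef z d) (T z))
        = ?E (c + d) - ?E c - ?E d" by (simp only: sum_subtractf)
    from tensor_relations_sub[OF 3 2[unfolded this]] have "pure_tensor 1 (c + d) - ?E (c + d) \<in> Rel" by simp
    then show "c + d \<in> HC \<and> pure_tensor 1 (c + d) - ?E (c + d) \<in> Rel" using c d add_HC by blast
  qed
  then show ?thesis ..
qed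

text \<open>The extension of \<open>ncoef\<close> to formal combinations of pairs. Pairs
  whose second component is not in the Hecke algebra are unconstrained by the relations and
  are sent to zero.\<close>

definition tensor_ncoef :: "'a \<Rightarrow> 'a pre_tensor \<Rightarrow> laurent" where
  "tensor_ncoef z f = (\<Sum>p\<in>Poly_Mapping.keys f. of_int (Poly_Mapping.lookup f p) *
     (if snd p \<in> HC then fst p * ncoef z (snd p) else 0))"

lemma tensor_ncoef_superset:
  assumes "finite K" "Poly_Mapping.keys f \<subseteq> K"
  shows "tensor_ncoef z f = (\<Sum>p\<in>K. of_int (Poly_Mapping.lookup f p) * (if snd p \<in> HC then fst p * ncoef z (snd p) else 0))"
  unfolding tensor_ncoef_def by (rule sum.mono_neutral_left) (use assms in \<open>auto simp: in_keys_iff\<close>)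

lemma tensor_ncoef_diff: "tensor_ncoef z (f - g) = tensor_ncoef z f - tensor_ncoef z g"
proof -
  let ?K = "Poly_Mapping.keys f \<union> Poly_Mapping.keys g"
  have K: "finite ?K" "Poly_Mapping.keys (f - g) \<subseteq> ?K" using keys_diff[of f g] by auto
  show ?thesis unfolding tensor_ncoef_superset[OF K] tensor_ncoef_superset[OF K(1), OF Un_upper1] tensor_ncoef_superset[OF K(1), OF Un_upper2]
    by (simp add: lookup_minus algebra_simps sum_subtractf[symmetric])
qed

lemma tensor_ncoef_0: "tensor_ncoef z 0 = 0" by (simp add: tensor_ncoef_def)
lemma tensor_ncoef_add: "tensor_ncoef z (f + g) = tensor_ncoef z f + tensor_ncoef z g"
  using tensor_ncoef_diff[of z "f + g" g] by simp
lemma tensor_ncoef_sum: "tensor_ncoef z (\<Sum>x\<in>K. f x) = (\<Sum>x\<in>K. tensor_ncoef z (f x))"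
  by (induction K rule: infinite_finite_induct) (simp_all add: tensor_ncoef_0 tensor_ncoef_add)
lemma tensor_ncoef_pure: "b \<in> HC \<Longrightarrow> tensor_ncoef z (pure_tensor a b) = a * ncoef z b"
  by (simp add: tensor_ncoef_def pure_tensor_def)

text \<open>The functional respects the relations, so the elements $N_z$ are linearly
  independent in the tensor product.\<close>

lemma tensor_ncoef_Rel: "f \<in> Rel \<Longrightarrow> tensor_ncoef z f = 0"
  unfolding tensor_relations_def
proof (induction rule: group_closure.induct)
  case (diff s t) then show ?case by (simp add: tensor_ncoef_diff)
next
  case (base s)
  then consider "s = 0"
    | a a' b where "s = pure_tensor (a + a') b - pure_tensor a b - pure_tensor a' b" "b \<in> HC"
    | a b b' where "s = pure_tensor a (b + b') - pure_tensor a b - pure_tensor a b'" "b \<in> HC" "b' \<in> HC"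
    | a k b where "s = pure_tensor (a * sign_character G S k) b - pure_tensor a (k \<cdot> b)" "k \<in> parabolic_hecke U" "b \<in> HC"
    by blast
  then show ?case
  proof cases
    case 1 then show ?thesis by (simp add: tensor_ncoef_0)
  next
    case 2 show ?thesis unfolding 2(1) using 2(2) by (simp only: tensor_ncoef_diff tensor_ncoef_pure distrib_right) simp
  next
    case 3 show ?thesis unfolding 3(1) using 3(2,3) by (simp only: tensor_ncoef_diff tensor_ncoef_pure add_HC ncoef_add distrib_left) simp
  next
    case 4
    have "k \<in> HC" using 4(2) U_carrier by (auto simp: parabolic_hecke_def HC_iff)
    then show ?thesis unfolding 4(1) using 4(2,3) by (simp add: tensor_ncoef_diff tensor_ncoef_pure mult_HC ncoef_parabolic mult.assoc)
  qed
qed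

text \<open>\<open>pure_tensor_expand\<close> gives existence and
  \<open>tensor_ncoef_Rel\<close> uniqueness of the coefficient vector that the definition
  of the polynomials describes.\<close>

lemma antispherical_kl_eq_ncoef:
  assumes x: "x \<in> carrier G"
  shows "antispherical_kl G S U H y x = (if y \<in> Wp then ncoef y (kl_basis G S H x) else 0)"
proof -
  let ?b = "kl_basis G S H x"
  have bH: "?b \<in> HC" using kl_basis_is_kl[OF x] by (simp add: is_kl_def)
  let ?K = "xpart ` Poly_Mapping.keys ?b"
  have keys: "w \<in> carrier G" if "w \<in> Poly_Mapping.keys ?b" for w using bH that by (auto simp: HC_iff)
  have K: "finite ?K" "?K \<subseteq> Wp" using parts(2) keys by auto
  have ncoef_K: "z \<in> ?K" if "ncoef z ?b \<noteq> 0" for z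
  proof (rule ccontr)
    assume "z \<notin> ?K"
    then have "ncoef z ?b = 0" unfolding ncoef_def lin_ext_def by (intro sum.neutral) auto
    then show False using that by simp
  qed
  define n where "n = Abs_poly_mapping (\<lambda>z. if z \<in> Wp then ncoef z ?b else 0)"
  have "finite {z. (if z \<in> Wp then ncoef z ?b else 0) \<noteq> 0}"
    by (rule finite_subset[OF _ K(1)]) (use ncoef_K in auto)
  then have n: "Poly_Mapping.lookup n z = (if z \<in> Wp then ncoef z ?b else 0)" for z
    unfolding n_def by (simp add: lookup_Abs_poly_mapping)
  have nK: "Poly_Mapping.keys n \<subseteq> ?K" using ncoef_K by (auto simp: in_keys_iff n split: if_splits)
  let ?P = "\<lambda>m :: 'a \<Rightarrow>\<^sub>0 laurent. Poly_Mapping.keys m \<subseteq> Wp \<and>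
     tensor_class G S U H (pure_tensor 1 ?b) =
     tensor_class G S U H (\<Sum>z\<in>Poly_Mapping.keys m. pure_tensor (Poly_Mapping.lookup m z) (hecke_basis z))"
  have "(THE m. ?P m) = n"
  proof (rule the_equality)
    have 1: "pure_tensor 1 ?b - (\<Sum>z\<in>?K. pure_tensor (ncoef z ?b) (T z)) \<in> Rel"
      by (rule pure_tensor_expand[OF K]) (use keys in auto)
    have e: "(\<Sum>z\<in>?K. pure_tensor (ncoef z ?b) (T z)) =
        (\<Sum>z\<in>Poly_Mapping.keys n. pure_tensor (ncoef z ?b) (T z)) + (\<Sum>z\<in>?K - Poly_Mapping.keys n. pure_tensor (ncoef z ?b) (T z))"
      using sum.subset_diff[OF nK K(1)] by (simp add: add.commute)
    have "(\<Sum>z\<in>?K - Poly_Mapping.keys n. pure_tensor (ncoef z ?b) (T z)) \<in> Rel"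
    proof (rule Rel_sum)
      fix z assume z: "z \<in> ?K - Poly_Mapping.keys n"
      then have "z \<in> Wp" using K by blast
      moreover have "Poly_Mapping.lookup n z = 0" using z by (simp add: in_keys_iff)
      ultimately show "pure_tensor (ncoef z ?b) (T z) \<in> Rel" using n[of z] Rel_zero_left T_HC Wp_carrier by simp
    qed
    from Rel_add[OF 1 this]
    have "pure_tensor 1 ?b - (\<Sum>z\<in>Poly_Mapping.keys n. pure_tensor (ncoef z ?b) (T z)) \<in> Rel" unfolding e by simp
    moreover have "(\<Sum>z\<in>Poly_Mapping.keys n. pure_tensor (ncoef z ?b) (T z)) =
        (\<Sum>z\<in>Poly_Mapping.keys n. pure_tensor (Poly_Mapping.lookup n z) (T z))"
      by (rule sum.cong) (use nK K in \<open>auto simp: n\<close>)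
    ultimately show "?P n" using nK K unfolding tensor_class_eq_iff by auto
  next
    fix m assume m: "?P m"
    have mW: "z \<in> Wp" if "z \<in> Poly_Mapping.keys m" for z using m that by blast
    have r: "pure_tensor 1 ?b - (\<Sum>z\<in>Poly_Mapping.keys m. pure_tensor (Poly_Mapping.lookup m z) (T z)) \<in> Rel"
      using m unfolding tensor_class_eq_iff by blast
    show "m = n"
    proof (rule poly_mapping_eqI)
      fix y
      have "ncoef y ?b = (\<Sum>z\<in>Poly_Mapping.keys m. tensor_ncoef y (pure_tensor (Poly_Mapping.lookup m z) (T z)))"
        using tensor_ncoef_Rel[OF r, of y] bH by (simp add: tensor_ncoef_diff tensor_ncoef_sum tensor_ncoef_pure)
      also have "\<dots> = (\<Sum>z\<in>Poly_Mapping.keys m. if z = y then Poly_Mapping.lookup m y else 0)"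
        by (rule sum.cong) (use mW Wp_carrier T_HC in \<open>auto simp: tensor_ncoef_pure ncoef_T'\<close>)
      also have "\<dots> = Poly_Mapping.lookup m y" by (simp add: in_keys_iff)
      finally have "ncoef y ?b = Poly_Mapping.lookup m y" .
      moreover have "Poly_Mapping.lookup m y = 0" if "y \<notin> Wp" using mW that by (auto simp: in_keys_iff)
      ultimately show "Poly_Mapping.lookup m y = Poly_Mapping.lookup n y" unfolding n by auto
    qed
  qed
  then show ?thesis unfolding antispherical_kl_def using n[of y] by simp
qed

section \<open>The degree bound\<close>

lemma ncoef_Tbar_U_mult:
  assumes u: "u \<in> U" and c: "c \<in> HC" shows "ncoef y (Tbar u \<cdot> c) = (- v_inv) ^ len u * ncoef y c"
proof -
  note uc = U_carrier[OF u]
  have "ncoef y c = ncoef y (T (inv u) \<cdot> (Tbar u \<cdot> c))"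
    using mult_assoc[of "T (inv u)" "Tbar u" c] uc c by (simp add: T_HC Tbar_HC T_inv_Tbar one_mult)
  also have "\<dots> = (- v) ^ len u * ncoef y (Tbar u \<cdot> c)"
    using ncoef_U_mult[OF U_inv[OF u] mult_HC[OF Tbar_HC[OF uc] c]] len_inv[OF uc] by simp
  finally have "(- v_inv) ^ len u * ncoef y c = ((- v_inv) ^ len u * (- v) ^ len u) * ncoef y (Tbar u \<cdot> c)"
    by (simp add: mult.assoc)
  also have "(- v_inv) ^ len u * (- v) ^ len u = 1"
    by (simp add: power_mult_distrib[symmetric] v_v_inv)
  finally show ?thesis by simp
qed

text \<open>The bar involution descends to the antispherical module, semilinearly: the
  scalar \<open>- v\<close> by which generators of \<open>U\<close> act becomes \<open>-
  v_inv\<close>, which is how the inverse generators act.\<close>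

lemma ncoef_hbar:
  assumes K: "finite K" "K \<subseteq> Wp" and b: "\<And>w. w \<in> Poly_Mapping.keys b \<Longrightarrow> w \<in> carrier G \<and> xpart w \<in> K"
  shows "ncoef y (hbar b) = (\<Sum>z\<in>K. barl (ncoef z b) * ncoef y (Tbar z))"
proof (rule hecke_induct[of b "{w \<in> carrier G. xpart w \<in> K}"])
  show "Poly_Mapping.keys b \<subseteq> {w \<in> carrier G. xpart w \<in> K}" using b by blast
  show "ncoef y (hbar 0) = (\<Sum>z\<in>K. barl (ncoef z 0) * ncoef y (Tbar z))" by (simp add: hbar_0 ncoef_0)
next
  fix a w assume "w \<in> {w \<in> carrier G. xpart w \<in> K}"
  then have w: "w \<in> carrier G" "xpart w \<in> K" by auto
  define u x where "u = upart w" and "x = xpart w"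
  have ux: "u \<in> U" "x \<in> Wp" "w = u \<otimes> x" "x \<in> K" using parts[OF w(1)] w(2) by (simp_all add: u_def x_def)
  have uc: "u \<in> carrier G" "x \<in> carrier G" using ux U_carrier Wp_carrier by auto
  have "Tbar w = Tbar u \<cdot> Tbar x" unfolding ux(3) by (rule Tbar_mult[OF uc len_U_Wp[OF ux(1,2)]])
  then have "ncoef y (hbar (hecke_scale a (T w))) = barl a * ((- v_inv) ^ len u * ncoef y (Tbar x))"
    using ncoef_Tbar_U_mult[OF ux(1) Tbar_HC[OF uc(2)]] by (simp add: hbar_scale hbar_T ncoef_scale)
  also have "\<dots> = (\<Sum>z\<in>K. if z = x then barl a * ((- v_inv) ^ len u * ncoef y (Tbar x)) else 0)"
    using K(1) ux(4) by simp
  also have "\<dots> = (\<Sum>z\<in>K. barl (ncoef z (hecke_scale a (T w))) * ncoef y (Tbar z))"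
    unfolding ux(3) ncoef_scale ncoef_T[OF ux(1,2)]
    by (rule sum.cong) (auto simp: barl_mult barl_power barl_minus barl_v mult.assoc)
  finally show "ncoef y (hbar (hecke_scale a (T w))) = (\<Sum>z\<in>K. barl (ncoef z (hecke_scale a (T w))) * ncoef y (Tbar z))" .
next
  fix c d assume "ncoef y (hbar c) = (\<Sum>z\<in>K. barl (ncoef z c) * ncoef y (Tbar z))" "ncoef y (hbar d) = (\<Sum>z\<in>K. barl (ncoef z d) * ncoef y (Tbar z))"
  then show "ncoef y (hbar (c + d)) = (\<Sum>z\<in>K. barl (ncoef z (c + d)) * ncoef y (Tbar z))"
    by (simp add: hbar_add ncoef_add barl_add distrib_right sum.distrib)
qed

text \<open>Right multiplication by the inverse generator in coordinates. In the first case
  the reflection can be moved to the left, where its inverse acts by \<open>- v_inv\<close>;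
  otherwise it exchanges $N_y$ with its neighbour.\<close>

lemma ncoef_mult_Ti:
  assumes c: "c \<in> HC" and y: "y \<in> Wp" and a: "a \<in> \<Delta>"
  shows "ncoef y (c \<cdot> Ti a) = (if y \<otimes> refl a \<notin> Wp then - v_inv * ncoef y c
     else ncoef (y \<otimes> refl a) c + (if act y a \<in> Pos then (v - v_inv) * ncoef y c else 0))"
  using c
proof (induction rule: HC_induct)
  case zero then show ?case using a by (simp add: zero_mult Ti_HC ncoef_0)
next
  case (add b c) then show ?case using a by (simp add: add_mult Ti_HC ncoef_add algebra_simps)
next
  case (basis c w)
  note ra = simple_car[OF a] and aR = simple_R[OF a] and yc = Wp_carrier[OF y]
  define u x where "u = upart w" and "x = xpart w"
  have ux: "u \<in> U" "x \<in> Wp" "w = u \<otimes> x" using parts[OF basis] by (simp_all add: u_def x_def)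
  have uc: "u \<in> carrier G" "x \<in> carrier G" using ux U_carrier Wp_carrier by auto
  have z: "hecke_scale (v_inv - v) b + hecke_scale (v - v_inv) b = 0" for b :: "'a hecke"
    by (simp add: hecke_scale_add_left[symmetric])
  have tw: "T w \<cdot> Ti a = T (w \<otimes> refl a) + (if act w a \<in> Pos then hecke_scale (v - v_inv) (T w) else 0)"
    unfolding mult_Ti[OF T_HC[OF basis] a] T_mult_simple[OF basis a] using z by (simp add: add.assoc)
  have ws: "w \<otimes> refl a = u \<otimes> (x \<otimes> refl a)" using ux uc ra by (simp add: m_assoc)
  have pw: "ncoef y (T w) = (if x = y then (- v) ^ len u else 0)" for y unfolding ux(3) by (rule ncoef_T[OF ux(1,2)])
  have sym: "y \<otimes> refl a = x \<longleftrightarrow> x \<otimes> refl a = y"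
    using mult_refl_refl[OF yc aR] mult_refl_refl[OF uc(2) aR] by metis
  have "ncoef y (T w \<cdot> Ti a) = (if y \<otimes> refl a \<notin> Wp then - v_inv * ncoef y (T w)
     else ncoef (y \<otimes> refl a) (T w) + (if act y a \<in> Pos then (v - v_inv) * ncoef y (T w) else 0))"
  proof (cases "x \<otimes> refl a \<in> Wp")
    case True
    have lx: "len (w \<otimes> refl a) = len u + len (x \<otimes> refl a)" "len w = len u + len x"
      unfolding ws using len_U_Wp ux True by auto
    have pos: "act w a \<in> Pos \<longleftrightarrow> act x a \<in> Pos"
    proof -
      have len_greater: "act g a \<in> Pos \<longleftrightarrow> len g < len (g \<otimes> refl a)" if "g \<in> carrier G" for g
        using len_mult_simple[OF that a] len_mult_simple'[OF that a] by linarith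
      show ?thesis unfolding len_greater[OF basis] len_greater[OF uc(2)] lx by simp
    qed
    have p1: "ncoef y (T (w \<otimes> refl a)) = (if x \<otimes> refl a = y then (- v) ^ len u else 0)"
      unfolding ws by (rule ncoef_T[OF ux(1) True])
    have l: "ncoef y (T w \<cdot> Ti a) = (if x \<otimes> refl a = y then (- v) ^ len u else 0) +
        (if act x a \<in> Pos then (v - v_inv) * ncoef y (T w) else 0)"
      unfolding tw pos ncoef_add p1 by (simp add: ncoef_scale ncoef_0)
    show ?thesis
    proof (cases "y \<otimes> refl a \<in> Wp")
      case yt: True
      have "ncoef (y \<otimes> refl a) (T w) = (if x \<otimes> refl a = y then (- v) ^ len u else 0)"
        unfolding pw using sym by auto
      then show ?thesis unfolding l using yt pw[of y] by auto
    next
      case False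
      then have "x \<noteq> y" "x \<otimes> refl a \<noteq> y" using True sym ux(2) by auto
      then show ?thesis unfolding l using False pw[of y] by auto
    qed
  next
    case False
    obtain c where c: "c \<in> \<Delta>f" "x \<otimes> refl a = refl c \<otimes> x" using Wp_mult_simple[OF ux(2) a False] by blast
    note sc = simplef[OF c(1)]
    have us: "u \<otimes> refl c \<in> U" using U_mult ux refl_U c by blast
    have ws': "w \<otimes> refl a = (u \<otimes> refl c) \<otimes> x" unfolding ws c(2) using uc sc by (simp add: m_assoc)
    have p1: "ncoef y (T (w \<otimes> refl a)) = (if x = y then (- v) ^ len (u \<otimes> refl c) else 0)" for y
      unfolding ws' by (rule ncoef_T[OF us ux(2)])
    have lx: "len (w \<otimes> refl a) = len (u \<otimes> refl c) + len x" "len w = len u + len x"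
      unfolding ws' using len_U_Wp ux us by auto
    have ne: "y \<otimes> refl a \<noteq> x" using sym False y by auto
    show ?thesis
    proof (cases "x = y")
      case xy: True
      have "ncoef y (T w \<cdot> Ti a) = - v_inv * ncoef y (T w)"
      proof (cases "act w a \<in> Pos")
        case True
        then have "len (u \<otimes> refl c) = Suc (len u)" using len_mult_simple[OF basis a True] lx by simp
        then show ?thesis unfolding tw ncoef_add p1 using True xy pw[of y] by (simp add: ncoef_scale algebra_simps)
      next
        case F: False
        then have "len u = Suc (len (u \<otimes> refl c))" using len_mult_simple'[OF basis a F] lx by simp
        then show ?thesis unfolding tw ncoef_add p1 using F xy pw[of y]
          by (simp add: ncoef_0 mult.assoc[symmetric] v_v_inv)
      qed
      then show ?thesis using False xy by simp
    next
      case n: False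
      have "ncoef y (T w \<cdot> Ti a) = 0" unfolding tw ncoef_add p1 using n pw[of y] by (simp add: ncoef_scale ncoef_0)
      moreover have "ncoef (y \<otimes> refl a) (T w) = 0" unfolding pw using ne by auto
      ultimately show ?thesis using n pw[of y] by simp
    qed
  qed
  then show ?case using basis a
    by (simp add: scale_mult T_HC Ti_HC ncoef_scale algebra_simps)
qed

text \<open>The bound on the $R$-polynomials, by removing a right descent \<open>a\<close>
  of \<open>z\<close>. The three terms of \<open>ncoef_mult_Ti\<close> are treated
  separately: multiplication by \<open>- v_inv\<close> lowers the degree by one, while the
  finite part changes by one simple reflection of \<open>U\<close>; for the neighbour of
  \<open>y\<close> the relative position to the shortened \<open>z\<close> is unchanged; and
  the factor \<open>v - v_inv\<close> is paid for by \<open>fpart_increase\<close>.\<close>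

lemma ncoef_Tbar_degree:
  "z \<in> Wp \<Longrightarrow> y \<in> Wp \<Longrightarrow> vle (int (len (fpart (y \<otimes> inv z)))) (ncoef y (Tbar z))"
proof (induction "len z" arbitrary: z y rule: less_induct)
  case less
  note zc = Wp_carrier[OF less.prems(1)] and yc = Wp_carrier[OF less.prems(2)]
  show ?case
  proof (cases "z = \<one>")
    case True
    have "ncoef y (Tbar z) = (if \<one> = y then 1 else 0)" unfolding True Tbar_one by (rule ncoef_T'[OF one_Wp])
    then show ?thesis using vle_mono[OF vle_1, of "int (len (fpart (y \<otimes> inv z)))"] by simp
  next
    case False
    then obtain a where a: "a \<in> \<Delta>" "act z a \<notin> Pos" using right_descent zc by blast
    note ra = simple_car[OF a(1)] and aR = simple_R[OF a(1)]
    let ?z = "z \<otimes> refl a"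
    have z': "?z \<in> carrier G" "act ?z a \<in> Pos" "?z \<otimes> refl a = z"
      using zc a ra aR by (simp_all add: act_mult_refl_self_Pos mult_refl_refl)
    have zW: "?z \<in> Wp" by (rule Wp_mult_simple_less[OF less.prems(1) a])
    have l: "len ?z < len z" using len_mult_simple'[OF zc a] by simp
    have tb: "Tbar z = Tbar ?z \<cdot> Ti a" using Tbar_mult_simple[OF z'(1) a(1) z'(2)] z'(3) by simp
    note ph = ncoef_mult_Ti[OF Tbar_HC[OF z'(1)] less.prems(2) a(1)]
    have iz: "inv ?z = refl a \<otimes> inv z" using zc ra aR by (simp add: inv_mult_group inv_refl)
    have yz: "y \<otimes> refl a \<otimes> inv ?z = y \<otimes> inv z"
    proof -
      have "y \<otimes> refl a \<otimes> inv ?z = y \<otimes> refl a \<otimes> refl a \<otimes> inv z" unfolding iz using yc ra zc by (simp add: m_assoc)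
      then show ?thesis unfolding mult_refl_refl[OF yc aR] .
    qed
    let ?d = "int (len (fpart (y \<otimes> inv z)))"
    show ?thesis
    proof (cases "y \<otimes> refl a \<in> Wp")
      case False
      obtain c where c: "c \<in> \<Delta>f" "y \<otimes> refl a = refl c \<otimes> y" using Wp_mult_simple[OF less.prems(2) a(1) False] by blast
      note sc = simplef[OF c(1)]
      have g: "y \<otimes> inv ?z \<in> carrier G" using yc z' by simp
      have "y \<otimes> inv z = refl c \<otimes> (y \<otimes> inv ?z)" unfolding yz[symmetric] c(2) using sc yc z' by (simp add: m_assoc)
      then have f: "fpart (y \<otimes> inv z) = refl c \<otimes> fpart (y \<otimes> inv ?z)"
        using fpart_mult[of "refl c" "y \<otimes> inv ?z"] sc g fpart_id[OF refl_U[OF c(1)]] by simp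
      note fc = U_carrier[OF fpart_U[OF g]]
      have "fpart (y \<otimes> inv ?z) = refl c \<otimes> fpart (y \<otimes> inv z)" unfolding f using refl_refl_mult[OF fc] sc by simp
      then have "len (fpart (y \<otimes> inv ?z)) \<le> len (refl c) + len (fpart (y \<otimes> inv z))"
        using len_mult_le[of "refl c" "fpart (y \<otimes> inv z)"] sc U_carrier[OF fpart_U, of "y \<otimes> inv z"] yc zc by simp
      then have le: "- 1 + int (len (fpart (y \<otimes> inv ?z))) \<le> ?d" using len_refl_le[of c] sc by simp
      have "vle (- 1 + int (len (fpart (y \<otimes> inv ?z)))) (- v_inv * ncoef y (Tbar ?z))"
        by (rule vle_mult[OF vle_minus[OF vle_v_inv] less.hyps[OF l zW less.prems(2)]])
      then show ?thesis unfolding tb ph using vle_mono[OF _ le] False by simp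
    next
      case True
      have 1: "vle ?d (ncoef (y \<otimes> refl a) (Tbar ?z))" using less.hyps[OF l zW True] unfolding yz .
      have "vle ?d ((v - v_inv) * ncoef y (Tbar ?z))" if p: "act y a \<in> Pos"
      proof -
        have "len (fpart (y \<otimes> inv ?z)) < len (fpart (y \<otimes> refl a \<otimes> inv ?z))"
          by (rule fpart_increase[OF less.prems(2) zW a(1) p z'(2) True]) (use z'(3) less.prems in simp)
        then have le: "1 + int (len (fpart (y \<otimes> inv ?z))) \<le> ?d" unfolding yz by simp
        have "vle 1 (v - v_inv)"
          unfolding diff_conv_add_uminus by (intro vle_add vle_v vle_minus vle_mono[OF vle_v_inv]) simp
        from vle_mult[OF this less.hyps[OF l zW less.prems(2)]] show ?thesis by (rule vle_mono[OF _ le])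
      qed
      then show ?thesis unfolding tb ph using True vle_add[OF 1] 1 by simp
    qed
  qed
qed

text \<open>Bar invariance of the Kazhdan-Lusztig element expresses its coefficient at
  \<open>y\<close> through barred coefficients, which have no positive powers of
  \<open>v\<close>, and $R$-polynomials.\<close>

theorem antispherical_degree_bound:
  assumes x: "x \<in> carrier G" and y: "y \<in> Wp" and N: "\<And>u. u \<in> U \<Longrightarrow> len u \<le> N"
  shows "\<exists>p. antispherical_kl G S U H y x = laurent_of_poly p \<and> degree p \<le> N"
proof -
  let ?b = "kl_basis G S H x"
  have kl: "is_kl x ?b" by (rule kl_basis_is_kl[OF x])
  have bH: "?b \<in> HC" and bb: "hbar ?b = ?b" using kl by (simp_all add: is_kl_def)
  let ?K = "xpart ` Poly_Mapping.keys ?b"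
  have keys: "w \<in> carrier G" if "w \<in> Poly_Mapping.keys ?b" for w using bH that by (auto simp: HC_iff)
  have K: "finite ?K" "?K \<subseteq> Wp" using parts(2) keys by auto
  have ge: "vge 0 (ncoef z ?b)" for z
    unfolding ncoef_def lin_ext_def
  proof (rule vge_sum)
    fix w
    show "vge 0 (coef ?b w * (if xpart w = z then (- v) ^ len (upart w) else 0))"
      using vge_mult[OF is_kl_vge_0[OF kl, of w] vge_minus_v_power] by simp
  qed
  have "ncoef y ?b = (\<Sum>z\<in>?K. barl (ncoef z ?b) * ncoef y (Tbar z))"
    using ncoef_hbar[OF K, of ?b y] keys bb by simp
  moreover have "vle (int N) (barl (ncoef z ?b) * ncoef y (Tbar z))" if z: "z \<in> ?K" for z
  proof -
    have zW: "z \<in> Wp" using z K by blast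
    have "fpart (y \<otimes> inv z) \<in> U" using y zW Wp_carrier by (intro fpart_U) simp
    then have le: "0 + int (len (fpart (y \<otimes> inv z))) \<le> int N" using N by simp
    show ?thesis by (rule vle_mono[OF vle_mult[OF barl_vge[OF ge] ncoef_Tbar_degree[OF zW y]] le])
  qed
  ultimately have "vle (int N) (ncoef y ?b)" by (simp add: vle_sum)
  then show ?thesis using vge_0_vle_poly[OF ge] antispherical_kl_eq_ncoef[OF x, of y] y by simp
qed

end


section \<open>The affine Weyl group\<close>

context triangular_decomposition
begin

interpretation A: parabolic_action W aroots apos asimple aneg aact arefl afin "(\<lambda>\<alpha>. (\<alpha>, 0)) ` simple_roots P" Wf
  by (rule affine_reflection_action)

text \<open>Crossing a wall upwards between dominant alcoves leads away from the origin. If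
  the finite part \<open>\<beta>\<close> of the wall were positive, the affine function
  \<open>(\<beta>, 0)\<close> would be positive on the second alcove, by dominance, and so
  would \<open>(\<beta>, k)\<close>, because \<open>k\<close> is not negative; but the
  second alcove lies on the negative side of this wall.\<close>

lemma Wp_direction:
  assumes y: "y \<in> A.Wp" and a: "a \<in> asimple" and p: "aact y a \<in> apos" and ya: "y \<otimes>\<^bsub>W\<^esub> arefl a \<in> A.Wp"
  shows "- fst (aact y a) \<in> P"
proof (rule ccontr)
  assume n: "- fst (aact y a) \<notin> P"
  note aR = A.simple_R[OF a] and ra = A.refl_carrier[OF A.simple_R[OF a]] and yc = A.Wp_carrier[OF y] and yac = A.Wp_carrier[OF ya]
  obtain \<beta> k where b: "aact y a = (\<beta>, k)" by (cases "aact y a")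
  have br: "\<beta> \<in> roots h" and k: "k \<ge> 0" using p b by (auto simp: apos_def)
  have bP: "\<beta> \<in> P" using n b positive br by (auto simp: positive_system_def)
  let ?x = "inv\<^bsub>W\<^esub> (y \<otimes>\<^bsub>W\<^esub> arefl a)"
  have xc: "?x \<in> carrier W" using yac by simp
  have "(\<beta>, 0) \<in> afin" "(\<beta>, 0) \<in> apos" using br bP by (auto simp: afin_def apos_def)
  then have "aact ?x (\<beta>, 0) \<in> apos" using ya unfolding A.Wp_iff by blast
  then have pos: "aact ?x (\<beta>, k) \<in> apos" using k by (auto simp: aact_pair apos_def)
  have "aneg (\<beta>, k) = aact (y \<otimes>\<^bsub>W\<^esub> arefl a) a" using A.act_mult_refl_self[OF yc aR] b by simp
  then have "aact ?x (aneg (\<beta>, k)) = a" using A.act_inv_act[OF yac aR] by simp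
  moreover have bR: "(\<beta>, k) \<in> aroots" using br by (simp add: aroots_def)
  ultimately have "aneg (aact ?x (\<beta>, k)) = a" using A.act_neg[OF xc bR] by simp
  then have "aneg (aact ?x (\<beta>, k)) \<in> apos" using A.simple_in_Pos[OF a] by simp
  then show False using A.neg_Pos[OF A.act_R[OF xc bR]] pos by blast
qed

text \<open>With \<open>c = y z\<inverse>\<close>, inserting the reflection multiplies
  \<open>c\<close> on the right by the reflection in \<open>z a\<close>, whose finite part
  \<open>\<gamma>\<close> is a negative root; and \<open>c\<close> maps it to the finite
  part of \<open>y a\<close>, also a negative root. So the linear part of \<open>c\<close>
  keeps the positive root \<open>- \<gamma>\<close> positive, and multiplying by its
  reflection increases the length.\<close>

lemma linp_increase:
  assumes y: "y \<in> A.Wp" and z: "z \<in> A.Wp" and a: "a \<in> asimple" and p: "aact y a \<in> apos" "aact z a \<in> apos"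
    and ya: "y \<otimes>\<^bsub>W\<^esub> arefl a \<in> A.Wp" and za: "z \<otimes>\<^bsub>W\<^esub> arefl a \<in> A.Wp"
  shows "A.len (linp (y \<otimes>\<^bsub>W\<^esub> inv\<^bsub>W\<^esub> z)) < A.len (linp (y \<otimes>\<^bsub>W\<^esub> arefl a \<otimes>\<^bsub>W\<^esub> inv\<^bsub>W\<^esub> z))"
proof -
  note aR = A.simple_R[OF a] and ra = A.refl_carrier[OF A.simple_R[OF a]] and yc = A.Wp_carrier[OF y] and zc = A.Wp_carrier[OF z]
  let ?c = "y \<otimes>\<^bsub>W\<^esub> inv\<^bsub>W\<^esub> z"
  have cc: "?c \<in> carrier W" using yc zc by simp
  obtain \<alpha> j where a': "a = (\<alpha>, j)" by (cases a)
  have ar: "\<alpha> \<in> roots h" using aR by (simp add: a' aroots_def)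
  define \<gamma> l where "\<gamma> = fst (aact z a)" and "l = snd (aact z a)"
  have g: "aact z a = (\<gamma>, l)" by (simp add: \<gamma>_def l_def)
  have gP: "- \<gamma> \<in> P" using Wp_direction[OF z a p(2) za] unfolding \<gamma>_def .
  have gr: "\<gamma> \<in> roots h" using p(2) by (auto simp: g apos_def)
  have mgr: "- \<gamma> \<in> roots h" using P_roots[OF gP] .
  have "?c \<otimes>\<^bsub>W\<^esub> arefl (aact z a) = y \<otimes>\<^bsub>W\<^esub> arefl a \<otimes>\<^bsub>W\<^esub> inv\<^bsub>W\<^esub> z"
    unfolding A.refl_act[OF zc aR] using yc zc ra by (simp add: A.m_assoc A.inv_solve_left')
  then have e: "linp (y \<otimes>\<^bsub>W\<^esub> arefl a \<otimes>\<^bsub>W\<^esub> inv\<^bsub>W\<^esub> z) = linp ?c \<otimes>\<^bsub>W\<^esub> linp (arefl (\<gamma>, l))"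
    unfolding g using linp_mult[OF cc arefl_W[OF gr, of l]] by simp
  have "arefl (- \<gamma>, 0) = arefl (aneg (\<gamma>, 0))" by (simp add: aneg_def)
  also have "\<dots> = arefl (\<gamma>, 0)" using A.refl_neg[of "(\<gamma>, 0)"] gr by (simp add: aroots_def)
  finally have r: "linp (arefl (\<gamma>, l)) = arefl (- \<gamma>, 0)" unfolding linp_arefl[OF gr] arefl_finite[OF gr] by simp
  have u: "linp ?c \<in> Wf" by (rule linp_Wf[OF cc])
  have ga: "\<gamma> = linp z \<alpha>" and ba: "fst (aact y a) = linp y \<alpha>" unfolding \<gamma>_def a' by (simp_all add: aact_pair)
  have cza: "fst (aact ?c (aact z a)) = linp ?c \<gamma>" unfolding g by (simp add: aact_pair)
  have "aact ?c (aact z a) = aact y a"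
    using A.act_mult[OF yc, of "inv\<^bsub>W\<^esub> z" "aact z a"] A.act_R[OF zc aR] A.act_inv_act[OF zc aR] zc by simp
  then have "linp ?c \<gamma> = fst (aact y a)" using cza by simp
  then have "- linp ?c \<gamma> \<in> P" using Wp_direction[OF y a p(1) ya] by simp
  then have mP: "linp ?c (- \<gamma>) \<in> P" unfolding Wf_minus[OF u root_dual[OF gr]] .
  have "A.len (linp ?c) < A.len (linp ?c \<otimes>\<^bsub>W\<^esub> arefl (- \<gamma>, 0))"
  proof (rule A.len_mult_refl_greater)
    show "linp ?c \<in> carrier W" by (rule Wf_W[OF u])
    show "(- \<gamma>, 0) \<in> apos" using mgr gP unfolding apos_def by blast
    show "aact (linp ?c) (- \<gamma>, 0) \<in> apos" unfolding aact_Wf[OF u] using mP P_roots[OF mP] unfolding apos_def by blast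
  qed
  then show ?thesis unfolding e r .
qed

text \<open>Negativity of the height after applying \<open>w0\<close> is additive in
  coroots, so it spreads from simple roots to positive ones.\<close>

lemma longest_element_negates_positive:
  assumes w: "w0 \<in> Wf" and simple: "\<And>\<alpha>. \<alpha> \<in> simple_roots P \<Longrightarrow> w0 \<alpha> \<notin> P" and b: "\<beta> \<in> P"
  shows "w0 \<beta> \<notin> P"
proof -
  obtain f1 f2 where f: "hlin f2" "\<And>\<beta>. \<beta> \<in> roots h \<Longrightarrow> linp w0 \<beta> \<in> P \<longleftrightarrow> f2 (coroot h \<beta>) > 0"
      "\<And>\<beta>. \<beta> \<in> roots h \<Longrightarrow> f2 (coroot h \<beta>) \<noteq> 0"
    using aact_pos_lex[OF Wf_W[OF w]] by blast
  have "f2 (coroot h \<beta>) < 0"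
    using b
  proof (induction rule: P_coroot_induct)
    case (simple \<alpha>)
    note ar = P_roots[OF simple_P[OF simple]]
    show ?case using f(2)[OF ar] f(3)[OF ar] assms(2)[OF simple] unfolding linp_of_Wf[OF w] by linarith
  next
    case (step \<beta> \<beta>' \<alpha> k)
    note ar = P_roots[OF simple_P[OF step(3)]]
    note br = P_roots[OF step(2)]
    have "f2 (coroot h \<alpha>) < 0" using f(2)[OF ar] f(3)[OF ar] assms(2)[OF step(3)] unfolding linp_of_Wf[OF w] by linarith
    then have "real k * f2 (coroot h \<alpha>) < 0" using step(4) by (simp add: mult_pos_neg)
    moreover have "f2 (coroot h \<beta>) = f2 (coroot h \<beta>') + real k * f2 (coroot h \<alpha>)"
      unfolding step(5) using hlinD[OF f(1)] coroot_h br ar h_scaleC by simp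
    ultimately show ?case using step(6) by linarith
  qed
  then show ?thesis using f(2)[OF P_roots[OF b]] unfolding linp_of_Wf[OF w] by linarith
qed

text \<open>By maximality, no simple reflection can lengthen the longest element, so its
  inversions are exactly the positive finite roots.\<close>

lemma length_longest_element:
  assumes "is_arg_max A.len (\<lambda>w. w \<in> Wf) w0" shows "A.len w0 = card P"
proof -
  have w: "w0 \<in> Wf" and mx: "\<And>u. u \<in> Wf \<Longrightarrow> \<not> A.len w0 < A.len u" using assms by (auto simp: is_arg_max_def)
  note wc = Wf_W[OF w]
  have simple: "w0 \<alpha> \<notin> P" if a: "\<alpha> \<in> simple_roots P" for \<alpha>
  proof
    assume p: "w0 \<alpha> \<in> P"
    have s: "(\<alpha>, 0) \<in> asimple" using a unfolding asimple_def by blast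
    have "aact w0 (\<alpha>, 0) \<in> apos" unfolding aact_Wf[OF w] using p P_roots[OF p] unfolding apos_def by blast
    then have "A.len (w0 \<otimes>\<^bsub>W\<^esub> arefl (\<alpha>, 0)) = Suc (A.len w0)" by (rule A.len_mult_simple[OF wc s])
    moreover have "w0 \<otimes>\<^bsub>W\<^esub> arefl (\<alpha>, 0) \<in> Wf"
      unfolding arefl_finite[OF P_roots[OF simple_P[OF a]]] by (rule A.U_mult[OF w reflection_Wf[OF P_roots[OF simple_P[OF a]]]])
    ultimately show False using mx by force
  qed
  have "A.inversions w0 = (\<lambda>\<beta>. (\<beta>, 0)) ` P"
  proof
    show "A.inversions w0 \<subseteq> (\<lambda>\<beta>. (\<beta>, 0)) ` P"
    proof
      fix b assume b: "b \<in> A.inversions w0"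
      obtain \<beta> k where bk: "b = (\<beta>, k)" by (cases b)
      have "(\<beta>, k) \<in> apos" "(w0 \<beta>, k) \<notin> apos" using b unfolding A.inversions_def bk aact_Wf[OF w, symmetric] by auto
      moreover then have "w0 \<beta> \<in> roots h" using Wf_root[OF w] unfolding apos_def by blast
      ultimately show "b \<in> (\<lambda>\<beta>. (\<beta>, 0)) ` P" unfolding apos_def bk by blast
    qed
    show "(\<lambda>\<beta>. (\<beta>, 0)) ` P \<subseteq> A.inversions w0"
    proof
      fix b assume "b \<in> (\<lambda>\<beta>. (\<beta>, 0 :: int)) ` P"
      then obtain \<beta> where b: "\<beta> \<in> P" "b = (\<beta>, 0)" by blast
      have n: "w0 \<beta> \<notin> P" by (rule longest_element_negates_positive[OF w simple b(1)])
      have "(\<beta>, 0) \<in> apos" using b(1) P_roots[OF b(1)] unfolding apos_def by blast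
      moreover have "aact w0 (\<beta>, 0) \<notin> apos" unfolding aact_Wf[OF w] using n unfolding apos_def by blast
      ultimately show "b \<in> A.inversions w0" unfolding A.inversions_def b(2) by blast
    qed
  qed
  then show ?thesis unfolding A.len_eq_card_inversions[OF wc] by (simp add: card_image inj_on_def)
qed

lemma antispherical_affine:
  assumes H: "hecke_algebra W (arefl ` asimple) H"
  shows "antispherical W aroots apos asimple aneg aact arefl afin ((\<lambda>\<alpha>. (\<alpha>, 0)) ` simple_roots P) Wf H linp"
proof unfold_locales
  show "hecke_algebra W (arefl ` asimple) H" by (rule H)
qed (use linp_Wf linp_mult linp_of_Wf linp_increase in blast)+

theorem affine_antispherical_degree_bound:
  assumes H: "hecke_algebra W (affine_simple_reflections h P) H"
    and w0: "is_arg_max (word_length W (affine_simple_reflections h P)) (\<lambda>w. w \<in> Wf) w0"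
    and x: "x \<in> shortest_coset_reps W (affine_simple_reflections h P) Wf"
    and y: "y \<in> shortest_coset_reps W (affine_simple_reflections h P) Wf"
  shows "\<exists>p. antispherical_kl W (affine_simple_reflections h P) Wf H y x = laurent_of_poly p \<and>
      degree p \<le> word_length W (affine_simple_reflections h P) w0"
    and "word_length W (affine_simple_reflections h P) w0 = complex_vector.dim (n_plus h P)"
proof -
  note S = affine_simple_reflections_eq
  interpret antispherical W aroots apos asimple aneg aact arefl afin "(\<lambda>\<alpha>. (\<alpha>, 0)) ` simple_roots P" Wf H linp
    by (rule antispherical_affine) (use H S in simp)
  have "A.len u \<le> A.len w0" if "u \<in> Wf" for u
    using w0 that unfolding S is_arg_max_def by force
  then show "\<exists>p. antispherical_kl W (affine_simple_reflections h P) Wf H y x = laurent_of_poly p \<and>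
      degree p \<le> word_length W (affine_simple_reflections h P) w0"
    unfolding S using antispherical_degree_bound x y A.Wp_carrier unfolding S by blast
  show "word_length W (affine_simple_reflections h P) w0 = complex_vector.dim (n_plus h P)"
    unfolding dim_n_plus using length_longest_element w0 unfolding S by blast
qed

end

theorem theorem4p4p3:
  fixes h :: "'g::complex_lie_algebra set"
    and P :: "'g weight set"
    and W :: "('g weight \<Rightarrow> 'g weight) monoid"
    and Wf S Wplus :: "('g weight \<Rightarrow> 'g weight) set"
    and H :: "('g weight \<Rightarrow> 'g weight) hecke ring"
    and w0 x y :: "'g weight \<Rightarrow> 'g weight"
  defines "W \<equiv> affine_weyl h"
    and "Wf \<equiv> finite_weyl h"
    and "S \<equiv> affine_simple_reflections h P"
    and "Wplus \<equiv> shortest_coset_reps W S Wf"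
  assumes "lie_finite_dimensional TYPE('g)"
    and "lie_semisimple TYPE('g)"
    and "cartan_subalgebra h"
    and "positive_system h P"
    and "hecke_algebra W S H"
    and "is_arg_max (word_length W S) (\<lambda>w. w \<in> Wf) w0"
    and "x \<in> Wplus" and "y \<in> Wplus"
  shows "(\<exists>p. antispherical_kl W S Wf H y x = laurent_of_poly p \<and>
              degree p \<le> word_length W S w0) \<and>
         word_length W S w0 = complex_vector.dim (n_plus h P)"
proof -
  interpret triangular_decomposition h P
    using assms(5-8) by unfold_locales
  show ?thesis
    using affine_antispherical_degree_bound[OF assms(9-12)[unfolded Wplus_def W_def Wf_def S_def]]
    unfolding W_def Wf_def S_def by blast
qed

end
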